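(* Let $\mathcal{A}$ and $\mathcal{B}$ be separable unital residually finite-dimensional (RFD) C*-algebras, let $\mathcal{D}$ be a finite-dimensional C*-algebra, and let $\psi_{\mathcal{A}}:\mathcal{D}\to\mathcal{A}$ and $\psi_{\mathcal{B}}:\mathcal{D}\to\mathcal{B}$ be unital embeddings. Let $\mathcal{A}\ast_{\mathcal{D}}\mathcal{B}$ be the corresponding unital full amalgamated free product. Then $\mathcal{A}\ast_{\mathcal{D}}\mathcal{B}$ is RFD if and only if there exist a sequence $\{k_n\}_{n=1}^{\infty}$ of positive integers and unital embeddings $$q_1:\mathcal{A}\to\prod_{n=1}^{\infty}\mathcal{M}_{k_n}(\mathbb{C}),\qquad q_2:\mathcal{B}\to\prod_{n=1}^{\infty}\mathcal{M}_{k_n}(\mathbb{C})$$ such that $q_1\circ\psi_{\mathcal{A}}=q_2\circ\psi_{\mathcal{B}}$.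
   Context: Embeddings are injective *-homomorphisms. A separable C*-algebra $\mathcal{R}$ is residually finite-dimensional (RFD) if for each nonzero $x\in\mathcal{R}$ there is a *-homomorphism $\pi$ from $\mathcal{R}$ to a finite-dimensional C*-algebra with $\pi(x)\neq 0$. $\prod_{n=1}^{\infty}\mathcal{M}_{k_n}(\mathbb{C})$ is the C*-algebra of norm-bounded sequences $(Y_n)_n$ with $Y_n\in\mathcal{M}_{k_n}(\mathbb{C})$, with the sup norm. Given unital embeddings $\psi_{\mathcal{A}}:\mathcal{D}\to\mathcal{A}$, $\psi_{\mathcal{B}}:\mathcal{D}\to\mathcal{B}$, the unital full amalgamated free product $\mathcal{A}\ast_{\mathcal{D}}\mathcal{B}$ is the C*-algebra $\mathcal{C}$ with unital embeddings $\sigma_{\mathcal{A}}:\mathcal{A}\to\mathcal{C}$, $\sigma_{\mathcal{B}}:\mathcal{B}\to\mathcal{C}$ such that $\sigma_{\mathcal{A}}\circ\psi_{\mathcal{A}}=\sigma_{\mathcal{B}}\circ\psi_{\mathcal{B}}$, $\mathcal{C}$ is generated by $\sigma_{\mathcal{A}}(\mathcal{A})\cup\sigma_{\mathcal{B}}(\mathcal{B})$, and whenever $\pi_{\mathcal{A}}:\mathcal{A}\to\mathcal{E}$, $\pi_{\mathcal{B}}:\mathcal{B}\to\mathcal{E}$ are *-homomorphisms into a C*-algebra $\mathcal{E}$ with $\pi_{\mathcal{A}}\circ\psi_{\mathcal{A}}=\pi_{\mathcal{B}}\circ\psi_{\mathcal{B}}$, there is a *-homomorphism $\pi:\mathcal{C}\to\mathcal{E}$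 with $\pi\circ\sigma_{\mathcal{A}}=\pi_{\mathcal{A}}$ and $\pi\circ\sigma_{\mathcal{B}}=\pi_{\mathcal{B}}$. *)

theory Defs
  imports
    "HOL-Analysis.Analysis"
    "Jordan_Normal_Form.VS_Connect"
    "Jordan_Normal_Form.Schur_Decomposition"
begin

section \<open>C*-algebras on a carrier set\<close>

text \<open>C*-algebras need not be unital. The field \<open>one\<close>, inherited from the ring record, carries no
  meaning unless \<open>cstar_unital\<close> holds; in particular \<open>cstar_algebra\<close> and \<open>star_hom\<close> ignore it.\<close>

record 'a cstar = "(complex, 'a) module" +
  star :: "'a \<Rightarrow> 'a"
  cnorm :: "'a \<Rightarrow> real"

text \<open>The distance is set to 0 off the carrier because \<open>Metric_space\<close> requires nonnegativity and
  symmetry on the whole type.\<close>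

definition cdist :: "'a cstar \<Rightarrow> 'a \<Rightarrow> 'a \<Rightarrow> real" where
  "cdist A x y = (if x \<in> carrier A \<and> y \<in> carrier A then cnorm A (x \<ominus>\<^bsub>A\<^esub> y) else 0)"

locale cstar_algebra = vectorspace "class_ring :: complex ring" A
  for A :: "'a cstar" (structure) +
  assumes mult_closed: "\<lbrakk>x \<in> carrier A; y \<in> carrier A\<rbrakk> \<Longrightarrow> x \<otimes> y \<in> carrier A"
    and mult_assoc: "\<lbrakk>x \<in> carrier A; y \<in> carrier A; z \<in> carrier A\<rbrakk> \<Longrightarrow> (x \<otimes> y) \<otimes> z = x \<otimes> (y \<otimes> z)"
    and distrib_right: "\<lbrakk>x \<in> carrier A; y \<in> carrier A; z \<in> carrier A\<rbrakk> \<Longrightarrow> (x \<oplus> y) \<otimes> z = x \<otimes> z \<oplus> y \<otimes> z"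
    and distrib_left: "\<lbrakk>x \<in> carrier A; y \<in> carrier A; z \<in> carrier A\<rbrakk> \<Longrightarrow> z \<otimes> (x \<oplus> y) = z \<otimes> x \<oplus> z \<otimes> y"
    and smult_mult_left: "\<lbrakk>x \<in> carrier A; y \<in> carrier A\<rbrakk> \<Longrightarrow> (c \<odot> x) \<otimes> y = c \<odot> (x \<otimes> y)"
    and smult_mult_right: "\<lbrakk>x \<in> carrier A; y \<in> carrier A\<rbrakk> \<Longrightarrow> x \<otimes> (c \<odot> y) = c \<odot> (x \<otimes> y)"
    and star_closed: "x \<in> carrier A \<Longrightarrow> star A x \<in> carrier A"
    and star_star: "x \<in> carrier A \<Longrightarrow> star A (star A x) = x"
    and star_add: "\<lbrakk>x \<in> carrier A; y \<in> carrier A\<rbrakk> \<Longrightarrow> star A (x \<oplus> y) = star A x \<oplus> star A y"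
    and star_smult: "x \<in> carrier A \<Longrightarrow> star A (c \<odot> x) = cnj c \<odot> star A x"
    and star_mult: "\<lbrakk>x \<in> carrier A; y \<in> carrier A\<rbrakk> \<Longrightarrow> star A (x \<otimes> y) = star A y \<otimes> star A x"
    and cnorm_nonneg: "x \<in> carrier A \<Longrightarrow> 0 \<le> cnorm A x"
    and cnorm_eq_0_iff: "x \<in> carrier A \<Longrightarrow> cnorm A x = 0 \<longleftrightarrow> x = \<zero>"
    and cnorm_triangle: "\<lbrakk>x \<in> carrier A; y \<in> carrier A\<rbrakk> \<Longrightarrow> cnorm A (x \<oplus> y) \<le> cnorm A x + cnorm A y"
    and cnorm_smult: "x \<in> carrier A \<Longrightarrow> cnorm A (c \<odot> x) = cmod c * cnorm A x"
    and cnorm_mult: "\<lbrakk>x \<in> carrier A; y \<in> carrier A\<rbrakk> \<Longrightarrow> cnorm A (x \<otimes> y) \<le> cnorm A x * cnorm A y"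
    and cstar_identity: "x \<in> carrier A \<Longrightarrow> cnorm A (star A x \<otimes> x) = (cnorm A x)\<^sup>2"
    and complete: "Metric_space.mcomplete (carrier A) (cdist A)"

abbreviation cstar_topology :: "'a cstar \<Rightarrow> 'a topology" where
  "cstar_topology A \<equiv> Metric_space.mtopology (carrier A) (cdist A)"

text \<open>The zero algebra is not counted as unital: it admits no unital embedding into a product of
  nonzero matrix algebras.\<close>

definition cstar_unital :: "'a cstar \<Rightarrow> bool" where
  "cstar_unital A \<longleftrightarrow> \<one>\<^bsub>A\<^esub> \<in> carrier A \<and> \<one>\<^bsub>A\<^esub> \<noteq> \<zero>\<^bsub>A\<^esub> \<and>
     (\<forall>x\<in>carrier A. \<one>\<^bsub>A\<^esub> \<otimes>\<^bsub>A\<^esub> x = x \<and> x \<otimes>\<^bsub>A\<^esub> \<one>\<^bsub>A\<^esub> = x)"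

definition cstar_separable :: "'a cstar \<Rightarrow> bool" where
  "cstar_separable A \<longleftrightarrow> separable_space (cstar_topology A)"

definition cstar_fin_dim :: "'a cstar \<Rightarrow> bool" where
  "cstar_fin_dim A \<longleftrightarrow> vectorspace.fin_dim (class_ring :: complex ring) A"

definition star_hom :: "'a cstar \<Rightarrow> 'b cstar \<Rightarrow> ('a \<Rightarrow> 'b) \<Rightarrow> bool" where
  "star_hom A B f \<longleftrightarrow>
     f \<in> carrier A \<rightarrow> carrier B \<and>
     (\<forall>x\<in>carrier A. \<forall>y\<in>carrier A. f (x \<oplus>\<^bsub>A\<^esub> y) = f x \<oplus>\<^bsub>B\<^esub> f y) \<and>
     (\<forall>c. \<forall>x\<in>carrier A. f (c \<odot>\<^bsub>A\<^esub> x) = c \<odot>\<^bsub>B\<^esub> f x) \<and>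
     (\<forall>x\<in>carrier A. \<forall>y\<in>carrier A. f (x \<otimes>\<^bsub>A\<^esub> y) = f x \<otimes>\<^bsub>B\<^esub> f y) \<and>
     (\<forall>x\<in>carrier A. f (star A x) = star B (f x))"

definition unital_embedding :: "'a cstar \<Rightarrow> 'b cstar \<Rightarrow> ('a \<Rightarrow> 'b) \<Rightarrow> bool" where
  "unital_embedding A B f \<longleftrightarrow> cstar_unital A \<and> cstar_unital B \<and>
     star_hom A B f \<and> inj_on f (carrier A) \<and> f \<one>\<^bsub>A\<^esub> = \<one>\<^bsub>B\<^esub>"

definition cstar_subalgebra :: "'a set \<Rightarrow> 'a cstar \<Rightarrow> bool" where
  "cstar_subalgebra S A \<longleftrightarrow> closedin (cstar_topology A) S \<and> \<zero>\<^bsub>A\<^esub> \<in> S \<and>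
     (\<forall>x\<in>S. \<forall>y\<in>S. x \<oplus>\<^bsub>A\<^esub> y \<in> S) \<and> (\<forall>c. \<forall>x\<in>S. c \<odot>\<^bsub>A\<^esub> x \<in> S) \<and>
     (\<forall>x\<in>S. \<forall>y\<in>S. x \<otimes>\<^bsub>A\<^esub> y \<in> S) \<and> (\<forall>x\<in>S. star A x \<in> S)"

definition cstar_generated_by :: "'a cstar \<Rightarrow> 'a set \<Rightarrow> bool" where
  "cstar_generated_by A G \<longleftrightarrow> G \<subseteq> carrier A \<and>
     (\<forall>S. cstar_subalgebra S A \<and> G \<subseteq> S \<longrightarrow> S = carrier A)"


section \<open>Matrix algebras and bounded products\<close>

definition vec_l2 :: "complex vec \<Rightarrow> real" where
  "vec_l2 v = sqrt (\<Sum>i<dim_vec v. (cmod (v $ i))\<^sup>2)"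

definition mat_opnorm :: "complex mat \<Rightarrow> real" where
  "mat_opnorm M = Sup {vec_l2 (M *\<^sub>v v) |v. v \<in> carrier_vec (dim_col M) \<and> vec_l2 v \<le> 1}"

definition mat_cstar :: "nat \<Rightarrow> complex mat cstar" where
  "mat_cstar k =
     \<lparr>carrier = carrier_mat k k, mult = (*), one = 1\<^sub>m k, zero = 0\<^sub>m k k, add = (+),
      smult = (\<cdot>\<^sub>m), star = mat_adjoint, cnorm = mat_opnorm\<rparr>"

definition cstar_prod :: "(nat \<Rightarrow> 'a cstar) \<Rightarrow> (nat \<Rightarrow> 'a) cstar" where
  "cstar_prod A =
     \<lparr>carrier = {Y. (\<forall>n. Y n \<in> carrier (A n)) \<and> bdd_above (range (\<lambda>n. cnorm (A n) (Y n)))},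
      mult = (\<lambda>X Y n. X n \<otimes>\<^bsub>A n\<^esub> Y n),
      one = (\<lambda>n. \<one>\<^bsub>A n\<^esub>),
      zero = (\<lambda>n. \<zero>\<^bsub>A n\<^esub>),
      add = (\<lambda>X Y n. X n \<oplus>\<^bsub>A n\<^esub> Y n),
      smult = (\<lambda>c X n. c \<odot>\<^bsub>A n\<^esub> X n),
      star = (\<lambda>X n. star (A n) (X n)),
      cnorm = (\<lambda>X. SUP n. cnorm (A n) (X n))\<rparr>"


section \<open>Residual finite-dimensionality and amalgamated free products\<close>

text \<open>Both notions quantify over all C*-algebras \<open>E\<close>, which HOL cannot do inside a formula. We let
  \<open>E\<close> range over the C*-algebras whose carrier is a subset of \<^typ>\<open>nat \<Rightarrow> complex\<close>, with arbitrary
  operations. This type has the cardinality of the continuum, as has every nonzero separable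
  C*-algebra, so that these represent all separable C*-algebras up to isomorphism. That nothing is
  lost is proved below, in \<open>rfd_any_target\<close> and \<open>full_amalgamated_free_product_universal\<close>.\<close>

definition rfd :: "'a cstar \<Rightarrow> bool" where
  "rfd R \<longleftrightarrow> cstar_separable R \<and>
     (\<forall>x\<in>carrier R. x \<noteq> \<zero>\<^bsub>R\<^esub> \<longrightarrow>
        (\<exists>(E :: (nat \<Rightarrow> complex) cstar) \<pi>.
           cstar_algebra E \<and> cstar_fin_dim E \<and> star_hom R E \<pi> \<and> \<pi> x \<noteq> \<zero>\<^bsub>E\<^esub>))"

definition amalgam_factors ::
  "'d cstar \<Rightarrow> 'a cstar \<Rightarrow> 'b cstar \<Rightarrow> ('d \<Rightarrow> 'a) \<Rightarrow> ('d \<Rightarrow> 'b) \<Rightarrow>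
   'c cstar \<Rightarrow> ('a \<Rightarrow> 'c) \<Rightarrow> ('b \<Rightarrow> 'c) \<Rightarrow> 'e cstar \<Rightarrow> bool" where
  "amalgam_factors D A B \<psi>A \<psi>B C \<sigma>A \<sigma>B E \<longleftrightarrow>
     (\<forall>\<pi>A \<pi>B. star_hom A E \<pi>A \<and> star_hom B E \<pi>B \<and> (\<forall>d\<in>carrier D. \<pi>A (\<psi>A d) = \<pi>B (\<psi>B d)) \<longrightarrow>
        (\<exists>\<pi>. star_hom C E \<pi> \<and>
             (\<forall>a\<in>carrier A. \<pi> (\<sigma>A a) = \<pi>A a) \<and> (\<forall>b\<in>carrier B. \<pi> (\<sigma>B b) = \<pi>B b)))"

definition full_amalgamated_free_product ::
  "'d cstar \<Rightarrow> 'a cstar \<Rightarrow> 'b cstar \<Rightarrow> ('d \<Rightarrow> 'a) \<Rightarrow> ('d \<Rightarrow> 'b) \<Rightarrow>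
   'c cstar \<Rightarrow> ('a \<Rightarrow> 'c) \<Rightarrow> ('b \<Rightarrow> 'c) \<Rightarrow> bool" where
  "full_amalgamated_free_product D A B \<psi>A \<psi>B C \<sigma>A \<sigma>B \<longleftrightarrow>
     cstar_algebra C \<and> unital_embedding A C \<sigma>A \<and> unital_embedding B C \<sigma>B \<and>
     (\<forall>d\<in>carrier D. \<sigma>A (\<psi>A d) = \<sigma>B (\<psi>B d)) \<and>
     cstar_generated_by C (\<sigma>A ` carrier A \<union> \<sigma>B ` carrier B) \<and>
     (\<forall>E :: (nat \<Rightarrow> complex) cstar. cstar_algebra E \<longrightarrow>
        amalgam_factors D A B \<psi>A \<psi>B C \<sigma>A \<sigma>B E)"


section \<open>The test algebras on sequences suffice\<close>

lemma star_homD: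
  assumes "star_hom A B f"
  shows "\<And>x. x \<in> carrier A \<Longrightarrow> f x \<in> carrier B"
    and "\<And>x y. \<lbrakk>x \<in> carrier A; y \<in> carrier A\<rbrakk> \<Longrightarrow> f (x \<oplus>\<^bsub>A\<^esub> y) = f x \<oplus>\<^bsub>B\<^esub> f y"
    and "\<And>c x. x \<in> carrier A \<Longrightarrow> f (c \<odot>\<^bsub>A\<^esub> x) = c \<odot>\<^bsub>B\<^esub> f x"
    and "\<And>x y. \<lbrakk>x \<in> carrier A; y \<in> carrier A\<rbrakk> \<Longrightarrow> f (x \<otimes>\<^bsub>A\<^esub> y) = f x \<otimes>\<^bsub>B\<^esub> f y"
    and "\<And>x. x \<in> carrier A \<Longrightarrow> f (star A x) = star B (f x)"
  using assms unfolding star_hom_def by auto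

lemma star_hom_compose:
  assumes "star_hom A B f" "star_hom B C g"
  shows "star_hom A C (\<lambda>x. g (f x))"
  using assms unfolding star_hom_def by (auto simp: Pi_iff)

context cstar_algebra
begin

lemma minus_eq_smult: "x \<in> carrier A \<Longrightarrow> y \<in> carrier A \<Longrightarrow> x \<ominus> y = x \<oplus> (- 1) \<odot> y"
  using smult_minus_1[of y] by (simp add: a_minus_def class_ring_simps)

lemma cdist_eq: "x \<in> carrier A \<Longrightarrow> y \<in> carrier A \<Longrightarrow> cdist A x y = cnorm A (x \<oplus> (- 1) \<odot> y)"
  by (simp add: cdist_def minus_eq_smult)

lemma smult_closed': "x \<in> carrier A \<Longrightarrow> c \<odot> x \<in> carrier A"
  by (rule smult_closed) auto

lemma Metric_space_cdist: "Metric_space (carrier A) (cdist A)"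
proof
  fix x y z
  show "0 \<le> cdist A x y"
    by (auto simp: cdist_def intro!: cnorm_nonneg)
  show "cdist A x y = cdist A y x"
  proof (cases "x \<in> carrier A \<and> y \<in> carrier A")
    case True
    then have "x \<ominus> y = (- 1) \<odot> (y \<ominus> x)"
      using smult_minus_1[of "y \<ominus> x"] by (simp add: a_minus_def minus_add a_comm class_ring_simps)
    then show ?thesis using True by (simp add: cdist_def cnorm_smult)
  qed (auto simp: cdist_def)
  assume xy: "x \<in> carrier A" "y \<in> carrier A"
  show "cdist A x y = 0 \<longleftrightarrow> x = y"
    using xy by (simp add: cdist_def cnorm_eq_0_iff)
  assume z: "z \<in> carrier A"
  have "x \<ominus> z = (x \<ominus> y) \<oplus> (y \<ominus> z)"
    using xy z by (simp add: a_minus_def a_assoc r_neg2 r_neg1)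
  then show "cdist A x z \<le> cdist A x y + cdist A y z"
    using xy z by (simp add: cdist_def cnorm_triangle)
qed

sublocale cmetric: Metric_space "carrier A" "cdist A"
  by (rule Metric_space_cdist)

end

text \<open>The image of a C*-subalgebra \<open>S\<close> under an injection \<open>h\<close>, with the operations carried over.\<close>

definition transport :: "'a cstar \<Rightarrow> 'a set \<Rightarrow> ('a \<Rightarrow> 'b) \<Rightarrow> 'b cstar" where
  "transport A S h = (let g = inv_into S h in
     \<lparr>carrier = h ` S, mult = (\<lambda>x y. h (g x \<otimes>\<^bsub>A\<^esub> g y)), one = h \<one>\<^bsub>A\<^esub>, zero = h \<zero>\<^bsub>A\<^esub>,
      add = (\<lambda>x y. h (g x \<oplus>\<^bsub>A\<^esub> g y)), smult = (\<lambda>c x. h (c \<odot>\<^bsub>A\<^esub> g x)),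
      star = (\<lambda>x. h (star A (g x))), cnorm = (\<lambda>x. cnorm A (g x))\<rparr>)"

lemma (in cstar_algebra) transport:
  fixes h :: "'a \<Rightarrow> 'b"
  assumes S: "cstar_subalgebra S A" and h: "inj_on h S"
  shows transport_cstar: "cstar_algebra (transport A S h)"
    and transport_inv: "star_hom (transport A S h) A (inv_into S h)"
    and transport_hom: "\<lbrakk>star_hom B A f; f ` carrier B \<subseteq> S\<rbrakk> \<Longrightarrow> star_hom B (transport A S h) (\<lambda>x. h (f x))"
proof -
  let ?T = "transport A S h"
  have clo: "closedin cmetric.mtopology S" and S0: "\<zero> \<in> S"
    and Sadd: "\<And>x y. \<lbrakk>x \<in> S; y \<in> S\<rbrakk> \<Longrightarrow> x \<oplus> y \<in> S"
    and Ssm: "\<And>c x. x \<in> S \<Longrightarrow> c \<odot> x \<in> S"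
    and Smu: "\<And>x y. \<lbrakk>x \<in> S; y \<in> S\<rbrakk> \<Longrightarrow> x \<otimes> y \<in> S"
    and Sst: "\<And>x. x \<in> S \<Longrightarrow> star A x \<in> S"
    using S by (auto simp: cstar_subalgebra_def)
  have SA: "\<And>x. x \<in> S \<Longrightarrow> x \<in> carrier A"
    using closedin_subset[OF clo] by auto
  have g: "\<And>x. x \<in> S \<Longrightarrow> inv_into S h (h x) = x"
    using h by simp
  have T: "carrier ?T = h ` S"
    "\<And>x y. \<lbrakk>x \<in> S; y \<in> S\<rbrakk> \<Longrightarrow> h x \<otimes>\<^bsub>?T\<^esub> h y = h (x \<otimes> y)"
    "\<zero>\<^bsub>?T\<^esub> = h \<zero>"
    "\<And>x y. \<lbrakk>x \<in> S; y \<in> S\<rbrakk> \<Longrightarrow> h x \<oplus>\<^bsub>?T\<^esub> h y = h (x \<oplus> y)"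
    "\<And>c x. x \<in> S \<Longrightarrow> c \<odot>\<^bsub>?T\<^esub> h x = h (c \<odot> x)"
    "\<And>x. x \<in> S \<Longrightarrow> star ?T (h x) = h (star A x)"
    "\<And>x. x \<in> S \<Longrightarrow> cnorm ?T (h x) = cnorm A x"
    by (simp_all add: transport_def Let_def g)
  have hS: "\<And>x y. \<lbrakk>x \<in> S; y \<in> S\<rbrakk> \<Longrightarrow> h x = h y \<longleftrightarrow> x = y"
    using h by (auto simp: inj_on_def)
  have neg: "(- 1) \<odot> x \<oplus> x = \<zero>" if "x \<in> carrier A" for x
    using smult_minus_1[of x] that by (simp add: class_ring_simps l_neg)
  have ag: "abelian_group ?T"
  proof (rule abelian_groupI)
    fix x assume "x \<in> carrier ?T"
    then obtain x' where x: "x' \<in> S" "x = h x'" by (auto simp: T)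
    then show "\<exists>y\<in>carrier ?T. y \<oplus>\<^bsub>?T\<^esub> x = \<zero>\<^bsub>?T\<^esub>"
      by (intro bexI[of _ "h ((- 1) \<odot> x')"]) (simp_all add: T Ssm SA neg)
  qed (auto simp: T S0 Sadd SA a_ac)
  have vs: "vectorspace (class_ring :: complex ring) ?T"
    unfolding vectorspace_def
  proof (intro conjI class_field moduleI ag)
    show "cring (class_ring :: complex ring)" by (rule is_cring)
    fix a b :: complex and x y
    assume "x \<in> carrier ?T"
    then obtain x' where x: "x' \<in> S" "x = h x'" by (auto simp: T)
    show "a \<odot>\<^bsub>?T\<^esub> x \<in> carrier ?T" using x by (auto simp: T Ssm)
    show "(a \<oplus>\<^bsub>class_ring\<^esub> b) \<odot>\<^bsub>?T\<^esub> x = a \<odot>\<^bsub>?T\<^esub> x \<oplus>\<^bsub>?T\<^esub> b \<odot>\<^bsub>?T\<^esub> x"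
      using x smult_l_distr[of a b x'] by (simp add: T Ssm SA)
    show "(a \<otimes>\<^bsub>class_ring\<^esub> b) \<odot>\<^bsub>?T\<^esub> x = a \<odot>\<^bsub>?T\<^esub> (b \<odot>\<^bsub>?T\<^esub> x)"
      using x smult_assoc1[of a b x'] by (simp add: T Ssm SA)
    show "\<one>\<^bsub>class_ring\<^esub> \<odot>\<^bsub>?T\<^esub> x = x"
      using x smult_one[of x'] by (simp add: T Ssm SA)
    assume "y \<in> carrier ?T"
    then obtain y' where y: "y' \<in> S" "y = h y'" by (auto simp: T)
    show "a \<odot>\<^bsub>?T\<^esub> (x \<oplus>\<^bsub>?T\<^esub> y) = a \<odot>\<^bsub>?T\<^esub> x \<oplus>\<^bsub>?T\<^esub> a \<odot>\<^bsub>?T\<^esub> y"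
      using x y smult_r_distr[of a x' y'] by (simp add: T Ssm SA Sadd)
  qed
  interpret TV: vectorspace "class_ring :: complex ring" ?T by (rule vs)
  have cd: "cdist ?T (h x) (h y) = cdist A x y" if "x \<in> S" "y \<in> S" for x y
  proof -
    have "h x \<ominus>\<^bsub>?T\<^esub> h y = h x \<oplus>\<^bsub>?T\<^esub> (- 1) \<odot>\<^bsub>?T\<^esub> h y"
      using TV.smult_minus_1[of "h y"] that by (simp add: a_minus_def class_ring_simps T)
    also have "\<dots> = h (x \<ominus> y)"
      using that by (simp add: T minus_eq_smult Ssm SA)
    finally show ?thesis using that
      by (simp add: cdist_def T SA minus_eq_smult Ssm Sadd)
  qed
  have MT: "Metric_space (carrier ?T) (cdist ?T)"
  proof
    fix x y z
    have *: "cdist ?T x y = (if x \<in> h ` S \<and> y \<in> h ` S then cdist A (inv_into S h x) (inv_into S h y) else 0)" for x y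
      using cd by (auto simp: g) (auto simp: cdist_def T)
    show "0 \<le> cdist ?T x y" by (simp add: *)
    show "cdist ?T x y = cdist ?T y x" by (simp add: * cmetric.commute)
    assume "x \<in> carrier ?T" "y \<in> carrier ?T"
    then obtain x' y' where xy: "x' \<in> S" "x = h x'" "y' \<in> S" "y = h y'" by (auto simp: T)
    show "cdist ?T x y = 0 \<longleftrightarrow> x = y"
      using xy by (simp add: cd SA hS)
    assume "z \<in> carrier ?T"
    then obtain z' where z: "z' \<in> S" "z = h z'" by (auto simp: T)
    show "cdist ?T x z \<le> cdist ?T x y + cdist ?T y z"
      using xy z by (simp add: cd SA cmetric.triangle)
  qed
  interpret TM: Metric_space "carrier ?T" "cdist ?T" by (rule MT)
  have comp: "TM.mcomplete"
    unfolding TM.mcomplete_def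
  proof (intro allI impI)
    fix \<sigma> assume c: "TM.MCauchy \<sigma>"
    define \<tau> where "\<tau> n = inv_into S h (\<sigma> n)" for n
    have \<tau>: "\<tau> n \<in> S" "h (\<tau> n) = \<sigma> n" for n
      using c unfolding TM.MCauchy_def \<tau>_def
      by (auto simp: T image_subset_iff inv_into_into f_inv_into_f)
    have "cmetric.MCauchy \<tau>"
      using c unfolding TM.MCauchy_def cmetric.MCauchy_def
      by (auto simp: \<tau> SA simp flip: cd)
    then obtain l where l: "limitin cmetric.mtopology \<tau> l sequentially"
      using complete unfolding cmetric.mcomplete_def by blast
    then have lS: "l \<in> S"
      using clo \<tau> unfolding cmetric.metric_closedin_iff_sequentially_closed by blast
    have "limitin TM.mtopology \<sigma> (h l) sequentially"
      using l lS unfolding TM.limit_metric_sequentially cmetric.limit_metric_sequentially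
      using \<tau> cd by (metis T(1) imageI)
    then show "\<exists>x. limitin TM.mtopology \<sigma> x sequentially" by blast
  qed
  show "cstar_algebra ?T"
    by (intro cstar_algebra.intro vs cstar_algebra_axioms.intro)
       (auto simp: T S0 Sadd Ssm Smu Sst SA hS mult_assoc distrib_left distrib_right smult_mult_left
         smult_mult_right star_star star_add star_smult star_mult cnorm_nonneg cnorm_eq_0_iff
         cnorm_triangle cnorm_smult cnorm_mult cstar_identity mult_closed star_closed smult_closed' comp[unfolded T(1)])
  show "star_hom ?T A (inv_into S h)"
    by (auto simp: star_hom_def T g Sadd Ssm Smu Sst SA)
  assume "star_hom B A f" "f ` carrier B \<subseteq> S"
  then show "star_hom B ?T (\<lambda>x. h (f x))"
    by (auto simp: star_hom_def T image_subset_iff Pi_iff)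
qed

text \<open>At most continuum many elements.\<close>

definition small :: "'a set \<Rightarrow> bool" where
  "small S \<longleftrightarrow> (\<exists>f :: (nat \<Rightarrow> complex) \<Rightarrow> 'a. S \<subseteq> range f)"

lemma small_inj:
  fixes h :: "'a \<Rightarrow> nat \<Rightarrow> complex"
  assumes "inj_on h S"
  shows "small S"
  unfolding small_def
  by (rule exI[of _ "inv_into S h"]) (metis assms inv_into_f_f rangeI subsetI)

lemma small_imp_inj:
  assumes "small S"
  obtains h :: "'a \<Rightarrow> nat \<Rightarrow> complex" where "inj_on h S"
  using assms unfolding small_def by (metis inj_on_inv_into)

lemma small_image: "small S \<Longrightarrow> small (f ` S)"
  unfolding small_def by (metis image_comp image_mono)

lemma small_subset: "small S \<Longrightarrow> T \<subseteq> S \<Longrightarrow> small T"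
  unfolding small_def by blast

lemma small_UNIV_complex: "small (UNIV :: complex set)"
  unfolding small_def by (rule exI[of _ "\<lambda>s. s 0"]) (auto simp: image_iff intro: exI[of _ "\<lambda>_. _"])

lemma small_UN:
  assumes "\<And>n::nat. small (S n)"
  shows "small (\<Union>n. S n)"
proof -
  obtain f :: "nat \<Rightarrow> (nat \<Rightarrow> complex) \<Rightarrow> 'a" where f: "\<And>n. S n \<subseteq> range (f n)"
    using assms unfolding small_def by metis
  define F where "F s = f (inv_into UNIV (of_nat :: nat \<Rightarrow> complex) (s 0)) (\<lambda>m. s (Suc m))" for s
  have "x \<in> range F" if "x \<in> S n" for x n
  proof -
    have "x \<in> range (f n)" using f[of n] that by blast
    then obtain t where t: "x = f n t" by blast
    have "F (case_nat (of_nat n) t) = x"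
      by (simp add: F_def t inv_f_f inj_of_nat)
    then show ?thesis by blast
  qed
  then show ?thesis unfolding small_def by blast
qed

lemma small_Un:
  assumes "small S" "small T"
  shows "small (S \<union> T)"
proof -
  have "small (\<Union>n::nat. if n = 0 then S else T)"
    by (rule small_UN) (use assms in auto)
  moreover have "S \<union> T \<subseteq> (\<Union>n::nat. if n = 0 then S else T)"
    by (auto intro: exI[of _ "1::nat"])
  ultimately show ?thesis by (rule small_subset)
qed

lemma small_seq:
  assumes "small S"
  shows "small {\<sigma> :: nat \<Rightarrow> 'a. range \<sigma> \<subseteq> S}"
proof -
  obtain f :: "(nat \<Rightarrow> complex) \<Rightarrow> 'a" where f: "S \<subseteq> range f"
    using assms unfolding small_def by metis
  define F where "F s n = f (\<lambda>m. s (prod_encode (n, m)))" for s :: "nat \<Rightarrow> complex" and n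
  have "\<sigma> \<in> range F" if \<sigma>: "range \<sigma> \<subseteq> S" for \<sigma>
  proof -
    have "\<forall>n. \<exists>t. \<sigma> n = f t" using f \<sigma> by blast
    then obtain t where t: "\<And>n. \<sigma> n = f (t n)" by metis
    have "F (\<lambda>i. t (fst (prod_decode i)) (snd (prod_decode i))) = \<sigma>"
      by (rule ext) (simp add: F_def t)
    then show ?thesis by blast
  qed
  then show ?thesis unfolding small_def by blast
qed

lemma small_Times:
  assumes "small S" "small T"
  shows "small (S \<times> T)"
proof -
  have s: "small (Inl ` S \<union> Inr ` T)" by (intro small_Un small_image assms)
  have "small ((\<lambda>\<sigma>. (projl (\<sigma> 0), projr (\<sigma> (1::nat)))) ` {\<sigma>. range \<sigma> \<subseteq> Inl ` S \<union> Inr ` T})"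
    by (intro small_image small_seq s)
  moreover have "S \<times> T \<subseteq> (\<lambda>\<sigma>. (projl (\<sigma> 0), projr (\<sigma> (1::nat)))) ` {\<sigma>. range \<sigma> \<subseteq> Inl ` S \<union> Inr ` T}"
  proof clarify
    fix x y assume "x \<in> S" "y \<in> T"
    then show "(x, y) \<in> (\<lambda>\<sigma>. (projl (\<sigma> 0), projr (\<sigma> (1::nat)))) ` {\<sigma>. range \<sigma> \<subseteq> Inl ` S \<union> Inr ` T}"
      by (intro image_eqI[of _ _ "\<lambda>n. if n = 0 then Inl x else Inr y"]) auto
  qed
  ultimately show ?thesis by (rule small_subset)
qed

context cstar_algebra
begin

lemma small_separable:
  assumes "cstar_separable A"
  shows "small (carrier A)"
proof -
  obtain U where U: "countable U" "U \<subseteq> carrier A" "cmetric.mtopology closure_of U = carrier A"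
    using assms unfolding cstar_separable_def separable_space_def by auto
  define h :: "'a \<Rightarrow> nat \<Rightarrow> complex" where
    "h x n = (case prod_decode n of (i, j) \<Rightarrow> if cdist A x (from_nat_into U i) < inverse (Suc j) then 1 else 0)" for x n
  have "inj_on h (carrier A)"
  proof (rule inj_onI, rule ccontr)
    fix x y assume xy: "x \<in> carrier A" "y \<in> carrier A" "h x = h y" "x \<noteq> y"
    then have "0 < cdist A x y / 2" using cmetric.mdist_pos_less by simp
    then obtain j where j: "inverse (Suc j) < cdist A x y / 2" using reals_Archimedean by blast
    have "x \<in> cmetric.mtopology closure_of U" using U xy by simp
    then obtain u where u: "u \<in> U" "cdist A x u < inverse (Suc j)"
      unfolding cmetric.metric_closure_of by (auto dest!: spec[of _ "inverse (real (Suc j))"])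
    then obtain i where i: "from_nat_into U i = u"
      using from_nat_into_surj[OF U(1) u(1)] by blast
    have "h x (prod_encode (i, j)) = 1" using u(2) by (simp add: h_def i)
    then have "h y (prod_encode (i, j)) = 1" by (simp add: xy)
    then have "cdist A y u < inverse (Suc j)" by (simp add: h_def i split: if_splits)
    then have "cdist A x y < cdist A x y"
      using cmetric.triangle[of x u y] u(2) xy(1,2) subsetD[OF U(2) u(1)] j cmetric.commute[of u y] by simp
    then show False by simp
  qed
  then show ?thesis by (rule small_inj)
qed

lemma small_fin_dim:
  assumes "cstar_fin_dim A"
  shows "small (carrier A)"
proof -
  obtain S where S: "finite S" "S \<subseteq> carrier A" "span S = carrier A"
    using assms unfolding cstar_fin_dim_def fin_dim_def by auto
  obtain f :: "'a \<Rightarrow> nat" where f: "inj_on f S"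
    using finite_imp_inj_to_nat_seg[OF S(1)] by blast
  have "carrier A \<subseteq> range (\<lambda>s. lincomb (\<lambda>x. s (f x)) S)"
  proof
    fix x assume "x \<in> carrier A"
    then obtain a where a: "x = lincomb a S"
      using finite_span[OF S(1,2)] S(3) by auto
    have "lincomb (\<lambda>x. a (inv_into S f (f x))) S = lincomb a S"
      unfolding lincomb_def using S f
      by (intro finsum_cong') (auto intro!: smult_closed')
    then show "x \<in> range (\<lambda>s. lincomb (\<lambda>x. s (f x)) S)"
      by (intro image_eqI[of _ _ "\<lambda>i. a (inv_into S f i)"]) (simp_all add: a)
  qed
  then show ?thesis unfolding small_def by blast
qed

lemma cnorm_star:
  assumes "x \<in> carrier A"
  shows "cnorm A (star A x) = cnorm A x"
proof -
  have *: "cnorm A x \<le> cnorm A (star A x)" if x: "x \<in> carrier A" for x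
  proof (cases "cnorm A x = 0")
    case True
    then show ?thesis using cnorm_nonneg[of "star A x"] x star_closed by simp
  next
    case False
    then have "0 < cnorm A x" using cnorm_nonneg[OF x] by simp
    moreover have "cnorm A x * cnorm A x \<le> cnorm A (star A x) * cnorm A x"
      using cnorm_mult[of "star A x" x] cstar_identity[OF x] x star_closed by (simp add: power2_eq_square)
    ultimately show ?thesis by simp
  qed
  show ?thesis using *[OF assms] *[of "star A x"] assms by (simp add: star_closed star_star)
qed

lemma cdist_smult: "x \<in> carrier A \<Longrightarrow> y \<in> carrier A \<Longrightarrow> cdist A (c \<odot> x) (c \<odot> y) = cmod c * cdist A x y"
proof -
  assume xy: "x \<in> carrier A" "y \<in> carrier A"
  have "c \<odot> x \<oplus> (- 1) \<odot> (c \<odot> y) = c \<odot> (x \<oplus> (- 1) \<odot> y)"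
    using xy smult_assoc1[of "-1" c y] smult_assoc1[of c "-1" y] smult_r_distr[of c x "(-1) \<odot> y"]
    by (simp add: smult_closed')
  then show ?thesis using xy by (simp add: cdist_eq smult_closed' cnorm_smult)
qed

lemma cdist_star: "x \<in> carrier A \<Longrightarrow> y \<in> carrier A \<Longrightarrow> cdist A (star A x) (star A y) = cdist A x y"
proof -
  assume xy: "x \<in> carrier A" "y \<in> carrier A"
  have "star A x \<oplus> (- 1) \<odot> star A y = star A (x \<oplus> (- 1) \<odot> y)"
    using xy by (simp add: star_add star_smult smult_closed')
  then show ?thesis using xy by (simp add: cdist_eq smult_closed' cnorm_star star_closed)
qed

lemma cdist_translate:
  assumes "x \<in> carrier A" "y \<in> carrier A" "z \<in> carrier A"
  shows "cdist A (z \<oplus> x) (z \<oplus> y) = cdist A x y"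
proof -
  have "(z \<oplus> x) \<ominus> (z \<oplus> y) = x \<ominus> y"
    using assms by (simp add: a_minus_def minus_add a_comm[of z x] a_assoc r_neg2)
  then show ?thesis using assms by (simp add: cdist_def)
qed

lemma cdist_add:
  assumes "x \<in> carrier A" "y \<in> carrier A" "x' \<in> carrier A" "y' \<in> carrier A"
  shows "cdist A (x \<oplus> y) (x' \<oplus> y') \<le> cdist A x x' + cdist A y y'"
  using cmetric.triangle[of "x \<oplus> y" "x \<oplus> y'" "x' \<oplus> y'"] assms
    cdist_translate[of y y' x] cdist_translate[of x x' y'] by (simp add: a_comm)

lemma cnorm_le_cdist:
  assumes "x \<in> carrier A" "y \<in> carrier A"
  shows "cnorm A y \<le> cnorm A x + cdist A x y"
proof -
  have "y = x \<oplus> (y \<ominus> x)" using assms by (simp add: a_minus_def a_comm[of y "\<ominus> x"] r_neg2)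
  then have "cnorm A y \<le> cnorm A x + cnorm A (y \<ominus> x)"
    using assms cnorm_triangle[of x "y \<ominus> x"] by simp
  then show ?thesis using assms cmetric.commute[of x y] by (simp add: cdist_def)
qed

lemma cdist_mult:
  assumes "x \<in> carrier A" "y \<in> carrier A" "x' \<in> carrier A" "y' \<in> carrier A"
  shows "cdist A (x \<otimes> y) (x' \<otimes> y') \<le> cnorm A x * cdist A y y' + cdist A x x' * cnorm A y'"
proof -
  have "cdist A (x \<otimes> y) (x \<otimes> y') \<le> cnorm A x * cdist A y y'"
  proof -
    have "x \<otimes> y \<oplus> (- 1) \<odot> (x \<otimes> y') = x \<otimes> (y \<oplus> (- 1) \<odot> y')"
      using assms by (simp add: distrib_left smult_mult_right smult_closed')
    then show ?thesis using assms cnorm_mult[of x "y \<oplus> (- 1) \<odot> y'"]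
      by (simp add: cdist_eq mult_closed smult_closed')
  qed
  moreover have "cdist A (x \<otimes> y') (x' \<otimes> y') \<le> cdist A x x' * cnorm A y'"
  proof -
    have "x \<otimes> y' \<oplus> (- 1) \<odot> (x' \<otimes> y') = (x \<oplus> (- 1) \<odot> x') \<otimes> y'"
      using assms by (simp add: distrib_right smult_mult_left smult_closed')
    then show ?thesis using assms cnorm_mult[of "x \<oplus> (- 1) \<odot> x'" y']
      by (simp add: cdist_eq mult_closed smult_closed')
  qed
  ultimately show ?thesis
    using cmetric.triangle[of "x \<otimes> y" "x \<otimes> y'" "x' \<otimes> y'"] assms by (simp add: mult_closed)
qed

lemma small_subalgebra:
  assumes G: "G \<subseteq> carrier A" "small G"
  obtains S where "cstar_subalgebra S A" "G \<subseteq> S" "small S"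
proof -
  define step where "step X = X \<union> (\<lambda>(x, y). x \<oplus> y) ` (X \<times> X) \<union> (\<lambda>(x, y). x \<otimes> y) ` (X \<times> X) \<union>
     (\<lambda>(c, x). c \<odot> x) ` (UNIV \<times> X) \<union> star A ` X" for X
  define W where "W n = (step ^^ n) (insert \<zero> G)" for n
  define U where "U = (\<Union>n. W n)"
  define S where "S = cmetric.mtopology closure_of U"
  have "W n \<subseteq> carrier A \<and> small (W n)" for n
  proof (induction n)
    case 0
    have "small (insert \<zero> G)"
      using small_Un[of "{\<zero>}" G] G by (auto simp: small_def[of "{\<zero>}"])
    then show ?case using G by (simp add: W_def)
  next
    case (Suc n)
    have "W (Suc n) = step (W n)" by (simp add: W_def)
    moreover have "small (step (W n))"
      unfolding step_def using Suc by (intro small_Un small_image small_Times small_UNIV_complex) auto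
    ultimately show ?case
      using Suc by (auto simp: step_def intro!: mult_closed smult_closed' star_closed)
  qed
  then have UA: "U \<subseteq> carrier A" and sU: "small U"
    unfolding U_def by (auto intro!: small_UN)
  have Wmono: "W m \<subseteq> W n" if "m \<le> n" for m n
    using that by (induction rule: dec_induct) (auto simp: W_def step_def)
  have Wstep: "step (W n) \<subseteq> U" for n
  proof -
    have "step (W n) = W (Suc n)" by (simp add: W_def)
    then show ?thesis unfolding U_def by blast
  qed
  have step1: "(\<lambda>(x, y). x \<oplus> y) ` (X \<times> X) \<subseteq> step X" "(\<lambda>(x, y). x \<otimes> y) ` (X \<times> X) \<subseteq> step X"
     "(\<lambda>(c, x). c \<odot> x) ` (UNIV \<times> X) \<subseteq> step X" "star A ` X \<subseteq> step X" for X
    unfolding step_def by blast+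
  have stepI: "x \<oplus> y \<in> step X" "x \<otimes> y \<in> step X" "c \<odot> x \<in> step X" "star A x \<in> step X"
    if "x \<in> X" "y \<in> X" for c x y X
    by (rule subsetD[OF step1(1)], rule image_eqI[of _ _ "(x, y)"], simp_all add: that)
       (rule subsetD[OF step1(2)], rule image_eqI[of _ _ "(x, y)"], simp_all add: that,
        rule subsetD[OF step1(3)], rule image_eqI[of _ _ "(c, x)"], simp_all add: that,
        rule subsetD[OF step1(4)], rule imageI, rule that)
  have two: "\<exists>n. x \<in> W n \<and> y \<in> W n" if xy: "x \<in> U" "y \<in> U" for x y
  proof -
    obtain m n where "x \<in> W m" "y \<in> W n" using xy unfolding U_def by blast
    then have "x \<in> W (max m n)" "y \<in> W (max m n)" using Wmono[of m "max m n"] Wmono[of n "max m n"] by auto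
    then show ?thesis by blast
  qed
  have Uadd: "x \<oplus> y \<in> U" and Umult: "x \<otimes> y \<in> U" if "x \<in> U" "y \<in> U" for x y
    using two[OF that] Wstep stepI by blast+
  have Usm: "c \<odot> x \<in> U" and Ust: "star A x \<in> U" if xU: "x \<in> U" for c x
    
  proof -
    obtain n where n: "x \<in> W n" using two[OF xU xU] by blast
    show "c \<odot> x \<in> U" by (rule subsetD[OF Wstep[of n] stepI(3)[OF n n]])
    show "star A x \<in> U" by (rule subsetD[OF Wstep[of n] stepI(4)[OF n n]])
  qed
  have memS: "x \<in> S \<longleftrightarrow> x \<in> carrier A \<and> (\<forall>r>0. \<exists>y\<in>U. cdist A x y < r)" for x
    using UA unfolding S_def cmetric.metric_closure_of mem_Collect_eq cmetric.in_mball by blast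
  have "U \<subseteq> S" using UA memS by (metis cmetric.mdist_zero subsetD subsetI)
  moreover have "insert \<zero> G = W 0" by (simp add: W_def)
  then have "insert \<zero> G \<subseteq> U" unfolding U_def by blast
  ultimately have GS: "insert \<zero> G \<subseteq> S" by blast
  have "cstar_subalgebra S A"
    unfolding cstar_subalgebra_def
  proof (intro conjI ballI allI)
    show "closedin cmetric.mtopology S" by (simp add: S_def)
    show "\<zero> \<in> S" using GS by simp
    fix x assume x: "x \<in> S"
    show "c \<odot> x \<in> S" for c
      unfolding memS
    proof (intro conjI allI impI)
      fix r :: real assume r: "r > 0"
      then have "r / (cmod c + 1) > 0" by (simp add: add_nonneg_pos)
      then obtain y where y: "y \<in> U" "cdist A x y < r / (cmod c + 1)" using x memS by blast
      have "cmod c * cdist A x y \<le> (cmod c + 1) * cdist A x y" by (simp add: mult_right_mono)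
      also have "\<dots> < r" 
      proof -
        have "cmod c + 1 > 0" by (simp add: add_nonneg_pos)
        then show ?thesis using y(2) by (simp only: pos_less_divide_eq mult.commute)
      qed
      finally have "cdist A (c \<odot> x) (c \<odot> y) < r"
        using cdist_smult[of x y c] x memS[of x] subsetD[OF UA y(1)] by simp
      then show "\<exists>y\<in>U. cdist A (c \<odot> x) y < r" using Usm[OF y(1)] by blast
    next
      show "c \<odot> x \<in> carrier A" using x memS[of x] by (simp add: smult_closed')
    qed
    show "star A x \<in> S"
      unfolding memS
    proof (intro conjI allI impI)
      fix r :: real assume "r > 0"
      then obtain y where y: "y \<in> U" "cdist A x y < r" using x memS[of x] by blast
      then have "cdist A (star A x) (star A y) < r"
        using cdist_star[of x y] x memS[of x] subsetD[OF UA y(1)] by simp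
      then show "\<exists>y\<in>U. cdist A (star A x) y < r" using Ust[OF y(1)] by blast
    next
      show "star A x \<in> carrier A" using x memS[of x] by (simp add: star_closed)
    qed
    fix y assume y: "y \<in> S"
    show "x \<oplus> y \<in> S"
      unfolding memS
    proof (intro conjI allI impI)
      fix r :: real assume "r > 0"
      then have "r / 2 > 0" by simp
      then obtain x' y' where *: "x' \<in> U" "cdist A x x' < r / 2" "y' \<in> U" "cdist A y y' < r / 2"
        using x y memS[of x] memS[of y] by blast
      then have "cdist A (x \<oplus> y) (x' \<oplus> y') < r"
        using cdist_add[of x y x' y'] x y memS[of x] memS[of y] subsetD[OF UA, of x'] subsetD[OF UA, of y'] by simp
      then show "\<exists>z\<in>U. cdist A (x \<oplus> y) z < r" using Uadd[OF *(1,3)] by blast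
    qed (use x y memS[of x] memS[of y] in auto)
    show "x \<otimes> y \<in> S"
      unfolding memS
    proof (intro conjI allI impI)
      fix r :: real assume r: "r > 0"
      define K where "K = cnorm A x + cnorm A y + 1"
      have K: "K > 0" using x y memS[of x] memS[of y] cnorm_nonneg by (simp add: K_def add_nonneg_pos)
      define e where "e = min 1 (r / K)"
      have e: "e > 0" "e \<le> 1" "e * K \<le> r" using r K by (auto simp: e_def min_def field_simps)
      then obtain x' y' where *: "x' \<in> U" "cdist A x x' < e" "y' \<in> U" "cdist A y y' < e"
        using x y memS[of x] memS[of y] by blast
      have cr: "x \<in> carrier A" "y \<in> carrier A" "x' \<in> carrier A" "y' \<in> carrier A"
        using * x y memS[of x] memS[of y] UA by auto
      have ny: "cnorm A y' < cnorm A y + 1" using cnorm_le_cdist[of y y'] cr * e by simp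
      have "cnorm A x * cdist A y y' \<le> cnorm A x * e"
        using * cnorm_nonneg[of x] cr by (intro mult_left_mono) auto
      moreover have "cdist A x x' * cnorm A y' < e * (cnorm A y + 1)"
        using * ny cnorm_nonneg[of y'] cr by (intro mult_strict_mono') auto
      ultimately have "cdist A (x \<otimes> y) (x' \<otimes> y') < e * K"
        using cdist_mult[OF cr(1,2,3,4)] by (simp add: K_def algebra_simps)
      then show "\<exists>z\<in>U. cdist A (x \<otimes> y) z < r" using Umult[OF *(1,3)] e by (meson less_le_trans)
    qed (use x y memS[of x] memS[of y] in \<open>simp add: mult_closed\<close>)
  qed
  moreover have "small S"
  proof -
    define L where "L \<sigma> = (SOME x. limitin cmetric.mtopology \<sigma> x sequentially)" for \<sigma>
    have "S \<subseteq> L ` {\<sigma>. range \<sigma> \<subseteq> U}"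
    proof
      fix x assume x: "x \<in> S"
      have "\<forall>n. \<exists>y\<in>U. cdist A x y < inverse (real (Suc n))"
        using x memS[of x] by simp
      then obtain \<sigma> where \<sigma>: "\<And>n. \<sigma> n \<in> U" "\<And>n. cdist A x (\<sigma> n) < inverse (real (Suc n))" by metis
      have lim: "limitin cmetric.mtopology \<sigma> x sequentially"
        unfolding cmetric.limit_metric_sequentially
      proof (intro conjI allI impI)
        fix e :: real assume "e > 0"
        then obtain N where N: "inverse (real (Suc N)) < e" using reals_Archimedean by blast
        have "cdist A (\<sigma> n) x < e" if "n \<ge> N" for n
        proof -
          have "inverse (real (Suc n)) \<le> inverse (real (Suc N))" using that by (simp add: field_simps)
          then show ?thesis using \<sigma>(2)[of n] N cmetric.commute[of x "\<sigma> n"] by linarith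
        qed
        then show "\<exists>N. \<forall>n\<ge>N. \<sigma> n \<in> carrier A \<and> cdist A (\<sigma> n) x < e" using \<sigma>(1) UA by blast
      qed (use x memS[of x] in auto)
      then have "limitin cmetric.mtopology \<sigma> (L \<sigma>) sequentially" unfolding L_def by (rule someI)
      then have "L \<sigma> = x" using lim cmetric.limitin_metric_unique by (meson trivial_limit_sequentially)
      then show "x \<in> L ` {\<sigma>. range \<sigma> \<subseteq> U}" using \<sigma>(1) by auto
    qed
    then show ?thesis using small_subset[OF small_image[OF small_seq[OF sU]]] by blast
  qed
  ultimately show ?thesis using that GS by blast
qed

end

lemma (in cstar_algebra) subalgebra_carrier: "cstar_subalgebra (carrier A) A"
  unfolding cstar_subalgebra_def
  using cmetric.closedin_metric by (auto simp: mult_closed smult_closed' star_closed)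

theorem rfd_any_target:
  fixes R :: "'a cstar" and E :: "'e cstar"
  assumes E: "cstar_algebra E" and fin: "cstar_fin_dim E" and \<pi>: "star_hom R E \<pi>"
    and x: "x \<in> carrier R" "\<pi> x \<noteq> \<zero>\<^bsub>E\<^esub>"
  shows "\<exists>(F :: (nat \<Rightarrow> complex) cstar) \<rho>.
     cstar_algebra F \<and> cstar_fin_dim F \<and> star_hom R F \<rho> \<and> \<rho> x \<noteq> \<zero>\<^bsub>F\<^esub>"
proof -
  interpret E: cstar_algebra E by (rule E)
  obtain h :: "'e \<Rightarrow> nat \<Rightarrow> complex" where h: "inj_on h (carrier E)"
    using E.small_fin_dim[OF fin] by (rule small_imp_inj)
  let ?F = "transport E (carrier E) h"
  note tr = E.transport_cstar[OF E.subalgebra_carrier h] E.transport_hom[OF E.subalgebra_carrier h]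
  interpret F: cstar_algebra ?F by (rule tr(1))
  have hom: "star_hom E ?F (\<lambda>x. h x)"
    by (rule tr(2)) (auto simp: star_hom_def)
  have mh: "h \<in> LinearCombinations.module_hom (class_ring :: complex ring) E ?F"
    using hom unfolding LinearCombinations.module_hom_def star_hom_def by simp
  have lm: "linear_map (class_ring :: complex ring) E ?F h"
    by (rule linear_map.intro[OF E.vectorspace_axioms F.vectorspace_axioms
          mod_hom.intro[OF E.module_axioms F.module_axioms mod_hom_axioms.intro[OF mh]]])
  have "h ` carrier E = carrier ?F" by (simp add: transport_def Let_def)
  then have "cstar_fin_dim ?F"
    using linear_map.rank_nullity_main(2)[OF lm] fin unfolding cstar_fin_dim_def by blast
  moreover have "star_hom R ?F (\<lambda>x. h (\<pi> x))"
    using star_hom_compose[OF \<pi> hom] .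
  moreover have "h (\<pi> x) \<noteq> \<zero>\<^bsub>?F\<^esub>"
    using x star_homD(1)[OF \<pi> x(1)] h by (auto simp: transport_def Let_def inj_on_def)
  ultimately show ?thesis using tr(1) by blast
qed

theorem full_amalgamated_free_product_universal:
  fixes E :: "'e cstar"
  assumes P: "full_amalgamated_free_product D A B \<psi>A \<psi>B C \<sigma>A \<sigma>B"
    and A: "cstar_algebra A" "cstar_separable A" and B: "cstar_algebra B" "cstar_separable B"
    and E: "cstar_algebra E"
  shows "amalgam_factors D A B \<psi>A \<psi>B C \<sigma>A \<sigma>B E"
  unfolding amalgam_factors_def
proof (intro allI impI, elim conjE)
  fix \<pi>A \<pi>B
  assume \<pi>: "star_hom A E \<pi>A" "star_hom B E \<pi>B" and eq: "\<forall>d\<in>carrier D. \<pi>A (\<psi>A d) = \<pi>B (\<psi>B d)"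
  interpret E: cstar_algebra E by (rule E)
  have "small (\<pi>A ` carrier A \<union> \<pi>B ` carrier B)"
    by (intro small_Un small_image cstar_algebra.small_separable A B)
  moreover have "\<pi>A ` carrier A \<union> \<pi>B ` carrier B \<subseteq> carrier E"
    using \<pi> by (auto simp: star_hom_def)
  ultimately obtain S where S: "cstar_subalgebra S E" "\<pi>A ` carrier A \<union> \<pi>B ` carrier B \<subseteq> S" "small S"
    using E.small_subalgebra by blast
  obtain h :: "'e \<Rightarrow> nat \<Rightarrow> complex" where h: "inj_on h S"
    using S(3) by (rule small_imp_inj)
  let ?F = "transport E S h"
  note tr = E.transport_cstar[OF S(1) h] E.transport_inv[OF S(1) h] E.transport_hom[OF S(1) h]
  have "amalgam_factors D A B \<psi>A \<psi>B C \<sigma>A \<sigma>B ?F"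
    using P tr(1) unfolding full_amalgamated_free_product_def by blast
  moreover have "star_hom A ?F (\<lambda>x. h (\<pi>A x))" "star_hom B ?F (\<lambda>x. h (\<pi>B x))"
    using tr(3) \<pi> S(2) by auto
  moreover have "\<forall>d\<in>carrier D. h (\<pi>A (\<psi>A d)) = h (\<pi>B (\<psi>B d))" using eq by simp
  ultimately obtain \<rho> where \<rho>: "star_hom C ?F \<rho>"
      "\<forall>a\<in>carrier A. \<rho> (\<sigma>A a) = h (\<pi>A a)" "\<forall>b\<in>carrier B. \<rho> (\<sigma>B b) = h (\<pi>B b)"
    unfolding amalgam_factors_def by blast
  have "star_hom C E (\<lambda>x. inv_into S h (\<rho> x))"
    by (rule star_hom_compose[OF \<rho>(1) tr(2)])
  moreover have "\<forall>a\<in>carrier A. inv_into S h (\<rho> (\<sigma>A a)) = \<pi>A a"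
    "\<forall>b\<in>carrier B. inv_into S h (\<rho> (\<sigma>B b)) = \<pi>B b"
    using \<rho>(2,3) h S(2) by (auto simp: image_subset_iff)
  ultimately show "\<exists>\<pi>. star_hom C E \<pi> \<and>
       (\<forall>a\<in>carrier A. \<pi> (\<sigma>A a) = \<pi>A a) \<and> (\<forall>b\<in>carrier B. \<pi> (\<sigma>B b) = \<pi>B b)" by blast
qed

end

theory Submission
  imports Defs
begin

text \<open>The implication to a common product only needs countably many finite-dimensional representations
  that separate the points of \<open>C\<close>; their product is restricted to \<open>A\<close> and \<open>B\<close>.

  For the converse let \<open>x \<noteq> 0\<close> in \<open>C\<close> and let \<open>\<phi>\<close> be a state with \<open>\<phi>(x\<^sup>* x) = \<parallel>x\<parallel>\<^sup>2\<close>. Since the coordinates of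
  \<open>q1\<close> separate the points of \<open>A\<close>, a Hahn-Banach argument shows that finitely many GNS vectors of \<open>\<phi>\<close>,
  together with the action of finitely many elements of \<open>A\<close> on them, are approximated by vectors in a direct
  sum of these coordinates; likewise for \<open>B\<close> and \<open>q2\<close>. The two families have almost the same Gram matrices
  over \<open>D\<close>. As \<open>D\<close> is finite-dimensional, some contraction that commutes exactly with \<open>D\<close> nearly carries one
  family to the other, and so does its unitary dilation. Conjugating by this unitary moves the action of \<open>B\<close> to
  the vectors of \<open>A\<close> without changing the action of \<open>D\<close>, and the universal property yields a
  finite-dimensional representation of \<open>C\<close>. In the limit over finite sets of vectors it acts on the
  approximating vectors as \<open>C\<close> acts on the GNS vectors, hence \<open>x\<close> does not act as \<open>0\<close>.\<close>

section \<open>Sublinear functionals and cones\<close>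

text \<open>The coordinates of \<open>q1\<close> and \<open>q2\<close> already induce
  representations of \<open>C\<close>, but these need not separate its points. So the actions of
  \<open>A\<close> and of \<open>B\<close> on the GNS vectors are modelled independently, and the
  obstacle is that the two models agree over \<open>D\<close> only up to an error, whereas the
  universal property asks for equality. Two choices remove it. Every direct sum of coordinates of
  \<open>q1\<close> also carries the action of \<open>B\<close> by the same coordinates of
  \<open>q2\<close>; hence both models sit in one space on which \<open>A\<close> and
  \<open>B\<close> act and already agree on \<open>D\<close>, and only vectors have to be moved. The
  map that moves them is built from the orbits of the vectors under a basis of \<open>D\<close>, on
  which \<open>D\<close> acts by copies of its left regular representation; the intertwining
  relation is then an identity, and only norm estimates carry errors. Positivity, square roots and
  states are developed from the norm alone, by iteration and Hahn-Banach, so that no spectral theory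
  enters. No GNS completion is formed either: the vectors are elements of \<open>C\<close> with the
  form \<open>\<phi> (star C y \<otimes> z)\<close>.\<close>

locale real_space =
  fixes V :: "'v set" and add :: "'v \<Rightarrow> 'v \<Rightarrow> 'v" (infixl "\<^bold>+" 65) and sm :: "real \<Rightarrow> 'v \<Rightarrow> 'v" (infixr "\<^bold>\<cdot>" 75)
    and zr :: 'v
  assumes V_add: "x \<in> V \<Longrightarrow> y \<in> V \<Longrightarrow> x \<^bold>+ y \<in> V"
    and V_sm: "x \<in> V \<Longrightarrow> c \<^bold>\<cdot> x \<in> V"
    and V_assoc: "x \<in> V \<Longrightarrow> y \<in> V \<Longrightarrow> z \<in> V \<Longrightarrow> (x \<^bold>+ y) \<^bold>+ z = x \<^bold>+ (y \<^bold>+ z)"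
    and V_comm: "x \<in> V \<Longrightarrow> y \<in> V \<Longrightarrow> x \<^bold>+ y = y \<^bold>+ x"
    and V_zero_add: "x \<in> V \<Longrightarrow> x \<^bold>+ zr = x"
    and V_sm_zero: "x \<in> V \<Longrightarrow> 0 \<^bold>\<cdot> x = zr"
    and V_sm_one: "x \<in> V \<Longrightarrow> 1 \<^bold>\<cdot> x = x"
    and V_sm_sm: "x \<in> V \<Longrightarrow> a \<^bold>\<cdot> (b \<^bold>\<cdot> x) = (a * b) \<^bold>\<cdot> x"
    and V_sm_add: "x \<in> V \<Longrightarrow> y \<in> V \<Longrightarrow> c \<^bold>\<cdot> (x \<^bold>+ y) = c \<^bold>\<cdot> x \<^bold>+ c \<^bold>\<cdot> y"
    and V_add_sm: "x \<in> V \<Longrightarrow> (a + b) \<^bold>\<cdot> x = a \<^bold>\<cdot> x \<^bold>+ b \<^bold>\<cdot> x"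
begin

definition sublinear :: "('v \<Rightarrow> real) \<Rightarrow> bool" where
  "sublinear q \<longleftrightarrow> (\<forall>x\<in>V. \<forall>y\<in>V. q (x \<^bold>+ y) \<le> q x + q y) \<and> (\<forall>t>0. \<forall>x\<in>V. q (t \<^bold>\<cdot> x) = t * q x)"

lemma V_neg: "x \<in> V \<Longrightarrow> x \<^bold>+ (- 1) \<^bold>\<cdot> x = zr"
  using V_add_sm[of x 1 "- 1"] by (simp add: V_sm_one V_sm_zero)

lemma V_left_comm: "x \<in> V \<Longrightarrow> y \<in> V \<Longrightarrow> z \<in> V \<Longrightarrow> x \<^bold>+ (y \<^bold>+ z) = y \<^bold>+ (x \<^bold>+ z)"
  by (metis V_assoc V_comm)

lemma V_zero: "x \<in> V \<Longrightarrow> zr \<in> V"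
  using V_sm[of x 0] by (simp add: V_sm_zero)

lemma sublinear_zero:
  assumes "sublinear q" "x \<in> V"
  shows "q zr = 0"
proof -
  have "2 \<^bold>\<cdot> zr = zr" using V_sm_sm[of x 2 0] assms(2) by (simp add: V_sm_zero)
  moreover have "q (2 \<^bold>\<cdot> zr) = 2 * q zr" using assms V_zero unfolding sublinear_def by auto
  ultimately show ?thesis by simp
qed

lemma sublinear_neg:
  assumes "sublinear q" "x \<in> V"
  shows "0 \<le> q x + q ((- 1) \<^bold>\<cdot> x)"
  using assms sublinear_zero[OF assms] V_neg[of x] V_sm[of x "-1"] unfolding sublinear_def by metis

lemma sublinear_scale: "sublinear q \<Longrightarrow> t \<ge> 0 \<Longrightarrow> x \<in> V \<Longrightarrow> q (t \<^bold>\<cdot> x) = t * q x"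
  using sublinear_zero[of q x] by (cases "t = 0") (auto simp: sublinear_def V_sm_zero)

text \<open>The standard modification of a sublinear functional in the direction \<open>y\<close>:
  it stays below \<open>q\<close> and is at most \<open>- q y\<close> at \<open>- y\<close>.
  Minimality of \<open>q\<close> therefore forces \<open>q (- y) = - q y\<close>.\<close>

definition lower :: "('v \<Rightarrow> real) \<Rightarrow> 'v \<Rightarrow> 'v \<Rightarrow> real" where
  "lower q y x = (INF t\<in>{0..}. q (x \<^bold>+ t \<^bold>\<cdot> y) - t * q y)"

text \<open>Subadditivity applied to \<open>t y = (x + t y) - x\<close>. The bound is independent of
  \<open>t\<close>, so the infimum in \<open>lower\<close> is taken over a set bounded
  below.\<close>

lemma lower_bound:
  assumes q: "sublinear q" and "x \<in> V" "y \<in> V" "t \<ge> 0"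
  shows "- q ((- 1) \<^bold>\<cdot> x) \<le> q (x \<^bold>+ t \<^bold>\<cdot> y) - t * q y"
proof -
  have "(x \<^bold>+ t \<^bold>\<cdot> y) \<^bold>+ (- 1) \<^bold>\<cdot> x = t \<^bold>\<cdot> y \<^bold>+ (x \<^bold>+ (- 1) \<^bold>\<cdot> x)"
    using assms V_sm by (metis V_assoc V_comm)
  also have "\<dots> = t \<^bold>\<cdot> y" using assms V_sm by (simp add: V_neg V_zero_add)
  finally have "q (t \<^bold>\<cdot> y) \<le> q (x \<^bold>+ t \<^bold>\<cdot> y) + q ((- 1) \<^bold>\<cdot> x)"
    using q assms V_sm V_add unfolding sublinear_def by metis
  then show ?thesis using sublinear_scale[OF q] assms by simp
qed

lemma lower_le:
  assumes q: "sublinear q" and "x \<in> V" "y \<in> V" "t \<ge> 0"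
  shows "lower q y x \<le> q (x \<^bold>+ t \<^bold>\<cdot> y) - t * q y"
  unfolding lower_def using lower_bound[OF q assms(2,3)] assms(4)
  by (intro cINF_lower bdd_belowI2[of _ "- q ((- 1) \<^bold>\<cdot> x)"]) auto

lemma lower_greatest:
  assumes "\<And>t. t \<ge> 0 \<Longrightarrow> b \<le> q (x \<^bold>+ t \<^bold>\<cdot> y) - t * q y"
  shows "b \<le> lower q y x"
  unfolding lower_def by (rule cINF_greatest) (use assms in auto)

lemma lower_less:
  assumes q: "sublinear q" and "x \<in> V" "y \<in> V" "lower q y x < b"
  obtains t where "t \<ge> 0" "q (x \<^bold>+ t \<^bold>\<cdot> y) - t * q y < b"
  using lower_greatest[of b q x y] assms(4) by fastforce

lemma sublinear_lower:
  assumes q: "sublinear q" and y: "y \<in> V"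
  shows "sublinear (lower q y)" and "\<And>x. x \<in> V \<Longrightarrow> lower q y x \<le> q x"
    and "lower q y ((- 1) \<^bold>\<cdot> y) \<le> - q y"
proof -
  show "lower q y x \<le> q x" if "x \<in> V" for x
    using lower_le[OF q that y, of 0] y that by (simp add: V_sm_zero V_zero_add)
  show "lower q y ((- 1) \<^bold>\<cdot> y) \<le> - q y"
  proof -
    have "(- 1) \<^bold>\<cdot> y \<^bold>+ 1 \<^bold>\<cdot> y = zr" using V_neg[OF y] V_comm y V_sm V_sm_one by metis
    then show ?thesis using lower_le[OF q V_sm[OF y, of "-1"] y, of 1] sublinear_zero[OF q y] by simp
  qed
  show "sublinear (lower q y)"
    unfolding sublinear_def
  proof (intro conjI ballI allI impI)
    fix x z assume xz: "x \<in> V" "z \<in> V"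
    show "lower q y (x \<^bold>+ z) \<le> lower q y x + lower q y z"
    proof (rule field_le_epsilon)
      fix e :: real assume "e > 0"
      then obtain t s where t: "t \<ge> 0" "q (x \<^bold>+ t \<^bold>\<cdot> y) - t * q y < lower q y x + e / 2"
        and s: "s \<ge> 0" "q (z \<^bold>+ s \<^bold>\<cdot> y) - s * q y < lower q y z + e / 2"
        using lower_less[OF q xz(1) y] lower_less[OF q xz(2) y] by (metis half_gt_zero less_add_same_cancel1)
      \<comment> \<open>Nearly optimal parameters for \<open>x\<close> and for \<open>z\<close> add
        up to a parameter for the sum.\<close>
      have "(x \<^bold>+ z) \<^bold>+ (t + s) \<^bold>\<cdot> y = (x \<^bold>+ t \<^bold>\<cdot> y) \<^bold>+ (z \<^bold>+ s \<^bold>\<cdot> y)"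
        using xz y by (simp add: V_add_sm V_assoc V_left_comm[of z] V_sm V_add)
      then have "q ((x \<^bold>+ z) \<^bold>+ (t + s) \<^bold>\<cdot> y) \<le> q (x \<^bold>+ t \<^bold>\<cdot> y) + q (z \<^bold>+ s \<^bold>\<cdot> y)"
        using q xz y unfolding sublinear_def by (simp add: V_add V_sm)
      then have "lower q y (x \<^bold>+ z) \<le> (q (x \<^bold>+ t \<^bold>\<cdot> y) - t * q y) + (q (z \<^bold>+ s \<^bold>\<cdot> y) - s * q y)"
        using lower_le[OF q V_add[OF xz] y, of "t + s"] t s by (simp add: algebra_simps)
      then show "lower q y (x \<^bold>+ z) \<le> lower q y x + lower q y z + e" using t s by simp
    qed
  next
    fix c :: real and x assume c: "c > 0" and x: "x \<in> V"
    have le: "lower q y (c \<^bold>\<cdot> x) \<le> c * lower q y x" if c: "c > 0" and x: "x \<in> V" for c x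
    proof -
      have "lower q y (c \<^bold>\<cdot> x) / c \<le> lower q y x"
      proof (rule lower_greatest)
        fix t :: real assume t: "t \<ge> 0"
        have "c \<^bold>\<cdot> (x \<^bold>+ t \<^bold>\<cdot> y) = c \<^bold>\<cdot> x \<^bold>+ (c * t) \<^bold>\<cdot> y"
          using x y by (simp add: V_sm_add V_sm V_sm_sm)
        then have "c * q (x \<^bold>+ t \<^bold>\<cdot> y) = q (c \<^bold>\<cdot> x \<^bold>+ (c * t) \<^bold>\<cdot> y)"
          using sublinear_scale[OF q, of c "x \<^bold>+ t \<^bold>\<cdot> y"] c x y V_add V_sm by simp
        then have "lower q y (c \<^bold>\<cdot> x) \<le> c * (q (x \<^bold>+ t \<^bold>\<cdot> y) - t * q y)"
          using lower_le[OF q V_sm[OF x, of c] y, of "c * t"] c t by (simp add: algebra_simps)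
        then show "lower q y (c \<^bold>\<cdot> x) / c \<le> q (x \<^bold>+ t \<^bold>\<cdot> y) - t * q y"
          using c by (simp add: field_simps)
      qed
      then show ?thesis using c by (simp add: field_simps)
    qed
    have "lower q y x \<le> (1 / c) * lower q y (c \<^bold>\<cdot> x)"
      using le[of "1 / c" "c \<^bold>\<cdot> x"] c x by (simp add: V_sm V_sm_sm V_sm_one)
    then show "lower q y (c \<^bold>\<cdot> x) = c * lower q y x"
      using le[OF c x] c by (simp add: field_simps)
  qed
qed

section \<open>Minimal sublinear functionals and the Hahn-Banach theorem\<close>

text \<open>Zorn's lemma for the reversed pointwise order. A chain is bounded by its pointwise
  infimum: \<open>- p (- x)\<close> bounds all members from below, and subadditivity survives
  because, of two members that are nearly optimal at different points, the smaller one serves both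
  points.\<close>

lemma ex_minimal_sublinear:
  assumes p: "sublinear p" and v: "v \<in> V"
  obtains q where "sublinear q" "\<And>x. x \<in> V \<Longrightarrow> q x \<le> p x"
    "\<And>r. sublinear r \<Longrightarrow> (\<And>x. x \<in> V \<Longrightarrow> r x \<le> q x) \<Longrightarrow> (\<And>x. x \<in> V \<Longrightarrow> r x = q x)"
proof -
  define P where "P = {q. sublinear q \<and> (\<forall>x\<in>V. q x \<le> p x) \<and> (\<forall>x. x \<notin> V \<longrightarrow> q x = 0)}"
  define R where "R f g \<longleftrightarrow> (\<forall>x\<in>V. g x \<le> f x)" for f g :: "'v \<Rightarrow> real"
  \<comment> \<open>Antisymmetry of the pointwise order needs functions that agree outside
    \<open>V\<close>, so they are normalized to 0 there.\<close>
  define cut where "cut q x = (if x \<in> V then q x else 0)" for q :: "'v \<Rightarrow> real" and x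
  have sub_cong: "sublinear (cut q)" if "sublinear q" for q
    using that unfolding sublinear_def cut_def by (auto simp: V_add V_sm)
  have po: "partial_order_on P (relation_of R P)"
  proof (rule partial_order_on_relation_ofI)
    show "R a a" for a by (simp add: R_def)
    show "R a c" if "R a b" "R b c" for a b c using that unfolding R_def by (meson order_trans)
    show "a = b" if "a \<in> P" "b \<in> P" "R a b" "R b a" for a b
      using that unfolding R_def P_def by (intro ext) (metis (mono_tags, lifting) mem_Collect_eq order_antisym)
  qed
  have ch: "\<exists>u\<in>P. \<forall>a\<in>C. R a u" if C: "C \<in> Chains (relation_of R P)" for C
  proof (cases "C = {}")
    case True
    have "cut p \<in> P" using sub_cong[OF p] by (simp add: P_def) (simp add: cut_def)
    then show ?thesis using True by blast
  next
    case False
    have CP: "C \<subseteq> P" and lin: "\<And>a b. a \<in> C \<Longrightarrow> b \<in> C \<Longrightarrow> R a b \<or> R b a"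
      using C unfolding Chains_def relation_of_def by auto
    define u where "u = cut (\<lambda>x. INF q\<in>C. q x)"
    have bd: "bdd_below ((\<lambda>q. q x) ` C)" if x: "x \<in> V" for x
    proof (rule bdd_belowI2[of _ "- p ((- 1) \<^bold>\<cdot> x)"])
      fix q assume "q \<in> C"
      then have "q \<in> P" using CP by blast
      then show "- p ((- 1) \<^bold>\<cdot> x) \<le> q x"
        using sublinear_neg[of q x] x V_sm[OF x, of "-1"] unfolding P_def by fastforce
    qed
    have ule: "u x \<le> q x" if "x \<in> V" "q \<in> C" for x q
      using cINF_lower[OF bd that(2), of x] that by (simp add: u_def cut_def)
    have ugt: "\<exists>q\<in>C. q x < b" if "x \<in> V" "u x < b" for x b
      using that cINF_less_iff[OF False bd[OF that(1)], of b] by (simp add: u_def cut_def)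
    have "sublinear u"
      unfolding sublinear_def
    proof (intro conjI ballI allI impI)
      fix x z assume xz: "x \<in> V" "z \<in> V"
      show "u (x \<^bold>+ z) \<le> u x + u z"
      proof (rule field_le_epsilon)
        fix e :: real assume "e > 0"
        then obtain q r where q: "q \<in> C" "q x < u x + e / 2" and r: "r \<in> C" "r z < u z + e / 2"
          using ugt[OF xz(1)] ugt[OF xz(2)] by (metis half_gt_zero less_add_same_cancel1)
        obtain w where w: "w \<in> C" "w x \<le> q x" "w z \<le> r z"
          using lin[OF q(1) r(1)] q r xz unfolding R_def by blast
        then have "w \<in> P" using CP by blast
        then have "w (x \<^bold>+ z) \<le> w x + w z" using xz unfolding P_def sublinear_def by simp
        then show "u (x \<^bold>+ z) \<le> u x + u z + e"
          using ule[OF V_add[OF xz] w(1)] w q r by simp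
      qed
    next
      fix c :: real and x assume c: "c > 0" and x: "x \<in> V"
      have le: "u (c \<^bold>\<cdot> x) \<le> c * u x" if c: "c > 0" and x: "x \<in> V" for c x
      proof (rule ccontr)
        assume "\<not> ?thesis"
        then have "u x < u (c \<^bold>\<cdot> x) / c" using c by (simp add: field_simps)
        then obtain q where q: "q \<in> C" "q x < u (c \<^bold>\<cdot> x) / c" using ugt[OF x] by blast
        then have "q (c \<^bold>\<cdot> x) = c * q x" using CP c x unfolding P_def sublinear_def by auto
        then show False using ule[OF V_sm[OF x] q(1), of c] q(2) c by (simp add: field_simps)
      qed
      have "u x \<le> (1 / c) * u (c \<^bold>\<cdot> x)"
        using le[of "1 / c" "c \<^bold>\<cdot> x"] c x by (simp add: V_sm V_sm_sm V_sm_one)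
      then show "u (c \<^bold>\<cdot> x) = c * u x"
        using le[OF c x] c by (simp add: field_simps)
    qed
    moreover have "\<forall>x\<in>V. u x \<le> p x"
    proof
      fix x assume x: "x \<in> V"
      obtain q where "q \<in> C" using False by blast
      then show "u x \<le> p x" using ule[OF x, of q] CP x unfolding P_def by fastforce
    qed
    ultimately have "u \<in> P" by (simp add: P_def u_def cut_def)
    then show ?thesis using ule unfolding R_def by blast
  qed
  from predicate_Zorn[OF po ch] obtain q where q: "q \<in> P" "\<And>a. a \<in> P \<Longrightarrow> R q a \<Longrightarrow> a = q" by blast
  show ?thesis
  proof (rule that[of q])
    show "sublinear q" "\<And>x. x \<in> V \<Longrightarrow> q x \<le> p x" using q(1) by (auto simp: P_def)
    fix r x assume r: "sublinear r" "\<And>x. x \<in> V \<Longrightarrow> r x \<le> q x" and x: "x \<in> V"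
    have rp: "r z \<le> p z" if "z \<in> V" for z
      using r(2)[OF that] q(1) that unfolding P_def by fastforce
    have "cut r \<in> P" using sub_cong[OF r(1)] rp by (auto simp: P_def) (auto simp: cut_def)
    moreover have "R q (cut r)" using r(2) by (simp add: R_def cut_def)
    ultimately have "cut r = q" by (rule q(2))
    then show "r x = q x" using x by (metis cut_def)
  qed
qed

text \<open>A minimal functional is taken below \<open>lower p z\<close> instead of
  \<open>p\<close>: its value at \<open>- z\<close> is then at most \<open>- p z\<close>, so oddness
  gives \<open>f z = p z\<close>. Oddness comes from comparing the minimal functional with its own
  \<open>lower\<close>, and it turns subadditivity into additivity.\<close>

theorem hahn_banach:
  assumes p: "sublinear p" and z: "z \<in> V"
  obtains f where "\<And>x y. x \<in> V \<Longrightarrow> y \<in> V \<Longrightarrow> f (x \<^bold>+ y) = f x + f y"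
    "\<And>t x. x \<in> V \<Longrightarrow> f (t \<^bold>\<cdot> x) = t * f x" "\<And>x. x \<in> V \<Longrightarrow> f x \<le> p x" "f z = p z"
proof -
  note p' = sublinear_lower[OF p z]
  obtain q where q: "sublinear q" "\<And>x. x \<in> V \<Longrightarrow> q x \<le> lower p z x"
    and min: "\<And>r x. sublinear r \<Longrightarrow> (\<And>x. x \<in> V \<Longrightarrow> r x \<le> q x) \<Longrightarrow> x \<in> V \<Longrightarrow> r x = q x"
    using ex_minimal_sublinear[OF p'(1) z] by blast
  have neg: "q ((- 1) \<^bold>\<cdot> y) = - q y" if y: "y \<in> V" for y
  proof -
    note l = sublinear_lower[OF q(1) y]
    have "lower q y ((- 1) \<^bold>\<cdot> y) = q ((- 1) \<^bold>\<cdot> y)" by (rule min[OF l(1,2) V_sm[OF y]])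
    then show ?thesis using l(3) sublinear_neg[OF q(1) y] by simp
  qed
  have add: "q (x \<^bold>+ y) = q x + q y" if xy: "x \<in> V" "y \<in> V" for x y
  proof -
    have "(x \<^bold>+ y) \<^bold>+ (- 1) \<^bold>\<cdot> y = x" using xy by (simp add: V_assoc V_sm V_neg V_zero_add)
    then have "q x \<le> q (x \<^bold>+ y) + q ((- 1) \<^bold>\<cdot> y)"
      using q(1) V_add[OF xy] V_sm[OF xy(2), of "-1"] unfolding sublinear_def by metis
    moreover have "q (x \<^bold>+ y) \<le> q x + q y" using q(1) xy unfolding sublinear_def by blast
    ultimately show ?thesis using neg[OF xy(2)] by simp
  qed
  have sc: "q (t \<^bold>\<cdot> x) = t * q x" if x: "x \<in> V" for t x
  proof (cases "t \<ge> 0")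
    case False
    have "t \<^bold>\<cdot> x = (- 1) \<^bold>\<cdot> ((- t) \<^bold>\<cdot> x)" using x by (simp add: V_sm_sm)
    then show ?thesis using neg[OF V_sm[OF x]] sublinear_scale[OF q(1) _ x, of "- t"] False by simp
  qed (use sublinear_scale[OF q(1) _ x] in simp)
  have "q z = p z"
    using q(2)[OF V_sm[OF z, of "-1"]] p'(3) neg[OF z] q(2)[OF z] p'(2)[OF z] by simp
  moreover have "q x \<le> p x" if "x \<in> V" for x using q(2)[OF that] p'(2)[OF that] by simp
  ultimately show ?thesis using that add sc by blast
qed

end

text \<open>The index type may be infinite; only the coordinates in \<open>I\<close> count.\<close>

lemma cone_separation:
  fixes K :: "('i \<Rightarrow> complex) set" and g :: "'i \<Rightarrow> complex"
  assumes I: "finite I" and K0: "(\<lambda>_. 0) \<in> K"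
    and Kadd: "\<And>k l. k \<in> K \<Longrightarrow> l \<in> K \<Longrightarrow> (\<lambda>i. k i + l i) \<in> K"
    and Ksc: "\<And>t k. t > 0 \<Longrightarrow> k \<in> K \<Longrightarrow> (\<lambda>i. of_real t * k i) \<in> K"
    and e: "e > 0" and far: "\<And>k. k \<in> K \<Longrightarrow> e \<le> (\<Sum>i\<in>I. cmod (g i - k i))"
  obtains c where "\<And>k. k \<in> K \<Longrightarrow> 0 \<le> Re (\<Sum>i\<in>I. c i * k i)" "Re (\<Sum>i\<in>I. c i * g i) < 0"
proof -
  interpret real_space "UNIV :: ('i \<Rightarrow> complex) set" "\<lambda>x y i. x i + y i" "\<lambda>t x i. of_real t * x i" "\<lambda>_. 0"
    by unfold_locales (auto simp: algebra_simps)
  \<comment> \<open>The l1-distance to \<open>K\<close> over the coordinates in \<open>I\<close>: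
    sublinear because \<open>K\<close> is a convex cone, at most 0 on \<open>K\<close>, and at least
    \<open>e\<close> at \<open>g\<close>.\<close>
  define p where "p x = (INF k\<in>K. \<Sum>i\<in>I. cmod (x i - k i))" for x :: "'i \<Rightarrow> complex"
  have bd: "bdd_below ((\<lambda>k. \<Sum>i\<in>I. cmod (x i - k i)) ` K)" for x :: "'i \<Rightarrow> complex"
    by (rule bdd_belowI2[of _ 0]) (simp add: sum_nonneg)
  have ple: "p x \<le> (\<Sum>i\<in>I. cmod (x i - k i))" if "k \<in> K" for x k
    unfolding p_def by (rule cINF_lower[OF bd that])
  have plt: "\<exists>k\<in>K. (\<Sum>i\<in>I. cmod (x i - k i)) < b" if "p x < b" for x b
    proof -
    have "K \<noteq> {}" using K0 by blast
    then show ?thesis using that cINF_less_iff[OF _ bd[of x], of b] unfolding p_def by simp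
  qed
  have sub: "sublinear p"
    unfolding sublinear_def
  proof (intro conjI ballI allI impI)
    fix x y :: "'i \<Rightarrow> complex"
    show "p (\<lambda>i. x i + y i) \<le> p x + p y"
    proof (rule field_le_epsilon)
      fix e :: real assume "e > 0"
      then obtain k l where k: "k \<in> K" "(\<Sum>i\<in>I. cmod (x i - k i)) < p x + e / 2"
        and l: "l \<in> K" "(\<Sum>i\<in>I. cmod (y i - l i)) < p y + e / 2"
        using plt by (metis half_gt_zero less_add_same_cancel1)
      have "p (\<lambda>i. x i + y i) \<le> (\<Sum>i\<in>I. cmod (x i + y i - (k i + l i)))"
        by (rule ple[OF Kadd[OF k(1) l(1)]])
      also have "\<dots> \<le> (\<Sum>i\<in>I. cmod (x i - k i) + cmod (y i - l i))"
        by (rule sum_mono) (metis add_diff_add norm_triangle_ineq)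
      finally show "p (\<lambda>i. x i + y i) \<le> p x + p y + e" using k l by (simp add: sum.distrib)
    qed
  next
    fix t :: real and x :: "'i \<Rightarrow> complex" assume t: "t > 0"
    have le: "p (\<lambda>i. of_real t * x i) \<le> t * p x" if t: "t > 0" for t x
    proof (rule ccontr)
      assume "\<not> ?thesis"
      then have "p x < p (\<lambda>i. of_real t * x i) / t" using t by (simp add: field_simps)
      then obtain k where k: "k \<in> K" "(\<Sum>i\<in>I. cmod (x i - k i)) < p (\<lambda>i. of_real t * x i) / t" using plt by blast
      have "p (\<lambda>i. of_real t * x i) \<le> (\<Sum>i\<in>I. cmod (of_real t * x i - of_real t * k i))"
        by (rule ple[OF Ksc[OF t k(1)]])
      also have "\<dots> = (\<Sum>i\<in>I. t * cmod (x i - k i))"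
        using t by (intro sum.cong refl) (simp flip: right_diff_distrib add: norm_mult)
      finally show False using k t by (simp add: field_simps flip: sum_distrib_left)
    qed
    have "p x \<le> (1 / t) * p (\<lambda>i. of_real t * x i)"
      using le[of "1 / t" "\<lambda>i. of_real t * x i"] t by simp
    then show "p (\<lambda>i. of_real t * x i) = t * p x" using le[OF t, of x] t by (simp add: field_simps)
  qed
  obtain f where f: "\<And>x y. x \<in> UNIV \<Longrightarrow> y \<in> UNIV \<Longrightarrow> f (\<lambda>i. x i + y i) = f x + f y"
    "\<And>t x. x \<in> UNIV \<Longrightarrow> f (\<lambda>i. of_real t * x i) = t * f x" "\<And>x. x \<in> UNIV \<Longrightarrow> f x \<le> p x" and fg: "f g = p g"
    by (rule hahn_banach[OF sub UNIV_I[of g]]) (rule that)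
  note fadd = f(1)[OF UNIV_I UNIV_I] and fsc = f(2)[OF UNIV_I] and fp = f(3)[OF UNIV_I]
  have f0: "f (\<lambda>_. 0) = 0" using fsc[of 0 "\<lambda>_. 0"] by simp
  have f_bound: "f x \<le> (\<Sum>i\<in>I. cmod (x i))" for x
    using fp[of x] ple[OF K0, of x] by simp
  have fneg: "f (\<lambda>i. - x i) = - f x" for x using fsc[of "-1" x] by simp
  \<comment> \<open>The l1-norm over \<open>I\<close> dominates \<open>f\<close>, so
    \<open>f\<close> cannot see the other coordinates and expands into finitely many terms.\<close>
  have floc: "f x = f y" if "\<And>i. i \<in> I \<Longrightarrow> x i = y i" for x y
  proof -
    have "f (\<lambda>i. x i + - y i) \<le> 0" "f (\<lambda>i. y i + - x i) \<le> 0"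
      using f_bound[of "\<lambda>i. x i + - y i"] f_bound[of "\<lambda>i. y i + - x i"] that by auto
    then show ?thesis using fadd[of x "\<lambda>i. - y i"] fadd[of y "\<lambda>i. - x i"] fneg by simp
  qed
  define u where "u j z i = (if i = j then z else 0)" for j i :: 'i and z :: complex
  \<comment> \<open>A real-linear functional on the complex line has the form
    \<open>z \<mapsto> Re (c * z)\<close>, and its values at 1 and \<open>\<i>\<close> determine
    \<open>c\<close>.\<close>
  define c where "c i = complex_of_real (f (u i 1)) - \<i> * of_real (f (u i \<i>))" for i
  have fu: "f (u i z) = Re (c i * z)" for i z
  proof -
    have "u i z = (\<lambda>j. of_real (Re z) * u i 1 j + of_real (Im z) * u i \<i> j)"
      by (auto simp: u_def complex_eq_iff)
    then have "f (u i z) = Re z * f (u i 1) + Im z * f (u i \<i>)" by (simp only: fadd fsc)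
    then show ?thesis by (simp add: c_def algebra_simps)
  qed
  have fsum: "f (\<lambda>j. \<Sum>i\<in>J. u i (x i) j) = (\<Sum>i\<in>J. f (u i (x i)))" if "finite J" for J x
    using that by (induction J) (simp_all add: f0 fadd)
  have fx: "f x = Re (\<Sum>i\<in>I. c i * x i)" for x
  proof -
    have "f x = f (\<lambda>j. \<Sum>i\<in>I. u i (x i) j)"
      by (rule floc) (simp add: u_def I)
    then show ?thesis by (simp add: fsum[OF I] fu)
  qed
  \<comment> \<open>\<open>f\<close> is at most 0 on \<open>K\<close> and positive at
    \<open>g\<close>; the coefficients sought are those of \<open>- f\<close>.\<close>
  have "e \<le> p g" unfolding p_def using K0 far by (intro cINF_greatest) auto
  then have "Re (\<Sum>i\<in>I. - c i * g i) < 0" using e fg fx[of g] by (simp add: sum_negf)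
  moreover have "0 \<le> Re (\<Sum>i\<in>I. - c i * k i)" if "k \<in> K" for k
    using fp[of k] ple[OF that, of k] fx[of k] by (simp add: sum_negf)
  ultimately show ?thesis using that[of "\<lambda>i. - c i"] by blast
qed

section \<open>Positive elements and states\<close>

text \<open>The unit is a parameter because it need not be the field \<open>one\<close> of the
  record: a corner used below has a projection as its unit while the record keeps the old
  field.\<close>

locale ucstar = cstar_algebra A for A :: "'a cstar" (structure) +
  fixes e :: 'a
  assumes e_closed [simp]: "e \<in> carrier A"
    and e_left [simp]: "x \<in> carrier A \<Longrightarrow> e \<otimes> x = x"
    and e_right [simp]: "x \<in> carrier A \<Longrightarrow> x \<otimes> e = x"
    and e_nonzero: "e \<noteq> \<zero>"

text \<open>With \<open>e\<close> in the field \<open>one\<close> the record is a ring; the rewrites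
  let ring lemmas and the \<open>algebra\<close> method speak about the operations of
  \<open>A\<close> itself.\<close>

sublocale ucstar \<subseteq> R: ring "\<lparr>carrier = carrier A, mult = mult A, one = e, zero = zero A, add = add A\<rparr>"
  rewrites "carrier \<lparr>carrier = carrier A, mult = mult A, one = e, zero = zero A, add = add A\<rparr> = carrier A"
    and "mult \<lparr>carrier = carrier A, mult = mult A, one = e, zero = zero A, add = add A\<rparr> = mult A"
    and "one \<lparr>carrier = carrier A, mult = mult A, one = e, zero = zero A, add = add A\<rparr> = e"
    and "zero \<lparr>carrier = carrier A, mult = mult A, one = e, zero = zero A, add = add A\<rparr> = zero A"
    and "add \<lparr>carrier = carrier A, mult = mult A, one = e, zero = zero A, add = add A\<rparr> = add A"
    and "a_inv \<lparr>carrier = carrier A, mult = mult A, one = e, zero = zero A, add = add A\<rparr> = a_inv A"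
    and "a_minus \<lparr>carrier = carrier A, mult = mult A, one = e, zero = zero A, add = add A\<rparr> = a_minus A"
proof -
  let ?R = "\<lparr>carrier = carrier A, mult = mult A, one = e, zero = zero A, add = add A\<rparr>"
  have i: "a_inv ?R = a_inv A" by (intro ext) (simp add: a_inv_def m_inv_def)
  show "a_inv ?R = a_inv A" by (rule i)
  show "a_minus ?R = a_minus A" by (intro ext) (simp add: a_minus_def i)
  show "ring ?R"
  proof (rule ringI)
    show "abelian_group ?R"
      by (rule abelian_groupI) (auto simp: a_ac intro: l_neg)
    show "monoid ?R" by (rule monoidI) (auto simp: mult_closed mult_assoc)
  qed (auto simp: distrib_left distrib_right)
qed simp_all

context ucstar
begin

lemmas closed [simp] = mult_closed star_closed smult_closed'

lemma smult_sum: "x \<in> carrier A \<Longrightarrow> (a + b) \<odot> x = a \<odot> x \<oplus> b \<odot> x"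
  using smult_l_distr[of a b x] by simp

lemma smult_oplus: "x \<in> carrier A \<Longrightarrow> y \<in> carrier A \<Longrightarrow> c \<odot> (x \<oplus> y) = c \<odot> x \<oplus> c \<odot> y"
  using smult_r_distr[of c x y] by simp

lemma smult_smult: "x \<in> carrier A \<Longrightarrow> a \<odot> (b \<odot> x) = (a * b) \<odot> x"
  using smult_assoc1[of a b x] by simp

lemma smult_1: "x \<in> carrier A \<Longrightarrow> 1 \<odot> x = x"
  using smult_one[of x] by simp

lemma uminus_smult: "x \<in> carrier A \<Longrightarrow> \<ominus> x = (- 1) \<odot> x"
  using smult_minus_1[of x] by (simp add: class_ring_simps)

lemma smult_uminus: "x \<in> carrier A \<Longrightarrow> c \<odot> (\<ominus> x) = \<ominus> (c \<odot> x)"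
  by (simp add: uminus_smult smult_smult)

lemma uminus_smult_left: "x \<in> carrier A \<Longrightarrow> (- c) \<odot> x = \<ominus> (c \<odot> x)"
  by (simp add: uminus_smult smult_smult)

lemma smult_minus: "x \<in> carrier A \<Longrightarrow> y \<in> carrier A \<Longrightarrow> c \<odot> (x \<ominus> y) = c \<odot> x \<ominus> c \<odot> y"
  by (simp add: a_minus_def smult_oplus smult_uminus)

lemma smult_diff: "x \<in> carrier A \<Longrightarrow> (a - b) \<odot> x = a \<odot> x \<ominus> b \<odot> x"
  using smult_sum[of x a "- b"] by (simp add: a_minus_def uminus_smult_left)

lemma smult_0: "x \<in> carrier A \<Longrightarrow> 0 \<odot> x = \<zero>"
  using smult_diff[of x 0 0] by (simp add: R.r_neg R.minus_eq)

lemma smult_zero: "c \<odot> \<zero> = \<zero>"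
  using smult_0[of e] smult_smult[of e c 0] by simp

lemma two_smult: "x \<in> carrier A \<Longrightarrow> 2 \<odot> x = x \<oplus> x"
  using smult_sum[of x 1 1] by (simp add: smult_1)

lemma star_uminus: "x \<in> carrier A \<Longrightarrow> star A (\<ominus> x) = \<ominus> star A x"
  by (simp add: uminus_smult star_smult)

lemma star_minus: "x \<in> carrier A \<Longrightarrow> y \<in> carrier A \<Longrightarrow> star A (x \<ominus> y) = star A x \<ominus> star A y"
  by (simp add: a_minus_def star_add star_uminus)

lemma star_zero: "star A \<zero> = \<zero>"
  using star_smult[of e 0] by (simp add: smult_0)

lemma star_e [simp]: "star A e = e"
  by (metis e_closed e_left e_right star_closed star_mult star_star)

lemma cnorm_zero: "cnorm A \<zero> = 0"
  by (simp add: cnorm_eq_0_iff)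

lemma cnorm_e: "cnorm A e = 1"
proof -
  have "cnorm A e = (cnorm A e)\<^sup>2" using cstar_identity[of e] by simp
  moreover have "cnorm A e \<noteq> 0" using e_nonzero by (simp add: cnorm_eq_0_iff)
  ultimately show ?thesis by (simp add: power2_eq_square)
qed

lemma cnorm_sc: "cnorm A (c \<odot> e) = cmod c"
  by (simp add: cnorm_smult cnorm_e)

lemma cnorm_uminus: "x \<in> carrier A \<Longrightarrow> cnorm A (\<ominus> x) = cnorm A x"
  by (simp add: uminus_smult cnorm_smult)

lemma cdist_cnorm: "x \<in> carrier A \<Longrightarrow> y \<in> carrier A \<Longrightarrow> cdist A x y = cnorm A (x \<ominus> y)"
  by (simp add: cdist_def)

lemma sc_left: "x \<in> carrier A \<Longrightarrow> (c \<odot> e) \<otimes> x = c \<odot> x"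
  by (simp add: smult_mult_left)

lemma minus_plus: "x \<in> carrier A \<Longrightarrow> y \<in> carrier A \<Longrightarrow> x \<ominus> y \<oplus> y = x"
  by algebra

lemma plus_minus: "x \<in> carrier A \<Longrightarrow> y \<in> carrier A \<Longrightarrow> x \<oplus> (y \<ominus> x) = y"
  by algebra

lemma minus_sum_plus: "x \<in> carrier A \<Longrightarrow> y \<in> carrier A \<Longrightarrow> z \<in> carrier A \<Longrightarrow> x \<ominus> (y \<oplus> z) \<oplus> z = x \<ominus> y"
  by algebra

lemma minus_minus_self: "x \<in> carrier A \<Longrightarrow> y \<in> carrier A \<Longrightarrow> x \<ominus> (x \<ominus> y) = y"
  by algebra

section \<open>Convergent sequences\<close>

definition tends :: "(nat \<Rightarrow> 'a) \<Rightarrow> 'a \<Rightarrow> bool" where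
  "tends s l \<longleftrightarrow> (\<forall>n. s n \<in> carrier A) \<and> l \<in> carrier A \<and> (\<lambda>n. cdist A (s n) l) \<longlonglongrightarrow> 0"

lemma tends_const: "x \<in> carrier A \<Longrightarrow> tends (\<lambda>_. x) x"
  by (simp add: tends_def)

lemma tends_unique: "tends s l \<Longrightarrow> tends s m \<Longrightarrow> l = m"
proof -
  assume s: "tends s l" "tends s m"
  then have "(\<lambda>n. cdist A (s n) l + cdist A (s n) m) \<longlonglongrightarrow> 0 + 0"
    unfolding tends_def by (intro tendsto_add) auto
  moreover have "cdist A l m \<le> cdist A (s n) l + cdist A (s n) m" for n
    using s cmetric.triangle[of l "s n" m] cmetric.commute[of l "s n"] unfolding tends_def by auto
  ultimately have "cdist A l m \<le> 0" using LIMSEQ_le_const[of _ 0 "cdist A l m"] by auto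
  then show ?thesis using s cmetric.nonneg[of l m] unfolding tends_def by (simp add: cmetric.zero)
qed

lemma tends_bound:
  assumes "\<And>n. s n \<in> carrier A" "l \<in> carrier A" "f \<longlonglongrightarrow> 0" "\<And>n. cdist A (s n) l \<le> f n"
  shows "tends s l"
  unfolding tends_def using assms by (auto intro: tendsto_sandwich[of "\<lambda>_. 0" _ _ f])

lemma tends_add: "tends s l \<Longrightarrow> tends u m \<Longrightarrow> tends (\<lambda>n. s n \<oplus> u n) (l \<oplus> m)"
  by (rule tends_bound[where f = "\<lambda>n. cdist A (s n) l + cdist A (u n) m"])
     (auto simp: tends_def intro!: tendsto_add_zero cdist_add)

lemma tends_smult: "tends s l \<Longrightarrow> tends (\<lambda>n. c \<odot> s n) (c \<odot> l)"
  by (rule tends_bound[where f = "\<lambda>n. cmod c * cdist A (s n) l"])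
     (auto simp: tends_def cdist_smult intro!: tendsto_mult_right_zero)

lemma tends_star: "tends s l \<Longrightarrow> tends (\<lambda>n. star A (s n)) (star A l)"
  by (auto simp: tends_def cdist_star)

lemma tends_cnorm: "tends s l \<Longrightarrow> (\<lambda>n. cnorm A (s n)) \<longlonglongrightarrow> cnorm A l"
proof -
  assume s: "tends s l"
  then have sc: "s n \<in> carrier A" and lc: "l \<in> carrier A" and lim: "(\<lambda>n. cdist A (s n) l) \<longlonglongrightarrow> 0" for n
    by (auto simp: tends_def)
  have le: "norm (cnorm A (s n) - cnorm A l) \<le> cdist A (s n) l" for n
    using cnorm_le_cdist[OF sc[of n] lc] cnorm_le_cdist[OF lc sc[of n]] cmetric.commute[of l "s n"]
    unfolding real_norm_def by linarith
  have "(\<lambda>n. cnorm A (s n) - cnorm A l) \<longlonglongrightarrow> 0"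
    by (rule Lim_null_comparison[OF always_eventually lim]) (rule allI, rule le)
  then show ?thesis by (rule LIM_zero_cancel)
qed

lemma tends_mult: "tends s l \<Longrightarrow> tends u m \<Longrightarrow> tends (\<lambda>n. s n \<otimes> u n) (l \<otimes> m)"
proof (rule tends_bound[where f = "\<lambda>n. cnorm A (s n) * cdist A (u n) m + cdist A (s n) l * cnorm A m"])
  assume *: "tends s l" "tends u m"
  have "(\<lambda>n. cnorm A (s n) * cdist A (u n) m) \<longlonglongrightarrow> cnorm A l * 0"
    using * by (intro tendsto_mult tends_cnorm) (auto simp: tends_def)
  then show "(\<lambda>n. cnorm A (s n) * cdist A (u n) m + cdist A (s n) l * cnorm A m) \<longlonglongrightarrow> 0"
    using * by (intro tendsto_add_zero tendsto_mult_left_zero) (auto simp: tends_def)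
qed (auto simp: tends_def intro: cdist_mult)

lemma tends_Suc: "tends s l \<Longrightarrow> tends (\<lambda>n. s (Suc n)) l"
  unfolding tends_def using LIMSEQ_Suc by auto

text \<open>The increments of \<open>s\<close> are dominated by those of a convergent real sequence,
  so telescoping carries over the Cauchy property. No rate of convergence is required, which matters
  for the square root.\<close>

lemma tends_cauchy:
  assumes s: "\<And>n. s n \<in> carrier A" and t: "convergent t"
    and st: "\<And>n. cdist A (s (Suc n)) (s n) \<le> t (Suc n) - t n"
  obtains l where "tends s l"
proof -
  have le: "cdist A (s (m + k)) (s m) \<le> t (m + k) - t m" for m k
  proof (induction k)
    case (Suc k)
    then show ?case using cmetric.triangle[of "s (Suc (m + k))" "s (m + k)" "s m"] s st[of "m + k"] by simp
  qed (simp add: s)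
  have "cmetric.MCauchy s"
    unfolding cmetric.MCauchy_def
  proof (intro conjI allI impI)
    show "range s \<subseteq> carrier A" using s by auto
    fix r :: real assume "r > 0"
    then obtain N where N: "\<And>m n. m \<ge> N \<Longrightarrow> n \<ge> N \<Longrightarrow> norm (t m - t n) < r"
      using convergent_Cauchy[OF t] unfolding Cauchy_iff by blast
    have "cdist A (s n) (s m) < r" if "N \<le> n" "n \<le> m" for n m
      using le[of n "m - n"] N[of m n] that cmetric.commute[of "s n" "s m"] by simp
    then show "\<exists>N. \<forall>n n'. N \<le> n \<longrightarrow> N \<le> n' \<longrightarrow> cdist A (s n) (s n') < r"
      by (metis cmetric.commute nle_le)
  qed
  then obtain l where "limitin cmetric.mtopology s l sequentially"
    using complete unfolding cmetric.mcomplete_def by blast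
  then have "l \<in> carrier A" "\<And>r. r > 0 \<Longrightarrow> \<exists>N. \<forall>n\<ge>N. cdist A (s n) l < r"
    unfolding cmetric.limit_metric_sequentially by (blast, meson)
  then have "tends s l" using s unfolding tends_def LIMSEQ_iff by auto
  then show ?thesis using that by blast
qed

section \<open>Square roots by iteration\<close>

text \<open>The iteration \<open>y \<mapsto> (h + y y) / 2\<close> from 0 has a limit with
  \<open>2 y = h + y y\<close>, that is \<open>(e - y)\<^sup>2 = e - h\<close>. For norm 1 it need
  not be a strict contraction, so its steps are compared with a scalar iteration instead of a
  geometric series. What commutes with \<open>h\<close> commutes with every iterate and hence with
  the limit.\<close>

lemma ex_root:
  assumes h: "h \<in> carrier A" "star A h = h" "cnorm A h \<le> 1"
  obtains y where "y \<in> carrier A" "star A y = y" "cnorm A y \<le> 1" "y \<oplus> y = h \<oplus> y \<otimes> y"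
    "\<And>b. b \<in> carrier A \<Longrightarrow> b \<otimes> h = h \<otimes> b \<Longrightarrow> b \<otimes> y = y \<otimes> b"
proof -
  define Y where "Y = rec_nat \<zero> (\<lambda>_ y. (1 / 2) \<odot> (h \<oplus> y \<otimes> y))"
  have Y0: "Y 0 = \<zero>" and YS: "Y (Suc n) = (1 / 2) \<odot> (h \<oplus> Y n \<otimes> Y n)" for n by (simp_all add: Y_def)
  \<comment> \<open>The majorant: the same iteration with the number 1 in place of \<open>h\<close>.
    It increases and never exceeds 1.\<close>
  define t :: "nat \<Rightarrow> real" where "t = rec_nat 0 (\<lambda>_ s. (1 + s\<^sup>2) / 2)"
  have t0: "t 0 = 0" and tS: "t (Suc n) = (1 + (t n)\<^sup>2) / 2" for n by (simp_all add: t_def)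
  have t01: "0 \<le> t n \<and> t n \<le> 1" for n
    by (induction n) (auto simp: t0 tS power_le_one)
  have tmono: "t n \<le> t (Suc n)" for n
    using sum_power2_ge_zero[of "t n - 1" 0] by (simp add: tS power2_eq_square algebra_simps)
  have "incseq t" using tmono by (rule incseq_SucI)
  then have conv: "convergent t"
    using t01 incseq_convergent[of t 1] unfolding convergent_def by blast
  have Yc: "Y n \<in> carrier A" and Ys: "star A (Y n) = Y n" and Yn: "cnorm A (Y n) \<le> t n" for n
  proof (induction n)
    case (Suc n)
    show "Y (Suc n) \<in> carrier A" using Suc h by (simp add: YS)
    show "star A (Y (Suc n)) = Y (Suc n)" using Suc h by (simp add: YS star_smult star_add star_mult)
    have "cnorm A (h \<oplus> Y n \<otimes> Y n) \<le> cnorm A h + cnorm A (Y n \<otimes> Y n)"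
      using Suc h by (intro cnorm_triangle) auto
    also have "\<dots> \<le> 1 + t n * t n"
      using Suc h cnorm_mult[of "Y n" "Y n"] cnorm_nonneg[of "Y n"]
        mult_mono[of "cnorm A (Y n)" "t n" "cnorm A (Y n)" "t n"] t01[of n] by linarith
    finally show "cnorm A (Y (Suc n)) \<le> t (Suc n)"
      using Suc h by (simp add: YS cnorm_smult tS power2_eq_square norm_divide)
  qed (simp_all add: Y0 t0 star_zero cnorm_zero)
  have step: "cdist A (Y (Suc n)) (Y n) \<le> t (Suc n) - t n" for n
  proof (induction n)
    case 0
    have "cdist A (Y (Suc 0)) (Y 0) = cnorm A ((1 / 2) \<odot> h)"
      using h by (simp add: YS Y0 cdist_cnorm smult_zero R.minus_eq)
    then show ?case using h by (simp add: cnorm_smult tS t0 norm_divide)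
  next
    case (Suc n)
    have "cdist A (Y (Suc (Suc n))) (Y (Suc n)) =
        1 / 2 * cdist A (h \<oplus> Y (Suc n) \<otimes> Y (Suc n)) (h \<oplus> Y n \<otimes> Y n)"
      using Yc h by (subst (1 2) YS) (simp add: cdist_smult norm_divide)
    also have "\<dots> = 1 / 2 * cdist A (Y (Suc n) \<otimes> Y (Suc n)) (Y n \<otimes> Y n)"
      using Yc h by (simp add: cdist_translate)
    also have "\<dots> \<le> 1 / 2 * (cnorm A (Y (Suc n)) * cdist A (Y (Suc n)) (Y n) + cdist A (Y (Suc n)) (Y n) * cnorm A (Y n))"
      using Yc cdist_mult by simp
    also have "\<dots> \<le> 1 / 2 * (t (Suc n) * (t (Suc n) - t n) + (t (Suc n) - t n) * t n)"
      using Suc Yn t01 tmono[of n] Yc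
      by (intro mult_left_mono add_mono mult_mono) (auto intro: cnorm_nonneg)
    also have "\<dots> = t (Suc (Suc n)) - t (Suc n)"
      using tS[of n] tS[of "Suc n"] by (simp add: power2_eq_square algebra_simps)
    finally show ?case .
  qed
  obtain y where y: "tends Y y" using tends_cauchy[OF Yc conv step] by blast
  have yc: "y \<in> carrier A" using y by (simp add: tends_def)
  have "star A y = y" using tends_unique[OF tends_star[OF y, unfolded Ys] y] .
  moreover have "cnorm A y \<le> 1"
    using LIMSEQ_le_const2[OF tends_cnorm[OF y], of 1] Yn t01 by (meson order_trans)
  moreover have "y \<oplus> y = h \<oplus> y \<otimes> y"
  proof -
    have "tends (\<lambda>n. (1 / 2) \<odot> (h \<oplus> Y n \<otimes> Y n)) ((1 / 2) \<odot> (h \<oplus> y \<otimes> y))"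
      using h by (intro tends_smult tends_add tends_mult y tends_const)
    then have "(1 / 2) \<odot> (h \<oplus> y \<otimes> y) = y"
      by (rule tends_unique[OF _ tends_Suc[OF y, unfolded YS]])
    then have "2 \<odot> y = 2 \<odot> ((1 / 2) \<odot> (h \<oplus> y \<otimes> y))" by simp
    then show ?thesis using yc h by (simp add: smult_smult two_smult smult_1)
  qed
  moreover have "b \<otimes> y = y \<otimes> b" if b: "b \<in> carrier A" "b \<otimes> h = h \<otimes> b" for b
  proof -
    have "b \<otimes> Y n = Y n \<otimes> b" for n
    proof (induction n)
      case (Suc n)
      have "b \<otimes> (Y n \<otimes> Y n) = (Y n \<otimes> Y n) \<otimes> b"
        using Suc b Yc by (metis mult_assoc)
      then show ?case using b h Yc by (simp add: YS smult_mult_left smult_mult_right distrib_left distrib_right)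
    qed (simp add: Y0 b)
    then have "(\<lambda>n. Y n \<otimes> b) = (\<lambda>n. b \<otimes> Y n)" by simp
    moreover have "tends (\<lambda>n. b \<otimes> Y n) (b \<otimes> y)" "tends (\<lambda>n. Y n \<otimes> b) (y \<otimes> b)"
      using b by (intro tends_mult y tends_const; simp)+
    ultimately show ?thesis using tends_unique by metis
  qed
  ultimately show ?thesis using that yc by blast
qed

text \<open>\<open>s = e - y\<close> with the \<open>y\<close> of \<open>ex_root\<close>, since
  \<open>(e - y)\<^sup>2 = e - 2 y + y y\<close>. The bound on \<open>e - s\<close> is the one that
  later makes \<open>s\<close> positive.\<close>

lemma ex_sqrt_diff:
  assumes h: "h \<in> carrier A" "star A h = h" "cnorm A h \<le> 1"
  obtains s where "s \<in> carrier A" "star A s = s" "s \<otimes> s = e \<ominus> h" "cnorm A (e \<ominus> s) \<le> 1"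
    "\<And>b. b \<in> carrier A \<Longrightarrow> b \<otimes> h = h \<otimes> b \<Longrightarrow> b \<otimes> s = s \<otimes> b"
proof -
  obtain y where y: "y \<in> carrier A" "star A y = y" "cnorm A y \<le> 1" "y \<oplus> y = h \<oplus> y \<otimes> y"
    "\<And>b. b \<in> carrier A \<Longrightarrow> b \<otimes> h = h \<otimes> b \<Longrightarrow> b \<otimes> y = y \<otimes> b"
    using ex_root[OF h] by blast
  have "(e \<ominus> y) \<otimes> (e \<ominus> y) = e \<ominus> (y \<oplus> y) \<oplus> y \<otimes> y"
    using y(1) e_closed e_right[OF y(1)] by algebra
  also have "\<dots> = e \<ominus> h" unfolding y(4) using y(1) h(1) e_closed by algebra
  finally have "(e \<ominus> y) \<otimes> (e \<ominus> y) = e \<ominus> h" .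
  moreover have "e \<ominus> (e \<ominus> y) = y" using y(1) e_closed by algebra
  moreover have "b \<otimes> (e \<ominus> y) = (e \<ominus> y) \<otimes> b" if "b \<in> carrier A" "b \<otimes> h = h \<otimes> b" for b
    using that y(1) y(5)[OF that] e_closed by (simp add: R.minus_eq R.r_distr R.l_distr R.r_minus R.l_minus)
  ultimately show ?thesis using that[of "e \<ominus> y"] y by (simp add: star_minus)
qed

text \<open>As \<open>w\<close> and \<open>v\<close> commute, \<open>w + \<i> v\<close> is normal
  with squared modulus \<open>w w + v v\<close>, and its real part \<open>w\<close> has no larger
  norm. This replaces a joint functional calculus in the order estimates below.\<close>

lemma comm_square:
  assumes w: "w \<in> carrier A" "star A w = w" and v: "v \<in> carrier A" "star A v = v" and c: "w \<otimes> v = v \<otimes> w"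
  shows "star A (w \<oplus> \<i> \<odot> v) \<otimes> (w \<oplus> \<i> \<odot> v) = w \<otimes> w \<oplus> v \<otimes> v"
    and "(cnorm A w)\<^sup>2 \<le> cnorm A (w \<otimes> w \<oplus> v \<otimes> v)"
proof -
  define x where "x = \<i> \<odot> v"
  have x: "x \<in> carrier A" "star A x = \<ominus> x" "w \<otimes> x = x \<otimes> w" "x \<otimes> x = \<ominus> (v \<otimes> v)"
    using v w c by (simp_all add: x_def star_smult uminus_smult_left smult_mult_left smult_mult_right
        smult_smult smult_1)
  have "star A (w \<oplus> x) \<otimes> (w \<oplus> x) = w \<otimes> w \<oplus> (w \<otimes> x \<ominus> x \<otimes> w) \<ominus> x \<otimes> x"
    using w x(1) by (simp add: star_add x(2)) algebra
  also have "\<dots> = w \<otimes> w \<oplus> v \<otimes> v"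
    using w v x(1) by (simp add: x(3,4)) algebra
  finally show 1: "star A (w \<oplus> \<i> \<odot> v) \<otimes> (w \<oplus> \<i> \<odot> v) = w \<otimes> w \<oplus> v \<otimes> v" by (simp add: x_def)
  then have n: "cnorm A (w \<otimes> w \<oplus> v \<otimes> v) = (cnorm A (w \<oplus> x))\<^sup>2"
    using cstar_identity[of "w \<oplus> x"] w x(1) by (simp add: x_def)
  have "w \<oplus> w = (w \<oplus> x) \<oplus> star A (w \<oplus> x)"
    using w x(1) by (simp add: star_add x(2)) algebra
  then have "cnorm A (2 \<odot> w) \<le> 2 * cnorm A (w \<oplus> x)"
    using cnorm_triangle[of "w \<oplus> x" "star A (w \<oplus> x)"] w x(1) by (simp add: two_smult cnorm_star)
  then have "cnorm A w \<le> cnorm A (w \<oplus> x)" using w by (simp add: cnorm_smult)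
  then show "(cnorm A w)\<^sup>2 \<le> cnorm A (w \<otimes> w \<oplus> v \<otimes> v)"
    using w by (simp add: n power_mono cnorm_nonneg)
qed

section \<open>The cone of positive elements\<close>

text \<open>Positivity in terms of the norm, so that sums of positive elements are visibly positive.\<close>

definition pos :: "'a \<Rightarrow> bool" where
  "pos h \<longleftrightarrow> h \<in> carrier A \<and> star A h = h \<and> (\<exists>t::real. cnorm A (of_real t \<odot> e \<ominus> h) \<le> t)"

lemma posD [simp]: "pos h \<Longrightarrow> h \<in> carrier A" "pos h \<Longrightarrow> star A h = h"
  by (auto simp: pos_def)

lemma pos_add:
  assumes "pos h" "pos g"
  shows "pos (h \<oplus> g)"
proof -
  obtain t s :: real where ts: "cnorm A (of_real t \<odot> e \<ominus> h) \<le> t" "cnorm A (of_real s \<odot> e \<ominus> g) \<le> s"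
    using assms unfolding pos_def by blast
  have "of_real (t + s) \<odot> e \<ominus> (h \<oplus> g) = (of_real t \<odot> e \<ominus> h) \<oplus> (of_real s \<odot> e \<ominus> g)"
    using assms by (simp add: smult_sum R.minus_eq R.minus_add R.a_ac)
  then have "cnorm A (of_real (t + s) \<odot> e \<ominus> (h \<oplus> g)) \<le> t + s"
    using cnorm_triangle[of "of_real t \<odot> e \<ominus> h" "of_real s \<odot> e \<ominus> g"] assms ts by (simp del: of_real_add)
  then show ?thesis using assms unfolding pos_def by (metis R.add.m_closed star_add)
qed

lemma pos_smult:
  assumes "pos h" "c \<ge> 0"
  shows "pos (of_real c \<odot> h)"
proof -
  obtain t :: real where t: "cnorm A (of_real t \<odot> e \<ominus> h) \<le> t"
    using assms unfolding pos_def by blast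
  have "of_real (c * t) \<odot> e \<ominus> of_real c \<odot> h = of_real c \<odot> (of_real t \<odot> e \<ominus> h)"
    using assms by (simp add: smult_minus smult_smult)
  then have "cnorm A (of_real (c * t) \<odot> e \<ominus> of_real c \<odot> h) \<le> c * t"
    using assms t by (simp add: cnorm_smult mult_left_mono)
  then show ?thesis using assms(1) unfolding pos_def by (auto simp: star_smult intro!: exI[of _ "c * t"])
qed

lemma pos_diff:
  assumes "r \<in> carrier A" "star A r = r" "cnorm A r \<le> s"
  shows "pos (of_real s \<odot> e \<ominus> r)"
proof -
  have "of_real s \<odot> e \<ominus> (of_real s \<odot> e \<ominus> r) = r"
    using assms by (simp add: minus_minus_self)
  then show ?thesis using assms unfolding pos_def by (auto simp: star_minus star_smult intro!: exI[of _ s])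
qed

lemma pos_zero: "pos \<zero>"
  unfolding pos_def by (auto intro!: exI[of _ 0] simp: star_zero smult_0 cnorm_zero R.minus_eq)

lemma pos_sc_iff: "pos (of_real c \<odot> e) \<longleftrightarrow> 0 \<le> c"
proof
  assume "pos (of_real c \<odot> e)"
  then obtain t :: real where "cnorm A (of_real t \<odot> e \<ominus> of_real c \<odot> e) \<le> t" unfolding pos_def by blast
  then have "\<bar>t - c\<bar> \<le> t"
    by (simp add: cnorm_sc flip: smult_diff of_real_diff)
  then show "0 \<le> c" by simp
next
  have "pos (of_real 1 \<odot> e \<ominus> \<zero>)" by (rule pos_diff) (simp_all add: star_zero cnorm_zero)
  then have "pos e" by (simp add: smult_1 R.minus_eq)
  then show "0 \<le> c \<Longrightarrow> pos (of_real c \<odot> e)" by (rule pos_smult)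
qed

text \<open>For a witness \<open>t\<close> of positivity, \<open>g = e - h / t\<close> has norm at
  most 1, so \<open>ex_sqrt_diff\<close> gives a root of \<open>e - g = h / t\<close>, which is
  multiplied by \<open>sqrt t\<close>. The witness \<open>t = 0\<close> means
  \<open>h = 0\<close>.\<close>

lemma ex_sqrt:
  assumes h: "pos h"
  obtains k where "pos k" "k \<otimes> k = h"
    "\<And>b. b \<in> carrier A \<Longrightarrow> b \<otimes> h = h \<otimes> b \<Longrightarrow> b \<otimes> k = k \<otimes> b"
proof -
  obtain t :: real where t: "cnorm A (of_real t \<odot> e \<ominus> h) \<le> t"
    using h unfolding pos_def by blast
  have hc: "h \<in> carrier A" "star A h = h" using h by auto
  have t0: "t \<ge> 0" using t cnorm_nonneg[of "of_real t \<odot> e \<ominus> h"] hc by simp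
  show ?thesis
  proof (cases "t = 0")
    case True
    then have "cnorm A (\<ominus> h) = 0"
      using t hc cnorm_nonneg[OF hc(1)] by (simp add: smult_0 R.minus_eq cnorm_uminus)
    then have "h = \<zero>" using hc by (simp add: cnorm_uminus cnorm_eq_0_iff)
    then show ?thesis using that[of \<zero>] by (simp add: pos_zero)
  next
    case False
    define g where "g = of_real (1 / t) \<odot> (of_real t \<odot> e \<ominus> h)"
    have g: "g \<in> carrier A" "star A g = g" using hc by (simp_all add: g_def star_smult star_minus)
    have ge: "g = e \<ominus> of_real (1 / t) \<odot> h"
      using hc False by (simp add: g_def smult_minus smult_smult smult_1)
    have "cnorm A g \<le> 1" using t t0 False hc by (simp add: g_def cnorm_smult norm_divide field_simps)
    from ex_sqrt_diff[OF g this] obtain s where s: "s \<in> carrier A" "star A s = s" "s \<otimes> s = e \<ominus> g"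
      "cnorm A (e \<ominus> s) \<le> 1" "\<And>b. b \<in> carrier A \<Longrightarrow> b \<otimes> g = g \<otimes> b \<Longrightarrow> b \<otimes> s = s \<otimes> b" by blast
    have "e \<ominus> g = of_real (1 / t) \<odot> h"
      using hc unfolding ge by (simp add: minus_minus_self)
    then have ss: "s \<otimes> s = of_real (1 / t) \<odot> h" using s(3) by simp
    have "pos s" using s(1,2,4) unfolding pos_def by (auto intro!: exI[of _ 1] simp: smult_1)
    then have "pos (of_real (sqrt t) \<odot> s)" by (rule pos_smult) (use t0 in simp)
    moreover have "(of_real (sqrt t) \<odot> s) \<otimes> (of_real (sqrt t) \<odot> s) = h"
      using s(1) ss hc t0 False
      by (simp add: smult_mult_left smult_mult_right smult_smult smult_1 flip: of_real_mult)
    moreover have "b \<otimes> (of_real (sqrt t) \<odot> s) = (of_real (sqrt t) \<odot> s) \<otimes> b"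
      if b: "b \<in> carrier A" "b \<otimes> h = h \<otimes> b" for b
    proof -
      have "b \<otimes> g = g \<otimes> b" using b hc unfolding ge
        by (simp add: R.minus_eq R.r_distr R.l_distr R.r_minus R.l_minus smult_mult_left smult_mult_right)
      then show ?thesis using s(5)[OF b(1)] b s(1) by (simp add: smult_mult_left smult_mult_right)
    qed
    ultimately show ?thesis using that by blast
  qed
qed

text \<open>After scaling to norm at most 1, \<open>e - k k\<close> has a root \<open>s\<close>
  commuting with \<open>k\<close>. As \<open>s s + k k = e\<close>, \<open>comm_square\<close>
  bounds the norm of \<open>s s = e - k k\<close> by 1.\<close>

lemma square_bound:
  assumes k: "k \<in> carrier A" "star A k = k" and t: "cnorm A (k \<otimes> k) \<le> t"
  shows "cnorm A (of_real t \<odot> e \<ominus> k \<otimes> k) \<le> t"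
proof -
  have kk: "cnorm A (k \<otimes> k) = (cnorm A k)\<^sup>2" using cstar_identity[of k] k by simp
  have t0: "t \<ge> 0" using t cnorm_nonneg[of "k \<otimes> k"] k by simp
  have *: "cnorm A (e \<ominus> k \<otimes> k) \<le> 1" if k: "k \<in> carrier A" "star A k = k" and n: "cnorm A (k \<otimes> k) \<le> 1" for k
  proof -
    have "star A (k \<otimes> k) = k \<otimes> k" using k by (simp add: star_mult)
    then obtain s where s: "s \<in> carrier A" "star A s = s" "s \<otimes> s = e \<ominus> k \<otimes> k"
      "\<And>b. b \<in> carrier A \<Longrightarrow> b \<otimes> (k \<otimes> k) = (k \<otimes> k) \<otimes> b \<Longrightarrow> b \<otimes> s = s \<otimes> b"
      by (rule ex_sqrt_diff[OF mult_closed[OF k(1) k(1)] _ n]) (rule that)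
    have "s \<otimes> k = k \<otimes> s" using s(4)[of k] k by (simp add: mult_assoc)
    then have "(cnorm A s)\<^sup>2 \<le> cnorm A (s \<otimes> s \<oplus> k \<otimes> k)" by (rule comm_square(2)[OF s(1,2) k])
    also have "s \<otimes> s \<oplus> k \<otimes> k = e" unfolding s(3) using k e_closed by algebra
    finally show ?thesis using cstar_identity[of s] s(1-3) by (simp add: cnorm_e)
  qed
  show ?thesis
  proof (cases "t = 0")
    case True
    then have "k \<otimes> k = \<zero>" using t k cnorm_nonneg[of "k \<otimes> k"] cnorm_eq_0_iff[of "k \<otimes> k"] by simp
    then show ?thesis using True by (simp add: smult_0 R.minus_eq cnorm_zero)
  next
    case False
    define k' where "k' = of_real (1 / sqrt t) \<odot> k"
    have k': "k' \<in> carrier A" "star A k' = k'" using k by (simp_all add: k'_def star_smult)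
    have kk': "k' \<otimes> k' = of_real (1 / t) \<odot> (k \<otimes> k)"
      using k t0 by (simp add: k'_def smult_mult_left smult_mult_right smult_smult flip: of_real_mult)
    have "cnorm A (k' \<otimes> k') \<le> 1" using t t0 False k by (simp add: kk' cnorm_smult norm_divide field_simps)
    then have "t * cnorm A (e \<ominus> k' \<otimes> k') \<le> t" using *[OF k'] t0 by (simp add: mult_left_le)
    moreover have "of_real t \<odot> e \<ominus> k \<otimes> k = of_real t \<odot> (e \<ominus> k' \<otimes> k')"
      using k False by (simp add: kk' smult_minus smult_smult smult_1)
    ultimately show ?thesis using t0 k' by (simp add: cnorm_smult)
  qed
qed

lemma pos_square: "k \<in> carrier A \<Longrightarrow> star A k = k \<Longrightarrow> pos (k \<otimes> k)"
  unfolding pos_def using square_bound[of k "cnorm A (k \<otimes> k)"] by (auto simp: star_mult)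

text \<open>\<open>pos\<close> supplies a single witness; since \<open>h\<close> is a square, every
  number above its norm is a witness too.\<close>

lemma pos_bound:
  assumes "pos h" "cnorm A h \<le> t"
  shows "cnorm A (of_real t \<odot> e \<ominus> h) \<le> t"
proof -
  obtain k where k: "pos k" "k \<otimes> k = h" by (rule ex_sqrt[OF assms(1)]) (rule that)
  show ?thesis
    using square_bound[OF posD[OF k(1)], of t] assms(2) unfolding k(2) .
qed

text \<open>The roots \<open>w\<close> of \<open>z\<close> and \<open>v\<close> of
  \<open>t e - z\<close> commute and their squares add up to \<open>t e\<close>, so
  \<open>comm_square\<close> bounds \<open>cnorm A z = (cnorm A w)\<^sup>2\<close> by
  \<open>t\<close>.\<close>

lemma pos_le_cnorm:
  assumes z: "pos z" and tz: "pos (of_real t \<odot> e \<ominus> z)"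
  shows "cnorm A z \<le> t"
proof -
  have "of_real t \<odot> e \<ominus> z \<oplus> z = of_real t \<odot> e"
    using posD(1)[OF z] by (simp add: minus_plus)
  then have t0: "t \<ge> 0" using pos_add[OF tz z] by (simp add: pos_sc_iff)
  obtain w where w: "pos w" "w \<otimes> w = z" "\<And>b. b \<in> carrier A \<Longrightarrow> b \<otimes> z = z \<otimes> b \<Longrightarrow> b \<otimes> w = w \<otimes> b"
    by (rule ex_sqrt[OF z]) (rule that)
  obtain v where v: "pos v" "v \<otimes> v = of_real t \<odot> e \<ominus> z"
    "\<And>b. b \<in> carrier A \<Longrightarrow> b \<otimes> (of_real t \<odot> e \<ominus> z) = (of_real t \<odot> e \<ominus> z) \<otimes> b \<Longrightarrow> b \<otimes> v = v \<otimes> b"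
    by (rule ex_sqrt[OF tz]) (rule that)
  have wc: "w \<in> carrier A" "star A w = w" and vc: "v \<in> carrier A" "star A v = v" and zc: "z \<in> carrier A"
    using posD[OF w(1)] posD[OF v(1)] posD[OF z] by blast+
  have wz: "w \<otimes> z = z \<otimes> w" using wc by (simp add: mult_assoc flip: w(2))
  have "w \<otimes> v = v \<otimes> w"
    by (rule v(3)[OF wc(1)]) (use wc zc wz in \<open>simp add: R.minus_eq R.r_distr R.l_distr R.r_minus R.l_minus
        smult_mult_left smult_mult_right\<close>)
  then have "(cnorm A w)\<^sup>2 \<le> cnorm A (w \<otimes> w \<oplus> v \<otimes> v)" by (rule comm_square(2)[OF wc vc])
  also have "w \<otimes> w \<oplus> v \<otimes> v = of_real t \<odot> e"
    unfolding w(2) v(2) using zc by (simp add: plus_minus)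
  finally show ?thesis using cstar_identity[OF wc(1)] wc w(2) t0 by (simp add: cnorm_sc)
qed

text \<open>With \<open>t = cnorm A (x \<oplus> y)\<close>, the element \<open>t e - x\<close> is
  the sum of the positive elements \<open>t e - (x + y)\<close> and \<open>y\<close>.\<close>

lemma pos_mono:
  assumes "pos x" "pos y"
  shows "cnorm A x \<le> cnorm A (x \<oplus> y)"
proof (rule pos_le_cnorm[OF assms(1)])
  have c: "x \<in> carrier A" "y \<in> carrier A" using assms by auto
  let ?t = "of_real (cnorm A (x \<oplus> y)) \<odot> e"
  have "pos (?t \<ominus> (x \<oplus> y))" by (rule pos_diff) (use assms in \<open>auto simp: star_add\<close>)
  from pos_add[OF this assms(2)] show "pos (?t \<ominus> x)"
  proof -
    have "?t \<ominus> (x \<oplus> y) \<oplus> y = ?t \<ominus> x" using c by (simp add: minus_sum_plus)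
    then show "pos (?t \<ominus> (x \<oplus> y) \<oplus> y) \<Longrightarrow> ?thesis" by simp
  qed
qed

section \<open>Inverses\<close>

text \<open>The Neumann series of \<open>e - a\<close>, with \<open>B\<close> listing its partial
  sums. The right inverse \<open>b\<close> gives the left inverse \<open>star A b\<close> because
  \<open>a\<close> is self-adjoint, and a left and a right inverse coincide.\<close>

lemma inverse_near_e:
  assumes a: "a \<in> carrier A" "star A a = a" and n: "cnorm A (e \<ominus> a) < 1"
  obtains b where "b \<in> carrier A" "star A b = b" "a \<otimes> b = e" "b \<otimes> a = e"
proof -
  let ?d = "e \<ominus> a" and ?r = "cnorm A (e \<ominus> a)"
  define B where "B = rec_nat \<zero> (\<lambda>_ b. e \<oplus> ?d \<otimes> b)"
  have B0: "B 0 = \<zero>" and BS: "B (Suc n) = e \<oplus> ?d \<otimes> B n" for n by (simp_all add: B_def)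
  have d: "?d \<in> carrier A" using a by simp
  have Bc: "B n \<in> carrier A" for n by (induction n) (use d in \<open>simp_all add: B0 BS\<close>)
  have step: "cdist A (B (Suc n)) (B n) \<le> ?r ^ n" for n
  proof (induction n)
    case 0
    have "B (Suc 0) = e" "e \<ominus> \<zero> = e" using d by (simp_all add: B0 BS) (simp add: R.minus_eq)
    then show ?case by (simp add: B0 cdist_cnorm cnorm_e)
  next
    case (Suc n)
    have "cdist A (B (Suc (Suc n))) (B (Suc n)) = cdist A (e \<oplus> ?d \<otimes> B (Suc n)) (e \<oplus> ?d \<otimes> B n)"
      by (metis BS)
    also have "\<dots> = cdist A (?d \<otimes> B (Suc n)) (?d \<otimes> B n)"
      using Bc d by (simp add: cdist_translate)
    also have "\<dots> \<le> ?r * cdist A (B (Suc n)) (B n)"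
      using cdist_mult[of ?d "B (Suc n)" ?d "B n"] Bc d by simp
    also have "\<dots> \<le> ?r * ?r ^ n" using Suc d by (intro mult_left_mono) (auto intro: cnorm_nonneg)
    finally show ?case by simp
  qed
  have conv: "convergent (\<lambda>n. \<Sum>i<n. ?r ^ i)"
    using summable_geometric[of ?r] n d cnorm_nonneg[of ?d] by (simp add: summable_iff_convergent)
  obtain b where b: "tends B b"
    by (rule tends_cauchy[of B, OF Bc conv]) (use step in simp, rule that)
  have bc: "b \<in> carrier A" using b by (simp add: tends_def)
  have "tends (\<lambda>n. e \<oplus> ?d \<otimes> B n) (e \<oplus> ?d \<otimes> b)"
    by (rule tends_add[OF tends_const[OF e_closed] tends_mult[OF tends_const[OF d] b]])
  then have "e \<oplus> ?d \<otimes> b = b" by (rule tends_unique[OF _ tends_Suc[OF b, unfolded BS]])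
  moreover have "a \<otimes> b = e \<oplus> b \<ominus> (e \<oplus> ?d \<otimes> b)" using a(1) bc e_closed e_left[OF bc] by algebra
  ultimately have ab: "a \<otimes> b = e" using bc e_closed by (simp add: R.minus_eq R.add.m_assoc R.r_neg)
  then have ba: "star A b \<otimes> a = e" using star_mult[of a b] a bc by simp
  have "star A b = star A b \<otimes> (a \<otimes> b)" using ab bc by simp
  also have "\<dots> = b" using ba bc a by (simp flip: mult_assoc)
  finally show ?thesis using that bc ab ba by simp
qed

lemma sum_minus_sum:
  "x \<in> carrier A \<Longrightarrow> y \<in> carrier A \<Longrightarrow> z \<in> carrier A \<Longrightarrow> (x \<oplus> y) \<ominus> (z \<oplus> y) = x \<ominus> z"
  by algebra

lemma minus_add_cancel:
  "x \<in> carrier A \<Longrightarrow> y \<in> carrier A \<Longrightarrow> z \<in> carrier A \<Longrightarrow> (x \<ominus> y) \<oplus> (z \<ominus> (\<ominus> y)) = x \<oplus> z"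
  by algebra

lemma square_sum:
  "x \<in> carrier A \<Longrightarrow> y \<in> carrier A \<Longrightarrow> (x \<oplus> y) \<otimes> (x \<oplus> y) = x \<otimes> x \<oplus> (x \<otimes> y \<oplus> y \<otimes> x) \<oplus> y \<otimes> y"
  by algebra

text \<open>With \<open>h = a - r e\<close> and \<open>t = cnorm A h\<close>, positivity of
  \<open>h\<close> puts \<open>a / (t + r)\<close> within \<open>t / (t + r) < 1\<close> of
  \<open>e\<close>.\<close>

lemma pos_inverse:
  assumes a: "a \<in> carrier A" and r: "r > 0" and pa: "pos (a \<ominus> of_real r \<odot> e)"
  obtains b where "b \<in> carrier A" "star A b = b" "a \<otimes> b = e" "b \<otimes> a = e"
proof -
  define h where "h = a \<ominus> of_real r \<odot> e"
  define t where "t = cnorm A h"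
  have h: "pos h" "h \<in> carrier A" using pa by (auto simp: h_def)
  have ah: "a = h \<oplus> of_real r \<odot> e" using a unfolding h_def by (simp add: minus_plus)
  have sa: "star A a = a" using h by (simp add: ah star_add star_smult)
  have t0: "t \<ge> 0" using cnorm_nonneg[OF h(2)] by (simp add: t_def)
  let ?s = "t + r"
  define a' where "a' = of_real (1 / ?s) \<odot> a"
  have "e \<ominus> a' = of_real (1 / ?s) \<odot> (of_real ?s \<odot> e \<ominus> a)"
    using a r t0 by (simp add: a'_def smult_minus smult_smult smult_1 flip: of_real_mult of_real_add)
  also have "of_real ?s \<odot> e \<ominus> a = of_real t \<odot> e \<ominus> h"
    using h(2) unfolding ah of_real_add smult_sum[OF e_closed] by (simp add: sum_minus_sum)
  finally have "cnorm A (e \<ominus> a') = cnorm A (of_real t \<odot> e \<ominus> h) / ?s"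
    using h r t0 by (simp add: cnorm_smult norm_divide flip: of_real_add)
  also have "\<dots> \<le> t / ?s" using pos_bound[OF h(1)] r t0 by (simp add: t_def divide_right_mono)
  also have "\<dots> < 1" using r t0 by simp
  finally have n: "cnorm A (e \<ominus> a') < 1" .
  have a': "a' \<in> carrier A" "star A a' = a'" using a sa by (simp_all add: a'_def star_smult)
  obtain b where b: "b \<in> carrier A" "star A b = b" "a' \<otimes> b = e" "b \<otimes> a' = e"
    by (rule inverse_near_e[OF a' n]) (rule that)
  show ?thesis
  proof (rule that[of "of_real (1 / ?s) \<odot> b"])
    show "a \<otimes> (of_real (1 / ?s) \<odot> b) = e" "(of_real (1 / ?s) \<odot> b) \<otimes> a = e"
      using b a by (simp_all add: a'_def smult_mult_left smult_mult_right)
  qed (use b in \<open>simp_all add: star_smult\<close>)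
qed

text \<open>Kaplansky's argument: \<open>y\<^sup>*y = a - k\<close> with \<open>a = |y\<^sup>*y|\<close>, and \<open>z = y k\<close> has \<open>z\<^sup>*z = - w\<^sup>2\<close> and \<open>z z\<^sup>*\<close>
  positive. Comparing \<open>z\<^sup>* (r - z z\<^sup>*)\<^sup>2 z\<close> with \<open>(r + w\<^sup>2)\<^sup>2 w\<^sup>2\<close> for \<open>r = \<parallel>z\<parallel>\<^sup>2\<close> forces \<open>z = 0\<close>
  without mentioning spectra.\<close>

theorem pos_star_mult:
  assumes y: "y \<in> carrier A"
  shows "pos (star A y \<otimes> y)"
proof -
  define h where "h = star A y \<otimes> y"
  have h: "h \<in> carrier A" "star A h = h" using y by (simp_all add: h_def star_mult star_star)
  obtain a where a: "pos a" "a \<otimes> a = h \<otimes> h"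
    "\<And>b. b \<in> carrier A \<Longrightarrow> b \<otimes> (h \<otimes> h) = (h \<otimes> h) \<otimes> b \<Longrightarrow> b \<otimes> a = a \<otimes> b"
    by (rule ex_sqrt[OF pos_square[OF h]]) (rule that)
  have ac: "a \<in> carrier A" "star A a = a" using posD[OF a(1)] by blast+
  have ha: "h \<otimes> a = a \<otimes> h" by (rule a(3)) (use h in \<open>simp_all add: mult_assoc\<close>)
  obtain g where g: "pos g" "g \<otimes> g = a" "\<And>b. b \<in> carrier A \<Longrightarrow> b \<otimes> a = a \<otimes> b \<Longrightarrow> b \<otimes> g = g \<otimes> b"
    by (rule ex_sqrt[OF a(1)]) (rule that)
  have gc: "g \<in> carrier A" "star A g = g" using posD[OF g(1)] by blast+
  \<comment> \<open>\<open>k\<close> is twice the negative part of \<open>h\<close>, so the goal is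
    \<open>k = 0\<close>. From \<open>a a = h h\<close> it follows that \<open>h\<close> acts on
    \<open>k\<close> as \<open>- a\<close>.\<close>
  define k where "k = a \<ominus> h"
  have k: "k \<in> carrier A" "star A k = k" using h ac by (simp_all add: k_def star_minus)
  have hk: "h \<otimes> k = \<ominus> (a \<otimes> k)" unfolding k_def using h(1) ac(1) a(2) ha by algebra
  have ka: "k \<otimes> a = a \<otimes> k" unfolding k_def using h(1) ac(1) ha by algebra
  have kg: "k \<otimes> g = g \<otimes> k" by (rule g(3)[OF k(1) ka])
  define z where "z = y \<otimes> k"
  define w where "w = g \<otimes> k"
  have z: "z \<in> carrier A" using y k by (simp add: z_def)
  have w: "w \<in> carrier A" "star A w = w" using gc k kg by (simp_all add: w_def star_mult)
  have zz: "star A z \<otimes> z = \<ominus> (w \<otimes> w)"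
  proof -
    have "star A z \<otimes> z = k \<otimes> (h \<otimes> k)"
      using y k by (simp add: z_def h_def star_mult mult_assoc)
    also have "\<dots> = \<ominus> (k \<otimes> (g \<otimes> (g \<otimes> k)))"
      using k gc ac by (simp add: hk R.r_minus mult_assoc flip: g(2))
    also have "k \<otimes> (g \<otimes> (g \<otimes> k)) = (k \<otimes> g) \<otimes> (g \<otimes> k)" using k gc by (simp add: mult_assoc)
    finally show ?thesis by (simp add: w_def kg)
  qed
  define q where "q = z \<otimes> star A z"
  have q: "q \<in> carrier A" using z by (simp add: q_def)
  have pw: "pos (w \<otimes> w)" by (rule pos_square[OF w])
  have "pos q"
  proof -
    \<comment> \<open>The two squares add up to \<open>2 q + 2 (star A z \<otimes> z)\<close>;
      adding \<open>w w\<close>, which is \<open>- (star A z \<otimes> z)\<close>, twice leaves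
      \<open>2 q\<close>.\<close>
    let ?b = "z \<oplus> star A z" and ?c = "\<i> \<odot> (z \<ominus> star A z)"
    have "pos (?b \<otimes> ?b)" by (rule pos_square) (use z in \<open>simp_all add: star_add star_star R.add.m_comm\<close>)
    moreover have "pos (?c \<otimes> ?c)"
    proof (rule pos_square)
      show "?c \<in> carrier A" using z by simp
      have "star A ?c = \<ominus> (\<i> \<odot> (star A z \<ominus> z))"
        using z by (simp add: star_smult star_minus star_star uminus_smult_left)
      also have "\<dots> = \<i> \<odot> (\<ominus> (star A z \<ominus> z))" using z by (simp add: smult_uminus)
      also have "\<ominus> (star A z \<ominus> z) = z \<ominus> star A z" using z star_closed[OF z] by algebra
      finally show "star A ?c = ?c" .
    qed
    ultimately have "pos (((?b \<otimes> ?b \<oplus> ?c \<otimes> ?c) \<oplus> w \<otimes> w) \<oplus> w \<otimes> w)"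
      using pw by (intro pos_add)
    moreover have "?c \<otimes> ?c = \<ominus> ((z \<ominus> star A z) \<otimes> (z \<ominus> star A z))"
      using z by (simp add: smult_mult_left smult_mult_right smult_smult uminus_smult_left smult_1)
    moreover have "?b \<otimes> ?b \<oplus> \<ominus> ((z \<ominus> star A z) \<otimes> (z \<ominus> star A z)) =
        (q \<oplus> q) \<oplus> (star A z \<otimes> z \<oplus> star A z \<otimes> z)"
      unfolding q_def using z star_closed[OF z] by algebra
    moreover have "(q \<oplus> q) \<oplus> (star A z \<otimes> z \<oplus> star A z \<otimes> z) \<oplus> w \<otimes> w \<oplus> w \<otimes> w = q \<oplus> q"
      unfolding zz using q mult_closed[OF w(1) w(1)] by algebra
    ultimately have "pos (2 \<odot> q)" using q by (simp add: two_smult)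
    then have "pos (of_real (1 / 2) \<odot> (2 \<odot> q))" by (rule pos_smult) simp
    then show ?thesis using q by (simp add: smult_smult smult_1)
  qed
  define r where "r = (cnorm A z)\<^sup>2"
  have r0: "r \<ge> 0" by (simp add: r_def)
  have nq: "cnorm A q = r"
    using cstar_identity[of "star A z"] z by (simp add: q_def r_def star_star cnorm_star)
  have nw: "cnorm A (w \<otimes> w) = r"
    using cstar_identity[OF z] w by (simp add: zz r_def cnorm_uminus)
  define d where "d = of_real r \<odot> e \<ominus> q"
  define m where "m = of_real r \<odot> e \<oplus> w \<otimes> w"
  have d: "d \<in> carrier A" and m: "m \<in> carrier A" "star A m = m"
    using q w by (simp_all add: d_def m_def star_add star_smult star_mult)
  have "d \<otimes> z = of_real r \<odot> z \<ominus> z \<otimes> (star A z \<otimes> z)"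
    using z by (simp add: d_def q_def R.minus_eq R.l_distr R.l_minus smult_mult_left mult_assoc)
  also have "\<dots> = z \<otimes> m"
    using z w by (simp add: zz m_def R.r_minus R.r_distr R.minus_eq smult_mult_right)
  finally have dz: "d \<otimes> z = z \<otimes> m" .
  have mw: "m \<otimes> w = of_real r \<odot> w \<oplus> w \<otimes> (w \<otimes> w)" and wm: "w \<otimes> m = m \<otimes> w"
    using w by (simp_all add: m_def R.l_distr R.r_distr smult_mult_left smult_mult_right mult_assoc)
  \<comment> \<open>\<open>v v\<close> is estimated twice: from above through \<open>d z\<close>,
    from below through its expansion in powers of \<open>w\<close>.\<close>
  define v where "v = m \<otimes> w"
  have v: "v \<in> carrier A" "star A v = v" using m w by (simp_all add: v_def star_mult wm)
  have "star A (d \<otimes> z) \<otimes> (d \<otimes> z) = m \<otimes> (star A z \<otimes> z) \<otimes> m"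
    using z m by (simp add: dz star_mult mult_assoc)
  also have "\<dots> = \<ominus> (m \<otimes> (w \<otimes> (w \<otimes> m)))"
    using w m by (simp add: zz R.r_minus R.l_minus mult_assoc)
  also have "m \<otimes> (w \<otimes> (w \<otimes> m)) = v \<otimes> v" using w m by (simp add: v_def wm mult_assoc)
  finally have vv: "star A (d \<otimes> z) \<otimes> (d \<otimes> z) = \<ominus> (v \<otimes> v)" .
  have "cnorm A (v \<otimes> v) = (cnorm A (d \<otimes> z))\<^sup>2"
    using cstar_identity[of "d \<otimes> z"] d z v by (simp add: vv cnorm_uminus)
  also have "\<dots> \<le> (r * cnorm A z)\<^sup>2"
  proof (rule power_mono)
    have "cnorm A d \<le> r" unfolding d_def by (rule pos_bound[OF \<open>pos q\<close>]) (simp add: nq)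
    then show "cnorm A (d \<otimes> z) \<le> r * cnorm A z"
      using cnorm_mult[OF d z] mult_right_mono[of "cnorm A d" r "cnorm A z"] cnorm_nonneg[OF z] by linarith
  qed (use d z in \<open>simp add: cnorm_nonneg\<close>)
  also have "\<dots> = r ^ 3" by (simp add: r_def power_mult_distrib power2_eq_square power3_eq_cube)
  finally have upper: "cnorm A (v \<otimes> v) \<le> r ^ 3" .
  \<comment> \<open>\<open>v v\<close> is \<open>2 r\<close> times the fourth power of
    \<open>w\<close> plus squares, and dropping positive summands does not increase the norm.
    Against the upper bound \<open>r ^ 3\<close> this leaves only \<open>r = 0\<close>.\<close>
  have "2 * r * r\<^sup>2 \<le> cnorm A (v \<otimes> v)"
  proof -
    let ?s = "w \<otimes> w"
    have sc: "?s \<in> carrier A" "star A ?s = ?s" using w by (simp_all add: star_mult)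
    have "v \<otimes> v = of_real (2 * r) \<odot> (?s \<otimes> ?s) \<oplus> ((of_real r \<odot> w) \<otimes> (of_real r \<odot> w) \<oplus> (w \<otimes> ?s) \<otimes> (w \<otimes> ?s))"
    proof -
      have "v = of_real r \<odot> w \<oplus> w \<otimes> ?s" by (simp add: v_def mw)
      then have "v \<otimes> v = (of_real r \<odot> w) \<otimes> (of_real r \<odot> w) \<oplus>
          ((of_real r \<odot> w) \<otimes> (w \<otimes> ?s) \<oplus> (w \<otimes> ?s) \<otimes> (of_real r \<odot> w)) \<oplus> (w \<otimes> ?s) \<otimes> (w \<otimes> ?s)"
        using square_sum[OF smult_closed'[OF w(1)] mult_closed[OF w(1) sc(1)]] by simp
      also have "(of_real r \<odot> w) \<otimes> (w \<otimes> ?s) = of_real r \<odot> (?s \<otimes> ?s)"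
        using w by (simp add: smult_mult_left mult_assoc)
      also have "(w \<otimes> ?s) \<otimes> (of_real r \<odot> w) = of_real r \<odot> (?s \<otimes> ?s)"
        using w by (simp add: smult_mult_right mult_assoc)
      also have "of_real r \<odot> (?s \<otimes> ?s) \<oplus> of_real r \<odot> (?s \<otimes> ?s) = of_real (2 * r) \<odot> (?s \<otimes> ?s)"
        by (simp only: of_real_add mult_2 smult_sum[OF mult_closed[OF sc(1) sc(1)]])
      finally show ?thesis using w by (simp add: R.add.m_ac)
    qed
    moreover have "pos (of_real (2 * r) \<odot> (?s \<otimes> ?s))"
      using r0 by (intro pos_smult pos_square sc) simp
    moreover have "pos ((of_real r \<odot> w) \<otimes> (of_real r \<odot> w) \<oplus> (w \<otimes> ?s) \<otimes> (w \<otimes> ?s))"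
      using w by (intro pos_add pos_square) (simp_all add: star_smult star_mult mult_assoc)
    ultimately have "cnorm A (of_real (2 * r) \<odot> (?s \<otimes> ?s)) \<le> cnorm A (v \<otimes> v)"
      using pos_mono by metis
    moreover have "cnorm A (?s \<otimes> ?s) = r\<^sup>2" using cstar_identity[OF sc(1)] sc nw by simp
    ultimately show ?thesis using sc r0 by (simp add: cnorm_smult)
  qed
  with upper have "2 * r ^ 3 \<le> r ^ 3" by (simp add: power2_eq_square power3_eq_cube mult.assoc)
  then have "r = 0" using r0 by (metis mult_2 add_le_same_cancel1 zero_le_power order_antisym power_eq_0_iff)
  then have "z = \<zero>" using z by (simp add: r_def cnorm_eq_0_iff)
  then have "h \<otimes> k = \<zero>" using y k by (simp add: h_def mult_assoc z_def)
  then have "a \<otimes> k = \<zero>" using hk ac k by (metis R.minus_minus R.minus_zero mult_closed)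
  then have "k \<otimes> k = \<zero>"
    using \<open>h \<otimes> k = \<zero>\<close> h ac k by (subst k_def) (simp add: R.minus_eq R.l_distr R.l_minus)
  then have "(cnorm A k)\<^sup>2 = 0" using cstar_identity[OF k(1)] k by (simp add: cnorm_zero)
  then have "k = \<zero>" using k by (simp add: cnorm_eq_0_iff)
  then have "h = a" using h ac by (simp add: k_def)
  then show ?thesis using a(1) by (simp add: h_def)
qed

section \<open>Positive functionals and states\<close>

definition positive_functional :: "('a \<Rightarrow> complex) \<Rightarrow> bool" where
  "positive_functional \<phi> \<longleftrightarrow>
     (\<forall>x\<in>carrier A. \<forall>y\<in>carrier A. \<phi> (x \<oplus> y) = \<phi> x + \<phi> y) \<and> (\<forall>c. \<forall>x\<in>carrier A. \<phi> (c \<odot> x) = c * \<phi> x) \<and>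
     (\<forall>x\<in>carrier A. \<phi> (star A x) = cnj (\<phi> x)) \<and> (\<forall>x\<in>carrier A. 0 \<le> Re (\<phi> (star A x \<otimes> x)))"

text \<open>Hahn-Banach for the functional \<open>p\<close> that assigns to \<open>y\<close> the
  least upper bound of its real part. Domination by \<open>p\<close> makes \<open>f\<close>
  nonnegative on positive elements, zero on \<open>\<i>\<close> times self-adjoint elements and 1 at
  \<open>e\<close>; and \<open>p (star A x \<otimes> x)\<close> is the full norm by
  \<open>pos_le_cnorm\<close>.\<close>

theorem ex_state:
  assumes x: "x \<in> carrier A"
  obtains \<phi> where "positive_functional \<phi>" "\<phi> e = 1" "\<phi> (star A x \<otimes> x) = of_real ((cnorm A x)\<^sup>2)"
proof -
  interpret V: real_space "carrier A" "add A" "\<lambda>t. smult A (of_real t)" "\<zero>"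
    by unfold_locales (auto simp: R.add.m_ac smult_0 smult_1 smult_smult smult_oplus smult_sum)
  \<comment> \<open>The upper bounds of the real part \<open>(y + star A y) / 2\<close>, with the
    factor 2 cleared.\<close>
  define S where "S y = {t. pos (of_real (2 * t) \<odot> e \<ominus> (y \<oplus> star A y))}" for y
  define p where "p y = Inf (S y)" for y
  have sa: "y \<oplus> star A y \<in> carrier A" "star A (y \<oplus> star A y) = y \<oplus> star A y" if "y \<in> carrier A" for y
    using that by (simp_all add: star_add star_star R.add.m_comm)
  have nsa: "cnorm A (y \<oplus> star A y) \<le> 2 * cnorm A y" if "y \<in> carrier A" for y
    using cnorm_triangle[of y "star A y"] that by (simp add: cnorm_star)
  have S_ge: "- cnorm A y \<le> t" if t: "t \<in> S y" and y: "y \<in> carrier A" for t y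
  proof -
    let ?r = "y \<oplus> star A y"
    have r: "\<ominus> ?r \<in> carrier A" "star A (\<ominus> ?r) = \<ominus> ?r" using sa[OF y] by (simp_all add: star_uminus del: closed)
    have "pos (of_real (2 * cnorm A y) \<odot> e \<ominus> (\<ominus> ?r))"
      by (rule pos_diff[OF r]) (use nsa[OF y] sa[OF y] in \<open>simp add: cnorm_uminus\<close>)
    then have "pos ((of_real (2 * t) \<odot> e \<ominus> ?r) \<oplus> (of_real (2 * cnorm A y) \<odot> e \<ominus> (\<ominus> ?r)))"
      using t by (intro pos_add) (simp_all add: S_def)
    also have "(of_real (2 * t) \<odot> e \<ominus> ?r) \<oplus> (of_real (2 * cnorm A y) \<odot> e \<ominus> (\<ominus> ?r)) =
        of_real (2 * t + 2 * cnorm A y) \<odot> e"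
      unfolding of_real_add smult_sum[OF e_closed]
      using minus_add_cancel[OF smult_closed'[OF e_closed] sa(1)[OF y] smult_closed'[OF e_closed]] .
    finally show ?thesis unfolding pos_sc_iff by simp
  qed
  have S_norm: "cnorm A y \<in> S y" if "y \<in> carrier A" for y
    using pos_diff[OF sa[OF that] nsa[OF that]] by (simp add: S_def)
  have bd: "bdd_below (S y)" if "y \<in> carrier A" for y
    using S_ge[OF _ that] by (rule bdd_belowI)
  have ple: "p y \<le> t" if "t \<in> S y" "y \<in> carrier A" for t y
    unfolding p_def by (rule cInf_lower[OF that(1) bd[OF that(2)]])
  have plt: "\<exists>t\<in>S y. t < b" if "p y < b" "y \<in> carrier A" for y b
  proof (rule cInf_lessD)
    show "S y \<noteq> {}" using S_norm[OF that(2)] by blast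
    show "Inf (S y) < b" using that(1) by (simp add: p_def)
  qed
  have sub: "V.sublinear p"
    unfolding V.sublinear_def
  proof (intro conjI ballI allI impI)
    fix y z assume yz: "y \<in> carrier A" "z \<in> carrier A"
    show "p (y \<oplus> z) \<le> p y + p z"
    proof (rule field_le_epsilon)
      fix d :: real assume d: "d > 0"
      obtain t where t: "t \<in> S y" "t < p y + d / 2" using plt[of y "p y + d / 2"] yz d by auto
      obtain s where s: "s \<in> S z" "s < p z + d / 2" using plt[of z "p z + d / 2"] yz d by auto
      have "pos ((of_real (2 * t) \<odot> e \<ominus> (y \<oplus> star A y)) \<oplus> (of_real (2 * s) \<odot> e \<ominus> (z \<oplus> star A z)))"
        using t s by (intro pos_add) (simp_all add: S_def)
      also have "(of_real (2 * t) \<odot> e \<ominus> (y \<oplus> star A y)) \<oplus> (of_real (2 * s) \<odot> e \<ominus> (z \<oplus> star A z)) =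
          of_real (2 * (t + s)) \<odot> e \<ominus> ((y \<oplus> z) \<oplus> star A (y \<oplus> z))"
        using yz by (simp add: distrib_left smult_sum star_add R.minus_eq R.minus_add R.add.m_ac)
      finally have "t + s \<in> S (y \<oplus> z)" by (simp add: S_def)
      then show "p (y \<oplus> z) \<le> p y + p z + d" using ple[of "t + s" "y \<oplus> z"] t s yz by simp
    qed
  next
    fix c :: real and y assume c: "c > 0" and y: "y \<in> carrier A"
    have le: "p (of_real c \<odot> y) \<le> c * p y" if c: "c > 0" and y: "y \<in> carrier A" for c :: real and y
    proof (rule ccontr)
      assume "\<not> ?thesis"
      then have "p y < p (of_real c \<odot> y) / c" using c by (simp add: field_simps)
      then obtain t where t: "t \<in> S y" "t < p (of_real c \<odot> y) / c" using plt[OF _ y] by blast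
      have "pos (of_real c \<odot> (of_real (2 * t) \<odot> e \<ominus> (y \<oplus> star A y)))"
        using t c by (intro pos_smult) (simp_all add: S_def)
      also have "of_real c \<odot> (of_real (2 * t) \<odot> e \<ominus> (y \<oplus> star A y)) =
          of_real (2 * (c * t)) \<odot> e \<ominus> (of_real c \<odot> y \<oplus> star A (of_real c \<odot> y))"
        using y by (simp add: smult_minus smult_oplus smult_smult star_smult mult.left_commute)
      finally have "c * t \<in> S (of_real c \<odot> y)" by (simp add: S_def)
      then show False using ple[of "c * t" "of_real c \<odot> y"] t c y by (simp add: field_simps)
    qed
    have "p y \<le> (1 / c) * p (of_real c \<odot> y)"
      using le[of "1 / c" "of_real c \<odot> y"] c y by (simp add: smult_smult smult_1)
    then show "p (of_real c \<odot> y) = c * p y" using le[OF c y] c by (simp add: field_simps)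
  qed
  let ?z = "star A x \<otimes> x"
  have z: "?z \<in> carrier A" "star A ?z = ?z" using x by (simp_all add: star_mult star_star)
  obtain f where fadd: "\<And>u v. u \<in> carrier A \<Longrightarrow> v \<in> carrier A \<Longrightarrow> f (u \<oplus> v) = f u + f v"
    and fsc: "\<And>t u. u \<in> carrier A \<Longrightarrow> f (of_real t \<odot> u) = t * f u"
    and fp: "\<And>u. u \<in> carrier A \<Longrightarrow> f u \<le> p u" and fz: "f ?z = p ?z"
    by (rule V.hahn_banach[OF sub z(1)]) (rule that)
  have fneg: "f (\<ominus> u) = - f u" if "u \<in> carrier A" for u
    using fsc[OF that, of "-1"] that by (simp add: uminus_smult)
  have fpos: "0 \<le> f u" if u: "pos u" for u
  proof -
    have uc: "u \<in> carrier A" "star A u = u" using posD[OF u] by blast+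
    have "of_real (2 * 0) \<odot> e \<ominus> (\<ominus> u \<oplus> star A (\<ominus> u)) = u \<oplus> u"
      using uc by (simp add: star_uminus smult_0 R.minus_eq R.minus_add)
    then have "0 \<in> S (\<ominus> u)" using pos_add[OF u u] by (simp add: S_def)
    then show ?thesis using fp[of "\<ominus> u"] ple[of 0 "\<ominus> u"] uc fneg by fastforce
  qed
  \<comment> \<open>Both \<open>\<i> u\<close> and its negative have real part 0, so
    \<open>p\<close> is at most 0 at each of them.\<close>
  have fi: "f (\<i> \<odot> u) = 0" if u: "u \<in> carrier A" "star A u = u" for u
  proof -
    have "\<i> \<odot> u \<oplus> star A (\<i> \<odot> u) = \<zero>" "\<ominus> (\<i> \<odot> u) \<oplus> star A (\<ominus> (\<i> \<odot> u)) = \<zero>"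
      using u by (simp_all add: star_smult star_uminus uminus_smult_left R.r_neg R.l_neg)
    then have "0 \<in> S (\<i> \<odot> u)" "0 \<in> S (\<ominus> (\<i> \<odot> u))" by (simp_all add: S_def smult_0 R.minus_eq pos_zero)
    then show ?thesis
      using fp[of "\<i> \<odot> u"] fp[of "\<ominus> (\<i> \<odot> u)"] ple[of 0 "\<i> \<odot> u"] ple[of 0 "\<ominus> (\<i> \<odot> u)"] u fneg[of "\<i> \<odot> u"] by simp
  qed
  \<comment> \<open>The complex-linear functional with real part \<open>f\<close>.\<close>
  define \<phi> where "\<phi> u = of_real (f u) - \<i> * of_real (f (\<i> \<odot> u))" for u
  have fc: "f (c \<odot> u) = Re c * f u + Im c * f (\<i> \<odot> u)" if u: "u \<in> carrier A" for c u
  proof -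
    have "c \<odot> u = of_real (Re c) \<odot> u \<oplus> of_real (Im c) \<odot> (\<i> \<odot> u)"
      using u by (simp add: smult_smult mult.commute flip: smult_sum complex_eq)
    then show ?thesis using u by (simp add: fadd fsc)
  qed
  have fstar: "f (star A u) = f u" "f (\<i> \<odot> star A u) = - f (\<i> \<odot> u)" if u: "u \<in> carrier A" for u
  proof -
    have *: "f (star A v) = f v" if v: "v \<in> carrier A" for v
    proof -
      let ?w = "(- \<i>) \<odot> (v \<ominus> star A v)"
      have "star A ?w = \<i> \<odot> \<ominus> (v \<ominus> star A v)"
        using v by (simp add: star_smult star_add star_uminus star_star R.minus_eq R.minus_add R.add.m_comm)
      also have "\<dots> = ?w" using v by (simp add: smult_uminus uminus_smult_left)
      finally have "f (\<i> \<odot> ?w) = 0" using v by (intro fi) auto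
      then have "f (v \<oplus> \<ominus> star A v) = 0" using v by (simp add: smult_smult smult_1 R.minus_eq)
      then show ?thesis using v by (simp add: fadd fneg)
    qed
    show "f (star A u) = f u" by (rule *[OF u])
    have "\<i> \<odot> star A u = \<ominus> star A (\<i> \<odot> u)" using u by (simp add: star_smult uminus_smult_left)
    then show "f (\<i> \<odot> star A u) = - f (\<i> \<odot> u)" using u *[of "\<i> \<odot> u"] by (simp add: fneg)
  qed
  have "positive_functional \<phi>"
    unfolding positive_functional_def
  proof (intro conjI ballI allI)
    fix u v assume uv: "u \<in> carrier A" "v \<in> carrier A"
    show "\<phi> (u \<oplus> v) = \<phi> u + \<phi> v" using uv by (simp add: \<phi>_def fadd smult_oplus algebra_simps)
  next
    fix c u assume u: "u \<in> carrier A"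
    show "\<phi> (c \<odot> u) = c * \<phi> u"
      using fc[OF u, of c] fc[OF u, of "\<i> * c"] u
      by (simp add: \<phi>_def smult_smult complex_eq_iff)
    show "\<phi> (star A u) = cnj (\<phi> u)" using fstar[OF u] by (simp add: \<phi>_def)
    show "0 \<le> Re (\<phi> (star A u \<otimes> u))" using fpos[OF pos_star_mult[OF u]] by (simp add: \<phi>_def)
  qed
  moreover have "\<phi> e = 1"
  proof -
    have "of_real (2 * 1) \<odot> e \<ominus> (e \<oplus> star A e) = \<zero>" by (simp add: two_smult R.r_neg R.minus_eq)
    then have "1 \<in> S e" unfolding S_def mem_Collect_eq by (metis pos_zero)
    then have "f e \<le> 1" using fp[of e] ple[of 1 e] by simp
    moreover have "\<ominus> (e \<oplus> e) \<ominus> (\<ominus> e \<oplus> \<ominus> e) = \<zero>" using e_closed by algebra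
    then have "of_real (2 * (- 1)) \<odot> e \<ominus> (\<ominus> e \<oplus> star A (\<ominus> e)) = \<zero>"
      by (simp add: uminus_smult_left two_smult star_uminus)
    then have "- 1 \<in> S (\<ominus> e)" unfolding S_def mem_Collect_eq by (metis pos_zero)
    then have "f (\<ominus> e) \<le> - 1" using fp[of "\<ominus> e"] ple[of "-1" "\<ominus> e"] by simp
    ultimately have "f e = 1" by (simp add: fneg)
    then show ?thesis using fi[of e] by (simp add: \<phi>_def)
  qed
  moreover have "\<phi> ?z = of_real ((cnorm A x)\<^sup>2)"
  proof -
    \<comment> \<open>Every upper bound \<open>t\<close> of the positive element \<open>?z\<close>
      is at least its norm, so the infimum \<open>p ?z\<close> is as well.\<close>
    have "cnorm A ?z \<le> p ?z"
      unfolding p_def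
    proof (rule cInf_greatest)
      show "S ?z \<noteq> {}" using S_norm[OF z(1)] by blast
      fix t assume "t \<in> S ?z"
      then have "pos (of_real (2 * t) \<odot> e \<ominus> (?z \<oplus> ?z))" unfolding S_def mem_Collect_eq z(2) .
      then have "pos (of_real (1 / 2) \<odot> (of_real (2 * t) \<odot> e \<ominus> (?z \<oplus> ?z)))" by (rule pos_smult) simp
      also have "of_real (1 / 2) \<odot> (of_real (2 * t) \<odot> e \<ominus> (?z \<oplus> ?z)) = of_real t \<odot> e \<ominus> ?z"
        using z(1) by (simp add: smult_minus smult_smult smult_1 flip: two_smult)
      finally show "cnorm A ?z \<le> t" using pos_le_cnorm pos_star_mult[OF x] by blast
    qed
    moreover have "p ?z \<le> cnorm A ?z" by (rule ple[OF S_norm z(1)]) (rule z(1))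
    ultimately have "f ?z = (cnorm A x)\<^sup>2" using fz cstar_identity[OF x] by simp
    then show ?thesis using fi[OF z] by (simp add: \<phi>_def)
  qed
  ultimately show ?thesis using that by blast
qed

end

section \<open>Contractivity of unital homomorphisms\<close>

lemma star_hom_uminus:
  assumes "cstar_algebra A" "cstar_algebra B" "star_hom A B f" "x \<in> carrier A"
  shows "f (\<ominus>\<^bsub>A\<^esub> x) = \<ominus>\<^bsub>B\<^esub> f x"
proof -
  interpret A: cstar_algebra A by fact
  interpret B: cstar_algebra B by fact
  have "\<ominus>\<^bsub>A\<^esub> x = (- 1) \<odot>\<^bsub>A\<^esub> x" using A.smult_minus_1[OF assms(4)] by (simp add: class_ring_simps)
  moreover have "\<ominus>\<^bsub>B\<^esub> f x = (- 1) \<odot>\<^bsub>B\<^esub> f x"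
    using B.smult_minus_1[OF star_homD(1)[OF assms(3,4)]] by (simp add: class_ring_simps)
  ultimately show ?thesis using star_homD(3)[OF assms(3,4)] by simp
qed

lemma star_hom_minus:
  assumes "cstar_algebra A" "cstar_algebra B" "star_hom A B f" "x \<in> carrier A" "y \<in> carrier A"
  shows "f (x \<ominus>\<^bsub>A\<^esub> y) = f x \<ominus>\<^bsub>B\<^esub> f y"
proof -
  interpret A: cstar_algebra A by fact
  show ?thesis
    using star_hom_uminus[OF assms(1-3,5)] star_homD(2)[OF assms(3,4), of "\<ominus>\<^bsub>A\<^esub> y"] assms(5)
    by (simp add: a_minus_def)
qed

text \<open>\<open>(cnorm A x)\<^sup>2 e - star A x \<otimes> x\<close> is a square of a
  self-adjoint element, hence so is its image, and \<open>pos_le_cnorm\<close> applies in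
  \<open>B\<close>.\<close>

theorem star_hom_contractive:
  assumes "ucstar A e" "ucstar B e'" "star_hom A B f" "f e = e'" and x: "x \<in> carrier A"
  shows "cnorm B (f x) \<le> cnorm A x"
proof -
  interpret A: ucstar A e by fact
  interpret B: ucstar B e' by fact
  note f = star_homD[OF assms(3)]
  note [simp] = f(1)
  let ?z = "star A x \<otimes>\<^bsub>A\<^esub> x" and ?t = "of_real ((cnorm A x)\<^sup>2) :: complex"
  have z: "?z \<in> carrier A" "star A ?z = ?z" using x by (simp_all add: A.star_mult A.star_star)
  have "A.pos (?t \<odot>\<^bsub>A\<^esub> e \<ominus>\<^bsub>A\<^esub> ?z)" by (rule A.pos_diff[OF z]) (simp add: A.cstar_identity[OF x])
  then obtain k where k: "A.pos k" "k \<otimes>\<^bsub>A\<^esub> k = ?t \<odot>\<^bsub>A\<^esub> e \<ominus>\<^bsub>A\<^esub> ?z" by (rule A.ex_sqrt) (rule that)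
  have kc: "k \<in> carrier A" "star A k = k" using A.posD[OF k(1)] by blast+
  have "B.pos (f k \<otimes>\<^bsub>B\<^esub> f k)"
    using B.pos_square[of "f k"] f(5)[OF kc(1)] kc by simp
  also have "f k \<otimes>\<^bsub>B\<^esub> f k = f (k \<otimes>\<^bsub>A\<^esub> k)" using f(4)[OF kc(1) kc(1)] by simp
  also have "\<dots> = ?t \<odot>\<^bsub>B\<^esub> e' \<ominus>\<^bsub>B\<^esub> (star B (f x) \<otimes>\<^bsub>B\<^esub> f x)"
    using star_hom_minus[OF A.cstar_algebra_axioms B.cstar_algebra_axioms assms(3), of "?t \<odot>\<^bsub>A\<^esub> e" ?z] x z
    unfolding k(2) by (simp add: f(3,4,5) assms(4))
  finally have "cnorm B (star B (f x) \<otimes>\<^bsub>B\<^esub> f x) \<le> (cnorm A x)\<^sup>2"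
    using B.pos_le_cnorm B.pos_star_mult[of "f x"] x by (metis f(1))
  then have "(cnorm B (f x))\<^sup>2 \<le> (cnorm A x)\<^sup>2" using B.cstar_identity[of "f x"] x by simp
  then show ?thesis by (rule power2_le_imp_le) (rule A.cnorm_nonneg[OF x])
qed

section \<open>Matrix algebras\<close>

definition ip :: "complex vec \<Rightarrow> complex vec \<Rightarrow> complex" where
  "ip u v = (\<Sum>i<dim_vec u. cnj (u $ i) * v $ i)"

lemma ip_add_right: "u \<in> carrier_vec n \<Longrightarrow> v \<in> carrier_vec n \<Longrightarrow> w \<in> carrier_vec n \<Longrightarrow> ip u (v + w) = ip u v + ip u w"
  unfolding ip_def by (auto simp: distrib_left distrib_right sum.distrib)

lemma ip_add_left: "u \<in> carrier_vec n \<Longrightarrow> v \<in> carrier_vec n \<Longrightarrow> w \<in> carrier_vec n \<Longrightarrow> ip (u + v) w = ip u w + ip v w"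
  unfolding ip_def by (auto simp: distrib_left distrib_right sum.distrib)

lemma ip_minus_right: "u \<in> carrier_vec n \<Longrightarrow> v \<in> carrier_vec n \<Longrightarrow> w \<in> carrier_vec n \<Longrightarrow> ip u (v - w) = ip u v - ip u w"
  unfolding ip_def by (auto simp: left_diff_distrib right_diff_distrib sum_subtractf)

lemma ip_minus_left: "u \<in> carrier_vec n \<Longrightarrow> v \<in> carrier_vec n \<Longrightarrow> w \<in> carrier_vec n \<Longrightarrow> ip (u - v) w = ip u w - ip v w"
  unfolding ip_def by (auto simp: left_diff_distrib right_diff_distrib sum_subtractf)

lemma ip_smult_right: "u \<in> carrier_vec n \<Longrightarrow> v \<in> carrier_vec n \<Longrightarrow> ip u (c \<cdot>\<^sub>v v) = c * ip u v"
  unfolding ip_def by (auto simp: mult_ac sum_distrib_left)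

lemma ip_smult_left: "u \<in> carrier_vec n \<Longrightarrow> v \<in> carrier_vec n \<Longrightarrow> ip (c \<cdot>\<^sub>v u) v = cnj c * ip u v"
  unfolding ip_def by (auto simp: mult_ac sum_distrib_left)

lemma ip_commute: "u \<in> carrier_vec n \<Longrightarrow> v \<in> carrier_vec n \<Longrightarrow> ip v u = cnj (ip u v)"
  unfolding ip_def by (auto simp: mult.commute)

lemma vec_l2_L2: "vec_l2 v = L2_set (\<lambda>i. cmod (v $ i)) {..<dim_vec v}"
  by (simp add: vec_l2_def L2_set_def)

lemma ip_self: "ip v v = of_real ((vec_l2 v)\<^sup>2)"
proof -
  have "(vec_l2 v)\<^sup>2 = (\<Sum>i<dim_vec v. (cmod (v $ i))\<^sup>2)"
    by (simp add: vec_l2_def sum_nonneg)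
  then show ?thesis unfolding ip_def
    by (simp add: mult.commute[of "cnj _"] flip: complex_norm_square)
qed

lemma vec_l2_nonneg [simp]: "0 \<le> vec_l2 v"
  by (simp add: vec_l2_def sum_nonneg)

lemma cauchy_schwarz_ip:
  assumes "u \<in> carrier_vec n" "v \<in> carrier_vec n"
  shows "cmod (ip u v) \<le> vec_l2 u * vec_l2 v"
proof -
  have "cmod (ip u v) \<le> (\<Sum>i<n. \<bar>cmod (u $ i)\<bar> * \<bar>cmod (v $ i)\<bar>)"
    unfolding ip_def using assms by (auto simp: norm_mult intro!: order_trans[OF norm_sum] sum_mono)
  also have "\<dots> \<le> vec_l2 u * vec_l2 v"
    using L2_set_mult_ineq[of "\<lambda>i. cmod (u $ i)" "\<lambda>i. cmod (v $ i)" "{..<n}"] assms by (simp add: vec_l2_L2)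
  finally show ?thesis .
qed

lemma vec_l2_triangle:
  assumes "u \<in> carrier_vec n" "v \<in> carrier_vec n"
  shows "vec_l2 (u + v) \<le> vec_l2 u + vec_l2 v"
proof -
  have "vec_l2 (u + v) \<le> L2_set (\<lambda>i. cmod (u $ i) + cmod (v $ i)) {..<n}"
    using assms by (auto simp: vec_l2_L2 intro!: L2_set_mono norm_triangle_ineq)
  also have "\<dots> \<le> vec_l2 u + vec_l2 v"
    using L2_set_triangle_ineq[of "\<lambda>i. cmod (u $ i)" "\<lambda>i. cmod (v $ i)" "{..<n}"] assms by (simp add: vec_l2_L2)
  finally show ?thesis .
qed

lemma vec_l2_smult: "vec_l2 (c \<cdot>\<^sub>v v) = cmod c * vec_l2 v"
proof -
  have "vec_l2 (c \<cdot>\<^sub>v v) = L2_set (\<lambda>i. cmod c * cmod (v $ i)) {..<dim_vec v}"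
    by (auto simp: vec_l2_L2 norm_mult intro!: L2_set_cong)
  then show ?thesis by (simp add: vec_l2_L2 L2_set_right_distrib)
qed

lemma vec_l2_zero: "vec_l2 (0\<^sub>v n) = 0"
  by (simp add: vec_l2_def)

lemma vec_l2_eq_0: "v \<in> carrier_vec n \<Longrightarrow> vec_l2 v = 0 \<longleftrightarrow> v = 0\<^sub>v n"
  by (auto simp: vec_l2_L2 L2_set_eq_0_iff)

lemma vec_l2_minus_commute: "u \<in> carrier_vec n \<Longrightarrow> v \<in> carrier_vec n \<Longrightarrow> vec_l2 (u - v) = vec_l2 (v - u)"
  by (auto simp: vec_l2_L2 norm_minus_commute intro!: L2_set_cong)

lemma vec_l2_minus_triangle:
  assumes "u \<in> carrier_vec n" "v \<in> carrier_vec n" "w \<in> carrier_vec n"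
  shows "vec_l2 (u - w) \<le> vec_l2 (u - v) + vec_l2 (v - w)"
proof -
  have "u - w = (u - v) + (v - w)" using assms by auto
  then show ?thesis using vec_l2_triangle[of "u - v" n "v - w"] assms by simp
qed

lemma vec_l2_le_add_diff:
  assumes "u \<in> carrier_vec n" "v \<in> carrier_vec n"
  shows "vec_l2 u \<le> vec_l2 v + vec_l2 (u - v)"
proof -
  have "u = v + (u - v)" using assms by auto
  then show ?thesis using vec_l2_triangle[of v n "u - v"] assms by simp
qed

lemma vec_l2_power2_le:
  assumes "0 \<le> a" "(vec_l2 v)\<^sup>2 \<le> a * vec_l2 v"
  shows "vec_l2 v \<le> a"
proof (cases "vec_l2 v = 0")
  case False
  then have "0 < vec_l2 v" using vec_l2_nonneg[of v] by linarith
  then show ?thesis using assms(2) mult_right_le_imp_le[of "vec_l2 v" "vec_l2 v" a] by (simp add: power2_eq_square)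
qed (use assms in simp)

lemma vec_l2_unit: "i < n \<Longrightarrow> vec_l2 (unit_vec n i) = 1"
proof -
  assume i: "i < n"
  have "(\<Sum>j<n. (cmod (unit_vec n i $ j :: complex))\<^sup>2) = (\<Sum>j<n. of_bool (j = i))"
    using i by (intro sum.cong[OF refl]) simp
  also have "\<dots> = (1::real)" using i by (simp add: of_bool_def)
  finally show ?thesis unfolding vec_l2_def index_unit_vec(3) by (simp only: real_sqrt_one)
qed

section \<open>Adjoint matrices\<close>

lemma mat_adjoint_dim [simp]: "dim_row (mat_adjoint M) = dim_col M" "dim_col (mat_adjoint M) = dim_row M"
  by (simp_all add: mat_adjoint_def)

lemma mat_adjoint_carrier [simp]: "M \<in> carrier_mat m n \<Longrightarrow> mat_adjoint M \<in> carrier_mat n m"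
  by (rule carrier_matI) auto

lemma mat_adjoint_index [simp]:
  "i < dim_col M \<Longrightarrow> j < dim_row M \<Longrightarrow> mat_adjoint M $$ (i, j) = cnj (M $$ (j, i))" for M :: "complex mat"
  by (simp add: mat_adjoint_def mat_of_rows_index)

lemma mat_adjoint_adjoint: "mat_adjoint (mat_adjoint M) = M" for M :: "complex mat"
  by (rule eq_matI) auto

lemma mat_adjoint_add: "M \<in> carrier_mat m n \<Longrightarrow> N \<in> carrier_mat m n \<Longrightarrow> mat_adjoint (M + N) = mat_adjoint M + mat_adjoint N"
  for M :: "complex mat"
  by (rule eq_matI) auto

lemma mat_adjoint_smult: "mat_adjoint (c \<cdot>\<^sub>m M) = cnj c \<cdot>\<^sub>m mat_adjoint M" for M :: "complex mat"
  by (rule eq_matI) auto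

lemma mat_adjoint_mult:
  "M \<in> carrier_mat m n \<Longrightarrow> N \<in> carrier_mat n k \<Longrightarrow> mat_adjoint (M * N) = mat_adjoint N * mat_adjoint M" for M :: "complex mat"
proof (rule eq_matI)
  assume M: "M \<in> carrier_mat m n" and N: "N \<in> carrier_mat n k"
  fix i j assume "i < dim_row (mat_adjoint N * mat_adjoint M)" "j < dim_col (mat_adjoint N * mat_adjoint M)"
  then have ij: "i < k" "j < m" using M N by auto
  have "mat_adjoint (M * N) $$ (i, j) = (\<Sum>l = 0..<n. cnj (M $$ (j, l)) * cnj (N $$ (l, i)))"
    using M N ij by (simp add: scalar_prod_def)
  also have "\<dots> = (\<Sum>l = 0..<n. cnj (N $$ (l, i)) * cnj (M $$ (j, l)))"
    by (intro sum.cong refl mult.commute)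
  also have "\<dots> = (mat_adjoint N * mat_adjoint M) $$ (i, j)"
    using M N ij by (simp add: scalar_prod_def)
  finally show "mat_adjoint (M * N) $$ (i, j) = (mat_adjoint N * mat_adjoint M) $$ (i, j)" .
qed auto

lemma ip_adjoint:
  assumes "M \<in> carrier_mat m n" "u \<in> carrier_vec m" "v \<in> carrier_vec n"
  shows "ip (mat_adjoint M *\<^sub>v u) v = ip u (M *\<^sub>v v)"
proof -
  have "ip (mat_adjoint M *\<^sub>v u) v = (\<Sum>i<n. \<Sum>j<m. M $$ (j, i) * cnj (u $ j) * v $ i)"
    using assms by (auto simp: ip_def scalar_prod_def sum_distrib_right lessThan_atLeast0)
  also have "\<dots> = (\<Sum>j<m. \<Sum>i<n. M $$ (j, i) * cnj (u $ j) * v $ i)" by (rule sum.swap)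
  also have "\<dots> = ip u (M *\<^sub>v v)"
    using assms by (auto simp: ip_def scalar_prod_def sum_distrib_left lessThan_atLeast0 mult_ac)
  finally show ?thesis .
qed

lemma ip_adjoint':
  assumes "M \<in> carrier_mat m n" "u \<in> carrier_vec n" "v \<in> carrier_vec m"
  shows "ip u (mat_adjoint M *\<^sub>v v) = ip (M *\<^sub>v u) v"
  using ip_adjoint[OF mat_adjoint_carrier[OF assms(1)] assms(2,3)] by (simp add: mat_adjoint_adjoint)

lemma mat_mult_unit_vec:
  fixes M :: "complex mat"
  assumes M: "M \<in> carrier_mat m n" and j: "j < n"
  shows "M *\<^sub>v unit_vec n j = col M j"
proof (rule eq_vecI)
  fix i assume "i < dim_vec (col M j)"
  then show "(M *\<^sub>v unit_vec n j) $ i = col M j $ i" using M j by simp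
qed (use M in simp)

lemma mat_eqI_vec:
  fixes M N :: "complex mat"
  assumes "M \<in> carrier_mat m n" "N \<in> carrier_mat m n" "\<And>v. v \<in> carrier_vec n \<Longrightarrow> M *\<^sub>v v = N *\<^sub>v v"
  shows "M = N"
proof (rule mat_col_eqI)
  fix i assume "i < dim_col N"
  then have "M *\<^sub>v unit_vec n i = col M i" "N *\<^sub>v unit_vec n i = col N i"
    using mat_mult_unit_vec assms(1,2) by auto
  then show "col M i = col N i" using assms(3)[of "unit_vec n i"] by simp
qed (use assms in auto)

section \<open>Operator norm\<close>

text \<open>A crude majorant of the operator norm. It bounds the set whose supremum is
  \<open>mat_opnorm\<close>, and it turns entrywise convergence into convergence in norm.\<close>

definition entry_sum :: "complex mat \<Rightarrow> real" where
  "entry_sum M = (\<Sum>i<dim_row M. \<Sum>j<dim_col M. cmod (M $$ (i, j)))"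

lemma vec_l2_le_sum: "vec_l2 v \<le> (\<Sum>i<dim_vec v. cmod (v $ i))"
  by (simp add: vec_l2_L2 L2_set_le_sum)

lemma cmod_le_vec_l2: "i < dim_vec v \<Longrightarrow> cmod (v $ i) \<le> vec_l2 v"
  using member_le_L2_set[of "{..<dim_vec v}" i "\<lambda>i. cmod (v $ i)"] by (simp add: vec_l2_L2)

lemma vec_l2_entry_sum:
  assumes "M \<in> carrier_mat m n" "v \<in> carrier_vec n"
  shows "vec_l2 (M *\<^sub>v v) \<le> entry_sum M * vec_l2 v"
proof -
  have "vec_l2 (M *\<^sub>v v) \<le> (\<Sum>i<m. cmod ((M *\<^sub>v v) $ i))" using vec_l2_le_sum[of "M *\<^sub>v v"] assms by simp
  also have "\<dots> \<le> (\<Sum>i<m. \<Sum>j<n. cmod (M $$ (i, j)) * vec_l2 v)"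
  proof (rule sum_mono)
    fix i assume "i \<in> {..<m}"
    then have "(M *\<^sub>v v) $ i = (\<Sum>j<n. M $$ (i, j) * v $ j)"
      using assms by (auto simp: scalar_prod_def lessThan_atLeast0)
    then show "cmod ((M *\<^sub>v v) $ i) \<le> (\<Sum>j<n. cmod (M $$ (i, j)) * vec_l2 v)"
      using assms cmod_le_vec_l2[of _ v]
      by (auto simp: norm_mult intro!: order_trans[OF norm_sum] sum_mono mult_left_mono)
  qed
  also have "\<dots> = entry_sum M * vec_l2 v" using assms by (simp add: entry_sum_def sum_distrib_right)
  finally show ?thesis .
qed

lemma entry_sum_nonneg: "0 \<le> entry_sum M"
  by (simp add: entry_sum_def sum_nonneg)

lemma opnorm_bdd:
  assumes "M \<in> carrier_mat m n"
  shows "bdd_above {vec_l2 (M *\<^sub>v v) |v. v \<in> carrier_vec (dim_col M) \<and> vec_l2 v \<le> 1}"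
proof (rule bdd_aboveI)
  fix x assume "x \<in> {vec_l2 (M *\<^sub>v v) |v. v \<in> carrier_vec (dim_col M) \<and> vec_l2 v \<le> 1}"
  then obtain v where v: "x = vec_l2 (M *\<^sub>v v)" "v \<in> carrier_vec n" "vec_l2 v \<le> 1" using assms by auto
  have "x \<le> entry_sum M * vec_l2 v" unfolding v(1) by (rule vec_l2_entry_sum[OF assms v(2)])
  also have "\<dots> \<le> entry_sum M" using v(3) entry_sum_nonneg by (simp add: mult_left_le)
  finally show "x \<le> entry_sum M" .
qed

lemma opnorm_bound:
  assumes M: "M \<in> carrier_mat m n" and v: "v \<in> carrier_vec n"
  shows "vec_l2 (M *\<^sub>v v) \<le> mat_opnorm M * vec_l2 v"
proof (cases "vec_l2 v = 0")
  case True
  then have "v = 0\<^sub>v n" using v by (simp add: vec_l2_eq_0)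
  then have "M *\<^sub>v v = 0\<^sub>v m" using M by (intro eq_vecI) (auto simp: scalar_prod_def)
  then show ?thesis using True by (simp add: vec_l2_zero)
next
  case False
  let ?c = "complex_of_real (1 / vec_l2 v)"
  have n: "vec_l2 (?c \<cdot>\<^sub>v v) \<le> 1" using False by (simp add: vec_l2_smult norm_divide)
  have "vec_l2 (M *\<^sub>v (?c \<cdot>\<^sub>v v)) \<le> mat_opnorm M"
    unfolding mat_opnorm_def by (rule cSup_upper[OF _ opnorm_bdd[OF M]]) (use M v n in \<open>auto intro!: exI[of _ "?c \<cdot>\<^sub>v v"]\<close>)
  moreover have "M *\<^sub>v (?c \<cdot>\<^sub>v v) = ?c \<cdot>\<^sub>v (M *\<^sub>v v)" by (rule mult_mat_vec[OF M v])
  ultimately have "vec_l2 (M *\<^sub>v v) / vec_l2 v \<le> mat_opnorm M" by (simp add: vec_l2_smult norm_divide)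
  then show ?thesis using False by (simp add: field_simps less_le)
qed

lemma opnorm_le:
  assumes M: "M \<in> carrier_mat m n" and c: "0 \<le> c" and le: "\<And>v. v \<in> carrier_vec n \<Longrightarrow> vec_l2 (M *\<^sub>v v) \<le> c * vec_l2 v"
  shows "mat_opnorm M \<le> c"
  unfolding mat_opnorm_def
proof (rule cSup_least)
  have "0\<^sub>v n \<in> carrier_vec (dim_col M)" "vec_l2 (0\<^sub>v n) \<le> 1" using M by (simp_all add: vec_l2_zero)
  then show "{vec_l2 (M *\<^sub>v v) |v. v \<in> carrier_vec (dim_col M) \<and> vec_l2 v \<le> 1} \<noteq> {}" by blast
  fix x assume "x \<in> {vec_l2 (M *\<^sub>v v) |v. v \<in> carrier_vec (dim_col M) \<and> vec_l2 v \<le> 1}"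
  then obtain v where v: "x = vec_l2 (M *\<^sub>v v)" "v \<in> carrier_vec n" "vec_l2 v \<le> 1" using M by auto
  have "x \<le> c * vec_l2 v" unfolding v(1) by (rule le[OF v(2)])
  also have "\<dots> \<le> c" using v(3) c by (simp add: mult_left_le)
  finally show "x \<le> c" .
qed

lemma opnorm_nonneg:
  assumes M: "M \<in> carrier_mat m n"
  shows "0 \<le> mat_opnorm M"
proof -
  have z: "0\<^sub>v n \<in> carrier_vec (dim_col M)" "vec_l2 (0\<^sub>v n) \<le> 1" using M by (simp_all add: vec_l2_zero)
  have "vec_l2 (M *\<^sub>v 0\<^sub>v n) \<le> mat_opnorm M"
    unfolding mat_opnorm_def by (rule cSup_upper[OF _ opnorm_bdd[OF M]]) (use z in \<open>auto intro!: exI[of _ "0\<^sub>v n"]\<close>)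
  then show ?thesis using vec_l2_nonneg order_trans by blast
qed

lemma opnorm_le_entry_sum: "M \<in> carrier_mat m n \<Longrightarrow> mat_opnorm M \<le> entry_sum M"
  by (rule opnorm_le[OF _ entry_sum_nonneg vec_l2_entry_sum])

lemma cmod_entry_le_opnorm:
  assumes M: "M \<in> carrier_mat m n" and "i < m" "j < n"
  shows "cmod (M $$ (i, j)) \<le> mat_opnorm M"
proof -
  have "M $$ (i, j) = (M *\<^sub>v unit_vec n j) $ i" using assms by (subst mat_mult_unit_vec[OF M]) auto
  also have "cmod \<dots> \<le> vec_l2 (M *\<^sub>v unit_vec n j)" using assms by (intro cmod_le_vec_l2) simp
  also have "\<dots> \<le> mat_opnorm M" using opnorm_bound[OF M, of "unit_vec n j"] assms by (simp add: vec_l2_unit)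
  finally show ?thesis .
qed

lemma opnorm_eq_0:
  assumes M: "M \<in> carrier_mat m n"
  shows "mat_opnorm M = 0 \<longleftrightarrow> M = 0\<^sub>m m n"
proof
  assume "mat_opnorm M = 0"
  then show "M = 0\<^sub>m m n" using cmod_entry_le_opnorm[OF M] M by (intro eq_matI) auto
next
  assume "M = 0\<^sub>m m n"
  then have "entry_sum M = 0" by (simp add: entry_sum_def)
  then show "mat_opnorm M = 0" using opnorm_le_entry_sum[OF M] opnorm_nonneg[OF M] by simp
qed

lemma opnorm_triangle:
  assumes "M \<in> carrier_mat m n" "N \<in> carrier_mat m n"
  shows "mat_opnorm (M + N) \<le> mat_opnorm M + mat_opnorm N"
proof (rule opnorm_le[of _ m n])
  fix v :: "complex vec" assume v: "v \<in> carrier_vec n"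
  have "vec_l2 ((M + N) *\<^sub>v v) = vec_l2 (M *\<^sub>v v + N *\<^sub>v v)" using assms v by (simp add: add_mult_distrib_mat_vec)
  also have "\<dots> \<le> vec_l2 (M *\<^sub>v v) + vec_l2 (N *\<^sub>v v)" using assms v by (intro vec_l2_triangle[of _ m]) auto
  also have "\<dots> \<le> (mat_opnorm M + mat_opnorm N) * vec_l2 v"
    using opnorm_bound[OF assms(1) v] opnorm_bound[OF assms(2) v] by (simp add: distrib_right)
  finally show "vec_l2 ((M + N) *\<^sub>v v) \<le> (mat_opnorm M + mat_opnorm N) * vec_l2 v" .
qed (use assms opnorm_nonneg in auto)

lemma smult_mat_vec: "M \<in> carrier_mat m n \<Longrightarrow> v \<in> carrier_vec n \<Longrightarrow> (c \<cdot>\<^sub>m M) *\<^sub>v v = c \<cdot>\<^sub>v (M *\<^sub>v v)" for M :: "complex mat"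
  by (rule eq_vecI) (auto simp: scalar_prod_def sum_distrib_left mult.assoc)

lemma opnorm_smult:
  assumes "M \<in> carrier_mat m n"
  shows "mat_opnorm (c \<cdot>\<^sub>m M) = cmod c * mat_opnorm M"
proof -
  have le: "mat_opnorm (c \<cdot>\<^sub>m M) \<le> cmod c * mat_opnorm M" if M: "M \<in> carrier_mat m n" for c M
  proof (rule opnorm_le[of _ m n])
    fix v :: "complex vec" assume v: "v \<in> carrier_vec n"
    show "vec_l2 ((c \<cdot>\<^sub>m M) *\<^sub>v v) \<le> cmod c * mat_opnorm M * vec_l2 v"
      using opnorm_bound[OF M v] M v by (simp add: smult_mat_vec vec_l2_smult mult.assoc mult_left_mono)
  qed (use M opnorm_nonneg in auto)
  show ?thesis
  proof (cases "c = 0")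
    case True
    then have "c \<cdot>\<^sub>m M = 0\<^sub>m m n" using assms by (intro eq_matI) auto
    then show ?thesis using True opnorm_eq_0[of "0\<^sub>m m n" m n] by simp
  next
    case False
    have "(1 / c) \<cdot>\<^sub>m (c \<cdot>\<^sub>m M) = M" using False by (intro eq_matI) auto
    then have "mat_opnorm M \<le> cmod (1 / c) * mat_opnorm (c \<cdot>\<^sub>m M)" using le[of "c \<cdot>\<^sub>m M" "1 / c"] assms by simp
    then show ?thesis using le[OF assms, of c] False by (simp add: norm_divide field_simps)
  qed
qed

lemma opnorm_mult:
  assumes M: "M \<in> carrier_mat m n" and N: "N \<in> carrier_mat n k"
  shows "mat_opnorm (M * N) \<le> mat_opnorm M * mat_opnorm N"
proof (rule opnorm_le[of _ m k])
  fix v :: "complex vec" assume v: "v \<in> carrier_vec k"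
  have "vec_l2 ((M * N) *\<^sub>v v) = vec_l2 (M *\<^sub>v (N *\<^sub>v v))" using assms v by (simp add: assoc_mult_mat_vec[of _ m n _ k])
  also have "\<dots> \<le> mat_opnorm M * vec_l2 (N *\<^sub>v v)" using opnorm_bound[OF M, of "N *\<^sub>v v"] N v by simp
  also have "\<dots> \<le> mat_opnorm M * (mat_opnorm N * vec_l2 v)"
    using opnorm_bound[OF N v] opnorm_nonneg[OF M] by (rule mult_left_mono)
  finally show "vec_l2 ((M * N) *\<^sub>v v) \<le> mat_opnorm M * mat_opnorm N * vec_l2 v" by (simp add: mult.assoc)
qed (use assms opnorm_nonneg[OF M] opnorm_nonneg[OF N] in auto)

text \<open>With \<open>w\<close> the image of \<open>v\<close> under the adjoint,
  \<open>ip w w = ip v (M w)\<close>; Cauchy-Schwarz then lets one factor \<open>vec_l2 w\<close>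
  cancel.\<close>

lemma opnorm_adjoint:
  assumes M: "M \<in> carrier_mat m n"
  shows "mat_opnorm (mat_adjoint M) \<le> mat_opnorm M"
proof (rule opnorm_le[OF mat_adjoint_carrier[OF M] opnorm_nonneg[OF M]])
  note Ms = mat_adjoint_carrier[OF M]
  fix v :: "complex vec" assume v: "v \<in> carrier_vec m"
  let ?w = "mat_adjoint M *\<^sub>v v"
  have w: "?w \<in> carrier_vec n" using mult_mat_vec_carrier[OF Ms v] .
  have "(vec_l2 ?w)\<^sup>2 = Re (ip v (M *\<^sub>v ?w))"
    using ip_adjoint[OF M v w] ip_self[of ?w] by (metis Re_complex_of_real)
  also have "\<dots> \<le> vec_l2 v * vec_l2 (M *\<^sub>v ?w)"
    using cauchy_schwarz_ip[of v m "M *\<^sub>v ?w"] v w M complex_Re_le_cmod order_trans by fastforce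
  also have "\<dots> \<le> vec_l2 v * (mat_opnorm M * vec_l2 ?w)" using opnorm_bound[OF M w] by (rule mult_left_mono) simp
  finally show "vec_l2 ?w \<le> mat_opnorm M * vec_l2 v"
    using opnorm_nonneg[OF M] by (intro vec_l2_power2_le) (auto simp: mult_ac)
qed

text \<open>The direction beyond submultiplicativity writes the squared norm of \<open>M v\<close>
  as an inner product of \<open>v\<close> with \<open>mat_adjoint M * M\<close> applied to
  \<open>v\<close> and uses Cauchy-Schwarz.\<close>

lemma opnorm_adjoint_mult:
  assumes M: "M \<in> carrier_mat m n"
  shows "mat_opnorm (mat_adjoint M * M) = (mat_opnorm M)\<^sup>2"
proof -
  note Ms = mat_adjoint_carrier[OF M]
  have MM: "mat_adjoint M * M \<in> carrier_mat n n" using M Ms by auto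
  have "mat_opnorm (mat_adjoint M * M) \<le> mat_opnorm M * mat_opnorm M"
    using opnorm_mult[OF Ms M] mult_right_mono[OF opnorm_adjoint[OF M] opnorm_nonneg[OF M]] by linarith
  moreover have "mat_opnorm M \<le> sqrt (mat_opnorm (mat_adjoint M * M))"
  proof (rule opnorm_le[OF M])
    fix v :: "complex vec" assume v: "v \<in> carrier_vec n"
    have Mv: "M *\<^sub>v v \<in> carrier_vec m" using M v by auto
    have "(vec_l2 (M *\<^sub>v v))\<^sup>2 = Re (ip v (mat_adjoint M *\<^sub>v (M *\<^sub>v v)))"
      using ip_adjoint'[OF M v Mv] ip_self[of "M *\<^sub>v v"] by simp
    also have "mat_adjoint M *\<^sub>v (M *\<^sub>v v) = (mat_adjoint M * M) *\<^sub>v v"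
      using M v Ms by (simp add: assoc_mult_mat_vec[of _ n m _ n])
    also have "Re (ip v ((mat_adjoint M * M) *\<^sub>v v)) \<le> vec_l2 v * vec_l2 ((mat_adjoint M * M) *\<^sub>v v)"
      using cauchy_schwarz_ip[of v n "(mat_adjoint M * M) *\<^sub>v v"] v MM complex_Re_le_cmod order_trans by fastforce
    also have "\<dots> \<le> vec_l2 v * (mat_opnorm (mat_adjoint M * M) * vec_l2 v)"
      using opnorm_bound[OF MM v] by (rule mult_left_mono) simp
    also have "\<dots> = (sqrt (mat_opnorm (mat_adjoint M * M)) * vec_l2 v)\<^sup>2"
      using opnorm_nonneg[OF MM] by (simp add: power_mult_distrib power2_eq_square)
    finally show "vec_l2 (M *\<^sub>v v) \<le> sqrt (mat_opnorm (mat_adjoint M * M)) * vec_l2 v"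
      by (rule power2_le_imp_le) (simp add: opnorm_nonneg[OF MM])
  qed (simp add: opnorm_nonneg[OF MM])
  then have "(mat_opnorm M)\<^sup>2 \<le> mat_opnorm (mat_adjoint M * M)"
    using opnorm_nonneg[OF M] opnorm_nonneg[OF MM] real_le_rsqrt real_sqrt_le_iff
    by (metis real_sqrt_pow2 power_mono)
  ultimately show ?thesis by (simp add: power2_eq_square)
qed

section \<open>The C*-algebra of square matrices\<close>

lemma mat_cstar_simps [simp]:
  "carrier (mat_cstar k) = carrier_mat k k" "mult (mat_cstar k) = (*)" "one (mat_cstar k) = 1\<^sub>m k"
  "zero (mat_cstar k) = 0\<^sub>m k k" "add (mat_cstar k) = (+)" "smult (mat_cstar k) = (\<cdot>\<^sub>m)"
  "star (mat_cstar k) = mat_adjoint" "cnorm (mat_cstar k) = mat_opnorm"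
  by (simp_all add: mat_cstar_def)

lemma vectorspace_mat_cstar: "vectorspace (class_ring :: complex ring) (mat_cstar k)"
  unfolding vectorspace_def
proof (intro conjI class_field moduleI)
  show "abelian_group (mat_cstar k)"
  proof (rule abelian_groupI)
    fix x assume x: "x \<in> carrier (mat_cstar k)"
    then have "- x + x = 0\<^sub>m k k" "- x \<in> carrier_mat k k" by auto
    then show "\<exists>y\<in>carrier (mat_cstar k). y \<oplus>\<^bsub>mat_cstar k\<^esub> x = \<zero>\<^bsub>mat_cstar k\<^esub>"
      by (intro bexI[of _ "- x"]) simp_all
  qed (auto simp: comm_add_mat[of _ k k])
  show "cring (class_ring :: complex ring)" by (rule domain.axioms(1)[OF field.axioms(1)[OF class_field]])
qed (auto simp: algebra_simps intro!: eq_matI)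

lemma minus_mat_cstar:
  assumes "x \<in> carrier_mat k k" "y \<in> carrier_mat k k"
  shows "x \<ominus>\<^bsub>mat_cstar k\<^esub> y = x - y"
proof -
  interpret vectorspace "class_ring :: complex ring" "mat_cstar k" by (rule vectorspace_mat_cstar)
  have "\<ominus>\<^bsub>mat_cstar k\<^esub> y = (- 1) \<cdot>\<^sub>m y" using smult_minus_1[of y] assms by (simp add: class_ring_simps)
  then show ?thesis using assms by (auto simp: a_minus_def)
qed

lemma cdist_mat_cstar: "x \<in> carrier_mat k k \<Longrightarrow> y \<in> carrier_mat k k \<Longrightarrow> cdist (mat_cstar k) x y = mat_opnorm (x - y)"
  by (simp add: cdist_def minus_mat_cstar)

lemma Metric_space_mat_cstar: "Metric_space (carrier_mat k k) (cdist (mat_cstar k))"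
proof
  fix x y z :: "complex mat"
  show "0 \<le> cdist (mat_cstar k) x y"
    by (auto simp: cdist_def minus_mat_cstar intro!: opnorm_nonneg[of _ k k])
  show "cdist (mat_cstar k) x y = cdist (mat_cstar k) y x"
  proof (cases "x \<in> carrier_mat k k \<and> y \<in> carrier_mat k k")
    case True
    then have "x - y = (- 1) \<cdot>\<^sub>m (y - x)" by (intro eq_matI) auto
    then show ?thesis using True opnorm_smult[of "y - x" k k "- 1"] by (simp add: cdist_mat_cstar minus_carrier_mat)
  qed (auto simp: cdist_def)
  assume xy: "x \<in> carrier_mat k k" "y \<in> carrier_mat k k"
  have "x - y = 0\<^sub>m k k \<longleftrightarrow> x = y"
  proof
    assume 0: "x - y = 0\<^sub>m k k"
    show "x = y"
    proof (rule eq_matI)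
      fix i j assume "i < dim_row y" "j < dim_col y"
      then show "x $$ (i, j) = y $$ (i, j)" using arg_cong[OF 0, of "\<lambda>m. m $$ (i, j)"] xy by simp
    qed (use xy in auto)
  qed (use xy in auto)
  then show "cdist (mat_cstar k) x y = 0 \<longleftrightarrow> x = y"
    using xy opnorm_eq_0[of "x - y" k k] by (simp add: cdist_mat_cstar minus_carrier_mat)
  assume z: "z \<in> carrier_mat k k"
  have "x - z = (x - y) + (y - z)" using xy z by (intro eq_matI) auto
  then show "cdist (mat_cstar k) x z \<le> cdist (mat_cstar k) x y + cdist (mat_cstar k) y z"
    using opnorm_triangle[of "x - y" k k "y - z"] xy z by (simp add: cdist_mat_cstar minus_carrier_mat)
qed

text \<open>Entries are dominated by the operator norm, which gives entrywise limits;
  \<open>entry_sum\<close> turns these into a limit in norm.\<close>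

lemma complete_mat_cstar: "Metric_space.mcomplete (carrier_mat k k) (cdist (mat_cstar k))"
proof -
  interpret M: Metric_space "carrier_mat k k" "cdist (mat_cstar k)" by (rule Metric_space_mat_cstar)
  show ?thesis
    unfolding M.mcomplete_def
  proof (intro allI impI)
    fix s assume s: "M.MCauchy s"
    have sc: "s n \<in> carrier_mat k k" for n using s unfolding M.MCauchy_def by auto
    have "Cauchy (\<lambda>n. s n $$ (i, j))" if ij: "i < k" "j < k" for i j
    proof (rule metric_CauchyI)
      fix r :: real assume "r > 0"
      then obtain N where N: "\<And>m n. N \<le> m \<Longrightarrow> N \<le> n \<Longrightarrow> cdist (mat_cstar k) (s m) (s n) < r"
        using s unfolding M.MCauchy_def by blast
      have "dist (s m $$ (i, j)) (s n $$ (i, j)) < r" if "N \<le> m" "N \<le> n" for m n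
        using N[OF that] cmod_entry_le_opnorm[of "s m - s n" k k i j] sc[of m] sc[of n] ij
        by (simp add: cdist_mat_cstar dist_norm minus_carrier_mat)
      then show "\<exists>N. \<forall>m\<ge>N. \<forall>n\<ge>N. dist (s m $$ (i, j)) (s n $$ (i, j)) < r" by blast
    qed
    then have "\<forall>i j. \<exists>l. i < k \<longrightarrow> j < k \<longrightarrow> (\<lambda>n. s n $$ (i, j)) \<longlonglongrightarrow> l"
      unfolding Cauchy_convergent_iff convergent_def by blast
    then obtain l where l: "\<And>i j. i < k \<Longrightarrow> j < k \<Longrightarrow> (\<lambda>n. s n $$ (i, j)) \<longlonglongrightarrow> l i j" by metis
    define L where "L = mat k k (\<lambda>(i, j). l i j)"
    have Lc: "L \<in> carrier_mat k k" by (simp add: L_def)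
    have "(\<lambda>n. \<Sum>i<k. \<Sum>j<k. cmod (s n $$ (i, j) - l i j)) \<longlonglongrightarrow> (\<Sum>i<k. \<Sum>j<k. 0)"
      by (intro tendsto_sum tendsto_norm_zero LIM_zero l) auto
    moreover have "entry_sum (s n - L) = (\<Sum>i<k. \<Sum>j<k. cmod (s n $$ (i, j) - l i j))" for n
      using sc[of n] by (auto simp: entry_sum_def L_def intro!: sum.cong)
    ultimately have lim: "(\<lambda>n. entry_sum (s n - L)) \<longlonglongrightarrow> 0" by simp
    have "limitin M.mtopology s L sequentially"
      unfolding M.limit_metric_sequentially
    proof (intro conjI allI impI Lc)
      fix r :: real assume "r > 0"
      then obtain N where N: "\<And>n. n \<ge> N \<Longrightarrow> entry_sum (s n - L) < r"
        using order_tendstoD(2)[OF lim, of r] unfolding eventually_sequentially by blast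
      have "cdist (mat_cstar k) (s n) L < r" if "n \<ge> N" for n
        using N[OF that] opnorm_le_entry_sum[of "s n - L" k k] sc[of n] Lc
        by (simp add: cdist_mat_cstar minus_carrier_mat)
      then show "\<exists>N. \<forall>n\<ge>N. s n \<in> carrier_mat k k \<and> cdist (mat_cstar k) (s n) L < r" using sc by blast
    qed
    then show "\<exists>x. limitin M.mtopology s x sequentially" by blast
  qed
qed

theorem cstar_algebra_mat_cstar: "cstar_algebra (mat_cstar k)"
  by (intro cstar_algebra.intro vectorspace_mat_cstar cstar_algebra_axioms.intro)
     (auto simp: mat_adjoint_adjoint mat_adjoint_add[of _ k k] mat_adjoint_smult mat_adjoint_mult[of _ k k]
       add_mult_distrib_mat[of _ k k] mult_add_distrib_mat[of _ k k] mult_smult_assoc_mat mult_smult_distrib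
       opnorm_nonneg[of _ k k] opnorm_eq_0 opnorm_triangle[of _ k k] opnorm_smult[of _ k k] opnorm_mult[of _ k k]
       opnorm_adjoint_mult[of _ k k] complete_mat_cstar)

lemma ucstar_mat_cstar: "0 < k \<Longrightarrow> ucstar (mat_cstar k) (1\<^sub>m k)"
proof (intro ucstar.intro ucstar_axioms.intro cstar_algebra_mat_cstar)
  assume k: "0 < k"
  have "(1\<^sub>m k :: complex mat) $$ (0, 0) \<noteq> 0\<^sub>m k k $$ (0, 0)" using k by simp
  then show "1\<^sub>m k \<noteq> \<zero>\<^bsub>mat_cstar k\<^esub>" by auto
qed auto

section \<open>Finite-dimensional representations\<close>

context ucstar
begin

text \<open>Combinations of an enumerated family, so that the coefficients can be read off as a
  column of a matrix.\<close>

primrec lincomb_upto :: "(nat \<Rightarrow> complex) \<Rightarrow> (nat \<Rightarrow> 'a) \<Rightarrow> nat \<Rightarrow> 'a" where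
  "lincomb_upto c b 0 = \<zero>"
| "lincomb_upto c b (Suc q) = lincomb_upto c b q \<oplus> c q \<odot> b q"

lemma lincomb_upto_closed: "(\<And>t. t < q \<Longrightarrow> b t \<in> carrier A) \<Longrightarrow> lincomb_upto c b q \<in> carrier A"
  by (induction q) auto

end

section \<open>The GNS form and orthonormalization\<close>

locale ucstar_functional = ucstar +
  fixes \<phi> :: "'a \<Rightarrow> complex"
  assumes \<phi>: "positive_functional \<phi>"
begin

text \<open>The GNS inner product on the algebra itself. Null vectors are not divided out, so the
  form may be degenerate.\<close>

definition form :: "'a \<Rightarrow> 'a \<Rightarrow> complex" where "form y z = \<phi> (star A y \<otimes> z)"

lemma \<phi>_add: "x \<in> carrier A \<Longrightarrow> y \<in> carrier A \<Longrightarrow> \<phi> (x \<oplus> y) = \<phi> x + \<phi> y"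
  and \<phi>_smult: "x \<in> carrier A \<Longrightarrow> \<phi> (c \<odot> x) = c * \<phi> x"
  and \<phi>_star: "x \<in> carrier A \<Longrightarrow> \<phi> (star A x) = cnj (\<phi> x)"
  using \<phi> unfolding positive_functional_def by blast+

lemma form_add_right: "y \<in> carrier A \<Longrightarrow> z \<in> carrier A \<Longrightarrow> w \<in> carrier A \<Longrightarrow> form y (z \<oplus> w) = form y z + form y w"
  by (simp add: form_def distrib_left \<phi>_add)

lemma form_smult_right: "y \<in> carrier A \<Longrightarrow> z \<in> carrier A \<Longrightarrow> form y (c \<odot> z) = c * form y z"
  by (simp add: form_def smult_mult_right \<phi>_smult)

lemma form_commute: "y \<in> carrier A \<Longrightarrow> z \<in> carrier A \<Longrightarrow> form z y = cnj (form y z)"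
  by (simp add: form_def star_mult star_star flip: \<phi>_star)

lemma form_add_left: "y \<in> carrier A \<Longrightarrow> z \<in> carrier A \<Longrightarrow> w \<in> carrier A \<Longrightarrow> form (z \<oplus> w) y = form z y + form w y"
  using form_commute[of y "z \<oplus> w"] form_commute[of y z] form_commute[of y w] by (simp add: form_add_right)

lemma form_smult_left: "y \<in> carrier A \<Longrightarrow> z \<in> carrier A \<Longrightarrow> form (c \<odot> z) y = cnj c * form z y"
  using form_commute[of y "c \<odot> z"] form_commute[of y z] by (simp add: form_smult_right)

lemma form_uminus: "y \<in> carrier A \<Longrightarrow> z \<in> carrier A \<Longrightarrow> form y (\<ominus> z) = - form y z"
  "y \<in> carrier A \<Longrightarrow> z \<in> carrier A \<Longrightarrow> form (\<ominus> z) y = - form z y"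
  by (simp_all add: uminus_smult form_smult_right form_smult_left)

lemma form_minus_right: "y \<in> carrier A \<Longrightarrow> z \<in> carrier A \<Longrightarrow> w \<in> carrier A \<Longrightarrow> form y (z \<ominus> w) = form y z - form y w"
  by (simp add: R.minus_eq form_add_right form_uminus)

lemma form_zero_right: "y \<in> carrier A \<Longrightarrow> form y \<zero> = 0"
  using form_smult_right[of y e 0] by (simp add: smult_0)

lemma form_mult_left: "x \<in> carrier A \<Longrightarrow> y \<in> carrier A \<Longrightarrow> z \<in> carrier A \<Longrightarrow> form y (x \<otimes> z) = form (star A x \<otimes> y) z"
  by (simp add: form_def star_mult star_star mult_assoc)

lemma form_self: "y \<in> carrier A \<Longrightarrow> 0 \<le> Re (form y y)" "y \<in> carrier A \<Longrightarrow> form y y = of_real (Re (form y y))"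
proof -
  show "y \<in> carrier A \<Longrightarrow> 0 \<le> Re (form y y)" using \<phi> unfolding positive_functional_def form_def by blast
  show "y \<in> carrier A \<Longrightarrow> form y y = of_real (Re (form y y))"
    using form_commute[of y y] by (auto simp: complex_eq_iff)
qed

text \<open>Cauchy-Schwarz in the degenerate case: if \<open>form z u\<close> were nonzero, adding a
  large multiple of \<open>u\<close> to \<open>z\<close> would make the form negative.\<close>

lemma form_null:
  assumes u: "u \<in> carrier A" "form u u = 0" and z: "z \<in> carrier A"
  shows "form z u = 0"
proof (rule ccontr)
  assume nz: "form z u \<noteq> 0"
  define b where "b = (cmod (form z u))\<^sup>2"
  have b: "b > 0" using nz by (simp add: b_def)
  \<comment> \<open>It suffices that \<open>2 t b\<close> exceeds \<open>form z z\<close>; the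
    summand 1 takes care of \<open>form z z = 0\<close>.\<close>
  define t where "t = (Re (form z z) + 1) / b"
  let ?c = "- of_real t * cnj (form z u)"
  have "form (z \<oplus> ?c \<odot> u) (z \<oplus> ?c \<odot> u) = form z z + ?c * form z u + cnj ?c * form u z"
    using u z by (simp add: form_add_left form_add_right form_smult_left form_smult_right)
  also have "form u z = cnj (form z u)" by (rule form_commute[OF z u(1)])
  also have "?c * form z u = - of_real (t * b)"
    by (simp add: b_def complex_norm_square mult.commute mult.left_commute del: of_real_power)
  also have "cnj ?c * cnj (form z u) = - of_real (t * b)"
    by (simp add: b_def complex_norm_square mult.commute mult.left_commute del: of_real_power)
  finally have "Re (form (z \<oplus> ?c \<odot> u) (z \<oplus> ?c \<odot> u)) = Re (form z z) - 2 * (t * b)" by simp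
  then have "0 \<le> Re (form z z) - 2 * (t * b)" using form_self(1)[of "z \<oplus> ?c \<odot> u"] u z by simp
  moreover have "t * b = Re (form z z) + 1" using b by (simp add: t_def)
  ultimately show False using form_self(1)[OF z] by simp
qed

lemma form_lincomb:
  "y \<in> carrier A \<Longrightarrow> (\<And>t. t < q \<Longrightarrow> b t \<in> carrier A) \<Longrightarrow> form y (lincomb_upto c b q) = (\<Sum>t<q. c t * form y (b t))"
  by (induction q) (auto simp: form_zero_right form_add_right form_smult_right lincomb_upto_closed)

definition orthonormal :: "nat \<Rightarrow> (nat \<Rightarrow> 'a) \<Rightarrow> bool" where
  "orthonormal q b \<longleftrightarrow> (\<forall>s<q. b s \<in> carrier A) \<and> (\<forall>s<q. \<forall>t<q. form (b s) (b t) = of_bool (s = t))"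

text \<open>The Gram-Schmidt remainder. As the form may be degenerate, dependence on
  \<open>b\<close> shows only as a remainder of norm 0, not as a remainder that is
  \<open>\<zero>\<close>.\<close>

definition residue :: "nat \<Rightarrow> (nat \<Rightarrow> 'a) \<Rightarrow> 'a \<Rightarrow> 'a" where
  "residue q b x = x \<ominus> lincomb_upto (\<lambda>t. form (b t) x) b q"

lemma residue_closed: "orthonormal q b \<Longrightarrow> x \<in> carrier A \<Longrightarrow> residue q b x \<in> carrier A"
  by (simp add: residue_def orthonormal_def lincomb_upto_closed)

lemma form_residue:
  assumes "orthonormal q b" "x \<in> carrier A" "z \<in> carrier A"
  shows "form z (residue q b x) = form z x - (\<Sum>t<q. form z (b t) * form (b t) x)"
  using assms unfolding residue_def orthonormal_def
  by (simp add: form_minus_right form_lincomb lincomb_upto_closed mult.commute)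

lemma form_basis_residue:
  assumes o: "orthonormal q b" and x: "x \<in> carrier A" and s: "s < q"
  shows "form (b s) (residue q b x) = 0"
proof -
  have "(\<Sum>t<q. form (b s) (b t) * form (b t) x) = (\<Sum>t<q. of_bool (s = t) * form (b t) x)"
    using o s unfolding orthonormal_def by (intro sum.cong) auto
  also have "\<dots> = form (b s) x" using s by (simp add: of_bool_def if_distrib[of "\<lambda>z. z * _"] cong: if_cong)
  finally show ?thesis using form_residue[OF o x, of "b s"] o s unfolding orthonormal_def by simp
qed

lemma form_residue_self:
  assumes o: "orthonormal q b" and x: "x \<in> carrier A"
  shows "form (residue q b x) (residue q b x) = form x x - of_real (\<Sum>t<q. (cmod (form (b t) x))\<^sup>2)"
proof -
  note r = residue_closed[OF o x]
  have "form (residue q b x) (b t) = 0" if "t < q" for t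
    using form_basis_residue[OF o x that] form_commute[of "b t" "residue q b x"] o that r
    unfolding orthonormal_def by simp
  then have "form (residue q b x) (residue q b x) = form (residue q b x) x"
    using form_residue[OF o x r] by simp
  also have "\<dots> = cnj (form x (residue q b x))" by (rule form_commute[OF x r])
  also have "\<dots> = form x x - (\<Sum>t<q. cnj (form x (b t) * form (b t) x))"
    using form_residue[OF o x x] form_commute[OF x x] by simp
  also have "(\<Sum>t<q. cnj (form x (b t) * form (b t) x)) = (\<Sum>t<q. of_real ((cmod (form (b t) x))\<^sup>2))"
  proof (rule sum.cong[OF refl])
    fix t assume "t \<in> {..<q}"
    then have "form x (b t) = cnj (form (b t) x)"
      using o x form_commute[of "b t" x] unfolding orthonormal_def by simp
    then show "cnj (form x (b t) * form (b t) x) = of_real ((cmod (form (b t) x))\<^sup>2)"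
      by (simp flip: complex_norm_square)
  qed
  finally show ?thesis by simp
qed

text \<open>Gram-Schmidt that skips null remainders. Enlarging the family keeps the earlier
  remainders null, since their squared norm can only drop and is never negative.\<close>

lemma ex_orthonormal_finite:
  assumes "finite S" "S \<subseteq> carrier A"
  shows "\<exists>q b. orthonormal q b \<and> (\<forall>x\<in>S. form (residue q b x) (residue q b x) = 0)"
  using assms
proof (induction S rule: finite_induct)
  case empty
  then show ?case by (auto simp: orthonormal_def intro!: exI[of _ 0])
next
  case (insert s S)
  then obtain q b where o: "orthonormal q b" and S: "\<forall>x\<in>S. form (residue q b x) (residue q b x) = 0" by auto
  have s: "s \<in> carrier A" using insert by simp
  define u where "u = residue q b s"
  define r where "r = Re (form u u)"
  have u: "u \<in> carrier A" unfolding u_def by (rule residue_closed[OF o s])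
  have uu: "form u u = of_real r" unfolding r_def by (rule form_self(2)[OF u])
  show ?case
  proof (cases "r = 0")
    case True
    then show ?thesis using o S uu unfolding u_def by auto
  next
    case False
    then have r: "r > 0" using form_self(1)[OF u] by (simp add: r_def)
    define v where "v = of_real (1 / sqrt r) \<odot> u"
    have v: "v \<in> carrier A" using u by (simp add: v_def)
    have vx: "form v x = of_real (1 / sqrt r) * form u x" if "x \<in> carrier A" for x
      using u that by (simp add: v_def form_smult_left)
    define b' where "b' = b(q := v)"
    have bv: "form (b t) v = 0" "form v (b t) = 0" if "t < q" for t
    proof -
      have "b t \<in> carrier A" using o that unfolding orthonormal_def by simp
      moreover have "form (b t) u = 0" unfolding u_def by (rule form_basis_residue[OF o s that])
      ultimately show "form (b t) v = 0" using u by (simp add: v_def form_smult_right)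
      then show "form v (b t) = 0" using form_commute[of "b t" v] v \<open>b t \<in> carrier A\<close> by simp
    qed
    have vv: "form v v = 1"
      using u r by (simp add: v_def form_smult_left form_smult_right uu flip: of_real_mult)
    have o': "orthonormal (Suc q) b'"
      using o v bv vv unfolding orthonormal_def b'_def by (auto simp: less_Suc_eq)
    have res: "form (residue (Suc q) b' x) (residue (Suc q) b' x) =
        form (residue q b x) (residue q b x) - of_real ((cmod (form v x))\<^sup>2)" if x: "x \<in> carrier A" for x
      by (simp add: form_residue_self[OF o' x] form_residue_self[OF o x]) (simp add: b'_def)
    have "form (residue (Suc q) b' x) (residue (Suc q) b' x) = 0" if "x \<in> insert s S" for x
    proof (cases "x = s")
      case True
      have "form u s = form u u"
      proof -
        have "form u (b t) = 0" if "t < q" for t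
          using bv(2)[OF that] vx[of "b t"] r o that unfolding orthonormal_def by simp
        then have "(\<Sum>t<q. form u (b t) * form (b t) s) = 0" by simp
        then show ?thesis using form_residue[OF o s u] by (simp add: u_def)
      qed
      then have "form v s = of_real (1 / sqrt r * r)"
        unfolding vx[OF s] by (simp only: uu of_real_mult)
      moreover have "1 / sqrt r * r = sqrt r" using r by (simp add: real_div_sqrt)
      ultimately have "form v s = of_real (sqrt r)" by metis
      then show ?thesis using res[OF s] r uu True by (simp add: u_def)
    next
      case False
      then have xS: "x \<in> S" "x \<in> carrier A" using that insert by auto
      have "form (residue (Suc q) b' x) (residue (Suc q) b' x) = of_real (- (cmod (form v x))\<^sup>2)"
        using res[OF xS(2)] S xS by simp
      moreover from this have "(cmod (form v x))\<^sup>2 \<le> 0"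
        using form_self(1)[OF residue_closed[OF o' xS(2)]] by simp
      ultimately show ?thesis by simp
    qed
    then show ?thesis using o' by blast
  qed
qed

text \<open>Parseval's identity against all \<open>z\<close> is linear in \<open>x\<close>, so it
  passes from a finite spanning set, where it holds by \<open>form_null\<close>, to the whole
  algebra.\<close>

theorem ex_orthonormal_basis:
  assumes fin: "cstar_fin_dim A"
  obtains q b where "orthonormal q b"
    "\<And>x. x \<in> carrier A \<Longrightarrow> form (residue q b x) (residue q b x) = 0"
    "\<And>x z. x \<in> carrier A \<Longrightarrow> z \<in> carrier A \<Longrightarrow> form z x = (\<Sum>t<q. form z (b t) * form (b t) x)"
proof -
  obtain S where S: "finite S" "S \<subseteq> carrier A" "span S = carrier A"
    using fin unfolding cstar_fin_dim_def fin_dim_def by auto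
  obtain q b where o: "orthonormal q b" and res: "\<forall>x\<in>S. form (residue q b x) (residue q b x) = 0"
    using ex_orthonormal_finite[OF S(1,2)] by blast
  have bc: "b t \<in> carrier A" if "t < q" for t using o that unfolding orthonormal_def by simp
  define N where "N = {x \<in> carrier A. \<forall>z\<in>carrier A. form z x = (\<Sum>t<q. form z (b t) * form (b t) x)}"
  have "S \<subseteq> N"
  proof
    fix x assume x: "x \<in> S"
    then have xc: "x \<in> carrier A" using S by blast
    have "form z (residue q b x) = 0" if "z \<in> carrier A" for z
      using form_null[OF residue_closed[OF o xc] _ that] res x by blast
    then show "x \<in> N" using form_residue[OF o xc] xc by (simp add: N_def)
  qed
  moreover have "submodule class_ring N A"
  proof (intro submodule.intro module_axioms)
    show "N \<subseteq> carrier A" by (auto simp: N_def)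
    have Nc: "v \<in> carrier A" and Nf: "z \<in> carrier A \<Longrightarrow> form z v = (\<Sum>t<q. form z (b t) * form (b t) v)" if "v \<in> N" for v z
      using that unfolding N_def by blast+
    show "v \<oplus> w \<in> N" if v: "v \<in> N" and w: "w \<in> N" for v w
    proof -
      have "form z (v \<oplus> w) = (\<Sum>t<q. form z (b t) * form (b t) (v \<oplus> w))" if z: "z \<in> carrier A" for z
      proof -
        have "(\<Sum>t<q. form z (b t) * form (b t) (v \<oplus> w)) =
            (\<Sum>t<q. form z (b t) * form (b t) v) + (\<Sum>t<q. form z (b t) * form (b t) w)"
          using Nc[OF v] Nc[OF w] bc by (simp add: form_add_right ring_distribs sum.distrib)
        then show ?thesis using form_add_right[OF z Nc[OF v] Nc[OF w]] Nf[OF v z] Nf[OF w z] by metis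
      qed
      then show ?thesis using Nc[OF v] Nc[OF w] unfolding N_def by blast
    qed
    show "\<zero> \<in> N" using bc by (auto simp: N_def form_zero_right)
    show "c \<odot> v \<in> N" if v: "v \<in> N" for c v
    proof -
      have "form z (c \<odot> v) = (\<Sum>t<q. form z (b t) * form (b t) (c \<odot> v))" if z: "z \<in> carrier A" for z
      proof -
        have "(\<Sum>t<q. form z (b t) * form (b t) (c \<odot> v)) = c * (\<Sum>t<q. form z (b t) * form (b t) v)"
          using Nc[OF v] bc by (simp add: form_smult_right sum_distrib_left mult.left_commute)
        then show ?thesis using form_smult_right[OF z Nc[OF v]] Nf[OF v z] by metis
      qed
      then show ?thesis using smult_closed'[OF Nc[OF v]] unfolding N_def by blast
    qed
  qed
  ultimately have "span S \<subseteq> N" by (rule span_is_subset)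
  then have N: "carrier A \<subseteq> N" using S by simp
  have eq: "form z x = (\<Sum>t<q. form z (b t) * form (b t) x)" if "x \<in> carrier A" "z \<in> carrier A" for x z
    using N that unfolding N_def by blast
  have "form (residue q b x) (residue q b x) = 0" if x: "x \<in> carrier A" for x
    using form_residue[OF o x residue_closed[OF o x]] eq[OF x residue_closed[OF o x]] by (metis diff_self)
  then show ?thesis using that[OF o] eq by blast
qed

section \<open>GNS representations by matrices\<close>

text \<open>The matrix of left multiplication by \<open>d\<close> on the GNS space in the
  orthonormal basis \<open>b\<close>.\<close>

definition gns_mat :: "nat \<Rightarrow> (nat \<Rightarrow> 'a) \<Rightarrow> 'a \<Rightarrow> complex mat" where
  "gns_mat q b d = mat q q (\<lambda>(t, s). form (b t) (d \<otimes> b s))"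

lemma gns_mat_carrier [simp]: "gns_mat q b d \<in> carrier_mat q q"
  by (simp add: gns_mat_def)

lemma gns_mat_index: "t < q \<Longrightarrow> s < q \<Longrightarrow> gns_mat q b d $$ (t, s) = form (b t) (d \<otimes> b s)"
  by (simp add: gns_mat_def)

text \<open>Multiplicativity is Parseval's identity between \<open>star A x \<otimes> b t\<close>
  and \<open>y \<otimes> b s\<close>.\<close>

lemma gns_mat_hom:
  assumes o: "orthonormal q b"
    and eq: "\<And>x z. x \<in> carrier A \<Longrightarrow> z \<in> carrier A \<Longrightarrow> form z x = (\<Sum>t<q. form z (b t) * form (b t) x)"
  shows "star_hom A (mat_cstar q) (gns_mat q b)" and "gns_mat q b e = 1\<^sub>m q"
proof -
  have bc: "b t \<in> carrier A" if "t < q" for t using o that unfolding orthonormal_def by simp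
  show "star_hom A (mat_cstar q) (gns_mat q b)"
    unfolding star_hom_def
  proof (intro conjI ballI allI)
    fix x y assume x: "x \<in> carrier A" and y: "y \<in> carrier A"
    show "gns_mat q b (x \<oplus> y) = gns_mat q b x \<oplus>\<^bsub>mat_cstar q\<^esub> gns_mat q b y"
      using x y bc by (intro eq_matI) (auto simp: gns_mat_def distrib_right form_add_right)
    show "gns_mat q b (x \<otimes> y) = gns_mat q b x \<otimes>\<^bsub>mat_cstar q\<^esub> gns_mat q b y"
    proof (rule eq_matI)
      fix t s assume "t < dim_row (gns_mat q b x \<otimes>\<^bsub>mat_cstar q\<^esub> gns_mat q b y)"
        "s < dim_col (gns_mat q b x \<otimes>\<^bsub>mat_cstar q\<^esub> gns_mat q b y)"
      then have ts: "t < q" "s < q" by (auto simp: gns_mat_def)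
      have "gns_mat q b (x \<otimes> y) $$ (t, s) = form (star A x \<otimes> b t) (y \<otimes> b s)"
        using ts x y bc by (simp add: gns_mat_index mult_assoc form_mult_left)
      also have "\<dots> = (\<Sum>r<q. form (star A x \<otimes> b t) (b r) * form (b r) (y \<otimes> b s))"
        using ts x y bc by (intro eq) auto
      also have "\<dots> = (\<Sum>r<q. gns_mat q b x $$ (t, r) * gns_mat q b y $$ (r, s))"
        using ts x y bc by (intro sum.cong) (auto simp: gns_mat_index form_mult_left)
      also have "\<dots> = (gns_mat q b x * gns_mat q b y) $$ (t, s)"
        using ts by (auto simp: scalar_prod_def gns_mat_def lessThan_atLeast0)
      finally show "gns_mat q b (x \<otimes> y) $$ (t, s) = (gns_mat q b x \<otimes>\<^bsub>mat_cstar q\<^esub> gns_mat q b y) $$ (t, s)" by simp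
    qed (auto simp: gns_mat_def)
  next
    fix c x assume x: "x \<in> carrier A"
    show "gns_mat q b (c \<odot> x) = c \<odot>\<^bsub>mat_cstar q\<^esub> gns_mat q b x"
      using x bc by (intro eq_matI) (auto simp: gns_mat_def smult_mult_left form_smult_right)
    show "gns_mat q b (star A x) = star (mat_cstar q) (gns_mat q b x)"
    proof (rule eq_matI)
      fix t s assume "t < dim_row (star (mat_cstar q) (gns_mat q b x))" "s < dim_col (star (mat_cstar q) (gns_mat q b x))"
      then have ts: "t < q" "s < q" by (auto simp: gns_mat_def)
      have "form (b t) (star A x \<otimes> b s) = form (x \<otimes> b t) (b s)"
        using ts x bc by (simp add: form_mult_left star_star)
      also have "\<dots> = cnj (form (b s) (x \<otimes> b t))" using ts x bc by (intro form_commute) auto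
      finally show "gns_mat q b (star A x) $$ (t, s) = star (mat_cstar q) (gns_mat q b x) $$ (t, s)"
        using ts by (simp add: gns_mat_def)
    qed (auto simp: gns_mat_def)
  qed auto
  show "gns_mat q b e = 1\<^sub>m q"
    using o bc by (intro eq_matI) (auto simp: gns_mat_def orthonormal_def)
qed

end

lemma ucstar_functionalI: "ucstar A e \<Longrightarrow> ucstar.positive_functional A \<phi> \<Longrightarrow> ucstar_functional A e \<phi>"
  by (intro ucstar_functional.intro ucstar_functional_axioms.intro)

text \<open>The GNS representation of a state that attains the norm of
  \<open>star A x \<otimes> x\<close>. If the matrix of \<open>x\<close> were 0, expanding
  \<open>e\<close> in the basis would give \<open>form (b t) x = 0\<close> for all \<open>t\<close>,
  and then \<open>form x x = 0\<close> by Parseval.\<close>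

theorem fin_dim_matrix_rep:
  assumes "ucstar A e" and finA: "cstar_fin_dim A" and x: "x \<in> carrier A" "x \<noteq> \<zero>\<^bsub>A\<^esub>"
  obtains k \<tau> where "0 < k" "star_hom A (mat_cstar k) \<tau>" "\<tau> e = 1\<^sub>m k" "\<tau> x \<noteq> 0\<^sub>m k k"
proof -
  interpret ucstar A e by fact
  obtain \<phi> where st: "positive_functional \<phi>" "\<phi> e = 1" "\<phi> (star A x \<otimes>\<^bsub>A\<^esub> x) = of_real ((cnorm A x)\<^sup>2)"
    by (rule ex_state[OF x(1)]) (rule that)
  interpret ucstar_functional A e \<phi> by unfold_locales (rule st(1))
  obtain q b where o: "orthonormal q b"
    and eq: "\<And>x z. x \<in> carrier A \<Longrightarrow> z \<in> carrier A \<Longrightarrow> form z x = (\<Sum>t<q. form z (b t) * form (b t) x)"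
    by (rule ex_orthonormal_basis[OF finA]) (rule that)
  have bc: "b t \<in> carrier A" if "t < q" for t using o that unfolding orthonormal_def by simp
  have "form e e = 1" using st(2) by (simp add: form_def)
  \<comment> \<open>For \<open>q = 0\<close> the Parseval sum for \<open>form e e = 1\<close> would
    be empty.\<close>
  then have "q \<noteq> 0" using eq[of e e] by (intro notI) simp
  moreover have "gns_mat q b x \<noteq> 0\<^sub>m q q"
  proof
    assume 0: "gns_mat q b x = 0\<^sub>m q q"
    have "form (b t) x = 0" if t: "t < q" for t
    proof -
      have "form (b t) x = form (star A x \<otimes>\<^bsub>A\<^esub> b t) e"
        using x(1) bc[OF t] form_mult_left[of x "b t" e] by simp
      also have "\<dots> = (\<Sum>s<q. form (star A x \<otimes>\<^bsub>A\<^esub> b t) (b s) * form (b s) e)"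
        using x(1) bc[OF t] by (intro eq) auto
      also have "\<dots> = (\<Sum>s<q. gns_mat q b x $$ (t, s) * form (b s) e)"
        using x(1) bc t by (intro sum.cong) (auto simp: gns_mat_index form_mult_left)
      finally show ?thesis using t by (simp add: 0)
    qed
    then have "form x x = 0" using eq[OF x(1) x(1)] by simp
    then show False using st(3) x by (simp add: form_def cnorm_eq_0_iff)
  qed
  ultimately show ?thesis using that gns_mat_hom[OF o eq] by blast
qed

text \<open>The corner \<open>pEp\<close> for \<open>p = \<pi>(1)\<close> replaces a target \<open>E\<close> on which \<open>\<pi>\<close> need not be unital.\<close>

theorem rfd_matrix_rep:
  assumes "ucstar R e" and "rfd R" and x: "x \<in> carrier R" "x \<noteq> \<zero>\<^bsub>R\<^esub>"
  obtains k \<tau> where "0 < k" "star_hom R (mat_cstar k) \<tau>" "\<tau> e = 1\<^sub>m k" "\<tau> x \<noteq> 0\<^sub>m k k"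
proof -
  interpret R: ucstar R e by fact
  obtain E :: "(nat \<Rightarrow> complex) cstar" and \<pi> where "cstar_algebra E" and finE: "cstar_fin_dim E"
    and \<pi>: "star_hom R E \<pi>" and \<pi>x: "\<pi> x \<noteq> \<zero>\<^bsub>E\<^esub>"
    using assms(2) x unfolding rfd_def by blast
  interpret E: cstar_algebra E by fact
  note h = star_homD[OF \<pi>]
  define p where "p = \<pi> e"
  have p: "p \<in> carrier E" "p \<otimes>\<^bsub>E\<^esub> p = p" "star E p = p"
    using h(1)[of e] h(4)[of e e] h(5)[of e] by (simp_all add: p_def)
  define S where "S = {y \<in> carrier E. p \<otimes>\<^bsub>E\<^esub> y = y \<and> y \<otimes>\<^bsub>E\<^esub> p = y}"
  have \<pi>S: "\<pi> y \<in> S" if "y \<in> carrier R" for y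
    using h(1)[OF that] h(4)[of e y] h(4)[of y e] that by (simp add: S_def p_def)
  have pS: "p \<in> S" using p by (simp add: S_def)
  have closed: "closedin E.cmetric.mtopology S"
    unfolding E.cmetric.metric_closedin_iff_sequentially_closed
  proof (intro conjI allI impI)
    show "S \<subseteq> carrier E" by (auto simp: S_def)
    fix s l assume "range s \<subseteq> S \<and> limitin E.cmetric.mtopology s l sequentially"
    then have s: "range s \<subseteq> S" and lim: "limitin E.cmetric.mtopology s l sequentially" by auto
    have l: "l \<in> carrier E" using lim by (simp add: E.cmetric.limit_metric_sequentially)
    have sc: "s n \<in> carrier E" "p \<otimes>\<^bsub>E\<^esub> s n = s n" "s n \<otimes>\<^bsub>E\<^esub> p = s n" for n using s by (auto simp: S_def)
    have d0: "cdist E (p \<otimes>\<^bsub>E\<^esub> l) l = 0 \<and> cdist E (l \<otimes>\<^bsub>E\<^esub> p) l = 0"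
    proof (rule ccontr)
      assume "\<not> ?thesis"
      then have "0 < cdist E (p \<otimes>\<^bsub>E\<^esub> l) l + cdist E (l \<otimes>\<^bsub>E\<^esub> p) l"
        using E.cmetric.nonneg[of "p \<otimes>\<^bsub>E\<^esub> l" l] E.cmetric.nonneg[of "l \<otimes>\<^bsub>E\<^esub> p" l] by linarith
      \<comment> \<open>The denominator is the factor by which the distance from \<open>s n\<close>
        to \<open>l\<close> controls the total displacement of \<open>l\<close> under left and right
        multiplication by \<open>p\<close>.\<close>
      moreover define r where "r = (cdist E (p \<otimes>\<^bsub>E\<^esub> l) l + cdist E (l \<otimes>\<^bsub>E\<^esub> p) l) / (2 * cnorm E p + 2)"
      ultimately have "r > 0" using E.cnorm_nonneg[OF p(1)] by simp
      then obtain n where n: "cdist E (s n) l < r"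
        using lim unfolding E.cmetric.limit_metric_sequentially by blast
      have "cdist E (p \<otimes>\<^bsub>E\<^esub> l) (p \<otimes>\<^bsub>E\<^esub> s n) \<le> cnorm E p * cdist E l (s n)"
        using E.cdist_mult[OF p(1) l p(1) sc(1)[of n]] p by simp
      moreover have "cdist E (l \<otimes>\<^bsub>E\<^esub> p) (s n \<otimes>\<^bsub>E\<^esub> p) \<le> cdist E l (s n) * cnorm E p"
        using E.cdist_mult[OF l p(1) sc(1)[of n] p(1)] p by simp
      moreover have "cdist E (p \<otimes>\<^bsub>E\<^esub> l) l \<le> cdist E (p \<otimes>\<^bsub>E\<^esub> l) (s n) + cdist E (s n) l"
        using sc[of n] l p by (intro E.cmetric.triangle) (auto intro: E.mult_closed)
      moreover have "cdist E (l \<otimes>\<^bsub>E\<^esub> p) l \<le> cdist E (l \<otimes>\<^bsub>E\<^esub> p) (s n) + cdist E (s n) l"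
        using sc[of n] l p by (intro E.cmetric.triangle) (auto intro: E.mult_closed)
      ultimately have "cdist E (p \<otimes>\<^bsub>E\<^esub> l) l + cdist E (l \<otimes>\<^bsub>E\<^esub> p) l \<le> (2 * cnorm E p + 2) * cdist E (s n) l"
        by (simp add: sc E.cmetric.commute[of l "s n"] algebra_simps)
      also have "\<dots> < (2 * cnorm E p + 2) * r" using n E.cnorm_nonneg[OF p(1)] by simp
      also have "\<dots> = cdist E (p \<otimes>\<^bsub>E\<^esub> l) l + cdist E (l \<otimes>\<^bsub>E\<^esub> p) l"
        using E.cnorm_nonneg[OF p(1)] by (simp add: r_def)
      finally show False by simp
    qed
    then show "l \<in> S" using l p(1) by (simp add: S_def E.mult_closed)
  qed
  have sub: "cstar_subalgebra S E"
    unfolding cstar_subalgebra_def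
  proof (intro conjI ballI allI closed)
    fix y assume y: "y \<in> S"
    then have yc: "y \<in> carrier E" "p \<otimes>\<^bsub>E\<^esub> y = y" "y \<otimes>\<^bsub>E\<^esub> p = y" by (auto simp: S_def)
    show "c \<odot>\<^bsub>E\<^esub> y \<in> S" for c
      using yc p(1) by (simp add: S_def E.smult_mult_left E.smult_mult_right E.smult_closed')
    show "star E y \<in> S"
      using E.star_mult[OF p(1) yc(1)] E.star_mult[OF yc(1) p(1)] yc p by (simp add: S_def E.star_closed)
    fix z assume "z \<in> S"
    then have zc: "z \<in> carrier E" "p \<otimes>\<^bsub>E\<^esub> z = z" "z \<otimes>\<^bsub>E\<^esub> p = z" by (auto simp: S_def)
    show "y \<oplus>\<^bsub>E\<^esub> z \<in> S" using yc zc p(1) by (simp add: S_def E.distrib_left E.distrib_right)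
    show "y \<otimes>\<^bsub>E\<^esub> z \<in> S" using yc zc p(1)
      by (simp add: S_def E.mult_closed E.mult_assoc) (simp add: E.mult_closed flip: E.mult_assoc)
  next
    have "p \<otimes>\<^bsub>E\<^esub> \<zero>\<^bsub>E\<^esub> = \<zero>\<^bsub>E\<^esub>" "\<zero>\<^bsub>E\<^esub> \<otimes>\<^bsub>E\<^esub> p = \<zero>\<^bsub>E\<^esub>"
      using E.cnorm_mult[of p "\<zero>\<^bsub>E\<^esub>"] E.cnorm_mult[of "\<zero>\<^bsub>E\<^esub>" p] p(1) E.cnorm_eq_0_iff[of "\<zero>\<^bsub>E\<^esub>"]
        E.cnorm_eq_0_iff[of "p \<otimes>\<^bsub>E\<^esub> \<zero>\<^bsub>E\<^esub>"] E.cnorm_eq_0_iff[of "\<zero>\<^bsub>E\<^esub> \<otimes>\<^bsub>E\<^esub> p"]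
        E.cnorm_nonneg[of "p \<otimes>\<^bsub>E\<^esub> \<zero>\<^bsub>E\<^esub>"] E.cnorm_nonneg[of "\<zero>\<^bsub>E\<^esub> \<otimes>\<^bsub>E\<^esub> p"]
      by (simp_all add: E.mult_closed)
    then show "\<zero>\<^bsub>E\<^esub> \<in> S" by (simp add: S_def)
  qed
  \<comment> \<open>Transport along the identity only shrinks the carrier. The field
    \<open>one\<close> of \<open>T\<close> is still that of \<open>E\<close>, whereas the unit is
    \<open>p\<close>.\<close>
  define T where "T = transport E S id"
  have inv: "inv_into S id y = y" if "y \<in> S" for y using that inv_into_f_f[of id S y] by simp
  have T: "carrier T = S" "\<zero>\<^bsub>T\<^esub> = \<zero>\<^bsub>E\<^esub>"
    "\<And>y z. y \<in> S \<Longrightarrow> z \<in> S \<Longrightarrow> y \<otimes>\<^bsub>T\<^esub> z = y \<otimes>\<^bsub>E\<^esub> z"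
    "\<And>y z. y \<in> S \<Longrightarrow> z \<in> S \<Longrightarrow> y \<oplus>\<^bsub>T\<^esub> z = y \<oplus>\<^bsub>E\<^esub> z"
    "\<And>c y. y \<in> S \<Longrightarrow> c \<odot>\<^bsub>T\<^esub> y = c \<odot>\<^bsub>E\<^esub> y"
    by (simp_all add: T_def transport_def Let_def inv)
  have csT: "cstar_algebra T" unfolding T_def by (rule E.transport_cstar[OF sub inj_on_id])
  have homT: "star_hom R T \<pi>"
    using E.transport_hom[OF sub inj_on_id \<pi>] \<pi>S unfolding T_def by (auto simp: image_subset_iff)
  have "p \<noteq> \<zero>\<^bsub>E\<^esub>"
  proof
    assume "p = \<zero>\<^bsub>E\<^esub>"
    moreover have "\<pi> x = p \<otimes>\<^bsub>E\<^esub> \<pi> x" using \<pi>S[OF x(1)] by (simp add: S_def)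
    ultimately have "cnorm E (\<pi> x) \<le> 0"
      using E.cnorm_mult[OF p(1) h(1)[OF x(1)]] E.cnorm_eq_0_iff[OF p(1)] by simp
    then show False using \<pi>x E.cnorm_eq_0_iff[OF h(1)[OF x(1)]] E.cnorm_nonneg[OF h(1)[OF x(1)]] by simp
  qed
  then have uT: "ucstar T p"
    using pS by (intro ucstar.intro csT ucstar_axioms.intro) (auto simp: T S_def)
  interpret T: ucstar T p by (rule uT)
  have finT: "cstar_fin_dim T"
  proof -
    \<comment> \<open>The compression to the corner is linear and onto, so finite dimension passes
      from \<open>E\<close> to \<open>T\<close>.\<close>
    let ?f = "\<lambda>y. p \<otimes>\<^bsub>E\<^esub> (y \<otimes>\<^bsub>E\<^esub> p)"
    have fS: "?f y \<in> S" if "y \<in> carrier E" for y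
    proof -
      have "p \<otimes>\<^bsub>E\<^esub> ?f y = (p \<otimes>\<^bsub>E\<^esub> p) \<otimes>\<^bsub>E\<^esub> (y \<otimes>\<^bsub>E\<^esub> p)" "?f y \<otimes>\<^bsub>E\<^esub> p = p \<otimes>\<^bsub>E\<^esub> (y \<otimes>\<^bsub>E\<^esub> (p \<otimes>\<^bsub>E\<^esub> p))"
        using that p(1) by (simp_all add: E.mult_assoc E.mult_closed)
      then show ?thesis using that p by (simp add: S_def E.mult_closed)
    qed
    have mh: "?f \<in> LinearCombinations.module_hom (class_ring :: complex ring) E T"
      unfolding LinearCombinations.module_hom_def using fS p(1)
      by (auto simp: T E.distrib_left E.distrib_right E.mult_closed E.smult_mult_left E.smult_mult_right)
    have lm: "linear_map (class_ring :: complex ring) E T ?f"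
      by (rule linear_map.intro[OF E.vectorspace_axioms T.vectorspace_axioms
            mod_hom.intro[OF E.module_axioms T.module_axioms mod_hom_axioms.intro[OF mh]]])
    have "?f ` carrier E = carrier T"
    proof
      show "?f ` carrier E \<subseteq> carrier T" using fS by (auto simp: T)
      show "carrier T \<subseteq> ?f ` carrier E"
      proof
        fix y assume "y \<in> carrier T"
        then have "y = ?f y" "y \<in> carrier E" by (auto simp: T S_def)
        then show "y \<in> ?f ` carrier E" by blast
      qed
    qed
    then show ?thesis
      using linear_map.rank_nullity_main(2)[OF lm] finE unfolding cstar_fin_dim_def by blast
  qed
  have "\<pi> x \<in> carrier T" "\<pi> x \<noteq> \<zero>\<^bsub>T\<^esub>" using \<pi>S[OF x(1)] \<pi>x by (simp_all add: T)
  then obtain k \<tau> where \<tau>: "0 < k" "star_hom T (mat_cstar k) \<tau>" "\<tau> p = 1\<^sub>m k" "\<tau> (\<pi> x) \<noteq> 0\<^sub>m k k"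
    by (rule fin_dim_matrix_rep[OF uT finT]) (rule that)
  show ?thesis
    using that[OF \<tau>(1) star_hom_compose[OF homT \<tau>(2)]] \<tau>(3,4) by (simp add: p_def)
qed

section \<open>Matrix representations and embeddings into products\<close>

lemma ucstar_unital: "cstar_algebra A \<Longrightarrow> cstar_unital A \<Longrightarrow> ucstar A \<one>\<^bsub>A\<^esub>"
  unfolding cstar_unital_def by (intro ucstar.intro ucstar_axioms.intro) auto

definition matrix_rep :: "'a cstar \<Rightarrow> nat \<Rightarrow> ('a \<Rightarrow> complex mat) \<Rightarrow> bool" where
  "matrix_rep A k \<tau> \<longleftrightarrow> 0 < k \<and> star_hom A (mat_cstar k) \<tau> \<and> \<tau> \<one>\<^bsub>A\<^esub> = 1\<^sub>m k"

lemma matrix_rep_contractive: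
  assumes "cstar_algebra A" "cstar_unital A" "matrix_rep A k \<tau>" "x \<in> carrier A"
  shows "mat_opnorm (\<tau> x) \<le> cnorm A x"
  using star_hom_contractive[OF ucstar_unital[OF assms(1,2)] ucstar_mat_cstar, of k \<tau> x] assms(3,4)
  by (simp add: matrix_rep_def)

lemma matrix_repD:
  assumes "matrix_rep A k \<tau>"
  shows "0 < k" "\<tau> \<one>\<^bsub>A\<^esub> = 1\<^sub>m k"
    and "\<And>x. x \<in> carrier A \<Longrightarrow> \<tau> x \<in> carrier_mat k k"
    and "\<And>x y. \<lbrakk>x \<in> carrier A; y \<in> carrier A\<rbrakk> \<Longrightarrow> \<tau> (x \<oplus>\<^bsub>A\<^esub> y) = \<tau> x + \<tau> y"
    and "\<And>c x. x \<in> carrier A \<Longrightarrow> \<tau> (c \<odot>\<^bsub>A\<^esub> x) = c \<cdot>\<^sub>m \<tau> x"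
    and "\<And>x y. \<lbrakk>x \<in> carrier A; y \<in> carrier A\<rbrakk> \<Longrightarrow> \<tau> (x \<otimes>\<^bsub>A\<^esub> y) = \<tau> x * \<tau> y"
    and "\<And>x. x \<in> carrier A \<Longrightarrow> \<tau> (star A x) = mat_adjoint (\<tau> x)"
  using assms star_homD[of A "mat_cstar k" \<tau>] by (auto simp: matrix_rep_def)

lemma matrix_rep_minus:
  assumes "cstar_algebra A" "matrix_rep A k \<tau>" "x \<in> carrier A" "y \<in> carrier A"
  shows "\<tau> (x \<ominus>\<^bsub>A\<^esub> y) = \<tau> x - \<tau> y"
  using star_hom_minus[OF assms(1) cstar_algebra_mat_cstar _ assms(3,4)] assms(2)
    minus_mat_cstar[OF matrix_repD(3)[OF assms(2,3)] matrix_repD(3)[OF assms(2,4)]]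
  by (simp add: matrix_rep_def)

abbreviation mat_prod :: "(nat \<Rightarrow> nat) \<Rightarrow> (nat \<Rightarrow> complex mat) cstar" where
  "mat_prod k \<equiv> cstar_prod (\<lambda>n. mat_cstar (k n))"

lemma cstar_unital_mat_prod:
  assumes "\<And>n. 0 < k n"
  shows "cstar_unital (mat_prod k)"
proof -
  have "bdd_above (range (\<lambda>n. mat_opnorm (1\<^sub>m (k n))))"
  proof (rule bdd_aboveI2)
    fix n show "mat_opnorm (1\<^sub>m (k n)) \<le> 1" by (rule opnorm_le[of _ "k n" "k n"]) auto
  qed
  moreover have "(\<lambda>n. 1\<^sub>m (k n)) \<noteq> (\<lambda>n. 0\<^sub>m (k n) (k n) :: complex mat)"
  proof
    assume "(\<lambda>n. 1\<^sub>m (k n)) = (\<lambda>n. 0\<^sub>m (k n) (k n) :: complex mat)"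
    then have "1\<^sub>m (k 0) $$ (0, 0) = (0\<^sub>m (k 0) (k 0) :: complex mat) $$ (0, 0)" by metis
    then show False using assms[of 0] by simp
  qed
  moreover have "(\<lambda>n. 1\<^sub>m (k n) * Y n) = Y" "(\<lambda>n. Y n * 1\<^sub>m (k n)) = Y"
    if "\<forall>n. Y n \<in> carrier_mat (k n) (k n)" for Y :: "nat \<Rightarrow> complex mat"
    using that left_mult_one_mat right_mult_one_mat unfolding fun_eq_iff by blast+
  ultimately show ?thesis by (simp add: cstar_unital_def cstar_prod_def)
qed

lemma mat_prod_coordinate:
  assumes "unital_embedding A (mat_prod k) q" and k: "\<And>n. 0 < k n"
  shows "matrix_rep A (k n) (\<lambda>x. q x n)"
proof -
  have h: "star_hom A (mat_prod k) q" and one: "q \<one>\<^bsub>A\<^esub> = \<one>\<^bsub>mat_prod k\<^esub>"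
    using assms(1) by (auto simp: unital_embedding_def)
  have "star_hom A (mat_cstar (k n)) (\<lambda>x. q x n)"
    using h by (auto simp: star_hom_def cstar_prod_def Pi_iff)
  then show ?thesis using k one by (simp add: matrix_rep_def cstar_prod_def)
qed

text \<open>One representation is chosen for each ball of radius \<open>inverse (Suc j)\<close>
  about a point of a countable dense set, nonvanishing on the whole ball if possible. This separates
  points: a representation with \<open>\<tau> x \<noteq> 0\<close> is contractive, hence nonzero on
  a ball about \<open>x\<close> that contains one of the countably many balls around
  \<open>x\<close>.\<close>

lemma ex_separating_matrix_reps:
  assumes C: "cstar_algebra C" "cstar_unital C" and rfd: "rfd C"
  obtains k \<tau> where "\<And>n::nat. matrix_rep C (k n) (\<tau> n)"
    "\<And>x. x \<in> carrier C \<Longrightarrow> x \<noteq> \<zero>\<^bsub>C\<^esub> \<Longrightarrow> \<exists>n. \<tau> n x \<noteq> 0\<^sub>m (k n) (k n)"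
proof -
  interpret ucstar C "\<one>\<^bsub>C\<^esub>" by (rule ucstar_unital[OF C])
  obtain U where U: "countable U" "U \<subseteq> carrier C" "cmetric.mtopology closure_of U = carrier C"
    using rfd unfolding rfd_def cstar_separable_def separable_space_def by auto
  define good where "good i j p \<longleftrightarrow> matrix_rep C (fst p) (snd p) \<and>
      (\<forall>y\<in>carrier C. cdist C y (from_nat_into U i) < inverse (Suc j) \<longrightarrow> snd p y \<noteq> 0\<^sub>m (fst p) (fst p))"
    for i j :: nat and p :: "nat \<times> ('a \<Rightarrow> complex mat)"
  \<comment> \<open>The default for those balls on which no representation is nowhere zero.\<close>
  obtain k0 \<tau>0 where "matrix_rep C k0 \<tau>0"
    by (rule rfd_matrix_rep[OF ucstar_unital[OF C] rfd e_closed e_nonzero]) (auto simp: matrix_rep_def intro: that)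
  then have "\<exists>p. matrix_rep C (fst p) (snd p) \<and> ((\<exists>p. good i j p) \<longrightarrow> good i j p)" for i j
  proof (cases "\<exists>p. good i j p")
    case True
    then obtain p where p: "good i j p" by blast
    then have "matrix_rep C (fst p) (snd p)" by (simp add: good_def)
    then show ?thesis using p by blast
  next
    case False
    then show ?thesis using \<open>matrix_rep C k0 \<tau>0\<close> by (metis fst_conv snd_conv)
  qed
  then obtain P where P: "\<And>i j. matrix_rep C (fst (P i j)) (snd (P i j))"
    "\<And>i j. \<exists>p. good i j p \<Longrightarrow> good i j (P i j)" by metis
  define Q where "Q n = (case prod_decode n of (i, j) \<Rightarrow> P i j)" for n
  show ?thesis
  proof (rule that[of "\<lambda>n. fst (Q n)" "\<lambda>n. snd (Q n)"])
    show "matrix_rep C (fst (Q n)) (snd (Q n))" for n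
      using P(1) by (simp add: Q_def split: prod.split)
    fix x assume x: "x \<in> carrier C" "x \<noteq> \<zero>\<^bsub>C\<^esub>"
    obtain k \<tau> where \<tau>: "matrix_rep C k \<tau>" "\<tau> x \<noteq> 0\<^sub>m k k"
      by (rule rfd_matrix_rep[OF ucstar_unital[OF C] rfd x]) (auto simp: matrix_rep_def intro: that)
    define r where "r = mat_opnorm (\<tau> x)"
    have r: "r > 0"
      using opnorm_nonneg[OF matrix_repD(3)[OF \<tau>(1) x(1)]] opnorm_eq_0[OF matrix_repD(3)[OF \<tau>(1) x(1)]] \<tau>(2)
      by (simp add: r_def)
    \<comment> \<open>Points of a ball of this radius that contains \<open>x\<close> are closer to
      \<open>x\<close> than \<open>r\<close>, the norm of \<open>\<tau> x\<close>, and contractivity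
      keeps \<open>\<tau>\<close> nonzero there.\<close>
    then obtain j where j: "inverse (Suc j) < r / 2" using reals_Archimedean[of "r / 2"] by auto
    have "x \<in> cmetric.mtopology closure_of U" using U x by simp
    then obtain u where u: "u \<in> U" "cdist C x u < inverse (Suc j)"
      unfolding cmetric.metric_closure_of by (auto dest!: spec[of _ "inverse (real (Suc j))"])
    then obtain i where i: "from_nat_into U i = u"
      using from_nat_into_surj[OF U(1) u(1)] by blast
    have uc: "u \<in> carrier C" using u U by blast
    have "good i j (k, \<tau>)"
      unfolding good_def i fst_conv snd_conv
    proof (intro conjI \<tau> ballI impI notI)
      fix y assume y: "y \<in> carrier C" "cdist C y u < inverse (Suc j)" "\<tau> y = 0\<^sub>m k k"
      have "cdist C x y < r"
        using cmetric.triangle[OF x(1) uc y(1)] u(2) y(2) j cmetric.commute[of u y] by linarith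
      then have "cnorm C (x \<ominus>\<^bsub>C\<^esub> y) < r" using x y by (simp add: cdist_cnorm)
      moreover have "\<tau> (x \<ominus>\<^bsub>C\<^esub> y) = \<tau> x"
        using matrix_rep_minus[OF C(1) \<tau>(1) x(1) y(1)] y(3) matrix_repD(3)[OF \<tau>(1) x(1)] by auto
      ultimately show False
        using matrix_rep_contractive[OF C \<tau>(1), of "x \<ominus>\<^bsub>C\<^esub> y"] x y by (simp add: r_def)
    qed
    then have "good i j (P i j)" using P(2) by blast
    then have "snd (P i j) x \<noteq> 0\<^sub>m (fst (P i j)) (fst (P i j))"
      using u(2) x unfolding good_def i by blast
    then show "\<exists>n. snd (Q n) x \<noteq> 0\<^sub>m (fst (Q n)) (fst (Q n))"
      by (intro exI[of _ "prod_encode (i, j)"]) (simp add: Q_def)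
  qed
qed

text \<open>Contractivity of the coordinates makes the sequence at each element bounded, and their
  joint injectivity gives an embedding.\<close>

lemma rfd_imp_embedding:
  assumes C: "cstar_algebra C" "cstar_unital C" and rfd: "rfd C"
  obtains k q where "\<And>n. 0 < k n" "unital_embedding C (mat_prod k) q"
proof -
  interpret ucstar C "\<one>\<^bsub>C\<^esub>" by (rule ucstar_unital[OF C])
  obtain k \<tau> where \<tau>: "\<And>n::nat. matrix_rep C (k n) (\<tau> n)"
    and sep: "\<And>x. x \<in> carrier C \<Longrightarrow> x \<noteq> \<zero>\<^bsub>C\<^esub> \<Longrightarrow> \<exists>n. \<tau> n x \<noteq> 0\<^sub>m (k n) (k n)"
    by (rule ex_separating_matrix_reps[OF C rfd]) (rule that)
  define q where "q x n = \<tau> n x" for x n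
  have k: "0 < k n" for n by (rule matrix_repD(1)[OF \<tau>])
  note t = matrix_repD(2-)[OF \<tau>]
  have bdd: "bdd_above (range (\<lambda>n. mat_opnorm (\<tau> n x)))" if "x \<in> carrier C" for x
    using matrix_rep_contractive[OF C \<tau> that] by (rule bdd_aboveI2)
  have "star_hom C (mat_prod k) q"
    using t bdd by (auto simp: star_hom_def cstar_prod_def q_def fun_eq_iff)
  moreover have "inj_on q (carrier C)"
  proof (rule inj_onI, rule ccontr)
    fix x y assume xy: "x \<in> carrier C" "y \<in> carrier C" "q x = q y" "x \<noteq> y"
    then obtain n where "\<tau> n (x \<ominus>\<^bsub>C\<^esub> y) \<noteq> 0\<^sub>m (k n) (k n)" using sep[of "x \<ominus>\<^bsub>C\<^esub> y"] by auto
    moreover have "\<tau> n x = \<tau> n y" using xy(3) by (metis q_def)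
    ultimately show False
      using matrix_rep_minus[OF C(1) \<tau> xy(1,2), of n] t(2)[OF xy(2), of n] by auto
  qed
  moreover have "q \<one>\<^bsub>C\<^esub> = \<one>\<^bsub>mat_prod k\<^esub>" by (simp add: q_def cstar_prod_def t(1) fun_eq_iff)
  ultimately have "unital_embedding C (mat_prod k) q"
    using C cstar_unital_mat_prod[of k, OF k] by (simp add: unital_embedding_def)
  then show ?thesis using that k by blast
qed

lemma unital_embedding_compose:
  assumes "unital_embedding A B f" "unital_embedding B C g"
  shows "unital_embedding A C (\<lambda>x. g (f x))"
proof -
  have "f ` carrier A \<subseteq> carrier B" using assms(1) by (auto simp: unital_embedding_def star_hom_def)
  then have "inj_on (g \<circ> f) (carrier A)"
    using assms unfolding unital_embedding_def by (intro comp_inj_on) (auto intro: inj_on_subset)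
  then show ?thesis
    using assms star_hom_compose[of A B f C g] by (simp add: unital_embedding_def comp_def)
qed

section \<open>Positivity of operator matrices\<close>

text \<open>Both \<open>\<complex>\<^sup>k\<close> with a representation and an ambient C*-algebra with a positive functional
  are instances.\<close>

locale cstar_module = ucstar A e for A :: "'a cstar" (structure) and e +
  fixes X :: "'x set" and vplus :: "'x \<Rightarrow> 'x \<Rightarrow> 'x" and vzero :: 'x
    and F :: "'x \<Rightarrow> 'x \<Rightarrow> complex" and act :: "'a \<Rightarrow> 'x \<Rightarrow> 'x"
  assumes vzero: "vzero \<in> X" and vplus: "u \<in> X \<Longrightarrow> v \<in> X \<Longrightarrow> vplus u v \<in> X"
    and act: "a \<in> carrier A \<Longrightarrow> u \<in> X \<Longrightarrow> act a u \<in> X"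
    and F_vplus: "u \<in> X \<Longrightarrow> v \<in> X \<Longrightarrow> w \<in> X \<Longrightarrow> F u (vplus v w) = F u v + F u w"
    and F_vzero: "u \<in> X \<Longrightarrow> F u vzero = 0"
    and F_commute: "u \<in> X \<Longrightarrow> v \<in> X \<Longrightarrow> F v u = cnj (F u v)"
    and F_pos: "u \<in> X \<Longrightarrow> 0 \<le> Re (F u u)"
    and F_act: "a \<in> carrier A \<Longrightarrow> u \<in> X \<Longrightarrow> v \<in> X \<Longrightarrow> F u (act a v) = F (act (star A a) u) v"
    and act_mult: "a \<in> carrier A \<Longrightarrow> b \<in> carrier A \<Longrightarrow> u \<in> X \<Longrightarrow> act (a \<otimes> b) u = act a (act b u)"
    and F_add: "a \<in> carrier A \<Longrightarrow> b \<in> carrier A \<Longrightarrow> u \<in> X \<Longrightarrow> v \<in> X \<Longrightarrow>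
      F u (act (a \<oplus> b) v) = F u (act a v) + F u (act b v)"
    and F_smult: "a \<in> carrier A \<Longrightarrow> u \<in> X \<Longrightarrow> v \<in> X \<Longrightarrow> F u (act (c \<odot> a) v) = c * F u (act a v)"
    and act_e: "u \<in> X \<Longrightarrow> act e u = u"
begin

lemma F_uminus: "a \<in> carrier A \<Longrightarrow> u \<in> X \<Longrightarrow> v \<in> X \<Longrightarrow> F u (act (\<ominus> a) v) = - F u (act a v)"
  by (simp add: uminus_smult F_smult)

lemma F_minus: "a \<in> carrier A \<Longrightarrow> b \<in> carrier A \<Longrightarrow> u \<in> X \<Longrightarrow> v \<in> X \<Longrightarrow>
  F u (act (a \<ominus> b) v) = F u (act a v) - F u (act b v)"
  by (simp add: R.minus_eq F_add F_uminus)

lemma F_zero: "u \<in> X \<Longrightarrow> v \<in> X \<Longrightarrow> F u (act \<zero> v) = 0"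
  using F_smult[of e u v 0] by (simp add: smult_0)

lemma F_lincomb: "(\<And>t. t < q \<Longrightarrow> b t \<in> carrier A) \<Longrightarrow> u \<in> X \<Longrightarrow> v \<in> X \<Longrightarrow>
  F u (act (lincomb_upto c b q) v) = (\<Sum>t<q. c t * F u (act (b t) v))"
  by (induction q) (auto simp: F_zero F_add F_smult lincomb_upto_closed)

primrec vsum :: "(nat \<Rightarrow> 'x) \<Rightarrow> nat \<Rightarrow> 'x" where
  "vsum f 0 = vzero"
| "vsum f (Suc m) = vplus (vsum f m) (f m)"

lemma vsum_closed: "(\<And>j. j < m \<Longrightarrow> f j \<in> X) \<Longrightarrow> vsum f m \<in> X"
  by (induction m) (auto simp: vzero vplus)

lemma F_vsum_right: "u \<in> X \<Longrightarrow> (\<And>j. j < m \<Longrightarrow> f j \<in> X) \<Longrightarrow> F u (vsum f m) = (\<Sum>j<m. F u (f j))"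
  by (induction m) (auto simp: F_vzero F_vplus vsum_closed)

lemma F_vsum_left:
  assumes "u \<in> X" "\<And>j. j < m \<Longrightarrow> f j \<in> X"
  shows "F (vsum f m) u = (\<Sum>j<m. F (f j) u)"
proof -
  have "F (vsum f m) u = cnj (\<Sum>j<m. F u (f j))"
    using F_commute[OF assms(1) vsum_closed] F_vsum_right[OF assms(1)] assms(2) by auto
  also have "\<dots> = (\<Sum>j<m. F (f j) u)"
    using assms F_commute[OF assms(1)] by simp
  finally show ?thesis .
qed

text \<open>Completing the square with pivot \<open>H m m = b\<^sup>-\<^sup>1\<close>; the identity itself needs no invertibility.\<close>

lemma complete_square:
  assumes H: "\<And>i j. i < n \<Longrightarrow> j < n \<Longrightarrow> H i j \<in> carrier A" "\<And>i j. i < n \<Longrightarrow> j < n \<Longrightarrow> star A (H i j) = H j i"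
    and b: "b \<in> carrier A" and w: "\<And>i. i < n \<Longrightarrow> w i \<in> X" and m: "m < n"
  defines "y \<equiv> vsum (\<lambda>j. act (H m j) (w j)) n"
  shows "(\<Sum>i<n. \<Sum>j<n. F (w i) (act (H i j) (w j))) =
    (\<Sum>i<n. \<Sum>j<n. F (w i) (act (H i j \<ominus> H i m \<otimes> (b \<otimes> H m j)) (w j))) + F y (act b y)"
proof -
  have fX: "act (H m j) (w j) \<in> X" if "j < n" for j using that H w m act by blast
  have y: "y \<in> X" unfolding y_def by (rule vsum_closed[OF fX])
  have sb: "star A b \<in> carrier A" using b by simp
  have "F y (act b y) = F (act (star A b) y) y" by (rule F_act[OF b y y])
  also have "\<dots> = (\<Sum>j<n. F (act (star A b) y) (act (H m j) (w j)))"
    unfolding y_def by (rule F_vsum_right[OF act[OF sb vsum_closed[OF fX]] fX])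
  also have "\<dots> = (\<Sum>j<n. F y (act b (act (H m j) (w j))))"
    by (intro sum.cong refl) (use F_act[OF b y] fX in simp)
  also have "\<dots> = (\<Sum>j<n. \<Sum>i<n. F (act (H m i) (w i)) (act b (act (H m j) (w j))))"
    unfolding y_def by (intro sum.cong refl F_vsum_left act[OF b] fX) auto
  also have "\<dots> = (\<Sum>j<n. \<Sum>i<n. F (w i) (act (H i m \<otimes> (b \<otimes> H m j)) (w j)))"
  proof (intro sum.cong refl)
    fix j i assume "j \<in> {..<n}" "i \<in> {..<n}"
    then have ij: "j < n" "i < n" by auto
    have "F (w i) (act (H i m \<otimes> (b \<otimes> H m j)) (w j)) = F (w i) (act (H i m) (act b (act (H m j) (w j))))"
      using H(1) b w m ij by (simp add: act_mult act)
    also have "\<dots> = F (act (H m i) (w i)) (act b (act (H m j) (w j)))"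
      using F_act[of "H i m" "w i" "act b (act (H m j) (w j))"] H w m ij fX[OF ij(1)] act[OF b] by simp
    finally show "F (act (H m i) (w i)) (act b (act (H m j) (w j))) = F (w i) (act (H i m \<otimes> (b \<otimes> H m j)) (w j))" ..
  qed
  also have "\<dots> = (\<Sum>i<n. \<Sum>j<n. F (w i) (act (H i m \<otimes> (b \<otimes> H m j)) (w j)))" by (rule sum.swap)
  finally have "F y (act b y) = \<dots>" .
  moreover have "(\<Sum>i<n. \<Sum>j<n. F (w i) (act (H i j \<ominus> H i m \<otimes> (b \<otimes> H m j)) (w j))) =
      (\<Sum>i<n. \<Sum>j<n. F (w i) (act (H i j) (w j))) - (\<Sum>i<n. \<Sum>j<n. F (w i) (act (H i m \<otimes> (b \<otimes> H m j)) (w j)))"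
    unfolding sum_subtractf[symmetric]
    by (intro sum.cong refl F_minus) (use H b w m in auto)
  ultimately show ?thesis by simp
qed

text \<open>When \<open>b\<close> inverts the pivot, row and column \<open>m\<close> of the reduced
  matrix in \<open>complete_square\<close> vanish, and only the smaller block remains.\<close>

lemma schur_complement:
  assumes H: "\<And>i j. i < Suc m \<Longrightarrow> j < Suc m \<Longrightarrow> H i j \<in> carrier A"
      "\<And>i j. i < Suc m \<Longrightarrow> j < Suc m \<Longrightarrow> star A (H i j) = H j i"
    and b: "b \<in> carrier A" "H m m \<otimes> b = e" "b \<otimes> H m m = e" and w: "\<And>i. i < Suc m \<Longrightarrow> w i \<in> X"
  defines "y \<equiv> vsum (\<lambda>j. act (H m j) (w j)) (Suc m)"
  shows "(\<Sum>i<Suc m. \<Sum>j<Suc m. F (w i) (act (H i j) (w j))) =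
    (\<Sum>i<m. \<Sum>j<m. F (w i) (act (H i j \<ominus> H i m \<otimes> (b \<otimes> H m j)) (w j))) + F y (act b y)"
proof -
  let ?K = "\<lambda>i j. H i j \<ominus> H i m \<otimes> (b \<otimes> H m j)"
  have im: "?K i m = \<zero>" if "i < Suc m" for i using H(1)[OF that, of m] b by simp
  have mj: "?K m j = \<zero>" if "j < Suc m" for j
    using H(1)[of m j] H(1)[of m m] b that by (simp flip: mult_assoc)
  have "(\<Sum>i<Suc m. \<Sum>j<Suc m. F (w i) (act (?K i j) (w j))) = (\<Sum>i<m. \<Sum>j<m. F (w i) (act (?K i j) (w j)))"
    using im mj w by (simp add: F_zero)
  then show ?thesis unfolding y_def
    using complete_square[where n = "Suc m" and H = H and w = w and b = b and m = m, OF H b(1) w lessI] by presburger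
qed

text \<open>The real part of the quadratic form sees only the Hermitian part of the coefficients. A
  separating functional yields an arbitrary matrix \<open>Y\<close>, and this makes it
  Hermitian.\<close>

lemma symmetrize:
  assumes Y: "\<And>i j. i < m \<Longrightarrow> j < m \<Longrightarrow> Y i j \<in> carrier A" and w: "\<And>i. i < m \<Longrightarrow> w i \<in> X"
  shows "Re (\<Sum>i<m. \<Sum>j<m. F (w i) (act (Y i j \<oplus> star A (Y j i)) (w j))) =
    2 * Re (\<Sum>i<m. \<Sum>j<m. F (w i) (act (Y i j) (w j)))"
proof -
  have "(\<Sum>i<m. \<Sum>j<m. F (w i) (act (star A (Y j i)) (w j))) = (\<Sum>i<m. \<Sum>j<m. cnj (F (w j) (act (Y j i) (w i))))"
  proof (intro sum.cong refl)
    fix i j assume "i \<in> {..<m}" "j \<in> {..<m}"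
    then have ij: "i < m" "j < m" by auto
    have "F (w i) (act (star A (Y j i)) (w j)) = F (act (Y j i) (w i)) (w j)"
      using F_act[of "star A (Y j i)" "w i" "w j"] Y w ij by (simp add: star_star)
    also have "\<dots> = cnj (F (w j) (act (Y j i) (w i)))" using Y w ij by (intro F_commute act) auto
    finally show "F (w i) (act (star A (Y j i)) (w j)) = cnj (F (w j) (act (Y j i) (w i)))" .
  qed
  also have "\<dots> = cnj (\<Sum>j<m. \<Sum>i<m. F (w j) (act (Y j i) (w i)))"
    by (subst sum.swap) simp
  finally have "Re (\<Sum>i<m. \<Sum>j<m. F (w i) (act (star A (Y j i)) (w j))) = Re (\<Sum>i<m. \<Sum>j<m. F (w i) (act (Y i j) (w j)))"
    by simp
  moreover have "(\<Sum>i<m. \<Sum>j<m. F (w i) (act (Y i j \<oplus> star A (Y j i)) (w j))) =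
      (\<Sum>i<m. \<Sum>j<m. F (w i) (act (Y i j) (w j))) + (\<Sum>i<m. \<Sum>j<m. F (w i) (act (star A (Y j i)) (w j)))"
    unfolding sum.distrib[symmetric] by (intro sum.cong refl F_add) (use Y w in auto)
  ultimately show ?thesis by simp
qed

text \<open>With \<open>a = g g\<close> for a self-adjoint \<open>g\<close>, the value is
  \<open>F\<close> of the vector \<open>act g u\<close> with itself.\<close>

lemma F_act_pos:
  assumes "pos a" "u \<in> X"
  shows "0 \<le> Re (F u (act a u))"
proof -
  obtain g where g: "pos g" "g \<otimes> g = a" by (rule ex_sqrt[OF assms(1)]) (rule that)
  have gc: "g \<in> carrier A" "star A g = g" using posD[OF g(1)] by blast+
  have "F u (act a u) = F (act g u) (act g u)"
    using F_act[OF gc(1) assms(2) act[OF gc(1) assms(2)]] act_mult[OF gc(1) gc(1) assms(2)] gc(2) g(2) by simp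
  then show ?thesis using F_pos[OF act[OF gc(1) assms(2)]] by simp
qed

end

lemma mult_mat_zero_vec: "M \<in> carrier_mat m n \<Longrightarrow> M *\<^sub>v 0\<^sub>v n = 0\<^sub>v m" for M :: "complex mat"
  by (intro eq_vecI) (auto simp: scalar_prod_def)

lemma mult_zero_mat_vec: "v \<in> carrier_vec n \<Longrightarrow> 0\<^sub>m m n *\<^sub>v v = 0\<^sub>v m" for v :: "complex vec"
  by (intro eq_vecI) (auto simp: scalar_prod_def)

lemma mult_mat_vec_uminus: "M \<in> carrier_mat m n \<Longrightarrow> v \<in> carrier_vec n \<Longrightarrow> M *\<^sub>v (- v) = - (M *\<^sub>v v)" for M :: "complex mat"
  by (intro eq_vecI) (auto simp: scalar_prod_def sum_negf)

lemma cstar_module_rep: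
  assumes A: "ucstar A \<one>\<^bsub>A\<^esub>" and \<tau>: "matrix_rep A k \<tau>"
  shows "cstar_module A \<one>\<^bsub>A\<^esub> (carrier_vec k) (+) (0\<^sub>v k) ip (\<lambda>a v. \<tau> a *\<^sub>v v)"
proof -
  interpret ucstar A "\<one>\<^bsub>A\<^esub>" by (rule A)
  note t = matrix_repD[OF \<tau>]
  show ?thesis
  proof (intro cstar_module.intro A cstar_module_axioms.intro)
    fix a b u v w :: _ and c
    show "(0\<^sub>v k :: complex vec) \<in> carrier_vec k" by simp
    show "u \<in> carrier_vec k \<Longrightarrow> v \<in> carrier_vec k \<Longrightarrow> u + v \<in> carrier_vec k" for u v :: "complex vec" by simp
    show "a \<in> carrier A \<Longrightarrow> u \<in> carrier_vec k \<Longrightarrow> \<tau> a *\<^sub>v u \<in> carrier_vec k"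
      using t(3)[of a] by (rule mult_mat_vec_carrier)
    show "u \<in> carrier_vec k \<Longrightarrow> v \<in> carrier_vec k \<Longrightarrow> w \<in> carrier_vec k \<Longrightarrow> ip u (v + w) = ip u v + ip u w" for u v w
      by (rule ip_add_right)
    show "u \<in> carrier_vec k \<Longrightarrow> ip u (0\<^sub>v k) = 0" for u by (simp add: ip_def)
    show "u \<in> carrier_vec k \<Longrightarrow> v \<in> carrier_vec k \<Longrightarrow> ip v u = cnj (ip u v)" for u v by (rule ip_commute)
    show "0 \<le> Re (ip u u)" for u by (simp add: ip_self)
    show "a \<in> carrier A \<Longrightarrow> u \<in> carrier_vec k \<Longrightarrow> v \<in> carrier_vec k \<Longrightarrow> ip u (\<tau> a *\<^sub>v v) = ip (\<tau> (star A a) *\<^sub>v u) v" for u v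
      using ip_adjoint[of "\<tau> a" k k u v] t by simp
    show "a \<in> carrier A \<Longrightarrow> b \<in> carrier A \<Longrightarrow> u \<in> carrier_vec k \<Longrightarrow> \<tau> (a \<otimes>\<^bsub>A\<^esub> b) *\<^sub>v u = \<tau> a *\<^sub>v (\<tau> b *\<^sub>v u)"
      using t(3)[of a] t(3)[of b] by (simp add: t(6) assoc_mult_mat_vec[of _ k k _ k])
    show "a \<in> carrier A \<Longrightarrow> b \<in> carrier A \<Longrightarrow> u \<in> carrier_vec k \<Longrightarrow> v \<in> carrier_vec k \<Longrightarrow>
        ip u (\<tau> (a \<oplus>\<^bsub>A\<^esub> b) *\<^sub>v v) = ip u (\<tau> a *\<^sub>v v) + ip u (\<tau> b *\<^sub>v v)" for u v
      using t(3)[of a] t(3)[of b] by (simp add: t(4) add_mult_distrib_mat_vec[of _ k k] ip_add_right[of _ k])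
    show "a \<in> carrier A \<Longrightarrow> u \<in> carrier_vec k \<Longrightarrow> v \<in> carrier_vec k \<Longrightarrow>
        ip u (\<tau> (c \<odot>\<^bsub>A\<^esub> a) *\<^sub>v v) = c * ip u (\<tau> a *\<^sub>v v)" for u v
      using t(3)[of a] by (simp add: t(5) smult_mat_vec[of _ k k] ip_smult_right[of _ k])
    show "u \<in> carrier_vec k \<Longrightarrow> \<tau> \<one>\<^bsub>A\<^esub> *\<^sub>v u = u" by (simp add: t(2))
  qed
qed

text \<open>\<open>B\<close> acts by left multiplication through \<open>\<sigma>\<close>: the GNS
  module of \<open>\<phi>\<close>, restricted to \<open>B\<close>. It will be used for both algebras
  of the amalgam.\<close>

lemma (in ucstar_functional) cstar_module_functional:
  assumes B: "ucstar B e'" and \<sigma>: "star_hom B A \<sigma>" and one: "\<sigma> e' = e"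
  shows "cstar_module B e' (carrier A) (add A) (zero A) form (\<lambda>b x. \<sigma> b \<otimes> x)"
proof -
  note h = star_homD[OF \<sigma>]
  show ?thesis
    by (intro cstar_module.intro B cstar_module_axioms.intro)
       (auto simp: h one form_add_right form_zero_right form_self(1) form_mult_left distrib_right star_star
          smult_mult_left form_smult_right mult_assoc intro: form_commute)
qed

section \<open>Positivity tested on the coordinates\<close>

text \<open>What is retained of an embedding into a product of matrix algebras: unital coordinates
  that are jointly injective.\<close>

locale separated_cstar = ucstar A "\<one>\<^bsub>A\<^esub>" for A :: "'a cstar" (structure) +
  fixes k :: "nat \<Rightarrow> nat" and \<rho> :: "nat \<Rightarrow> 'a \<Rightarrow> complex mat"
  assumes rep: "matrix_rep A (k n) (\<rho> n)"
    and separating: "x \<in> carrier A \<Longrightarrow> (\<And>n. \<rho> n x = 0\<^sub>m (k n) (k n)) \<Longrightarrow> x = \<zero>"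
begin

text \<open>With \<open>a = |h|\<close>, every \<open>\<rho> n\<close> sends \<open>h\<close> and \<open>a\<close> to positive matrices with the same square,
  hence to the same matrix.\<close>

lemma pos_reflect:
  assumes h: "h \<in> carrier A" "star A h = h"
    and p: "\<And>n v. v \<in> carrier_vec (k n) \<Longrightarrow> 0 \<le> Re (ip v (\<rho> n h *\<^sub>v v))"
  shows "pos h"
proof -
  obtain a where a: "pos a" "a \<otimes> a = h \<otimes> h"
    "\<And>b. b \<in> carrier A \<Longrightarrow> b \<otimes> (h \<otimes> h) = (h \<otimes> h) \<otimes> b \<Longrightarrow> b \<otimes> a = a \<otimes> b"
    by (rule ex_sqrt[OF pos_square[OF h]]) (rule that)
  have ac: "a \<in> carrier A" "star A a = a" using posD[OF a(1)] by blast+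
  have ha: "h \<otimes> a = a \<otimes> h" by (rule a(3)) (use h in \<open>simp_all add: mult_assoc\<close>)
  obtain g where g: "pos g" "g \<otimes> g = a" by (rule ex_sqrt[OF a(1)]) (rule that)
  have gc: "g \<in> carrier A" "star A g = g" using posD[OF g(1)] by blast+
  define d where "d = a \<ominus> h"
  have d: "d \<in> carrier A" "star A d = d" using ac h by (simp_all add: d_def star_minus)
  \<comment> \<open>For \<open>x\<close> in the range of \<open>\<rho> n d\<close> this makes the
    nonnegative numbers \<open>ip x (a x)\<close> and \<open>ip x (h x)\<close> add up to 0. Then
    \<open>a\<close> kills \<open>x\<close>, therefore also \<open>h\<close>, and so
    \<open>d\<close> kills its own range.\<close>
  have ahd: "(a \<oplus> h) \<otimes> d = \<zero>" unfolding d_def using ac(1) h(1) a(2) ha by algebra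
  have "\<rho> n d = 0\<^sub>m (k n) (k n)" for n
  proof -
    interpret M: cstar_module A "\<one>" "carrier_vec (k n)" "(+)" "0\<^sub>v (k n)" ip "\<lambda>a v. \<rho> n a *\<^sub>v v"
      by (rule cstar_module_rep[OF ucstar_axioms rep])
    note t = matrix_repD[OF rep[of n]]
    have *: "\<rho> n d *\<^sub>v (\<rho> n d *\<^sub>v v) = 0\<^sub>v (k n)" if v: "v \<in> carrier_vec (k n)" for v
    proof -
      define x where "x = \<rho> n d *\<^sub>v v"
      have x: "x \<in> carrier_vec (k n)" unfolding x_def using M.act[OF d(1) v] .
      have "ip x (\<rho> n ((a \<oplus> h) \<otimes> d) *\<^sub>v v) = ip x (\<rho> n (a \<oplus> h) *\<^sub>v x)"
        using M.act_mult[of "a \<oplus> h" d v] ac h d v by (simp add: x_def)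
      also have "\<dots> = ip x (\<rho> n a *\<^sub>v x) + ip x (\<rho> n h *\<^sub>v x)" using M.F_add[OF ac(1) h(1) x x] .
      finally have s: "ip x (\<rho> n a *\<^sub>v x) + ip x (\<rho> n h *\<^sub>v x) = 0" using M.F_zero[OF x v] by (simp add: ahd)
      have gx: "\<rho> n g *\<^sub>v x \<in> carrier_vec (k n)" using M.act[OF gc(1) x] .
      have agx: "\<rho> n a *\<^sub>v x = \<rho> n g *\<^sub>v (\<rho> n g *\<^sub>v x)" using M.act_mult[OF gc(1) gc(1) x] by (simp add: g(2))
      then have "ip x (\<rho> n a *\<^sub>v x) = ip (\<rho> n g *\<^sub>v x) (\<rho> n g *\<^sub>v x)"
        using M.F_act[OF gc(1) x gx] gc(2) by simp
      then have "Re (ip (\<rho> n g *\<^sub>v x) (\<rho> n g *\<^sub>v x)) + Re (ip x (\<rho> n h *\<^sub>v x)) = 0"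
        using arg_cong[OF s, of Re] by simp
      then have "(vec_l2 (\<rho> n g *\<^sub>v x))\<^sup>2 \<le> 0" using p[OF x] unfolding ip_self Re_complex_of_real by linarith
      then have "\<rho> n g *\<^sub>v x = 0\<^sub>v (k n)" using vec_l2_eq_0[OF gx] by simp
      then have a0: "\<rho> n a *\<^sub>v x = 0\<^sub>v (k n)" using agx mult_mat_zero_vec[OF t(3)[OF gc(1)]] by simp
      have "0\<^sub>v (k n) = \<rho> n ((a \<oplus> h) \<otimes> d) *\<^sub>v v"
        using v matrix_repD(5)[OF rep[of n] e_closed, of 0] unfolding ahd
        by (intro eq_vecI) (auto simp: smult_0 t(2) scalar_prod_def)
      also have "\<dots> = \<rho> n (a \<oplus> h) *\<^sub>v x"
        using M.act_mult[of "a \<oplus> h" d v] ac h d v by (simp add: x_def)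
      also have "\<dots> = \<rho> n a *\<^sub>v x + \<rho> n h *\<^sub>v x"
        using t(3)[OF ac(1)] t(3)[OF h(1)] x by (simp add: t(4)[OF ac(1) h(1)] add_mult_distrib_mat_vec)
      finally have h0: "\<rho> n h *\<^sub>v x = 0\<^sub>v (k n)" using a0 M.act[OF h(1) x] by simp
      have "\<rho> n d *\<^sub>v x = \<rho> n a *\<^sub>v x - \<rho> n h *\<^sub>v x"
        using matrix_rep_minus[OF cstar_algebra_axioms rep[of n] ac(1) h(1)] t(3)[OF ac(1)] t(3)[OF h(1)] x
        by (simp add: d_def minus_mult_distrib_mat_vec)
      then show ?thesis unfolding x_def[symmetric] by (simp add: a0 h0)
    qed
    show ?thesis
    proof (rule mat_eqI_vec[OF t(3)[OF d(1)]])
      fix v :: "complex vec" assume v: "v \<in> carrier_vec (k n)"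
      note dv = M.act[OF d(1) v]
      have "ip (\<rho> n d *\<^sub>v v) (\<rho> n d *\<^sub>v v) = ip v (\<rho> n d *\<^sub>v (\<rho> n d *\<^sub>v v))"
        using M.F_act[OF d(1) v dv] d(2) by simp
      also have "\<dots> = 0" unfolding *[OF v] by (rule M.F_vzero[OF v])
      finally have "\<rho> n d *\<^sub>v v = 0\<^sub>v (k n)" using vec_l2_eq_0[OF dv] by (simp add: ip_self)
      then show "\<rho> n d *\<^sub>v v = 0\<^sub>m (k n) (k n) *\<^sub>v v" using v by (simp add: mult_zero_mat_vec)
    qed simp
  qed
  then have "d = \<zero>" by (rule separating[OF d(1)])
  then show ?thesis using a(1) ac h by (simp add: d_def)
qed

text \<open>Induction by Schur complements. In every coordinate the pivot is at least
  \<open>d\<close>, so \<open>pos_reflect\<close> and \<open>pos_inverse\<close> invert it inside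
  \<open>A\<close>, and the complement satisfies the hypotheses again with the same
  \<open>d\<close>. Positivity of an operator matrix thus passes from the coordinates to any module
  while only single elements of \<open>A\<close> are handled, never matrices over
  \<open>A\<close>.\<close>

theorem matrix_positivity:
  fixes m :: nat and H :: "nat \<Rightarrow> nat \<Rightarrow> 'a"
  assumes M: "cstar_module A \<one> X vplus vzero F act"
    and H: "\<And>i j. i < m \<Longrightarrow> j < m \<Longrightarrow> H i j \<in> carrier A" "\<And>i j. i < m \<Longrightarrow> j < m \<Longrightarrow> star A (H i j) = H j i"
    and d: "d > 0"
    and p: "\<And>n w. (\<And>i. i < m \<Longrightarrow> w i \<in> carrier_vec (k n)) \<Longrightarrow>
        d * (\<Sum>i<m. (vec_l2 (w i))\<^sup>2) \<le> Re (\<Sum>i<m. \<Sum>j<m. ip (w i) (\<rho> n (H i j) *\<^sub>v w j))"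
    and v: "\<And>i. i < m \<Longrightarrow> v i \<in> X"
  shows "0 \<le> Re (\<Sum>i<m. \<Sum>j<m. F (v i) (act (H i j) (v j)))"
  using H p v
proof (induction m arbitrary: H v)
  case 0
  then show ?case by simp
next
  case (Suc m)
  interpret M: cstar_module A "\<one>" X vplus vzero F act by (rule M)
  note Hc = Suc.prems(1) and Hs = Suc.prems(2) and p = Suc.prems(3) and v = Suc.prems(4)
  let ?a = "H m m"
  have a: "?a \<in> carrier A" "star A ?a = ?a" using Hc Hs by auto
  have pd: "pos (?a \<ominus> of_real d \<odot> \<one>)"
  proof (rule pos_reflect)
    show "?a \<ominus> of_real d \<odot> \<one> \<in> carrier A" "star A (?a \<ominus> of_real d \<odot> \<one>) = ?a \<ominus> of_real d \<odot> \<one>"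
      using a by (simp_all add: star_minus star_smult)
    fix n and u :: "complex vec" assume u: "u \<in> carrier_vec (k n)"
    interpret N: cstar_module A "\<one>" "carrier_vec (k n)" "(+)" "0\<^sub>v (k n)" ip "\<lambda>a v. \<rho> n a *\<^sub>v v"
      by (rule cstar_module_rep[OF ucstar_axioms rep])
    \<comment> \<open>A family concentrated at the index \<open>m\<close> tests the pivot
      alone.\<close>
    define w where "w i = (if i = m then u else 0\<^sub>v (k n))" for i
    have w: "w i \<in> carrier_vec (k n)" for i using u by (simp add: w_def)
    have z0: "ip (0\<^sub>v (k n)) x = 0" for x by (simp add: ip_def)
    have z: "\<rho> n (H i j) *\<^sub>v 0\<^sub>v (k n) = 0\<^sub>v (k n)"
      if "i < Suc m" "j < Suc m" for i j
      using mult_mat_zero_vec[OF matrix_repD(3)[OF rep[of n] Hc[OF that]]] by simp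
    have "(\<Sum>i<Suc m. (vec_l2 (w i))\<^sup>2) = (vec_l2 u)\<^sup>2" by (simp add: w_def vec_l2_zero)
    moreover have "(\<Sum>i<Suc m. \<Sum>j<Suc m. ip (w i) (\<rho> n (H i j) *\<^sub>v w j)) = ip u (\<rho> n ?a *\<^sub>v u)"
      using u by (simp add: w_def z0 z N.F_vzero)
    ultimately have "d * (vec_l2 u)\<^sup>2 \<le> Re (ip u (\<rho> n ?a *\<^sub>v u))" using p[of w n] w by simp
    moreover have "ip u (\<rho> n (?a \<ominus> of_real d \<odot> \<one>) *\<^sub>v u) = ip u (\<rho> n ?a *\<^sub>v u) - of_real d * ip u u"
      using N.F_minus[OF a(1) smult_closed'[OF e_closed] u u, of "of_real d"] N.F_smult[OF e_closed u u] N.act_e[OF u] by simp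
    ultimately show "0 \<le> Re (ip u (\<rho> n (?a \<ominus> of_real d \<odot> \<one>) *\<^sub>v u))" by (simp add: ip_self)
  qed
  obtain b where b: "b \<in> carrier A" "star A b = b" "?a \<otimes> b = \<one>" "b \<otimes> ?a = \<one>"
    by (rule pos_inverse[OF a(1) d pd]) (rule that)
  let ?K = "\<lambda>i j. H i j \<ominus> H i m \<otimes> (b \<otimes> H m j)"
  have Kc: "?K i j \<in> carrier A" if "i < m" "j < m" for i j using Hc[of i j] Hc[of i m] Hc[of m j] b that by simp
  have Ks: "star A (?K i j) = ?K j i" if "i < m" "j < m" for i j
    using Hc[of i j] Hc[of i m] Hc[of m j] Hc[of j m] Hc[of m i] Hs[of i j] Hs[of i m] Hs[of m j] b that
    by (simp add: star_minus star_mult mult_assoc)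
  have Kp: "d * (\<Sum>i<m. (vec_l2 (w i))\<^sup>2) \<le> Re (\<Sum>i<m. \<Sum>j<m. ip (w i) (\<rho> n (?K i j) *\<^sub>v w j))"
    if w: "\<And>i. i < m \<Longrightarrow> w i \<in> carrier_vec (k n)" for n w
  proof -
    interpret N: cstar_module A "\<one>" "carrier_vec (k n)" "(+)" "0\<^sub>v (k n)" ip "\<lambda>a v. \<rho> n a *\<^sub>v v"
      by (rule cstar_module_rep[OF ucstar_axioms rep])
    define s where "s = N.vsum (\<lambda>j. \<rho> n (H m j) *\<^sub>v w j) m"
    have s: "s \<in> carrier_vec (k n)" unfolding s_def using Hc w by (intro N.vsum_closed N.act) auto
    \<comment> \<open>The last entry makes the completed square vanish, so that the form of
      \<open>H\<close> at \<open>w'\<close> equals the form of the Schur complement at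
      \<open>w\<close>.\<close>
    define w' where "w' i = (if i < m then w i else - (\<rho> n b *\<^sub>v s))" for i
    have bs: "\<rho> n b *\<^sub>v s \<in> carrier_vec (k n)" using N.act[OF b(1) s] .
    have w': "w' i \<in> carrier_vec (k n)" for i using w bs by (simp add: w'_def)
    have "N.vsum (\<lambda>j. \<rho> n (H m j) *\<^sub>v w' j) q = N.vsum (\<lambda>j. \<rho> n (H m j) *\<^sub>v w j) q" if "q \<le> m" for q
      using that by (induction q) (simp_all add: w'_def)
    then have "N.vsum (\<lambda>j. \<rho> n (H m j) *\<^sub>v w' j) (Suc m) = s + \<rho> n ?a *\<^sub>v (- (\<rho> n b *\<^sub>v s))"
      by (simp add: s_def w'_def)
    also have "\<rho> n ?a *\<^sub>v (- (\<rho> n b *\<^sub>v s)) = - s"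
      using N.act_mult[OF a(1) b(1) s] N.act_e[OF s] matrix_repD(3)[OF rep[of n] a(1)] bs
      by (simp add: b(3) mult_mat_vec_uminus)
    also have "s + - s = 0\<^sub>v (k n)" using s by simp
    finally have y: "N.vsum (\<lambda>j. \<rho> n (H m j) *\<^sub>v w' j) (Suc m) = 0\<^sub>v (k n)" .
    have "(\<Sum>i<Suc m. \<Sum>j<Suc m. ip (w' i) (\<rho> n (H i j) *\<^sub>v w' j)) =
        (\<Sum>i<m. \<Sum>j<m. ip (w' i) (\<rho> n (?K i j) *\<^sub>v w' j)) + ip (0\<^sub>v (k n)) (\<rho> n b *\<^sub>v 0\<^sub>v (k n))"
      using N.schur_complement[where H = H and w = w' and m = m and b = b, OF Hc Hs b(1,3,4) w'] unfolding y .
    also have "\<dots> = (\<Sum>i<m. \<Sum>j<m. ip (w i) (\<rho> n (?K i j) *\<^sub>v w j))"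
      by (simp add: w'_def ip_def[of "0\<^sub>v (k n)"])
    finally have "Re (\<Sum>i<m. \<Sum>j<m. ip (w i) (\<rho> n (?K i j) *\<^sub>v w j)) \<ge> d * (\<Sum>i<Suc m. (vec_l2 (w' i))\<^sup>2)"
      using p[of w' n] w' by simp
    moreover have "(\<Sum>i<m. (vec_l2 (w i))\<^sup>2) \<le> (\<Sum>i<Suc m. (vec_l2 (w' i))\<^sup>2)"
      by (simp add: w'_def)
    ultimately show ?thesis using d mult_left_mono[of "\<Sum>i<m. (vec_l2 (w i))\<^sup>2" "\<Sum>i<Suc m. (vec_l2 (w' i))\<^sup>2" d] by linarith
  qed
  have "0 \<le> Re (\<Sum>i<m. \<Sum>j<m. F (v i) (act (?K i j) (v j)))"
    using v by (intro Suc.IH[of ?K v, OF Kc Ks Kp]) auto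
  moreover define y where "y = M.vsum (\<lambda>j. act (H m j) (v j)) (Suc m)"
  have y: "y \<in> X" unfolding y_def using Hc v by (intro M.vsum_closed M.act) auto
  have "(\<Sum>i<Suc m. \<Sum>j<Suc m. F (v i) (act (H i j) (v j))) =
      (\<Sum>i<m. \<Sum>j<m. F (v i) (act (?K i j) (v j))) + F y (act b y)"
    unfolding y_def by (rule M.schur_complement[where H = H and w = v and m = m and b = b, OF Hc Hs b(1,3,4) v])
  moreover have "0 \<le> Re (F y (act b y))"
  proof -
    \<comment> \<open>Since \<open>b\<close> inverts the pivot, \<open>F y (act b y)\<close> is the
      value of the positive pivot at the vector \<open>act b y\<close>.\<close>
    have "pos ((?a \<ominus> of_real d \<odot> \<one>) \<oplus> of_real d \<odot> \<one>)"
      using d by (intro pos_add pd) (simp add: pos_sc_iff)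
    then have "pos ?a" using a(1) by (simp add: minus_plus)
    then have "0 \<le> Re (F (act b y) (act ?a (act b y)))" using M.F_act_pos[OF _ M.act[OF b(1) y]] by blast
    moreover have "F (act b y) (act ?a (act b y)) = F (act b y) y"
      using M.act_mult[OF a(1) b(1) y] M.act_e[OF y] by (simp add: b(3))
    moreover have "F (act b y) y = F y (act b y)" using M.F_act[OF b(1) y y] b(2) by simp
    ultimately show ?thesis by simp
  qed
  ultimately show ?case by simp
qed

end

section \<open>Approximation of Gram matrices\<close>

lemma sum_lessThan_add: "(\<Sum>i<m + n. f i) = (\<Sum>i<m. f i) + (\<Sum>i<n. f (m + i))" for f :: "nat \<Rightarrow> complex"
  by (induction n) (simp_all add: add.assoc)

lemma ip_append:
  assumes "u \<in> carrier_vec m" "u' \<in> carrier_vec m" "v \<in> carrier_vec n" "v' \<in> carrier_vec n"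
  shows "ip (u @\<^sub>v v) (u' @\<^sub>v v') = ip u u' + ip v v'"
proof -
  have "ip (u @\<^sub>v v) (u' @\<^sub>v v') = (\<Sum>i<m + n. cnj ((u @\<^sub>v v) $ i) * (u' @\<^sub>v v') $ i)"
    using assms by (simp add: ip_def)
  also have "\<dots> = (\<Sum>i<m. cnj (u $ i) * u' $ i) + (\<Sum>i<n. cnj (v $ i) * v' $ i)"
    unfolding sum_lessThan_add using assms by (intro arg_cong2[of _ _ _ _ "(+)"] sum.cong) auto
  finally show ?thesis using assms by (simp add: ip_def)
qed

definition dsum :: "complex mat \<Rightarrow> complex mat \<Rightarrow> complex mat" where
  "dsum M N = four_block_mat M (0\<^sub>m (dim_row M) (dim_col N)) (0\<^sub>m (dim_row N) (dim_col M)) N"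

lemma dsum_carrier [simp]: "M \<in> carrier_mat m m \<Longrightarrow> N \<in> carrier_mat n n \<Longrightarrow> dsum M N \<in> carrier_mat (m + n) (m + n)"
  by (simp add: dsum_def)

lemma dsum_mult_vec:
  assumes "M \<in> carrier_mat m m" "N \<in> carrier_mat n n" "u \<in> carrier_vec m" "v \<in> carrier_vec n"
  shows "dsum M N *\<^sub>v (u @\<^sub>v v) = (M *\<^sub>v u) @\<^sub>v (N *\<^sub>v v)"
proof -
  have "dsum M N *\<^sub>v (u @\<^sub>v v) = (M *\<^sub>v u + 0\<^sub>m m n *\<^sub>v v) @\<^sub>v (0\<^sub>m n m *\<^sub>v u + N *\<^sub>v v)"
    unfolding dsum_def using assms by (subst four_block_mat_mult_vec[of _ m m _ n _ n]) auto
  then show ?thesis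
    using assms mult_mat_vec_carrier[OF assms(1,3)] mult_mat_vec_carrier[OF assms(2,4)]
    by (simp add: mult_zero_mat_vec)
qed

lemma matrix_rep_dsum:
  assumes \<tau>: "matrix_rep A m \<tau>" and \<tau>': "matrix_rep A n \<tau>'"
  shows "matrix_rep A (m + n) (\<lambda>a. dsum (\<tau> a) (\<tau>' a))"
proof -
  note t = matrix_repD[OF \<tau>] and t' = matrix_repD[OF \<tau>']
  have "star_hom A (mat_cstar (m + n)) (\<lambda>a. dsum (\<tau> a) (\<tau>' a))"
    unfolding star_hom_def
  proof (intro conjI ballI allI)
    show "(\<lambda>a. dsum (\<tau> a) (\<tau>' a)) \<in> carrier A \<rightarrow> carrier (mat_cstar (m + n))"
      using t(3) t'(3) by auto
    fix x y assume x: "x \<in> carrier A" and y: "y \<in> carrier A"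
    have c: "\<tau> x \<in> carrier_mat m m" "\<tau> y \<in> carrier_mat m m" "\<tau>' x \<in> carrier_mat n n" "\<tau>' y \<in> carrier_mat n n"
      using t(3) t'(3) x y by auto
    show "dsum (\<tau> (x \<oplus>\<^bsub>A\<^esub> y)) (\<tau>' (x \<oplus>\<^bsub>A\<^esub> y)) = dsum (\<tau> x) (\<tau>' x) \<oplus>\<^bsub>mat_cstar (m + n)\<^esub> dsum (\<tau> y) (\<tau>' y)"
      unfolding dsum_def t(4)[OF x y] t'(4)[OF x y] mat_cstar_simps using c
      by (subst add_four_block_mat[of _ m m _ n _ n]) auto
    show "dsum (\<tau> (x \<otimes>\<^bsub>A\<^esub> y)) (\<tau>' (x \<otimes>\<^bsub>A\<^esub> y)) = dsum (\<tau> x) (\<tau>' x) \<otimes>\<^bsub>mat_cstar (m + n)\<^esub> dsum (\<tau> y) (\<tau>' y)"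
      unfolding dsum_def t(6)[OF x y] t'(6)[OF x y] mat_cstar_simps using c
      by (subst mult_four_block_mat[of _ m m _ n _ n _ _ m _ n]) auto
  next
    fix c x assume x: "x \<in> carrier A"
    have cx: "\<tau> x \<in> carrier_mat m m" "\<tau>' x \<in> carrier_mat n n" using t(3) t'(3) x by auto
    show "dsum (\<tau> (c \<odot>\<^bsub>A\<^esub> x)) (\<tau>' (c \<odot>\<^bsub>A\<^esub> x)) = c \<odot>\<^bsub>mat_cstar (m + n)\<^esub> dsum (\<tau> x) (\<tau>' x)"
      unfolding dsum_def t(5)[OF x] t'(5)[OF x] mat_cstar_simps using cx
      by (subst smult_four_block_mat[of _ m m _ n _ n]) auto
    show "dsum (\<tau> (star A x)) (\<tau>' (star A x)) = star (mat_cstar (m + n)) (dsum (\<tau> x) (\<tau>' x))"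
      unfolding dsum_def t(7)[OF x] t'(7)[OF x] mat_cstar_simps using cx
      by (intro eq_matI) (auto simp: carrier_matD[OF cx(1)] carrier_matD[OF cx(2)])
  qed
  then show ?thesis using t(1,2) t'(1,2) by (simp add: matrix_rep_def dsum_def)
qed

text \<open>The Gram arrays realized by admissible representations form a convex cone: direct sums
  add them, and scaling the vectors by \<open>sqrt t\<close> scales them by \<open>t\<close>. If the
  target stayed away from the cone, the separating functional would be a matrix \<open>Y\<close> of
  elements of \<open>A\<close> whose form has nonnegative real part in all coordinates and negative
  real part on \<open>v\<close>, which \<open>matrix_positivity\<close> forbids. \<open>P\<close>
  carries a property along direct sums; later this is the existence of a partner on the other
  algebra.\<close>

theorem (in separated_cstar) gram_approx:
  fixes m r :: nat and a :: "nat \<Rightarrow> 'a" and v :: "nat \<Rightarrow> 'x" and P :: "nat \<Rightarrow> ('a \<Rightarrow> complex mat) \<Rightarrow> bool"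
  assumes M: "cstar_module A \<one> X vplus vzero F act"
    and P: "\<And>N \<tau>. P N \<tau> \<Longrightarrow> matrix_rep A N \<tau>" "\<And>n. P (k n) (\<rho> n)"
      "\<And>N \<tau> N' \<tau>'. P N \<tau> \<Longrightarrow> P N' \<tau>' \<Longrightarrow> P (N + N') (\<lambda>a. dsum (\<tau> a) (\<tau>' a))"
    and v: "\<And>i. i < m \<Longrightarrow> v i \<in> X" and a: "\<And>s. s < r \<Longrightarrow> a s \<in> carrier A" and e: "\<epsilon> > 0"
  obtains N \<tau> w where "P N \<tau>" "\<And>i. w i \<in> carrier_vec N"
    "\<And>i j s. i < m \<Longrightarrow> j < m \<Longrightarrow> s < r \<Longrightarrow> cmod (ip (w i) (\<tau> (a s) *\<^sub>v w j) - F (v i) (act (a s) (v j))) < \<epsilon>"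
proof -
  interpret M: cstar_module A "\<one>" X vplus vzero F act by (rule M)
  define gram where "gram \<tau> w = (\<lambda>(i, j, s). ip (w i) (\<tau> (a s) *\<^sub>v w j))" for \<tau> :: "'a \<Rightarrow> complex mat" and w :: "nat \<Rightarrow> complex vec"
  define K where "K = {\<kappa>. \<exists>N \<tau> w. P N \<tau> \<and> (\<forall>i. w i \<in> carrier_vec N) \<and> (\<forall>i j s. s < r \<longrightarrow> \<kappa> (i, j, s) = gram \<tau> w (i, j, s))}"
  have KI: "\<kappa> \<in> K" if "P N \<tau>" "\<And>i. w i \<in> carrier_vec N" "\<And>i j s. s < r \<Longrightarrow> \<kappa> (i, j, s) = gram \<tau> w (i, j, s)"
    for \<kappa> N \<tau> w
    unfolding K_def mem_Collect_eq by (rule exI[of _ N], rule exI[of _ \<tau>], rule exI[of _ w]) (simp add: that)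
  define g where "g = (\<lambda>(i, j, s). F (v i) (act (a s) (v j)))"
  let ?I = "{..<m} \<times> {..<m} \<times> {..<r}"
  have "\<exists>\<kappa>\<in>K. (\<Sum>x\<in>?I. cmod (g x - \<kappa> x)) < \<epsilon>"
  proof (rule ccontr)
    assume "\<not> ?thesis"
    then have far: "\<epsilon> \<le> (\<Sum>x\<in>?I. cmod (g x - \<kappa> x))" if "\<kappa> \<in> K" for \<kappa> using that by force
    have finI: "finite ?I" by simp
    have K0: "(\<lambda>_. 0) \<in> K"
    proof -
      have "gram (\<rho> 0) (\<lambda>_. 0\<^sub>v (k 0)) (i, j, s) = 0" for i j s by (simp add: gram_def ip_def)
      then show ?thesis by (intro KI[OF P(2)[of 0], of "\<lambda>_. 0\<^sub>v (k 0)"]) auto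
    qed
    have Kadd: "(\<lambda>i. \<kappa> i + \<eta> i) \<in> K" if "\<kappa> \<in> K" "\<eta> \<in> K" for \<kappa> \<eta>
    proof -
      obtain N \<tau> w where 1: "P N \<tau>" "\<And>i. w i \<in> carrier_vec N" "\<And>i j s. s < r \<Longrightarrow> \<kappa> (i, j, s) = gram \<tau> w (i, j, s)"
        using \<open>\<kappa> \<in> K\<close> unfolding K_def by blast
      obtain N' \<tau>' w' where 2: "P N' \<tau>'" "\<And>i. w' i \<in> carrier_vec N'" "\<And>i j s. s < r \<Longrightarrow> \<eta> (i, j, s) = gram \<tau>' w' (i, j, s)"
        using \<open>\<eta> \<in> K\<close> unfolding K_def by blast
      have "gram (\<lambda>a. dsum (\<tau> a) (\<tau>' a)) (\<lambda>i. w i @\<^sub>v w' i) (i, j, s) = gram \<tau> w (i, j, s) + gram \<tau>' w' (i, j, s)"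
        if s: "s < r" for i j s
      proof -
        have t: "\<tau> (a s) \<in> carrier_mat N N" "\<tau>' (a s) \<in> carrier_mat N' N'"
          using matrix_repD(3)[OF P(1)[OF 1(1)] a[OF s]] matrix_repD(3)[OF P(1)[OF 2(1)] a[OF s]] .
        show ?thesis
          unfolding gram_def prod.case dsum_mult_vec[OF t 1(2) 2(2)]
          by (rule ip_append[OF 1(2) mult_mat_vec_carrier[OF t(1) 1(2)] 2(2) mult_mat_vec_carrier[OF t(2) 2(2)]])
      qed
      then show ?thesis
        by (intro KI[OF P(3)[OF 1(1) 2(1)], of "\<lambda>i. w i @\<^sub>v w' i"]) (simp_all add: 1(2,3) 2(2,3))
    qed
    have Ksc: "(\<lambda>i. of_real t * \<kappa> i) \<in> K" if "t > 0" "\<kappa> \<in> K" for t \<kappa>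
    proof -
      obtain N \<tau> w where 1: "P N \<tau>" "\<And>i. w i \<in> carrier_vec N" "\<And>i j s. s < r \<Longrightarrow> \<kappa> (i, j, s) = gram \<tau> w (i, j, s)"
        using \<open>\<kappa> \<in> K\<close> unfolding K_def by blast
      let ?c = "complex_of_real (sqrt t)"
      have "gram \<tau> (\<lambda>i. ?c \<cdot>\<^sub>v w i) (i, j, s) = of_real t * gram \<tau> w (i, j, s)" if s: "s < r" for i j s
      proof -
        have t: "\<tau> (a s) \<in> carrier_mat N N" using matrix_repD(3)[OF P(1)[OF 1(1)] a[OF s]] .
        have "?c * ?c = of_real t" using \<open>t > 0\<close> by (simp flip: of_real_mult)
        then show ?thesis
          unfolding gram_def prod.case mult_mat_vec[OF t 1(2)]
          using ip_smult_left[OF 1(2), of "?c \<cdot>\<^sub>v (\<tau> (a s) *\<^sub>v w j)" ?c i] ip_smult_right[OF 1(2) mult_mat_vec_carrier[OF t 1(2)]]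
            mult_mat_vec_carrier[OF t 1(2)[of j]] by (simp flip: mult.assoc)
      qed
      then show ?thesis by (intro KI[OF 1(1), of "\<lambda>i. ?c \<cdot>\<^sub>v w i"]) (simp_all add: 1(2,3))
    qed
    obtain c where c: "\<And>\<kappa>. \<kappa> \<in> K \<Longrightarrow> 0 \<le> Re (\<Sum>x\<in>?I. c x * \<kappa> x)" and cg: "Re (\<Sum>x\<in>?I. c x * g x) < 0"
      by (rule cone_separation[OF finI K0 Kadd Ksc e far]) (assumption+, rule that)
    define Y where "Y i j = lincomb_upto (\<lambda>s. c (i, j, s)) a r" for i j
    have Y: "Y i j \<in> carrier A" for i j unfolding Y_def using a by (rule lincomb_upto_closed)
    have sumI: "(\<Sum>x\<in>?I. f x) = (\<Sum>i<m. \<Sum>j<m. \<Sum>s<r. f (i, j, s))" for f :: "nat \<times> nat \<times> nat \<Rightarrow> complex"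
      by (simp add: sum.cartesian_product case_prod_unfold)
    have cgY: "(\<Sum>x\<in>?I. c x * g x) = (\<Sum>i<m. \<Sum>j<m. F (v i) (act (Y i j) (v j)))"
      unfolding sumI Y_def using v a by (intro sum.cong refl) (simp add: M.F_lincomb g_def)
    define N where "N = (\<Sum>i<m. Re (F (v i) (v i)))"
    have main: "0 \<le> 2 * Re (\<Sum>x\<in>?I. c x * g x) + d * N" if d: "d > 0" for d
    proof -
      \<comment> \<open>Twice the Hermitian part of \<open>Y\<close>, with \<open>d\<close> on the
        diagonal to provide the strict lower bound that \<open>matrix_positivity\<close> asks
        for.\<close>
      define H where "H i j = (Y i j \<oplus> star A (Y j i)) \<oplus> (if i = j then of_real d \<odot> \<one> else \<zero>)" for i j
      have H: "H i j \<in> carrier A" "star A (H i j) = H j i" for i j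
        using Y by (auto simp: H_def star_add star_star star_smult star_zero R.add.m_comm)
      have expand: "Re (\<Sum>i<m. \<Sum>j<m. F' (x i) (act' (H i j) (x j))) =
          2 * Re (\<Sum>i<m. \<Sum>j<m. F' (x i) (act' (Y i j) (x j))) + d * (\<Sum>i<m. Re (F' (x i) (x i)))"
        if M': "cstar_module A \<one> X' vplus' vzero' F' act'" and x: "\<And>i. i < m \<Longrightarrow> x i \<in> X'"
        for X' :: "'y set" and vplus' vzero' F' act' x
      proof -
        interpret M': cstar_module A "\<one>" X' vplus' vzero' F' act' by (rule M')
        have "F' (x i) (act' (H i j) (x j)) = F' (x i) (act' (Y i j \<oplus> star A (Y j i)) (x j)) +
            (if i = j then of_real d * F' (x i) (x i) else 0)" if "i < m" "j < m" for i j
          unfolding H_def using x that Y by (auto simp: M'.F_add M'.F_smult M'.act_e M'.F_zero)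
        then have "(\<Sum>i<m. \<Sum>j<m. F' (x i) (act' (H i j) (x j))) =
            (\<Sum>i<m. \<Sum>j<m. F' (x i) (act' (Y i j \<oplus> star A (Y j i)) (x j))) + (\<Sum>i<m. of_real d * F' (x i) (x i))"
          by (simp add: sum.distrib)
        moreover have "Re (\<Sum>i<m. of_real d * F' (x i) (x i)) = d * (\<Sum>i<m. Re (F' (x i) (x i)))"
          by (simp add: sum_distrib_left)
        ultimately show ?thesis using M'.symmetrize[of m Y x] Y x by simp
      qed
      have "0 \<le> Re (\<Sum>i<m. \<Sum>j<m. F (v i) (act (H i j) (v j)))"
      proof (rule matrix_positivity[OF M H d _ v])
        fix n and w :: "nat \<Rightarrow> complex vec" assume w: "\<And>i. i < m \<Longrightarrow> w i \<in> carrier_vec (k n)"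
        interpret W: cstar_module A "\<one>" "carrier_vec (k n)" "(+)" "0\<^sub>v (k n)" ip "\<lambda>a v. \<rho> n a *\<^sub>v v"
          by (rule cstar_module_rep[OF ucstar_axioms rep])
        \<comment> \<open>Membership in \<open>K\<close> involves vectors at all indices, hence the
          default 0 from \<open>m\<close> on.\<close>
        define w' where "w' i = (if i < m then w i else 0\<^sub>v (k n))" for i
        have w': "w' i \<in> carrier_vec (k n)" for i using w by (simp add: w'_def)
        have "gram (\<rho> n) w' \<in> K" by (rule KI[OF P(2) w' refl])
        then have "0 \<le> Re (\<Sum>x\<in>?I. c x * gram (\<rho> n) w' x)" by (rule c)
        also have "(\<Sum>x\<in>?I. c x * gram (\<rho> n) w' x) = (\<Sum>i<m. \<Sum>j<m. ip (w i) (\<rho> n (Y i j) *\<^sub>v w j))"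
          unfolding sumI Y_def using w a by (intro sum.cong refl) (simp add: W.F_lincomb gram_def w'_def)
        finally show "d * (\<Sum>i<m. (vec_l2 (w i))\<^sup>2) \<le> Re (\<Sum>i<m. \<Sum>j<m. ip (w i) (\<rho> n (H i j) *\<^sub>v w j))"
          using expand[OF W.cstar_module_axioms, of w] w by (simp add: ip_self)
      qed
      then show ?thesis using expand[OF M v] by (simp add: cgY N_def)
    qed
    have N: "N \<ge> 0" unfolding N_def using v M.F_pos by (intro sum_nonneg) auto
    \<comment> \<open>Chosen so that \<open>d (N + 1)\<close> cancels one of the two copies of the
      negative value; adding 1 avoids a division by 0.\<close>
    define d where "d = - Re (\<Sum>x\<in>?I. c x * g x) / (N + 1)"
    have "d > 0" unfolding d_def by (rule divide_pos_pos) (use cg N in linarith)+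
    then have "0 \<le> 2 * Re (\<Sum>x\<in>?I. c x * g x) + d * N" by (rule main)
    also have "d * N \<le> d * (N + 1)" using \<open>d > 0\<close> by simp
    also have "d * (N + 1) = - Re (\<Sum>x\<in>?I. c x * g x)" using N by (simp add: d_def)
    finally show False using cg by simp
  qed
  then obtain \<kappa> where "\<kappa> \<in> K" and \<kappa>: "(\<Sum>x\<in>?I. cmod (g x - \<kappa> x)) < \<epsilon>" by blast
  then obtain N \<tau> w where 1: "P N \<tau>" "\<And>i. w i \<in> carrier_vec N" "\<And>i j s. s < r \<Longrightarrow> \<kappa> (i, j, s) = gram \<tau> w (i, j, s)"
    unfolding K_def by blast
  show ?thesis
  proof (rule that[OF 1(1,2)])
    fix i j s assume ijs: "i < m" "j < m" "s < r"
    have "cmod (g (i, j, s) - \<kappa> (i, j, s)) \<le> (\<Sum>x\<in>?I. cmod (g x - \<kappa> x))"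
      using ijs by (intro member_le_sum) auto
    then show "cmod (ip (w i) (\<tau> (a s) *\<^sub>v w j) - F (v i) (act (a s) (v j))) < \<epsilon>"
      using \<kappa> 1(3)[OF ijs(3), of i j] by (simp add: gram_def g_def norm_minus_commute)
  qed
qed

section \<open>Intertwiners and unitary dilations\<close>

lemma ex_mat_inverse:
  fixes A :: "complex mat"
  assumes A: "A \<in> carrier_mat n n" and inj: "\<And>v. v \<in> carrier_vec n \<Longrightarrow> A *\<^sub>v v = 0\<^sub>v n \<Longrightarrow> v = 0\<^sub>v n"
  obtains Z where "Z \<in> carrier_mat n n" "A * Z = 1\<^sub>m n" "Z * A = 1\<^sub>m n"
proof -
  have "det A \<noteq> 0" using det_0_iff_vec_prod_zero[OF A] inj by blast
  from det_non_zero_imp_unit[OF A this, of undefined] show ?thesis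
    using that unfolding Units_def ring_mat_def by auto
qed

text \<open>\<open>T = L2 (L1\<^sup>* L1 + \<epsilon>)\<^sup>-\<^sup>1 L1\<^sup>*\<close>: regularizing by \<open>\<epsilon>\<close> keeps \<open>T\<close> an exact contraction and an exact
  intertwiner, while \<open>T L1 = L2\<close> holds up to \<open>sqrt \<epsilon>\<close>.\<close>

theorem ex_intertwiner:
  fixes L1 L2 :: "complex mat"
  assumes L1: "L1 \<in> carrier_mat N1 M" and L2: "L2 \<in> carrier_mat N2 M" and e: "\<epsilon> > 0"
    and le: "\<And>u. u \<in> carrier_vec M \<Longrightarrow> (vec_l2 (L2 *\<^sub>v u))\<^sup>2 \<le> (vec_l2 (L1 *\<^sub>v u))\<^sup>2 + \<epsilon> * (vec_l2 u)\<^sup>2"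
  obtains T where "T \<in> carrier_mat N2 N1" "\<And>v. v \<in> carrier_vec N1 \<Longrightarrow> vec_l2 (T *\<^sub>v v) \<le> vec_l2 v"
    "\<And>x. x \<in> carrier_vec M \<Longrightarrow> (vec_l2 (T *\<^sub>v (L1 *\<^sub>v x) - L2 *\<^sub>v x))\<^sup>2 \<le> \<epsilon> * (vec_l2 x)\<^sup>2"
    "\<And>X1 X2 Y. \<lbrakk>X1 \<in> carrier_mat N1 N1; X2 \<in> carrier_mat N2 N2; Y \<in> carrier_mat M M; X1 * L1 = L1 * Y; X2 * L2 = L2 * Y;
      mat_adjoint X1 * L1 = L1 * mat_adjoint Y\<rbrakk> \<Longrightarrow> X2 * T = T * X1"
proof -
  define S where "S = mat_adjoint L1"
  have S: "S \<in> carrier_mat M N1" using L1 by (simp add: S_def)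
  define G where "G = S * L1 + of_real \<epsilon> \<cdot>\<^sub>m 1\<^sub>m M"
  have SL: "S * L1 \<in> carrier_mat M M" using S L1 by simp
  have G: "G \<in> carrier_mat M M" using SL by (simp add: G_def)
  have Gu: "G *\<^sub>v u = S *\<^sub>v (L1 *\<^sub>v u) + of_real \<epsilon> \<cdot>\<^sub>v u" if u: "u \<in> carrier_vec M" for u
    unfolding G_def using S L1 SL u
    by (simp add: add_mult_distrib_mat_vec[of _ M M] smult_mat_vec[of _ M M] assoc_mult_mat_vec[of _ M N1 _ M])
  have quad: "Re (ip u (G *\<^sub>v u)) = (vec_l2 (L1 *\<^sub>v u))\<^sup>2 + \<epsilon> * (vec_l2 u)\<^sup>2" if u: "u \<in> carrier_vec M" for u
  proof -
    have lu: "L1 *\<^sub>v u \<in> carrier_vec N1" using L1 u by (rule mult_mat_vec_carrier)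
    have "ip u (G *\<^sub>v u) = ip u (S *\<^sub>v (L1 *\<^sub>v u)) + of_real \<epsilon> * ip u u"
      unfolding Gu[OF u] using u mult_mat_vec_carrier[OF S lu]
      by (simp add: ip_add_right[of _ M] ip_smult_right[of _ M])
    also have "ip u (S *\<^sub>v (L1 *\<^sub>v u)) = ip (L1 *\<^sub>v u) (L1 *\<^sub>v u)" unfolding S_def by (rule ip_adjoint'[OF L1 u lu])
    finally show ?thesis by (simp add: ip_self)
  qed
  obtain Z where Z: "Z \<in> carrier_mat M M" "G * Z = 1\<^sub>m M" "Z * G = 1\<^sub>m M"
  proof (rule ex_mat_inverse[OF G])
    fix v :: "complex vec" assume v: "v \<in> carrier_vec M" "G *\<^sub>v v = 0\<^sub>v M"
    then have "ip v (G *\<^sub>v v) = 0" by (simp add: ip_def)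
    then have "(vec_l2 (L1 *\<^sub>v v))\<^sup>2 + \<epsilon> * (vec_l2 v)\<^sup>2 = 0" using quad[OF v(1)] by simp
    moreover have "0 \<le> (vec_l2 (L1 *\<^sub>v v))\<^sup>2" "0 \<le> \<epsilon> * (vec_l2 v)\<^sup>2" using e by simp_all
    ultimately have "\<epsilon> * (vec_l2 v)\<^sup>2 = 0" by linarith
    then show "v = 0\<^sub>v M" using e vec_l2_eq_0[OF v(1)] by simp
  qed (rule that)
  have GZ: "G *\<^sub>v (Z *\<^sub>v u) = u" if "u \<in> carrier_vec M" for u
    using assoc_mult_mat_vec[OF G Z(1) that] that by (simp add: Z(2))
  define T where "T = L2 * Z * S"
  have T: "T \<in> carrier_mat N2 N1" using L2 Z(1) S by (simp add: T_def)
  have Tv: "T *\<^sub>v v = L2 *\<^sub>v (Z *\<^sub>v (S *\<^sub>v v))" if v: "v \<in> carrier_vec N1" for v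
  proof -
    have sv: "S *\<^sub>v v \<in> carrier_vec M" using S v by (rule mult_mat_vec_carrier)
    have "T *\<^sub>v v = (L2 * Z) *\<^sub>v (S *\<^sub>v v)"
      unfolding T_def using L2 Z(1) S v by (intro assoc_mult_mat_vec[of _ N2 M _ N1]) auto
    also have "\<dots> = L2 *\<^sub>v (Z *\<^sub>v (S *\<^sub>v v))" by (rule assoc_mult_mat_vec[OF L2 Z(1) sv])
    finally show ?thesis .
  qed
  have contr: "vec_l2 (T *\<^sub>v v) \<le> vec_l2 v" if v: "v \<in> carrier_vec N1" for v
  proof -
    have sv: "S *\<^sub>v v \<in> carrier_vec M" using S v by (rule mult_mat_vec_carrier)
    \<comment> \<open>As \<open>G u = S v\<close>, pairing with \<open>u\<close> bounds
      \<open>quad\<close> by \<open>vec_l2 (L1 u) * vec_l2 v\<close>. This bounds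
      \<open>L1 u\<close> first, and then \<open>L2 u = T v\<close> by the comparison of
      \<open>L1\<close> and \<open>L2\<close>.\<close>
    define u where "u = Z *\<^sub>v (S *\<^sub>v v)"
    have u: "u \<in> carrier_vec M" unfolding u_def using Z(1) sv by (rule mult_mat_vec_carrier)
    have lu: "L1 *\<^sub>v u \<in> carrier_vec N1" using L1 u by (rule mult_mat_vec_carrier)
    have "G *\<^sub>v u = S *\<^sub>v v" unfolding u_def by (rule GZ[OF sv])
    then have "ip u (G *\<^sub>v u) = ip (L1 *\<^sub>v u) v" using ip_adjoint'[OF L1 u v] by (simp add: S_def)
    then have q: "(vec_l2 (L1 *\<^sub>v u))\<^sup>2 + \<epsilon> * (vec_l2 u)\<^sup>2 \<le> vec_l2 (L1 *\<^sub>v u) * vec_l2 v"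
      using quad[OF u] cauchy_schwarz_ip[OF lu v] complex_Re_le_cmod[of "ip (L1 *\<^sub>v u) v"] by simp
    have "0 \<le> \<epsilon> * (vec_l2 u)\<^sup>2" using e by simp
    then have "(vec_l2 (L1 *\<^sub>v u))\<^sup>2 \<le> vec_l2 v * vec_l2 (L1 *\<^sub>v u)" using q by (simp add: mult.commute)
    then have "vec_l2 (L1 *\<^sub>v u) \<le> vec_l2 v" by (rule vec_l2_power2_le[OF vec_l2_nonneg])
    then have "vec_l2 (L1 *\<^sub>v u) * vec_l2 v \<le> vec_l2 v * vec_l2 v" by (rule mult_right_mono) simp
    then have "(vec_l2 (L2 *\<^sub>v u))\<^sup>2 \<le> (vec_l2 v)\<^sup>2" using le[OF u] q by (simp add: power2_eq_square)
    then show ?thesis unfolding Tv[OF v] u_def[symmetric] by (rule power2_le_imp_le) simp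
  qed
  have approx: "(vec_l2 (T *\<^sub>v (L1 *\<^sub>v x) - L2 *\<^sub>v x))\<^sup>2 \<le> \<epsilon> * (vec_l2 x)\<^sup>2" if x: "x \<in> carrier_vec M" for x
  proof -
    have lx: "L1 *\<^sub>v x \<in> carrier_vec N1" using L1 x by (rule mult_mat_vec_carrier)
    have slx: "S *\<^sub>v (L1 *\<^sub>v x) \<in> carrier_vec M" using S lx by (rule mult_mat_vec_carrier)
    \<comment> \<open>Here \<open>G u = x\<close>. Applying \<open>Z\<close> to \<open>G x\<close>
      shows that the defect is \<open>- \<epsilon>\<close> times \<open>L2 u\<close>, while
      \<open>quad\<close> bounds \<open>\<epsilon> * vec_l2 u\<close> by
      \<open>vec_l2 x\<close>.\<close>
    define u where "u = Z *\<^sub>v x"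
    have u: "u \<in> carrier_vec M" unfolding u_def using Z(1) x by (rule mult_mat_vec_carrier)
    have ZGx: "Z *\<^sub>v (G *\<^sub>v x) = x" using assoc_mult_mat_vec[OF Z(1) G x] x by (simp add: Z(3))
    have "x = Z *\<^sub>v (S *\<^sub>v (L1 *\<^sub>v x)) + of_real \<epsilon> \<cdot>\<^sub>v u"
      using ZGx Z(1) x slx unfolding Gu[OF x] u_def
      by (simp add: mult_add_distrib_mat_vec[of _ M M] mult_mat_vec[of _ M M])
    then have "L2 *\<^sub>v x = L2 *\<^sub>v (Z *\<^sub>v (S *\<^sub>v (L1 *\<^sub>v x)) + of_real \<epsilon> \<cdot>\<^sub>v u)" by simp
    also have "\<dots> = T *\<^sub>v (L1 *\<^sub>v x) + of_real \<epsilon> \<cdot>\<^sub>v (L2 *\<^sub>v u)"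
      unfolding Tv[OF lx] using L2 u mult_mat_vec_carrier[OF Z(1) slx]
      by (simp add: mult_add_distrib_mat_vec[of _ N2 M] mult_mat_vec[of _ N2 M])
    finally have eq: "L2 *\<^sub>v x = T *\<^sub>v (L1 *\<^sub>v x) + of_real \<epsilon> \<cdot>\<^sub>v (L2 *\<^sub>v u)" .
    have l2u: "L2 *\<^sub>v u \<in> carrier_vec N2" using L2 u by (rule mult_mat_vec_carrier)
    have tl: "T *\<^sub>v (L1 *\<^sub>v x) \<in> carrier_vec N2" using T lx by (rule mult_mat_vec_carrier)
    have "T *\<^sub>v (L1 *\<^sub>v x) - L2 *\<^sub>v x = (- of_real \<epsilon>) \<cdot>\<^sub>v (L2 *\<^sub>v u)"
      unfolding eq using l2u tl by (intro eq_vecI) auto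
    then have 1: "(vec_l2 (T *\<^sub>v (L1 *\<^sub>v x) - L2 *\<^sub>v x))\<^sup>2 = \<epsilon>\<^sup>2 * (vec_l2 (L2 *\<^sub>v u))\<^sup>2"
      using e by (simp add: vec_l2_smult power_mult_distrib)
    have "G *\<^sub>v u = x" unfolding u_def by (rule GZ[OF x])
    then have q: "(vec_l2 (L1 *\<^sub>v u))\<^sup>2 + \<epsilon> * (vec_l2 u)\<^sup>2 \<le> vec_l2 u * vec_l2 x"
      using quad[OF u] cauchy_schwarz_ip[OF u x] complex_Re_le_cmod[of "ip u x"] by simp
    have "\<epsilon> * (vec_l2 u)\<^sup>2 \<le> vec_l2 u * vec_l2 x" using q by (smt (verit) zero_le_power2)
    then have "\<epsilon> * vec_l2 u * vec_l2 u \<le> vec_l2 x * vec_l2 u" by (simp add: power2_eq_square mult_ac)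
    then have "\<epsilon> * vec_l2 u \<le> vec_l2 x"
      by (cases "vec_l2 u = 0") (auto simp: mult_le_cancel_right not_le less_le)
    then have "(\<epsilon> * vec_l2 u) * vec_l2 x \<le> vec_l2 x * vec_l2 x" by (rule mult_right_mono) simp
    moreover have "(vec_l2 (L2 *\<^sub>v u))\<^sup>2 \<le> vec_l2 u * vec_l2 x" using le[OF u] q by simp
    then have "\<epsilon>\<^sup>2 * (vec_l2 (L2 *\<^sub>v u))\<^sup>2 \<le> \<epsilon>\<^sup>2 * (vec_l2 u * vec_l2 x)" by (rule mult_left_mono) simp
    moreover have "\<epsilon>\<^sup>2 * (vec_l2 u * vec_l2 x) = \<epsilon> * ((\<epsilon> * vec_l2 u) * vec_l2 x)" by (simp add: power2_eq_square)
    moreover have "\<epsilon> * ((\<epsilon> * vec_l2 u) * vec_l2 x) \<le> \<epsilon> * (vec_l2 x * vec_l2 x)"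
      using calculation(1) e by (intro mult_left_mono) auto
    ultimately show ?thesis unfolding 1 by (simp add: power2_eq_square)
  qed
  have inter: "X2 * T = T * X1"
    if X1: "X1 \<in> carrier_mat N1 N1" and X2: "X2 \<in> carrier_mat N2 N2" and Y: "Y \<in> carrier_mat M M"
      and c: "X1 * L1 = L1 * Y" "X2 * L2 = L2 * Y" "mat_adjoint X1 * L1 = L1 * mat_adjoint Y" for X1 X2 Y
  proof -
    \<comment> \<open>The adjoint of the third relation. With it \<open>Y\<close> commutes with
      \<open>S * L1\<close>, hence with \<open>G\<close> and with its inverse
      \<open>Z\<close>.\<close>
    have YS: "Y * S = S * X1"
    proof -
      have "mat_adjoint (mat_adjoint X1 * L1) = S * X1"
        using X1 L1 by (simp add: mat_adjoint_mult[of _ N1 N1 _ M] mat_adjoint_adjoint S_def)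
      moreover have "mat_adjoint (L1 * mat_adjoint Y) = Y * S"
        using Y L1 by (simp add: mat_adjoint_mult[of _ N1 M _ M] mat_adjoint_adjoint S_def)
      ultimately show ?thesis using c(3) by simp
    qed
    have "S * L1 * Y = S * (X1 * L1)" unfolding c(1) by (rule assoc_mult_mat[OF S L1 Y])
    also have "\<dots> = (S * X1) * L1" by (rule assoc_mult_mat[OF S X1 L1, symmetric])
    also have "\<dots> = Y * (S * L1)" unfolding YS[symmetric] by (rule assoc_mult_mat[OF Y S L1])
    finally have "G * Y = Y * G"
      unfolding G_def using SL Y
      by (simp add: add_mult_distrib_mat[of _ M M] mult_add_distrib_mat[of _ M M] mult_smult_assoc_mat[of _ M M _ M] mult_smult_distrib[of _ M M _ M])
    have "Y * Z = Z * (G * Y) * Z"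
      unfolding assoc_mult_mat[OF Z(1) G Y, symmetric] Z(3) using Y by simp
    also have "\<dots> = Z * (Y * G * Z)"
      unfolding \<open>G * Y = Y * G\<close> using Z(1) Y G by (intro assoc_mult_mat[of _ M M _ M _ M]) auto
    also have "\<dots> = Z * Y" unfolding assoc_mult_mat[OF Y G Z(1)] Z(2) using Y by simp
    finally have YZ: "Y * Z = Z * Y" .
    have ZS: "Z * S \<in> carrier_mat M N1" using Z(1) S by simp
    have T': "T = L2 * (Z * S)" unfolding T_def by (rule assoc_mult_mat[OF L2 Z(1) S])
    have "X2 * T = (X2 * L2) * (Z * S)" unfolding T' by (rule assoc_mult_mat[OF X2 L2 ZS, symmetric])
    also have "\<dots> = L2 * (Y * (Z * S))" unfolding c(2) by (rule assoc_mult_mat[OF L2 Y ZS])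
    also have "Y * (Z * S) = (Y * Z) * S" by (rule assoc_mult_mat[OF Y Z(1) S, symmetric])
    also have "\<dots> = Z * (S * X1)" unfolding YZ assoc_mult_mat[OF Z(1) Y S] YS ..
    also have "\<dots> = (Z * S) * X1" by (rule assoc_mult_mat[OF Z(1) S X1, symmetric])
    also have "L2 * \<dots> = T * X1" unfolding T' by (rule assoc_mult_mat[OF L2 ZS X1, symmetric])
    finally show ?thesis .
  qed
  show ?thesis by (rule that[OF T contr approx inter])
qed

section \<open>Unitary dilation of a contraction\<close>

text \<open>The self-adjoint form of \<open>T\<close> on the direct sum of its domain and codomain,
  to which the square root construction applies although \<open>T\<close> need not be
  square.\<close>

definition offdiag :: "complex mat \<Rightarrow> complex mat" where
  "offdiag T = four_block_mat (0\<^sub>m (dim_col T) (dim_col T)) (mat_adjoint T) T (0\<^sub>m (dim_row T) (dim_row T))"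

lemma offdiag_carrier: "T \<in> carrier_mat N2 N1 \<Longrightarrow> offdiag T \<in> carrier_mat (N1 + N2) (N1 + N2)"
  by (simp add: offdiag_def)

lemma offdiag_mult_vec:
  assumes T: "T \<in> carrier_mat N2 N1" and u: "u \<in> carrier_vec N1" and v: "v \<in> carrier_vec N2"
  shows "offdiag T *\<^sub>v (u @\<^sub>v v) = (mat_adjoint T *\<^sub>v v) @\<^sub>v (T *\<^sub>v u)"
proof -
  have "offdiag T *\<^sub>v (u @\<^sub>v v) = (0\<^sub>m N1 N1 *\<^sub>v u + mat_adjoint T *\<^sub>v v) @\<^sub>v (T *\<^sub>v u + 0\<^sub>m N2 N2 *\<^sub>v v)"
    unfolding offdiag_def using assms by (subst four_block_mat_mult_vec[of _ N1 N1 _ N2 _ N2]) auto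
  then show ?thesis
    using u v mult_mat_vec_carrier[OF T u] mult_mat_vec_carrier[OF mat_adjoint_carrier[OF T] v]
    by (simp add: mult_zero_mat_vec)
qed

lemma vec_l2_append:
  assumes "u \<in> carrier_vec m" "v \<in> carrier_vec n"
  shows "(vec_l2 (u @\<^sub>v v))\<^sup>2 = (vec_l2 u)\<^sup>2 + (vec_l2 v)\<^sup>2"
  using ip_append[OF assms(1,1,2,2)] unfolding ip_self by (metis of_real_add of_real_eq_iff)

text \<open>The intertwining relation for the adjoints is needed for the block that contains
  \<open>mat_adjoint T\<close>.\<close>

lemma offdiag_commute:
  assumes T: "T \<in> carrier_mat N2 N1" and X1: "X1 \<in> carrier_mat N1 N1" and X2: "X2 \<in> carrier_mat N2 N2"
    and c: "X2 * T = T * X1" "mat_adjoint X2 * T = T * mat_adjoint X1"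
  shows "dsum X1 X2 * offdiag T = offdiag T * dsum X1 X2"
proof -
  have "X1 * mat_adjoint T = mat_adjoint (T * mat_adjoint X1)"
    using T X1 by (simp add: mat_adjoint_mult[of _ N2 N1 _ N1] mat_adjoint_adjoint)
  also have "\<dots> = mat_adjoint T * X2"
    using T X2 by (simp add: mat_adjoint_mult[of _ N2 N2 _ N1] mat_adjoint_adjoint flip: c(2))
  finally have "X1 * mat_adjoint T = mat_adjoint T * X2" .
  then show ?thesis
    unfolding dsum_def offdiag_def using T X1 X2
    by (subst (1 2) mult_four_block_mat[of _ N1 N1 _ N2 _ N2 _ _ N1 _ N2]) (auto simp: c(1))
qed

text \<open>\<open>U = Q + \<i> S\<close> with \<open>Q = offdiag T\<close> and \<open>S\<close> the
  root of \<open>1 - Q Q\<close>; it is unitary by \<open>comm_square\<close>, and what commutes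
  with \<open>Q\<close> commutes with both summands. On a vector \<open>(w, 0)\<close> the part
  \<open>Q\<close> gives \<open>(0, T w)\<close>, and the part \<open>S\<close> has squared norm
  \<open>(vec_l2 w)\<^sup>2 - (vec_l2 (T w))\<^sup>2\<close>, which is the second error
  term.\<close>

theorem ex_unitary:
  fixes T :: "complex mat"
  assumes T: "T \<in> carrier_mat N2 N1" and N1: "0 < N1" and contr: "\<And>v. v \<in> carrier_vec N1 \<Longrightarrow> vec_l2 (T *\<^sub>v v) \<le> vec_l2 v"
  obtains U where "U \<in> carrier_mat (N1 + N2) (N1 + N2)" "mat_adjoint U * U = 1\<^sub>m (N1 + N2)" "U * mat_adjoint U = 1\<^sub>m (N1 + N2)"
    "\<And>X. X \<in> carrier_mat (N1 + N2) (N1 + N2) \<Longrightarrow> X * offdiag T = offdiag T * X \<Longrightarrow> X * U = U * X"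
    "\<And>w w'. w \<in> carrier_vec N1 \<Longrightarrow> w' \<in> carrier_vec N2 \<Longrightarrow>
      vec_l2 (U *\<^sub>v (w @\<^sub>v 0\<^sub>v N2) - (0\<^sub>v N1 @\<^sub>v w')) \<le> vec_l2 (T *\<^sub>v w - w') + sqrt ((vec_l2 w)\<^sup>2 - (vec_l2 (T *\<^sub>v w))\<^sup>2)"
proof -
  let ?N = "N1 + N2"
  interpret ucstar "mat_cstar ?N" "1\<^sub>m ?N" by (rule ucstar_mat_cstar) (use N1 in simp)
  define Q where "Q = offdiag T"
  have Q: "Q \<in> carrier_mat ?N ?N" unfolding Q_def by (rule offdiag_carrier[OF T])
  have Qs: "mat_adjoint Q = Q"
    unfolding Q_def offdiag_def using T by (intro eq_matI) (auto simp: carrier_matD[OF T])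
  have T1: "mat_opnorm T \<le> 1" by (rule opnorm_le[OF T]) (use contr in auto)
  have contr': "vec_l2 (mat_adjoint T *\<^sub>v v) \<le> vec_l2 v" if "v \<in> carrier_vec N2" for v
    using opnorm_bound[OF mat_adjoint_carrier[OF T] that] opnorm_adjoint[OF T] T1
      mult_right_mono[of "mat_opnorm (mat_adjoint T)" 1 "vec_l2 v"] by simp
  have Qn: "mat_opnorm Q \<le> 1"
  proof (rule opnorm_le[OF Q])
    fix x :: "complex vec" assume x: "x \<in> carrier_vec ?N"
    define u where "u = vec_first x N1"
    define v where "v = vec_last x N2"
    have uv: "u \<in> carrier_vec N1" "v \<in> carrier_vec N2" "x = u @\<^sub>v v" using x by (simp_all add: u_def v_def)
    have "(vec_l2 (Q *\<^sub>v x))\<^sup>2 = (vec_l2 (mat_adjoint T *\<^sub>v v))\<^sup>2 + (vec_l2 (T *\<^sub>v u))\<^sup>2"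
      unfolding uv(3) Q_def offdiag_mult_vec[OF T uv(1,2)]
      by (rule vec_l2_append[OF mult_mat_vec_carrier[OF mat_adjoint_carrier[OF T] uv(2)] mult_mat_vec_carrier[OF T uv(1)]])
    also have "\<dots> \<le> (vec_l2 v)\<^sup>2 + (vec_l2 u)\<^sup>2"
      using contr[OF uv(1)] contr'[OF uv(2)] by (intro add_mono power_mono) auto
    also have "\<dots> = (vec_l2 x)\<^sup>2" unfolding uv(3) using vec_l2_append[OF uv(1,2)] by simp
    finally show "vec_l2 (Q *\<^sub>v x) \<le> 1 * vec_l2 x" using power2_le_imp_le by fastforce
  qed simp
  have QQ: "Q * Q \<in> carrier (mat_cstar ?N)" "star (mat_cstar ?N) (Q * Q) = Q * Q" "cnorm (mat_cstar ?N) (Q * Q) \<le> 1"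
    using Q Qs opnorm_mult[OF Q Q] Qn opnorm_nonneg[OF Q] mult_le_one[of "mat_opnorm Q" "mat_opnorm Q"]
    by (simp_all add: mat_adjoint_mult[of _ ?N ?N])
  obtain S where S0: "S \<in> carrier (mat_cstar ?N)" "star (mat_cstar ?N) S = S"
    "S \<otimes>\<^bsub>mat_cstar ?N\<^esub> S = 1\<^sub>m ?N \<ominus>\<^bsub>mat_cstar ?N\<^esub> Q * Q"
    and Scomm0: "\<And>b. b \<in> carrier (mat_cstar ?N) \<Longrightarrow> b \<otimes>\<^bsub>mat_cstar ?N\<^esub> (Q * Q) = (Q * Q) \<otimes>\<^bsub>mat_cstar ?N\<^esub> b \<Longrightarrow>
      b \<otimes>\<^bsub>mat_cstar ?N\<^esub> S = S \<otimes>\<^bsub>mat_cstar ?N\<^esub> b"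
    by (rule ex_sqrt_diff[OF QQ]) (rule that)
  have S: "S \<in> carrier_mat ?N ?N" "mat_adjoint S = S" "S * S = 1\<^sub>m ?N - Q * Q"
    using S0 minus_mat_cstar[of "1\<^sub>m ?N" ?N "Q * Q"] Q by simp_all
  have Scomm: "X * S = S * X" if X: "X \<in> carrier_mat ?N ?N" "X * Q = Q * X" for X
  proof -
    have "X * (Q * Q) = (X * Q) * Q" by (rule assoc_mult_mat[OF X(1) Q Q, symmetric])
    also have "\<dots> = Q * (X * Q)" unfolding X(2) by (rule assoc_mult_mat[OF Q X(1) Q, unfolded X(2)])
    also have "\<dots> = (Q * Q) * X" unfolding X(2) by (rule assoc_mult_mat[OF Q Q X(1), symmetric])
    finally show ?thesis using Scomm0[of X] X by simp
  qed
  have QS: "Q * S = S * Q" using Scomm[OF Q] by simp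
  define U where "U = Q + \<i> \<cdot>\<^sub>m S"
  have U: "U \<in> carrier_mat ?N ?N" using Q S by (simp add: U_def)
  have "mat_adjoint U * U = Q * Q + S * S"
    using comm_square(1)[of Q S] Q Qs S(1,2) QS by (simp add: U_def)
  also have "\<dots> = 1\<^sub>m ?N" unfolding S(3) using Q by (intro eq_matI) auto
  finally have UU: "mat_adjoint U * U = 1\<^sub>m ?N" .
  then have UU': "U * mat_adjoint U = 1\<^sub>m ?N"
    by (rule mat_mult_left_right_inverse[OF mat_adjoint_carrier[OF U] U])
  have comm: "X * U = U * X" if X: "X \<in> carrier_mat ?N ?N" "X * offdiag T = offdiag T * X" for X
    unfolding U_def using X(1) Q S(1) Scomm[OF X[folded Q_def]] X(2)[folded Q_def]
    by (simp add: mult_add_distrib_mat[of _ ?N ?N] add_mult_distrib_mat[of _ ?N ?N] mult_smult_distrib[of _ ?N ?N] mult_smult_assoc_mat[of _ ?N ?N])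
  have approx: "vec_l2 (U *\<^sub>v (w @\<^sub>v 0\<^sub>v N2) - (0\<^sub>v N1 @\<^sub>v w')) \<le> vec_l2 (T *\<^sub>v w - w') + sqrt ((vec_l2 w)\<^sup>2 - (vec_l2 (T *\<^sub>v w))\<^sup>2)"
    if w: "w \<in> carrier_vec N1" and w': "w' \<in> carrier_vec N2" for w w'
  proof -
    define x where "x = w @\<^sub>v 0\<^sub>v N2"
    have x: "x \<in> carrier_vec ?N" using w by (simp add: x_def)
    have Tw: "T *\<^sub>v w \<in> carrier_vec N2" using T w by (rule mult_mat_vec_carrier)
    have Qx: "Q *\<^sub>v x = 0\<^sub>v N1 @\<^sub>v (T *\<^sub>v w)"
      unfolding Q_def x_def using offdiag_mult_vec[OF T w zero_carrier_vec] mult_mat_zero_vec[OF mat_adjoint_carrier[OF T]] by simp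
    have Sx: "S *\<^sub>v x \<in> carrier_vec ?N" using S(1) x by (rule mult_mat_vec_carrier)
    have Qxc: "Q *\<^sub>v x \<in> carrier_vec ?N" using Q x by (rule mult_mat_vec_carrier)
    have "ip (S *\<^sub>v x) (S *\<^sub>v x) = ip x (S *\<^sub>v (S *\<^sub>v x))" using ip_adjoint'[OF S(1) x Sx] S(2) by simp
    also have "S *\<^sub>v (S *\<^sub>v x) = x - Q *\<^sub>v (Q *\<^sub>v x)"
    proof -
      have "S *\<^sub>v (S *\<^sub>v x) = (1\<^sub>m ?N - Q * Q) *\<^sub>v x" using assoc_mult_mat_vec[OF S(1,1) x] S(3) by simp
      also have "\<dots> = 1\<^sub>m ?N *\<^sub>v x - (Q * Q) *\<^sub>v x" using Q x by (intro minus_mult_distrib_mat_vec[of _ ?N ?N]) auto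
      finally show ?thesis using assoc_mult_mat_vec[OF Q Q x] x by simp
    qed
    also have "ip x (x - Q *\<^sub>v (Q *\<^sub>v x)) = ip x x - ip x (Q *\<^sub>v (Q *\<^sub>v x))"
      using x mult_mat_vec_carrier[OF Q Qxc] by (intro ip_minus_right[of _ ?N]) auto
    also have "ip x (Q *\<^sub>v (Q *\<^sub>v x)) = ip (Q *\<^sub>v x) (Q *\<^sub>v x)" using ip_adjoint'[OF Q x Qxc] Qs by simp
    finally have "(vec_l2 (S *\<^sub>v x))\<^sup>2 = (vec_l2 x)\<^sup>2 - (vec_l2 (Q *\<^sub>v x))\<^sup>2"
      unfolding ip_self by (metis of_real_diff of_real_eq_iff)
    also have "(vec_l2 x)\<^sup>2 = (vec_l2 w)\<^sup>2" unfolding x_def using vec_l2_append[OF w zero_carrier_vec[of N2]] by (simp add: vec_l2_zero)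
    also have "(vec_l2 (Q *\<^sub>v x))\<^sup>2 = (vec_l2 (T *\<^sub>v w))\<^sup>2"
      unfolding Qx using vec_l2_append[OF zero_carrier_vec[of N1] Tw] by (simp add: vec_l2_zero)
    finally have Sn: "vec_l2 (S *\<^sub>v x) = sqrt ((vec_l2 w)\<^sup>2 - (vec_l2 (T *\<^sub>v w))\<^sup>2)"
      by (metis real_sqrt_unique vec_l2_nonneg)
    have "U *\<^sub>v x - (0\<^sub>v N1 @\<^sub>v w') = (0\<^sub>v N1 @\<^sub>v (T *\<^sub>v w - w')) + \<i> \<cdot>\<^sub>v (S *\<^sub>v x)"
    proof -
      have "U *\<^sub>v x = (0\<^sub>v N1 @\<^sub>v (T *\<^sub>v w)) + \<i> \<cdot>\<^sub>v (S *\<^sub>v x)"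
        unfolding U_def using Q S(1) x by (simp add: add_mult_distrib_mat_vec[of _ ?N ?N] smult_mat_vec[of _ ?N ?N] Qx)
      moreover have "(0\<^sub>v N1 @\<^sub>v t) + z - (0\<^sub>v N1 @\<^sub>v w') = (0\<^sub>v N1 @\<^sub>v (t - w')) + z"
        if "t \<in> carrier_vec N2" "z \<in> carrier_vec ?N" for t z :: "complex vec"
        using that w' by (intro eq_vecI) auto
      ultimately show ?thesis using Tw Sx by simp
    qed
    then have "vec_l2 (U *\<^sub>v x - (0\<^sub>v N1 @\<^sub>v w')) \<le> vec_l2 (0\<^sub>v N1 @\<^sub>v (T *\<^sub>v w - w')) + vec_l2 (S *\<^sub>v x)"
      using vec_l2_triangle[of "0\<^sub>v N1 @\<^sub>v (T *\<^sub>v w - w')" ?N "\<i> \<cdot>\<^sub>v (S *\<^sub>v x)"] Tw w' Sx by (simp add: vec_l2_smult)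
    also have "vec_l2 (0\<^sub>v N1 @\<^sub>v (T *\<^sub>v w - w')) = vec_l2 (T *\<^sub>v w - w')"
    proof -
      have "T *\<^sub>v w - w' \<in> carrier_vec N2" using Tw w' by simp
      then have "(vec_l2 (0\<^sub>v N1 @\<^sub>v (T *\<^sub>v w - w')))\<^sup>2 = (vec_l2 (T *\<^sub>v w - w'))\<^sup>2"
        using vec_l2_append[OF zero_carrier_vec[of N1]] by (simp add: vec_l2_zero)
      then show ?thesis by (rule power2_eq_imp_eq) simp_all
    qed
    finally show ?thesis unfolding Sn unfolding x_def .
  qed
  show ?thesis by (rule that[OF U UU UU' comm approx])
qed

lemma matrix_rep_conj:
  assumes \<tau>: "matrix_rep A N \<tau>" and U: "U \<in> carrier_mat N N" "mat_adjoint U * U = 1\<^sub>m N" "U * mat_adjoint U = 1\<^sub>m N"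
  shows "matrix_rep A N (\<lambda>a. mat_adjoint U * \<tau> a * U)"
proof -
  note t = matrix_repD[OF \<tau>]
  note Us = mat_adjoint_carrier[OF U(1)]
  note as = assoc_mult_mat[of _ N N _ N _ N]
  have "star_hom A (mat_cstar N) (\<lambda>a. mat_adjoint U * \<tau> a * U)"
    unfolding star_hom_def
  proof (intro conjI ballI allI)
    show "(\<lambda>a. mat_adjoint U * \<tau> a * U) \<in> carrier A \<rightarrow> carrier (mat_cstar N)"
      using t(3) U(1) Us by auto
    fix x y assume x: "x \<in> carrier A" and y: "y \<in> carrier A"
    note xy = t(3)[OF x] t(3)[OF y]
    show "mat_adjoint U * \<tau> (x \<oplus>\<^bsub>A\<^esub> y) * U = mat_adjoint U * \<tau> x * U \<oplus>\<^bsub>mat_cstar N\<^esub> mat_adjoint U * \<tau> y * U"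
      unfolding t(4)[OF x y] mat_cstar_simps mult_add_distrib_mat[OF Us xy]
      by (rule add_mult_distrib_mat[OF mult_carrier_mat[OF Us xy(1)] mult_carrier_mat[OF Us xy(2)] U(1)])
    note M = mult_carrier_mat[OF Us xy(1)] and W = mult_carrier_mat[OF xy(2) U(1)]
    have "mat_adjoint U * \<tau> x * U * (mat_adjoint U * \<tau> y * U) = mat_adjoint U * \<tau> x * (U * (mat_adjoint U * (\<tau> y * U)))"
      unfolding as[OF Us xy(2) U(1)] by (rule as[OF M U(1) mult_carrier_mat[OF Us W]])
    also have "U * (mat_adjoint U * (\<tau> y * U)) = \<tau> y * U"
      unfolding as[OF U(1) Us W, symmetric] U(3) by (rule left_mult_one_mat[OF W])
    also have "mat_adjoint U * \<tau> x * (\<tau> y * U) = mat_adjoint U * (\<tau> x * \<tau> y) * U"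
      unfolding as[OF Us xy(1,2), symmetric] by (rule as[OF M xy(2) U(1), symmetric])
    finally show "mat_adjoint U * \<tau> (x \<otimes>\<^bsub>A\<^esub> y) * U = mat_adjoint U * \<tau> x * U \<otimes>\<^bsub>mat_cstar N\<^esub> (mat_adjoint U * \<tau> y * U)"
      by (simp add: t(6)[OF x y])
  next
    fix c x assume x: "x \<in> carrier A"
    note xc = t(3)[OF x]
    show "mat_adjoint U * \<tau> (c \<odot>\<^bsub>A\<^esub> x) * U = c \<odot>\<^bsub>mat_cstar N\<^esub> (mat_adjoint U * \<tau> x * U)"
      unfolding t(5)[OF x] mat_cstar_simps mult_smult_distrib[OF Us xc]
      by (rule mult_smult_assoc_mat[OF mult_carrier_mat[OF Us xc] U(1)])
    show "mat_adjoint U * \<tau> (star A x) * U = star (mat_cstar N) (mat_adjoint U * \<tau> x * U)"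
      unfolding t(7)[OF x] mat_cstar_simps mat_adjoint_mult[OF mult_carrier_mat[OF Us xc] U(1)]
        mat_adjoint_mult[OF Us xc] mat_adjoint_adjoint
      by (rule as[OF Us mat_adjoint_carrier[OF xc] U(1)])
  qed
  then show ?thesis using t(1,2) U Us by (simp add: matrix_rep_def)
qed

lemma (in separated_cstar) gram_approx_finite:
  fixes m :: nat and v :: "nat \<Rightarrow> 'x" and P :: "nat \<Rightarrow> ('a \<Rightarrow> complex mat) \<Rightarrow> bool"
  assumes M: "cstar_module A \<one> X vplus vzero F act"
    and P: "\<And>N \<tau>. P N \<tau> \<Longrightarrow> matrix_rep A N \<tau>" "\<And>n. P (k n) (\<rho> n)"
      "\<And>N \<tau> N' \<tau>'. P N \<tau> \<Longrightarrow> P N' \<tau>' \<Longrightarrow> P (N + N') (\<lambda>a. dsum (\<tau> a) (\<tau>' a))"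
    and v: "\<And>i. i < m \<Longrightarrow> v i \<in> X" and S: "finite S" "S \<subseteq> carrier A" and e: "\<epsilon> > 0"
  obtains N \<tau> w where "P N \<tau>" "\<And>i. w i \<in> carrier_vec N"
    "\<And>i j a. i < m \<Longrightarrow> j < m \<Longrightarrow> a \<in> S \<Longrightarrow> cmod (ip (w i) (\<tau> a *\<^sub>v w j) - F (v i) (act a (v j))) < \<epsilon>"
proof -
  obtain l where l: "set l = S" using finite_list[OF S(1)] by blast
  have ls: "l ! s \<in> carrier A" if "s < length l" for s using that l S(2) nth_mem by blast
  obtain N \<tau> w where *: "P N \<tau>" "\<And>i. w i \<in> carrier_vec N"
    "\<And>i j s. i < m \<Longrightarrow> j < m \<Longrightarrow> s < length l \<Longrightarrow> cmod (ip (w i) (\<tau> (l ! s) *\<^sub>v w j) - F (v i) (act (l ! s) (v j))) < \<epsilon>"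
    by (rule gram_approx[where m = m and r = "length l" and a = "\<lambda>s. l ! s" and v = v and P = P, OF M P v ls e]) (assumption+, rule that)
  show ?thesis
    by (rule that[OF *(1,2)]) (use *(3) l in \<open>auto simp: in_set_conv_nth\<close>)
qed

section \<open>Orbits of a finite-dimensional algebra\<close>

text \<open>The normalized traces of the coordinates, summed with weights
  \<open>(1 / 2) ^ n\<close>. On \<open>star A x \<otimes> x\<close> this is a weighted sum of the
  squared moduli of all entries, so it vanishes only if every coordinate does.\<close>

lemma (in separated_cstar) ex_faithful_functional:
  obtains \<phi> where "positive_functional \<phi>" "\<And>x. x \<in> carrier A \<Longrightarrow> \<phi> (star A x \<otimes> x) = 0 \<Longrightarrow> x = \<zero>"
proof -
  define t where "t n x = (\<Sum>i<k n. \<rho> n x $$ (i, i)) / of_nat (k n)" for n x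
  define \<phi> where "\<phi> x = (\<Sum>n. (1 / 2) ^ n * t n x)" for x
  have k: "0 < k n" for n by (rule matrix_repD(1)[OF rep])
  note \<rho> = matrix_repD(3-)[OF rep]
  have t_bound: "cmod (t n x) \<le> cnorm A x" if x: "x \<in> carrier A" for n x
  proof -
    have "cmod (\<Sum>i<k n. \<rho> n x $$ (i, i)) \<le> (\<Sum>i<k n. mat_opnorm (\<rho> n x))"
      by (rule order_trans[OF norm_sum sum_mono]) (use cmod_entry_le_opnorm[OF \<rho>(1)[OF x]] in auto)
    also have "mat_opnorm (\<rho> n x) \<le> cnorm A x"
      using star_hom_contractive[OF ucstar_axioms ucstar_mat_cstar[OF k[of n]] _ _ x, of "\<rho> n"] rep[of n]
      by (simp add: matrix_rep_def)
    finally show ?thesis using k[of n] by (simp add: t_def norm_divide field_simps)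
  qed
  have summ: "summable (\<lambda>n. (1 / 2) ^ n * t n x)" if x: "x \<in> carrier A" for x
  proof (rule summable_comparison_test')
    show "summable (\<lambda>n. (1 / 2) ^ n * cnorm A x :: real)" by (intro summable_mult2 summable_geometric) simp
    show "norm ((1 / 2) ^ n * t n x) \<le> (1 / 2) ^ n * cnorm A x" for n
      using t_bound[OF x, of n] by (simp add: norm_mult norm_power mult_left_mono)
  qed
  have t_add: "t n (x \<oplus> y) = t n x + t n y" if "x \<in> carrier A" "y \<in> carrier A" for n x y
    using that carrier_matD[OF \<rho>(1)[OF that(1), of n]] carrier_matD[OF \<rho>(1)[OF that(2), of n]]
    by (simp add: t_def \<rho>(2) sum.distrib add_divide_distrib)
  have t_smult: "t n (c \<odot> x) = c * t n x" if "x \<in> carrier A" for n c x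
    using that carrier_matD[OF \<rho>(1)[OF that, of n]] by (simp add: t_def \<rho>(3) sum_distrib_left)
  have t_star: "t n (star A x) = cnj (t n x)" if "x \<in> carrier A" for n x
    using that carrier_matD[OF \<rho>(1)[OF that, of n]] by (simp add: t_def \<rho>(5))
  have t_square: "t n (star A x \<otimes> x) = of_real ((\<Sum>i<k n. \<Sum>l<k n. (cmod (\<rho> n x $$ (l, i)))\<^sup>2) / k n)"
    if x: "x \<in> carrier A" for n x
  proof -
    have "(mat_adjoint (\<rho> n x) * \<rho> n x) $$ (i, i) = of_real (\<Sum>l<k n. (cmod (\<rho> n x $$ (l, i)))\<^sup>2)" if "i < k n" for i
      using that carrier_matD[OF \<rho>(1)[OF x, of n]]
      by (simp add: scalar_prod_def lessThan_atLeast0 complex_norm_square mult.commute del: of_real_power)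
    then show ?thesis using x by (simp add: t_def \<rho>(4,5))
  qed
  have Re\<phi>: "Re (\<phi> (star A x \<otimes> x)) = (\<Sum>n. (1 / 2) ^ n * ((\<Sum>i<k n. \<Sum>l<k n. (cmod (\<rho> n x $$ (l, i)))\<^sup>2) / k n))"
    and summ': "summable (\<lambda>n. (1 / 2) ^ n * ((\<Sum>i<k n. \<Sum>l<k n. (cmod (\<rho> n x $$ (l, i)))\<^sup>2) / k n))"
    if x: "x \<in> carrier A" for x
  proof -
    have xx: "star A x \<otimes> x \<in> carrier A" using x by simp
    have Re: "Re ((1 / 2) ^ n * t n (star A x \<otimes> x)) = (1 / 2) ^ n * ((\<Sum>i<k n. \<Sum>l<k n. (cmod (\<rho> n x $$ (l, i)))\<^sup>2) / k n)" for n
    proof -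
      have "(1 / 2 :: complex) ^ n = of_real ((1 / 2) ^ n)" by simp
      then show ?thesis unfolding t_square[OF x] by (metis Re_complex_of_real of_real_mult)
    qed
    show "Re (\<phi> (star A x \<otimes> x)) = (\<Sum>n. (1 / 2) ^ n * ((\<Sum>i<k n. \<Sum>l<k n. (cmod (\<rho> n x $$ (l, i)))\<^sup>2) / k n))"
      unfolding \<phi>_def using Re_suminf[OF summ[OF xx]] unfolding Re .
    show "summable (\<lambda>n. (1 / 2) ^ n * ((\<Sum>i<k n. \<Sum>l<k n. (cmod (\<rho> n x $$ (l, i)))\<^sup>2) / k n))"
      using summable_Re[OF summ[OF xx]] unfolding Re .
  qed
  have "positive_functional \<phi>"
    unfolding positive_functional_def
  proof (intro conjI ballI allI)
    fix x y assume x: "x \<in> carrier A" and y: "y \<in> carrier A"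
    show "\<phi> (x \<oplus> y) = \<phi> x + \<phi> y"
      unfolding \<phi>_def suminf_add[OF summ[OF x] summ[OF y]] using x y by (simp add: t_add distrib_left ring_distribs)
  next
    fix c x assume x: "x \<in> carrier A"
    show "\<phi> (c \<odot> x) = c * \<phi> x"
      unfolding \<phi>_def suminf_mult[OF summ[OF x], symmetric] using x by (simp add: t_smult mult.left_commute)
    show "\<phi> (star A x) = cnj (\<phi> x)"
      unfolding \<phi>_def bounded_linear.suminf[OF bounded_linear_cnj summ[OF x]] using x by (simp add: t_star)
    show "0 \<le> Re (\<phi> (star A x \<otimes> x))"
      unfolding Re\<phi>[OF x] by (intro suminf_nonneg summ'[OF x]) (simp add: sum_nonneg)
  qed
  moreover have "x = \<zero>" if x: "x \<in> carrier A" and 0: "\<phi> (star A x \<otimes> x) = 0" for x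
  proof (rule separating[OF x])
    fix n
    have "(\<Sum>n. (1 / 2) ^ n * ((\<Sum>i<k n. \<Sum>l<k n. (cmod (\<rho> n x $$ (l, i)))\<^sup>2) / k n)) = 0"
      using Re\<phi>[OF x] 0 by simp
    then have "\<forall>n. (1 / 2) ^ n * ((\<Sum>i<k n. \<Sum>l<k n. (cmod (\<rho> n x $$ (l, i)))\<^sup>2) / k n) = 0"
      by (subst (asm) suminf_eq_zero_iff[OF summ'[OF x]]) (auto simp: sum_nonneg)
    then have "(\<Sum>i<k n. \<Sum>l<k n. (cmod (\<rho> n x $$ (l, i)))\<^sup>2) = 0" using k[of n] by (auto dest: spec[of _ n])
    then have z: "\<forall>i<k n. \<forall>l<k n. (cmod (\<rho> n x $$ (l, i)))\<^sup>2 = 0"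
      by (simp add: sum_nonneg_eq_0_iff sum_nonneg)
    show "\<rho> n x = 0\<^sub>m (k n) (k n)"
      using \<rho>(1)[OF x, of n] z by (intro eq_matI) auto
  qed
  ultimately show ?thesis by (rule that)
qed

theorem (in separated_cstar) ex_left_regular:
  assumes finA: "cstar_fin_dim A"
  obtains q b \<Lambda> c where "\<And>t. t < q \<Longrightarrow> b t \<in> carrier A"
    "star_hom A (mat_cstar q) \<Lambda>"
    "\<And>d s. d \<in> carrier A \<Longrightarrow> s < q \<Longrightarrow> d \<otimes> b s = lincomb_upto (\<lambda>t. \<Lambda> d $$ (t, s)) b q"
    "\<one> = lincomb_upto c b q"
proof -
  obtain \<phi> where \<phi>: "positive_functional \<phi>" and faithful: "\<And>x. x \<in> carrier A \<Longrightarrow> \<phi> (star A x \<otimes> x) = 0 \<Longrightarrow> x = \<zero>"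
    by (rule ex_faithful_functional) (rule that)
  interpret E: ucstar_functional A "\<one>" \<phi> by (rule ucstar_functionalI[OF ucstar_axioms \<phi>])
  obtain q b where o: "E.orthonormal q b"
    and res: "\<And>x. x \<in> carrier A \<Longrightarrow> E.form (E.residue q b x) (E.residue q b x) = 0"
    and eq: "\<And>x z. x \<in> carrier A \<Longrightarrow> z \<in> carrier A \<Longrightarrow> E.form z x = (\<Sum>t<q. E.form z (b t) * E.form (b t) x)"
    by (rule E.ex_orthonormal_basis[OF finA]) (rule that)
  have bc: "b t \<in> carrier A" if "t < q" for t using o that unfolding E.orthonormal_def by simp
  have expand: "x = lincomb_upto (\<lambda>t. E.form (b t) x) b q" if x: "x \<in> carrier A" for x
  proof -
    have "E.residue q b x = \<zero>" using faithful[OF E.residue_closed[OF o x]] res[OF x] by (simp add: E.form_def)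
    then show ?thesis using x lincomb_upto_closed[OF bc] by (simp add: E.residue_def)
  qed
  have cong: "lincomb_upto f b n = lincomb_upto g b n" if "\<And>t. t < n \<Longrightarrow> f t = g t" for f g n
    using that by (induction n) auto
  show ?thesis
  proof (rule that[OF bc E.gns_mat_hom(1)[OF o eq] _ expand[OF e_closed]])
    fix d s assume d: "d \<in> carrier A" and s: "s < q"
    show "d \<otimes> b s = lincomb_upto (\<lambda>t. E.gns_mat q b d $$ (t, s)) b q"
      using expand[of "d \<otimes> b s"] d bc[OF s] s cong[of q "\<lambda>t. E.form (b t) (d \<otimes> b s)" "\<lambda>t. E.gns_mat q b d $$ (t, s)"]
      by (simp add: E.gns_mat_index)
  qed
qed

section \<open>Orbit matrices\<close>

lemma sum_lessThan_mult: "(\<Sum>a<m * q. f a) = (\<Sum>j<m. \<Sum>t<q. f (j * q + t))" for f :: "nat \<Rightarrow> complex"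
  by (induction m) (simp_all add: add.commute[of q] sum_lessThan_add)

lemma ip_unit_left: "r < n \<Longrightarrow> x \<in> carrier_vec n \<Longrightarrow> ip (unit_vec n r) x = x $ r"
proof -
  assume r: "r < n" and x: "x \<in> carrier_vec n"
  have "ip (unit_vec n r) x = (\<Sum>i<n. of_bool (i = r) * x $ i)"
    unfolding ip_def using r by (intro sum.cong) auto
  also have "\<dots> = x $ r" using r by (simp add: of_bool_def if_distrib[of "\<lambda>z. z * _"] cong: if_cong)
  finally show ?thesis .
qed

text \<open>For comparing matrices with different numbers of rows: \<open>L\<close> enters only
  through the Gram matrix of its columns.\<close>

lemma ip_mult_mat_self:
  assumes L: "L \<in> carrier_mat N M" and u: "u \<in> carrier_vec M"
  shows "ip (L *\<^sub>v u) (L *\<^sub>v u) = (\<Sum>c<M. \<Sum>c'<M. cnj (u $ c) * u $ c' * ip (col L c) (col L c'))"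
proof -
  have Lu: "(L *\<^sub>v u) $ r = (\<Sum>c<M. L $$ (r, c) * u $ c)" if "r < N" for r
    using L u that by (simp add: scalar_prod_def lessThan_atLeast0)
  have "ip (L *\<^sub>v u) (L *\<^sub>v u) = (\<Sum>r<N. cnj (\<Sum>c<M. L $$ (r, c) * u $ c) * (\<Sum>c<M. L $$ (r, c) * u $ c))"
    unfolding ip_def using L by (intro sum.cong) (auto simp: Lu simp del: index_mult_mat_vec cnj_sum)
  also have "\<dots> = (\<Sum>r<N. \<Sum>c<M. \<Sum>c'<M. cnj (u $ c) * u $ c' * (cnj (L $$ (r, c)) * L $$ (r, c')))"
    by (simp only: cnj_sum sum_product complex_cnj_mult, intro sum.cong refl) (simp only: mult_ac)
  also have "\<dots> = (\<Sum>c<M. \<Sum>r<N. \<Sum>c'<M. cnj (u $ c) * u $ c' * (cnj (L $$ (r, c)) * L $$ (r, c')))"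
    by (rule sum.swap)
  also have "\<dots> = (\<Sum>c<M. \<Sum>c'<M. \<Sum>r<N. cnj (u $ c) * u $ c' * (cnj (L $$ (r, c)) * L $$ (r, c')))"
    by (intro sum.cong refl sum.swap)
  also have "\<dots> = (\<Sum>c<M. \<Sum>c'<M. cnj (u $ c) * u $ c' * ip (col L c) (col L c'))"
    using L by (intro sum.cong refl) (auto simp: ip_def sum_distrib_left)
  finally show ?thesis .
qed

text \<open>The vectors \<open>\<delta>(b s) w j\<close> as columns, with column index \<open>j q + s\<close>; left multiplication by \<open>\<delta> d\<close>
  then becomes right multiplication by \<open>m\<close> diagonal copies of the left regular representation.\<close>

definition orbit_mat :: "nat \<Rightarrow> ('d \<Rightarrow> complex mat) \<Rightarrow> nat \<Rightarrow> nat \<Rightarrow> (nat \<Rightarrow> 'd) \<Rightarrow> (nat \<Rightarrow> complex vec) \<Rightarrow> complex mat" where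
  "orbit_mat N \<delta> m q b w = mat N (m * q) (\<lambda>(r, c). (\<delta> (b (c mod q)) *\<^sub>v w (c div q)) $ r)"

definition copies :: "nat \<Rightarrow> nat \<Rightarrow> complex mat \<Rightarrow> complex mat" where
  "copies m q Y = mat (m * q) (m * q) (\<lambda>(a, c). if a div q = c div q then Y $$ (a mod q, c mod q) else 0)"

lemma div_mod_bound: "c < m * q \<Longrightarrow> c div q < m \<and> c mod q < q" for c m q :: nat
  by (cases "q = 0") (auto simp: less_mult_imp_div_less)

lemma orbit_mat_carrier [simp]: "orbit_mat N \<delta> m q b w \<in> carrier_mat N (m * q)"
  by (simp add: orbit_mat_def)

lemma copies_carrier [simp]: "copies m q Y \<in> carrier_mat (m * q) (m * q)"
  by (simp add: copies_def)

lemma mat_adjoint_copies: "Y \<in> carrier_mat q q \<Longrightarrow> mat_adjoint (copies m q Y) = copies m q (mat_adjoint Y)"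
  using div_mod_bound[of _ m q] by (intro eq_matI) (auto simp: copies_def)

lemma orbit_mat_col:
  assumes "\<delta> (b (c mod q)) \<in> carrier_mat N N" "c < m * q"
  shows "col (orbit_mat N \<delta> m q b w) c = \<delta> (b (c mod q)) *\<^sub>v w (c div q)"
  using assms by (intro eq_vecI) (auto simp: orbit_mat_def)

context separated_cstar
begin

text \<open>\<open>\<delta> d\<close> turns the column of \<open>b s\<close> and \<open>w j\<close>
  into the vector of \<open>d \<otimes> b s\<close> and \<open>w j\<close>; expanding
  \<open>d \<otimes> b s\<close> in \<open>b\<close> yields column \<open>s\<close> of
  \<open>\<Lambda> d\<close> inside block \<open>j\<close>.\<close>

lemma orbit_mat_equivariant:
  assumes \<delta>: "matrix_rep A N \<delta>" and w: "\<And>j. w j \<in> carrier_vec N" and b: "\<And>t. t < q \<Longrightarrow> b t \<in> carrier A"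
    and \<Lambda>: "\<And>s. s < q \<Longrightarrow> d \<otimes> b s = lincomb_upto (\<lambda>t. \<Lambda> d $$ (t, s)) b q" and d: "d \<in> carrier A"
  shows "\<delta> d * orbit_mat N \<delta> m q b w = orbit_mat N \<delta> m q b w * copies m q (\<Lambda> d)"
proof (rule eq_matI)
  let ?L = "orbit_mat N \<delta> m q b w"
  interpret M: cstar_module A "\<one>" "carrier_vec N" "(+)" "0\<^sub>v N" ip "\<lambda>a v. \<delta> a *\<^sub>v v"
    by (rule cstar_module_rep[OF ucstar_axioms \<delta>])
  note \<delta>c = matrix_repD(3)[OF \<delta>]
  fix r c assume "r < dim_row (?L * copies m q (\<Lambda> d))" "c < dim_col (?L * copies m q (\<Lambda> d))"
  then have r: "r < N" and c: "c < m * q" by (auto simp: orbit_mat_def copies_def)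
  note dm = div_mod_bound[OF c]
  have L: "?L $$ (r, j * q + t) = (\<delta> (b t) *\<^sub>v w j) $ r" if "j < m" "t < q" for j t
  proof -
    have "j * q + t < m * q" using that mult_le_mono1[of "Suc j" m q] by simp
    then show ?thesis using r that by (simp add: orbit_mat_def)
  qed
  have C: "copies m q (\<Lambda> d) $$ (j * q + t, c) = (if j = c div q then \<Lambda> d $$ (t, c mod q) else 0)" if "j < m" "t < q" for j t
  proof -
    have "j * q + t < m * q" using that mult_le_mono1[of "Suc j" m q] by simp
    then show ?thesis using c that by (simp add: copies_def)
  qed
  have colL: "col ?L c = \<delta> (b (c mod q)) *\<^sub>v w (c div q)"
    by (rule orbit_mat_col) (use \<delta>c b dm c in auto)
  have "(\<delta> d * ?L) $$ (r, c) = (\<delta> d *\<^sub>v (\<delta> (b (c mod q)) *\<^sub>v w (c div q))) $ r"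
    using r c carrier_matD[OF \<delta>c[OF d]] carrier_matD[OF orbit_mat_carrier[of N \<delta> m q b w]]
    by (simp add: colL)
  also have "\<dots> = ip (unit_vec N r) (\<delta> (d \<otimes> b (c mod q)) *\<^sub>v w (c div q))"
    using M.act_mult[OF d b w] M.act[OF d M.act[OF b w]] dm r by (simp add: ip_unit_left)
  also have "\<dots> = (\<Sum>t<q. \<Lambda> d $$ (t, c mod q) * ip (unit_vec N r) (\<delta> (b t) *\<^sub>v w (c div q)))"
    using dm b w by (simp add: \<Lambda> M.F_lincomb)
  also have "\<dots> = (\<Sum>t<q. ?L $$ (r, c div q * q + t) * \<Lambda> d $$ (t, c mod q))"
    using dm r M.act[OF b w] by (intro sum.cong) (auto simp: L ip_unit_left)
  also have "\<dots> = (\<Sum>j<m. if j = c div q then (\<Sum>t<q. ?L $$ (r, j * q + t) * \<Lambda> d $$ (t, c mod q)) else 0)"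
    using dm by simp
  also have "\<dots> = (\<Sum>j<m. \<Sum>t<q. ?L $$ (r, j * q + t) * copies m q (\<Lambda> d) $$ (j * q + t, c))"
    by (intro sum.cong refl) (simp add: C)
  also have "\<dots> = (\<Sum>a<m * q. ?L $$ (r, a) * copies m q (\<Lambda> d) $$ (a, c))" by (rule sum_lessThan_mult[symmetric])
  also have "\<dots> = (?L * copies m q (\<Lambda> d)) $$ (r, c)"
    using r c by (simp add: scalar_prod_def lessThan_atLeast0 orbit_mat_def copies_def)
  finally show "(\<delta> d * ?L) $$ (r, c) = (?L * copies m q (\<Lambda> d)) $$ (r, c)" .
qed (use matrix_repD(3)[OF \<delta> d] in \<open>simp_all add: orbit_mat_def copies_def\<close>)

text \<open>\<open>x\<close> places the coefficients of the unit in block \<open>j\<close>. It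
  depends neither on the representation nor on \<open>w\<close>, so the same \<open>x\<close>
  recovers the corresponding vectors of two different families.\<close>

lemma orbit_mat_unit:
  assumes \<delta>: "matrix_rep A N \<delta>" and w: "\<And>j. w j \<in> carrier_vec N" and b: "\<And>t. t < q \<Longrightarrow> b t \<in> carrier A"
    and one: "\<one> = lincomb_upto c b q" and j: "j < m"
  defines "x \<equiv> vec (m * q) (\<lambda>a. if a div q = j then c (a mod q) else 0)"
  shows "orbit_mat N \<delta> m q b w *\<^sub>v x = w j"
proof (rule eq_vecI)
  let ?L = "orbit_mat N \<delta> m q b w"
  interpret M: cstar_module A "\<one>" "carrier_vec N" "(+)" "0\<^sub>v N" ip "\<lambda>a v. \<delta> a *\<^sub>v v"
    by (rule cstar_module_rep[OF ucstar_axioms \<delta>])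
  fix r assume "r < dim_vec (w j)"
  then have r: "r < N" using w[of j] by simp
  have bd: "i * q + t < m * q" if "i < m" "t < q" for i t using that mult_le_mono1[of "Suc i" m q] by simp
  have "(?L *\<^sub>v x) $ r = (\<Sum>a<m * q. ?L $$ (r, a) * x $ a)"
    using r by (simp add: scalar_prod_def lessThan_atLeast0 orbit_mat_def x_def)
  also have "\<dots> = (\<Sum>i<m. \<Sum>t<q. ?L $$ (r, i * q + t) * x $ (i * q + t))" by (rule sum_lessThan_mult)
  also have "\<dots> = (\<Sum>i<m. \<Sum>t<q. if i = j then c t * ip (unit_vec N r) (\<delta> (b t) *\<^sub>v w j) else 0)"
    using r bd M.act[OF b w] by (intro sum.cong refl) (auto simp: orbit_mat_def x_def ip_unit_left)
  also have "\<dots> = (\<Sum>i<m. if i = j then (\<Sum>t<q. c t * ip (unit_vec N r) (\<delta> (b t) *\<^sub>v w j)) else 0)"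
    by (intro sum.cong) auto
  also have "\<dots> = (\<Sum>t<q. c t * ip (unit_vec N r) (\<delta> (b t) *\<^sub>v w j))" using j by simp
  also have "\<dots> = ip (unit_vec N r) (\<delta> \<one> *\<^sub>v w j)" using b w unfolding one by (simp add: M.F_lincomb)
  also have "\<dots> = w j $ r" using M.act_e[OF w] r w[of j] by (simp add: ip_unit_left)
  finally show "(?L *\<^sub>v x) $ r = w j $ r" .
qed (use w[of j] in \<open>simp add: orbit_mat_def\<close>)

end

section \<open>Gluing representations over the amalgam\<close>

text \<open>Exactly the data that the universal property turns into a matrix representation of the
  amalgam.\<close>

definition compatible_reps where
  "compatible_reps D A B \<psi>A \<psi>B N \<tau>A \<tau>B \<longleftrightarrow>
     matrix_rep A N \<tau>A \<and> matrix_rep B N \<tau>B \<and> (\<forall>d\<in>carrier D. \<tau>A (\<psi>A d) = \<tau>B (\<psi>B d))"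

lemma compatible_reps_dsum:
  "compatible_reps D A B \<psi>A \<psi>B N \<tau>A \<tau>B \<Longrightarrow> compatible_reps D A B \<psi>A \<psi>B N' \<tau>A' \<tau>B' \<Longrightarrow>
    compatible_reps D A B \<psi>A \<psi>B (N + N') (\<lambda>a. dsum (\<tau>A a) (\<tau>A' a)) (\<lambda>b. dsum (\<tau>B b) (\<tau>B' b))"
  unfolding compatible_reps_def by (simp add: matrix_rep_dsum)

lemma matrix_rep_compose:
  assumes "matrix_rep A N \<tau>" "star_hom D A \<psi>" "\<psi> \<one>\<^bsub>D\<^esub> = \<one>\<^bsub>A\<^esub>"
  shows "matrix_rep D N (\<lambda>d. \<tau> (\<psi> d))"
  using assms star_hom_compose[of D A \<psi> "mat_cstar N" \<tau>] unfolding matrix_rep_def by simp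

lemma vec_l2_sum_square:
  assumes "u \<in> carrier_vec M"
  shows "(\<Sum>c<M. cmod (u $ c))\<^sup>2 \<le> real M * (vec_l2 u)\<^sup>2"
proof -
  have "(\<Sum>c<M. cmod (u $ c)) \<le> vec_l2 u * sqrt (real M)"
    using L2_set_mult_ineq[of "\<lambda>c. cmod (u $ c)" "\<lambda>_. 1" "{..<M}"] assms
    by (simp add: vec_l2_L2 L2_set_def[of "\<lambda>_. 1"])
  then have "(\<Sum>c<M. cmod (u $ c))\<^sup>2 \<le> (vec_l2 u * sqrt (real M))\<^sup>2" by (rule power_mono) (simp add: sum_nonneg)
  then show ?thesis by (simp add: power_mult_distrib mult.commute)
qed

text \<open>The two forms differ by at most \<open>r\<close> times the squared l1-norm of
  \<open>u\<close>, and Cauchy-Schwarz bounds the latter by \<open>M\<close> times the squared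
  Euclidean norm.\<close>

lemma quadratic_form_close:
  assumes L1: "L1 \<in> carrier_mat N1 M" and L2: "L2 \<in> carrier_mat N2 M" and u: "u \<in> carrier_vec M"
    and r: "\<And>c c'. c < M \<Longrightarrow> c' < M \<Longrightarrow> cmod (ip (col L2 c) (col L2 c') - ip (col L1 c) (col L1 c')) \<le> r" and r0: "r \<ge> 0"
  shows "(vec_l2 (L2 *\<^sub>v u))\<^sup>2 \<le> (vec_l2 (L1 *\<^sub>v u))\<^sup>2 + r * (real M + 1) * (vec_l2 u)\<^sup>2"
proof -
  have "(vec_l2 (L2 *\<^sub>v u))\<^sup>2 - (vec_l2 (L1 *\<^sub>v u))\<^sup>2 = Re (ip (L2 *\<^sub>v u) (L2 *\<^sub>v u) - ip (L1 *\<^sub>v u) (L1 *\<^sub>v u))"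
    by (simp add: ip_self)
  also have "\<dots> \<le> cmod (ip (L2 *\<^sub>v u) (L2 *\<^sub>v u) - ip (L1 *\<^sub>v u) (L1 *\<^sub>v u))" by (rule complex_Re_le_cmod)
  also have "ip (L2 *\<^sub>v u) (L2 *\<^sub>v u) - ip (L1 *\<^sub>v u) (L1 *\<^sub>v u) =
      (\<Sum>c<M. \<Sum>c'<M. cnj (u $ c) * u $ c' * (ip (col L2 c) (col L2 c') - ip (col L1 c) (col L1 c')))"
    unfolding ip_mult_mat_self[OF L1 u] ip_mult_mat_self[OF L2 u] right_diff_distrib sum_subtractf ..
  also have "cmod \<dots> \<le> (\<Sum>c<M. \<Sum>c'<M. cmod (u $ c) * cmod (u $ c') * r)"
    by (intro order_trans[OF norm_sum] sum_mono) (auto simp: norm_mult intro!: mult_left_mono r)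
  also have "\<dots> = r * (\<Sum>c<M. cmod (u $ c))\<^sup>2"
    by (simp add: power2_eq_square sum_product sum_distrib_left mult_ac)
  also have "\<dots> \<le> r * (real M * (vec_l2 u)\<^sup>2)" using vec_l2_sum_square[OF u] r0 by (rule mult_left_mono)
  also have "\<dots> \<le> r * (real M + 1) * (vec_l2 u)\<^sup>2" using r0 by (simp add: algebra_simps)
  finally show ?thesis by simp
qed

text \<open>The squared distance expands into four Gram entries, for
  \<open>star A a \<otimes> a\<close>, for \<open>a\<close> and its conjugate, and for the unit. The
  same combination for \<open>v\<close> is 0 because \<open>v j = act a (v i)\<close>, so four
  errors \<open>\<eta>\<close> remain.\<close>

lemma gram_vector_close:
  assumes A: "ucstar A \<one>\<^bsub>A\<^esub>" and \<tau>: "matrix_rep A N \<tau>" and M: "cstar_module A \<one>\<^bsub>A\<^esub> X vplus vzero F act"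
    and w: "\<And>i. w i \<in> carrier_vec N" and a: "a \<in> carrier A" and v: "v i \<in> X" "v j = act a (v i)"
    and g: "\<And>x y c. x \<in> {i, j} \<Longrightarrow> y \<in> {i, j} \<Longrightarrow> c \<in> {\<one>\<^bsub>A\<^esub>, a, star A a \<otimes>\<^bsub>A\<^esub> a} \<Longrightarrow>
      cmod (ip (w x) (\<tau> c *\<^sub>v w y) - F (v x) (act c (v y))) \<le> \<eta>"
  shows "vec_l2 (\<tau> a *\<^sub>v w i - w j) \<le> sqrt (4 * \<eta>)"
proof -
  interpret A: ucstar A "\<one>\<^bsub>A\<^esub>" by (rule A)
  interpret M: cstar_module A "\<one>\<^bsub>A\<^esub>" X vplus vzero F act by (rule M)
  interpret N: cstar_module A "\<one>\<^bsub>A\<^esub>" "carrier_vec N" "(+)" "0\<^sub>v N" ip "\<lambda>a v. \<tau> a *\<^sub>v v"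
    by (rule cstar_module_rep[OF A \<tau>])
  let ?u = "\<tau> a *\<^sub>v w i" and ?s = "star A a \<otimes>\<^bsub>A\<^esub> a"
  have u: "?u \<in> carrier_vec N" by (rule N.act[OF a w])
  have vj: "v j \<in> X" using M.act[OF a v(1)] v(2) by simp
  have sa: "star A a \<in> carrier A" using a by simp
  have uu: "ip ?u ?u = ip (w i) (\<tau> ?s *\<^sub>v w i)"
    using N.F_act[OF sa w u, of i] N.act_mult[OF sa a w, of i] a by (simp add: A.star_star)
  have vv: "F (v j) (v j) = F (v i) (act ?s (v i))"
    using M.F_act[OF sa v(1) vj] M.act_mult[OF sa a v(1)] a v(2) by (simp add: A.star_star)
  have four: "cmod (p - cnj q - q + r) \<le> \<eta> + \<eta> + \<eta> + \<eta>"
    if "cmod p \<le> \<eta>" "cmod q \<le> \<eta>" "cmod r \<le> \<eta>" for p q r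
    using that norm_triangle_ineq4[of p "cnj q"] norm_triangle_ineq4[of "p - cnj q" q]
      norm_triangle_ineq[of "p - cnj q - q" r] by simp
  have "of_real ((vec_l2 (?u - w j))\<^sup>2) = ip ?u ?u - ip ?u (w j) - (ip (w j) ?u - ip (w j) (w j))"
    unfolding ip_self[symmetric] using u w[of j] by (simp add: ip_minus_left[of _ N] ip_minus_right[of _ N])
  also have "ip ?u (w j) = cnj (ip (w j) ?u)" by (rule ip_commute[OF w u])
  finally have "of_real ((vec_l2 (?u - w j))\<^sup>2) =
      (ip (w i) (\<tau> ?s *\<^sub>v w i) - F (v i) (act ?s (v i))) - cnj (ip (w j) ?u - F (v j) (act a (v i))) -
      (ip (w j) ?u - F (v j) (act a (v i))) + (ip (w j) (\<tau> \<one>\<^bsub>A\<^esub> *\<^sub>v w j) - F (v j) (act \<one>\<^bsub>A\<^esub> (v j)))"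
    using M.F_commute[OF vj vj] N.act_e[OF w] M.act_e[OF vj] by (simp add: uu vv[symmetric] v(2)[symmetric])
  also have "cmod \<dots> \<le> \<eta> + \<eta> + \<eta> + \<eta>"
    using g[of i i ?s] g[of j i a] g[of j j "\<one>\<^bsub>A\<^esub>"] by (intro four) simp_all
  finally have "(vec_l2 (?u - w j))\<^sup>2 \<le> 4 * \<eta>" by (simp add: norm_power)
  then show ?thesis by (rule real_le_rsqrt)
qed

section \<open>Gluing at one finite stage\<close>

text \<open>The two embeddings enter through coordinates of the same sizes \<open>k n\<close>;
  \<open>coords\<close> expresses that they agree on \<open>D\<close> coordinate by
  coordinate.\<close>

locale amalgam_setting =
  D: ucstar D "\<one>\<^bsub>D\<^esub>" + A: separated_cstar A k \<rho>A + B: separated_cstar B k \<rho>B + C: ucstar C "\<one>\<^bsub>C\<^esub>"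
  for D :: "'d cstar" and A :: "'a cstar" and B :: "'b cstar" and C :: "'c cstar" and k \<rho>A \<rho>B +
  fixes \<psi>A \<psi>B \<sigma>A \<sigma>B
  assumes finD: "cstar_fin_dim D"
    and \<psi>A: "star_hom D A \<psi>A" "inj_on \<psi>A (carrier D)" "\<psi>A \<one>\<^bsub>D\<^esub> = \<one>\<^bsub>A\<^esub>"
    and \<psi>B: "star_hom D B \<psi>B" "\<psi>B \<one>\<^bsub>D\<^esub> = \<one>\<^bsub>B\<^esub>"
    and \<sigma>A: "star_hom A C \<sigma>A" "\<sigma>A \<one>\<^bsub>A\<^esub> = \<one>\<^bsub>C\<^esub>"
    and \<sigma>B: "star_hom B C \<sigma>B" "\<sigma>B \<one>\<^bsub>B\<^esub> = \<one>\<^bsub>C\<^esub>"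
    and amalgam: "d \<in> carrier D \<Longrightarrow> \<sigma>A (\<psi>A d) = \<sigma>B (\<psi>B d)"
    and coords: "compatible_reps D A B \<psi>A \<psi>B (k n) (\<rho>A n) (\<rho>B n)"
begin

lemma separated_D: "separated_cstar D k (\<lambda>n d. \<rho>A n (\<psi>A d))"
proof (intro separated_cstar.intro D.ucstar_axioms separated_cstar_axioms.intro)
  show "matrix_rep D (k n) (\<lambda>d. \<rho>A n (\<psi>A d))" for n
    by (rule matrix_rep_compose[OF A.rep \<psi>A(1,3)])
  fix x assume x: "x \<in> carrier D" and "\<And>n. \<rho>A n (\<psi>A x) = 0\<^sub>m (k n) (k n)"
  then have "\<psi>A x = \<zero>\<^bsub>A\<^esub>" using A.separating[of "\<psi>A x"] star_homD(1)[OF \<psi>A(1) x] by blast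
  moreover have "\<psi>A \<zero>\<^bsub>D\<^esub> = \<zero>\<^bsub>A\<^esub>"
    using star_homD(3)[OF \<psi>A(1), of "\<one>\<^bsub>D\<^esub>" 0] star_homD(1)[OF \<psi>A(1), of "\<one>\<^bsub>D\<^esub>"] by (simp add: D.smult_0 A.smult_0)
  ultimately show "x = \<zero>\<^bsub>D\<^esub>" using x \<psi>A(2) by (auto simp: inj_on_def)
qed

text \<open>Both approximations are realized on one space \<open>K1 \<oplus> K2\<close>; a unitary commuting with \<open>D\<close> and nearly
  carrying the first family of vectors to the second conjugates the action of \<open>B\<close>.\<close>

theorem finite_stage:
  fixes m :: nat and v :: "nat \<Rightarrow> 'c"
  assumes \<phi>: "C.positive_functional \<phi>" and v: "\<And>i. i < m \<Longrightarrow> v i \<in> carrier C"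
    and SA: "finite SA" "SA \<subseteq> carrier A" and SB: "finite SB" "SB \<subseteq> carrier B" and e: "\<epsilon> > 0"
  obtains N \<tau>A \<tau>B W where "compatible_reps D A B \<psi>A \<psi>B N \<tau>A \<tau>B" "\<And>i. W i \<in> carrier_vec N"
    "\<And>i j. i < m \<Longrightarrow> j < m \<Longrightarrow> cmod (ip (W i) (W j) - \<phi> (star C (v i) \<otimes>\<^bsub>C\<^esub> v j)) < \<epsilon>"
    "\<And>i j a. i < m \<Longrightarrow> j < m \<Longrightarrow> a \<in> SA \<Longrightarrow> v j = \<sigma>A a \<otimes>\<^bsub>C\<^esub> v i \<Longrightarrow> vec_l2 (\<tau>A a *\<^sub>v W i - W j) < \<epsilon>"
    "\<And>i j b. i < m \<Longrightarrow> j < m \<Longrightarrow> b \<in> SB \<Longrightarrow> v j = \<sigma>B b \<otimes>\<^bsub>C\<^esub> v i \<Longrightarrow> vec_l2 (\<tau>B b *\<^sub>v W i - W j) < \<epsilon>"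
proof -
  interpret E: ucstar_functional C "\<one>\<^bsub>C\<^esub>" \<phi> by (rule ucstar_functionalI[OF C.ucstar_axioms \<phi>])
  interpret DS: separated_cstar D k "\<lambda>n d. \<rho>A n (\<psi>A d)" by (rule separated_D)
  note MA = E.cstar_module_functional[OF A.ucstar_axioms \<sigma>A] and MB = E.cstar_module_functional[OF B.ucstar_axioms \<sigma>B]
  obtain q b \<Lambda> c where b: "\<And>t. t < q \<Longrightarrow> b t \<in> carrier D" and \<Lambda>: "star_hom D (mat_cstar q) \<Lambda>"
    and regular: "\<And>d s. d \<in> carrier D \<Longrightarrow> s < q \<Longrightarrow> d \<otimes>\<^bsub>D\<^esub> b s = D.lincomb_upto (\<lambda>t. \<Lambda> d $$ (t, s)) b q"
    and one: "\<one>\<^bsub>D\<^esub> = D.lincomb_upto c b q"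
    by (rule DS.ex_left_regular[OF finD]) (rule that)
  let ?M = "m * q"
  define x where "x j = vec ?M (\<lambda>a. if a div q = j then c (a mod q) else 0)" for j
  have xc: "x j \<in> carrier_vec ?M" for j by (simp add: x_def)
  \<comment> \<open>The constants depend only on data fixed before the approximating representations
    are chosen, so \<open>\<eta>\<close> can be picked first. \<open>t \<eta>\<close> will bound the
    distance of \<open>T w1\<close> from \<open>w2\<close>, \<open>\<kappa> \<eta>\<close> that of
    \<open>U W\<close> from the second family, and \<open>\<beta>\<close> the norms of the elements
    of \<open>SB\<close>.\<close>
  define Y where "Y = (\<Sum>j<m. (vec_l2 (x j))\<^sup>2)"
  define G where "G = (\<Sum>i<m. Re (E.form (v i) (v i)))"
  define \<beta> where "\<beta> = (\<Sum>b\<in>SB. cnorm B b)"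
  define t where "t \<eta> = sqrt (2 * \<eta> * (real ?M + 1) * Y)" for \<eta> :: real
  define \<kappa> where "\<kappa> \<eta> = t \<eta> + sqrt (2 * \<eta> + 2 * t \<eta> * (G + 1))" for \<eta> :: real
  have "((\<lambda>\<eta>. (\<beta> + 1) * \<kappa> \<eta> + sqrt (4 * \<eta>)) \<longlongrightarrow> (\<beta> + 1) * \<kappa> 0 + sqrt (4 * 0)) (at_right 0)"
    unfolding \<kappa>_def t_def by (intro tendsto_intros)
  then have "((\<lambda>\<eta>. (\<beta> + 1) * \<kappa> \<eta> + sqrt (4 * \<eta>)) \<longlongrightarrow> 0) (at_right 0)" by (simp add: \<kappa>_def t_def)
  then have "\<forall>\<^sub>F \<eta> in at_right 0. (\<beta> + 1) * \<kappa> \<eta> + sqrt (4 * \<eta>) < \<epsilon>" using e by (rule order_tendstoD(2))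
  moreover have "\<forall>\<^sub>F \<eta> in at_right 0. \<eta> < min 1 \<epsilon> \<and> 0 < (\<eta>::real)"
    using eventually_at_right_less[of 0] eventually_at_right_real[of 0 "min 1 \<epsilon>"] e by (auto elim: eventually_elim2)
  ultimately obtain \<eta> where \<eta>: "(\<beta> + 1) * \<kappa> \<eta> + sqrt (4 * \<eta>) < \<epsilon>" "\<eta> < 1" "\<eta> < \<epsilon>" "0 < \<eta>"
    using eventually_happens'[OF _ eventually_conj] trivial_limit_at_right_real min_less_iff_conj by (metis (no_types, lifting))
  \<comment> \<open>These products give the Gram matrices of the orbits. The sets below also contain
    the unit and the elements \<open>star A a \<otimes> a\<close>, as
    \<open>gram_vector_close\<close> requires.\<close>
  define bb where "bb = (\<lambda>(s, t). star D (b s) \<otimes>\<^bsub>D\<^esub> b t) ` ({..<q} \<times> {..<q})"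
  have bb: "finite bb" "bb \<subseteq> carrier D" using b by (auto simp: bb_def)
  define SA' where "SA' = {\<one>\<^bsub>A\<^esub>} \<union> SA \<union> (\<lambda>a. star A a \<otimes>\<^bsub>A\<^esub> a) ` SA \<union> \<psi>A ` bb"
  define SB' where "SB' = {\<one>\<^bsub>B\<^esub>} \<union> SB \<union> (\<lambda>a. star B a \<otimes>\<^bsub>B\<^esub> a) ` SB \<union> \<psi>B ` bb"
  have SA': "finite SA'" "SA' \<subseteq> carrier A" using SA bb star_homD(1)[OF \<psi>A(1)] by (auto simp: SA'_def)
  have SB': "finite SB'" "SB' \<subseteq> carrier B" using SB bb star_homD(1)[OF \<psi>B(1)] by (auto simp: SB'_def)
  \<comment> \<open>The property asks for a partner on \<open>B\<close>, so that \<open>B\<close>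
    acts on the space that models \<open>A\<close>; symmetrically below.\<close>
  obtain N1 \<tau>A1 w1 where "\<exists>\<tau>B. compatible_reps D A B \<psi>A \<psi>B N1 \<tau>A1 \<tau>B" and w1: "\<And>i. w1 i \<in> carrier_vec N1"
    and g1: "\<And>i j a. i < m \<Longrightarrow> j < m \<Longrightarrow> a \<in> SA' \<Longrightarrow> cmod (ip (w1 i) (\<tau>A1 a *\<^sub>v w1 j) - E.form (v i) (\<sigma>A a \<otimes>\<^bsub>C\<^esub> v j)) < \<eta>"
  proof (rule A.gram_approx_finite[where P = "\<lambda>N \<tau>. \<exists>\<tau>B. compatible_reps D A B \<psi>A \<psi>B N \<tau> \<tau>B", OF MA _ _ _ v SA' \<eta>(4)])
    show "\<exists>\<tau>B. compatible_reps D A B \<psi>A \<psi>B N \<tau> \<tau>B \<Longrightarrow> matrix_rep A N \<tau>" for N \<tau> by (auto simp: compatible_reps_def)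
    show "\<exists>\<tau>B. compatible_reps D A B \<psi>A \<psi>B (k n) (\<rho>A n) \<tau>B" for n using coords by blast
    show "\<exists>\<tau>B. compatible_reps D A B \<psi>A \<psi>B N \<tau> \<tau>B \<Longrightarrow> \<exists>\<tau>B. compatible_reps D A B \<psi>A \<psi>B N' \<tau>' \<tau>B \<Longrightarrow>
        \<exists>\<tau>B. compatible_reps D A B \<psi>A \<psi>B (N + N') (\<lambda>a. dsum (\<tau> a) (\<tau>' a)) \<tau>B" for N \<tau> N' \<tau>'
      using compatible_reps_dsum by blast
  qed (assumption+, rule that)
  then obtain \<tau>B1 where c1: "compatible_reps D A B \<psi>A \<psi>B N1 \<tau>A1 \<tau>B1" by blast
  obtain N2 \<tau>B2 w2 where "\<exists>\<tau>A. compatible_reps D A B \<psi>A \<psi>B N2 \<tau>A \<tau>B2" and w2: "\<And>i. w2 i \<in> carrier_vec N2"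
    and g2: "\<And>i j a. i < m \<Longrightarrow> j < m \<Longrightarrow> a \<in> SB' \<Longrightarrow> cmod (ip (w2 i) (\<tau>B2 a *\<^sub>v w2 j) - E.form (v i) (\<sigma>B a \<otimes>\<^bsub>C\<^esub> v j)) < \<eta>"
  proof (rule B.gram_approx_finite[where P = "\<lambda>N \<tau>. \<exists>\<tau>A. compatible_reps D A B \<psi>A \<psi>B N \<tau>A \<tau>", OF MB _ _ _ v SB' \<eta>(4)])
    show "\<exists>\<tau>A. compatible_reps D A B \<psi>A \<psi>B N \<tau>A \<tau> \<Longrightarrow> matrix_rep B N \<tau>" for N \<tau> by (auto simp: compatible_reps_def)
    show "\<exists>\<tau>A. compatible_reps D A B \<psi>A \<psi>B (k n) \<tau>A (\<rho>B n)" for n using coords by blast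
    show "\<exists>\<tau>A. compatible_reps D A B \<psi>A \<psi>B N \<tau>A \<tau> \<Longrightarrow> \<exists>\<tau>A. compatible_reps D A B \<psi>A \<psi>B N' \<tau>A \<tau>' \<Longrightarrow>
        \<exists>\<tau>A. compatible_reps D A B \<psi>A \<psi>B (N + N') \<tau>A (\<lambda>a. dsum (\<tau> a) (\<tau>' a))" for N \<tau> N' \<tau>'
      using compatible_reps_dsum by blast
  qed (assumption+, rule that)
  then obtain \<tau>A2 where c2: "compatible_reps D A B \<psi>A \<psi>B N2 \<tau>A2 \<tau>B2" by blast
  let ?N = "N1 + N2"
  have reps: "matrix_rep A N1 \<tau>A1" "matrix_rep B N1 \<tau>B1" "matrix_rep A N2 \<tau>A2" "matrix_rep B N2 \<tau>B2"
    and agree1: "\<And>d. d \<in> carrier D \<Longrightarrow> \<tau>A1 (\<psi>A d) = \<tau>B1 (\<psi>B d)"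
    and agree2: "\<And>d. d \<in> carrier D \<Longrightarrow> \<tau>A2 (\<psi>A d) = \<tau>B2 (\<psi>B d)"
    using c1 c2 by (auto simp: compatible_reps_def)
  define \<delta>1 where "\<delta>1 d = \<tau>A1 (\<psi>A d)" for d
  define \<delta>2 where "\<delta>2 d = \<tau>B2 (\<psi>B d)" for d
  have \<delta>1: "matrix_rep D N1 \<delta>1" unfolding \<delta>1_def by (rule matrix_rep_compose[OF reps(1) \<psi>A(1,3)])
  have \<delta>2: "matrix_rep D N2 \<delta>2" unfolding \<delta>2_def by (rule matrix_rep_compose[OF reps(4) \<psi>B])
  define L1 where "L1 = orbit_mat N1 \<delta>1 m q b w1"
  define L2 where "L2 = orbit_mat N2 \<delta>2 m q b w2"
  have L1: "L1 \<in> carrier_mat N1 ?M" and L2: "L2 \<in> carrier_mat N2 ?M" by (simp_all add: L1_def L2_def)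
  have col_gram: "ip (col (orbit_mat N \<delta> m q b w) a) (col (orbit_mat N \<delta> m q b w) a') =
      ip (w (a div q)) (\<delta> (star D (b (a mod q)) \<otimes>\<^bsub>D\<^esub> b (a' mod q)) *\<^sub>v w (a' div q))"
    if \<delta>: "matrix_rep D N \<delta>" and w: "\<And>i. w i \<in> carrier_vec N" and a: "a < ?M" "a' < ?M" for N \<delta> w a a'
  proof -
    interpret V: cstar_module D "\<one>\<^bsub>D\<^esub>" "carrier_vec N" "(+)" "0\<^sub>v N" ip "\<lambda>a v. \<delta> a *\<^sub>v v"
      by (rule cstar_module_rep[OF D.ucstar_axioms \<delta>])
    have ba: "b (a mod q) \<in> carrier D" "b (a' mod q) \<in> carrier D" using b div_mod_bound a by blast+
    have cols: "col (orbit_mat N \<delta> m q b w) a = \<delta> (b (a mod q)) *\<^sub>v w (a div q)"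
      "col (orbit_mat N \<delta> m q b w) a' = \<delta> (b (a' mod q)) *\<^sub>v w (a' div q)"
      by (rule orbit_mat_col[where N = N and \<delta> = \<delta> and m = m and q = q and b = b and c = a, OF matrix_repD(3)[OF \<delta> ba(1)] a(1)],
          rule orbit_mat_col[where N = N and \<delta> = \<delta> and m = m and q = q and b = b and c = a', OF matrix_repD(3)[OF \<delta> ba(2)] a(2)])
    show ?thesis unfolding cols
      using V.F_act[of "star D (b (a mod q))" "w (a div q)" "\<delta> (b (a' mod q)) *\<^sub>v w (a' div q)"]
        V.act_mult[of "star D (b (a mod q))" "b (a' mod q)" "w (a' div q)"] V.act[OF ba(2) w] ba w
      by (simp add: D.star_star)
  qed
  have close: "cmod (ip (col L2 a) (col L2 a') - ip (col L1 a) (col L1 a')) \<le> 2 * \<eta>" if a: "a < ?M" "a' < ?M" for a a'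
  proof -
    let ?d = "star D (b (a mod q)) \<otimes>\<^bsub>D\<^esub> b (a' mod q)" and ?i = "a div q" and ?j = "a' div q"
    have ij: "?i < m" "?j < m" "a mod q < q" "a' mod q < q" using div_mod_bound a by blast+
    then have d: "?d \<in> bb" unfolding bb_def by (intro image_eqI[of _ _ "(a mod q, a' mod q)"]) auto
    then have dc: "?d \<in> carrier D" using bb by blast
    have "cmod (ip (w1 ?i) (\<delta>1 ?d *\<^sub>v w1 ?j) - E.form (v ?i) (\<sigma>A (\<psi>A ?d) \<otimes>\<^bsub>C\<^esub> v ?j)) < \<eta>"
      unfolding \<delta>1_def using ij d by (intro g1) (auto simp: SA'_def)
    moreover have "cmod (ip (w2 ?i) (\<delta>2 ?d *\<^sub>v w2 ?j) - E.form (v ?i) (\<sigma>A (\<psi>A ?d) \<otimes>\<^bsub>C\<^esub> v ?j)) < \<eta>"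
      unfolding \<delta>2_def amalgam[OF dc] using ij d by (intro g2) (auto simp: SB'_def)
    ultimately show ?thesis
      unfolding L1_def L2_def col_gram[OF \<delta>1 w1 a] col_gram[OF \<delta>2 w2 a]
      using norm_triangle_ineq4[of "ip (w2 ?i) (\<delta>2 ?d *\<^sub>v w2 ?j) - E.form (v ?i) (\<sigma>A (\<psi>A ?d) \<otimes>\<^bsub>C\<^esub> v ?j)"
          "ip (w1 ?i) (\<delta>1 ?d *\<^sub>v w1 ?j) - E.form (v ?i) (\<sigma>A (\<psi>A ?d) \<otimes>\<^bsub>C\<^esub> v ?j)"] by simp
  qed
  \<comment> \<open>The summand 1 keeps \<open>\<gamma>\<close> positive when there are no
    columns.\<close>
  define \<gamma> where "\<gamma> = 2 * \<eta> * (real ?M + 1)"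
  have \<gamma>: "\<gamma> > 0" using \<eta> by (simp add: \<gamma>_def add_nonneg_pos)
  have le: "(vec_l2 (L2 *\<^sub>v u))\<^sup>2 \<le> (vec_l2 (L1 *\<^sub>v u))\<^sup>2 + \<gamma> * (vec_l2 u)\<^sup>2" if "u \<in> carrier_vec ?M" for u
    unfolding \<gamma>_def by (rule quadratic_form_close[OF L1 L2 that close]) (use \<eta> in auto)
  obtain T where T: "T \<in> carrier_mat N2 N1" and contr: "\<And>v. v \<in> carrier_vec N1 \<Longrightarrow> vec_l2 (T *\<^sub>v v) \<le> vec_l2 v"
    and Tx: "\<And>x. x \<in> carrier_vec ?M \<Longrightarrow> (vec_l2 (T *\<^sub>v (L1 *\<^sub>v x) - L2 *\<^sub>v x))\<^sup>2 \<le> \<gamma> * (vec_l2 x)\<^sup>2"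
    and inter: "\<And>X1 X2 Y. \<lbrakk>X1 \<in> carrier_mat N1 N1; X2 \<in> carrier_mat N2 N2; Y \<in> carrier_mat ?M ?M; X1 * L1 = L1 * Y; X2 * L2 = L2 * Y;
      mat_adjoint X1 * L1 = L1 * mat_adjoint Y\<rbrakk> \<Longrightarrow> X2 * T = T * X1"
    by (rule ex_intertwiner[OF L1 L2 \<gamma> le]) (assumption, rule that)
  have \<Lambda>c: "\<Lambda> d \<in> carrier_mat q q" and \<Lambda>s: "\<Lambda> (star D d) = mat_adjoint (\<Lambda> d)" if "d \<in> carrier D" for d
    using star_homD(1,5)[OF \<Lambda> that] by simp_all
  have equi: "\<delta>1 d * L1 = L1 * copies m q (\<Lambda> d)" "\<delta>2 d * L2 = L2 * copies m q (\<Lambda> d)" if d: "d \<in> carrier D" for d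
    unfolding L1_def L2_def
    by (rule DS.orbit_mat_equivariant[where N = N1 and w = w1 and m = m and q = q and b = b and \<Lambda> = \<Lambda> and d = d, OF \<delta>1 w1 b regular[OF d] d], assumption, assumption,
        rule DS.orbit_mat_equivariant[where N = N2 and w = w2 and m = m and q = q and b = b and \<Lambda> = \<Lambda> and d = d, OF \<delta>2 w2 b regular[OF d] d])
  \<comment> \<open>Both orbit matrices carry \<open>D\<close> by the same matrix
    \<open>copies m q (\<Lambda> d)\<close>, which therefore serves as the common \<open>Y\<close>
    of \<open>ex_intertwiner\<close>.\<close>
  have TD: "\<delta>2 d * T = T * \<delta>1 d" if d: "d \<in> carrier D" for d
  proof (rule inter)
    show "\<delta>1 d \<in> carrier_mat N1 N1" "\<delta>2 d \<in> carrier_mat N2 N2" using matrix_repD(3)[OF \<delta>1 d] matrix_repD(3)[OF \<delta>2 d] .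
    show "mat_adjoint (\<delta>1 d) * L1 = L1 * mat_adjoint (copies m q (\<Lambda> d))"
      using equi(1)[OF D.star_closed[OF d]] matrix_repD(7)[OF \<delta>1 d] \<Lambda>s[OF d] mat_adjoint_copies[OF \<Lambda>c[OF d]] by simp
  qed (use equi[OF d] in simp_all)
  have N1: "0 < N1" by (rule matrix_repD(1)[OF reps(1)])
  obtain U where U: "U \<in> carrier_mat ?N ?N" "mat_adjoint U * U = 1\<^sub>m ?N" "U * mat_adjoint U = 1\<^sub>m ?N"
    and Ucomm: "\<And>X. X \<in> carrier_mat ?N ?N \<Longrightarrow> X * offdiag T = offdiag T * X \<Longrightarrow> X * U = U * X"
    and Uw: "\<And>w w'. w \<in> carrier_vec N1 \<Longrightarrow> w' \<in> carrier_vec N2 \<Longrightarrow>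
      vec_l2 (U *\<^sub>v (w @\<^sub>v 0\<^sub>v N2) - (0\<^sub>v N1 @\<^sub>v w')) \<le> vec_l2 (T *\<^sub>v w - w') + sqrt ((vec_l2 w)\<^sup>2 - (vec_l2 (T *\<^sub>v w))\<^sup>2)"
    by (rule ex_unitary[OF T N1 contr]) (assumption, rule that)
  note Us = mat_adjoint_carrier[OF U(1)]
  define \<tau>A where "\<tau>A a = dsum (\<tau>A1 a) (\<tau>A2 a)" for a
  define \<tau>B0 where "\<tau>B0 a = dsum (\<tau>B1 a) (\<tau>B2 a)" for a
  define \<tau>B where "\<tau>B a = mat_adjoint U * \<tau>B0 a * U" for a
  have \<tau>A: "matrix_rep A ?N \<tau>A" unfolding \<tau>A_def by (rule matrix_rep_dsum[OF reps(1,3)])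
  have \<tau>B0: "matrix_rep B ?N \<tau>B0" unfolding \<tau>B0_def by (rule matrix_rep_dsum[OF reps(2,4)])
  have \<tau>B: "matrix_rep B ?N \<tau>B" unfolding \<tau>B_def by (rule matrix_rep_conj[OF \<tau>B0 U])
  have "\<tau>A (\<psi>A d) = \<tau>B (\<psi>B d)" if d: "d \<in> carrier D" for d
  proof -
    let ?X = "dsum (\<delta>1 d) (\<delta>2 d)"
    have dc: "\<delta>1 d \<in> carrier_mat N1 N1" "\<delta>2 d \<in> carrier_mat N2 N2"
      using matrix_repD(3)[OF \<delta>1 d] matrix_repD(3)[OF \<delta>2 d] .
    have X: "?X \<in> carrier_mat ?N ?N" using dc by simp
    have "?X * offdiag T = offdiag T * ?X"
      using TD[OF D.star_closed[OF d]] matrix_repD(7)[OF \<delta>1 d] matrix_repD(7)[OF \<delta>2 d]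
      by (intro offdiag_commute[OF T dc TD[OF d]]) simp
    then have XU: "?X * U = U * ?X" by (rule Ucomm[OF X])
    have "\<tau>B (\<psi>B d) = mat_adjoint U * ?X * U"
      using agree1[OF d] by (simp add: \<tau>B_def \<tau>B0_def \<delta>1_def \<delta>2_def)
    also have "\<dots> = mat_adjoint U * (U * ?X)" unfolding XU[symmetric] by (rule assoc_mult_mat[OF Us X U(1)])
    also have "\<dots> = ?X" unfolding assoc_mult_mat[OF Us U(1) X, symmetric] U(2) by (rule left_mult_one_mat[OF X])
    also have "\<dots> = \<tau>A (\<psi>A d)" using agree2[OF d] by (simp add: \<tau>A_def \<delta>1_def \<delta>2_def)
    finally show ?thesis ..
  qed
  then have compat: "compatible_reps D A B \<psi>A \<psi>B ?N \<tau>A \<tau>B" using \<tau>A \<tau>B by (simp add: compatible_reps_def)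
  \<comment> \<open>The model of \<open>A\<close> occupies the first summand. \<open>U\<close>
    carries it close to the model of \<open>B\<close> in the second summand, where
    \<open>\<tau>B0\<close> acts as desired.\<close>
  define W where "W i = w1 i @\<^sub>v 0\<^sub>v N2" for i
  have W: "W i \<in> carrier_vec ?N" for i using w1 by (simp add: W_def)
  have gw1: "cmod (ip (w1 i) (w1 j) - E.form (v i) (v j)) < \<eta>" if "i < m" "j < m" for i j
    using g1[OF that, of "\<one>\<^bsub>A\<^esub>"] v[OF that(2)] w1[of j] matrix_repD(2)[OF reps(1)] \<sigma>A(2) by (simp add: SA'_def)
  have gw2: "cmod (ip (w2 i) (w2 j) - E.form (v i) (v j)) < \<eta>" if "i < m" "j < m" for i j
    using g2[OF that, of "\<one>\<^bsub>B\<^esub>"] v[OF that(2)] w2[of j] matrix_repD(2)[OF reps(4)] \<sigma>B(2) by (simp add: SB'_def)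
  have near: "vec_l2 (U *\<^sub>v W i - (0\<^sub>v N1 @\<^sub>v w2 i)) \<le> \<kappa> \<eta>" if i: "i < m" for i
  proof -
    \<comment> \<open>One coefficient vector yields \<open>w1 i\<close> from the first orbit matrix
      and \<open>w2 i\<close> from the second, so \<open>Tx\<close> compares these two
      vectors.\<close>
    have L: "L1 *\<^sub>v x i = w1 i" "L2 *\<^sub>v x i = w2 i"
      unfolding L1_def L2_def x_def
      by (rule DS.orbit_mat_unit[OF \<delta>1 w1 b one i], assumption, rule DS.orbit_mat_unit[OF \<delta>2 w2 b one i])
    have Tw: "T *\<^sub>v w1 i \<in> carrier_vec N2" by (rule mult_mat_vec_carrier[OF T w1])
    have "(vec_l2 (x i))\<^sup>2 \<le> Y" unfolding Y_def using i by (intro member_le_sum) auto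
    then have "(vec_l2 (T *\<^sub>v w1 i - w2 i))\<^sup>2 \<le> \<gamma> * Y"
      using Tx[OF xc, of i] \<gamma> mult_left_mono[of "(vec_l2 (x i))\<^sup>2" Y \<gamma>] unfolding L by linarith
    then have t1: "vec_l2 (T *\<^sub>v w1 i - w2 i) \<le> t \<eta>" unfolding t_def \<gamma>_def by (rule real_le_rsqrt)
    have t0: "0 \<le> t \<eta>" using t1 vec_l2_nonneg[of "T *\<^sub>v w1 i - w2 i"] by linarith
    have d1: "(vec_l2 (w1 i))\<^sup>2 \<le> Re (E.form (v i) (v i)) + \<eta>"
      using gw1[OF i i] complex_Re_le_cmod[of "ip (w1 i) (w1 i) - E.form (v i) (v i)"] by (simp add: ip_self)
    have d2: "\<bar>(vec_l2 (w2 i))\<^sup>2 - Re (E.form (v i) (v i))\<bar> \<le> \<eta>"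
      using gw2[OF i i] abs_Re_le_cmod[of "ip (w2 i) (w2 i) - E.form (v i) (v i)"] by (simp add: ip_self)
    have G: "Re (E.form (v i) (v i)) \<le> G" "0 \<le> G"
      unfolding G_def using i v E.form_self(1) by (auto intro!: member_le_sum sum_nonneg)
    have "(vec_l2 (w2 i))\<^sup>2 \<le> G + 1" using d2 G \<eta> by linarith
    also have "\<dots> \<le> (G + 1)\<^sup>2" using G by (simp add: power2_eq_square algebra_simps)
    finally have w2G: "vec_l2 (w2 i) \<le> G + 1" by (rule power2_le_imp_le) (use G(2) in linarith)
    have tri: "vec_l2 (w2 i) \<le> vec_l2 (T *\<^sub>v w1 i) + t \<eta>"
      using vec_l2_le_add_diff[OF w2 Tw, of i] t1 vec_l2_minus_commute[OF Tw w2, of i] by linarith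
    \<comment> \<open>A lower bound for \<open>T w1\<close>, from
      \<open>vec_l2 (w2 i) - t \<eta> \<le> vec_l2 (T w1)\<close>. Squaring needs a nonnegative left
      side, whence the two cases.\<close>
    have "(vec_l2 (w2 i))\<^sup>2 - 2 * t \<eta> * vec_l2 (w2 i) \<le> (vec_l2 (T *\<^sub>v w1 i))\<^sup>2"
    proof (cases "vec_l2 (w2 i) \<le> t \<eta>")
      case True
      then have "vec_l2 (w2 i) * vec_l2 (w2 i) \<le> t \<eta> * vec_l2 (w2 i)" by (rule mult_right_mono) simp
      moreover have "0 \<le> t \<eta> * vec_l2 (w2 i)" using t0 by simp
      ultimately have "(vec_l2 (w2 i))\<^sup>2 - 2 * t \<eta> * vec_l2 (w2 i) \<le> 0" by (simp add: power2_eq_square)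
      then show ?thesis by (rule order_trans) simp
    next
      case False
      then have "(vec_l2 (w2 i) - t \<eta>)\<^sup>2 \<le> (vec_l2 (T *\<^sub>v w1 i))\<^sup>2" using tri by (intro power_mono) auto
      moreover have "(vec_l2 (w2 i))\<^sup>2 - 2 * t \<eta> * vec_l2 (w2 i) = (vec_l2 (w2 i) - t \<eta>)\<^sup>2 - (t \<eta>)\<^sup>2"
        by (simp add: power2_eq_square algebra_simps)
      ultimately show ?thesis using zero_le_power2[of "t \<eta>"] by linarith
    qed
    moreover have "2 * t \<eta> * vec_l2 (w2 i) \<le> 2 * t \<eta> * (G + 1)" using w2G t0 by (intro mult_left_mono) auto
    ultimately have "(vec_l2 (w1 i))\<^sup>2 - (vec_l2 (T *\<^sub>v w1 i))\<^sup>2 \<le> 2 * \<eta> + 2 * t \<eta> * (G + 1)"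
      using d1 d2 by linarith
    then have "sqrt ((vec_l2 (w1 i))\<^sup>2 - (vec_l2 (T *\<^sub>v w1 i))\<^sup>2) \<le> sqrt (2 * \<eta> + 2 * t \<eta> * (G + 1))" by simp
    then show ?thesis using Uw[OF w1 w2, of i i] t1 unfolding W_def \<kappa>_def by linarith
  qed
  have \<beta>0: "\<beta> \<ge> 0" unfolding \<beta>_def using SB by (intro sum_nonneg B.cnorm_nonneg) auto
  have \<kappa>0: "\<kappa> \<eta> \<ge> 0" unfolding \<kappa>_def t_def Y_def G_def using \<eta> v E.form_self(1)
    by (intro add_nonneg_nonneg real_sqrt_ge_zero mult_nonneg_nonneg sum_nonneg) auto
  have s4: "sqrt (4 * \<eta>) < \<epsilon>" using \<eta>(1) \<beta>0 \<kappa>0 mult_nonneg_nonneg[of "\<beta> + 1" "\<kappa> \<eta>"] by linarith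
  show ?thesis
  proof (rule that[OF compat W])
    fix i j assume ij: "i < m" "j < m"
    have "ip (W i) (W j) = ip (w1 i) (w1 j)"
      unfolding W_def using ip_append[OF w1[of i] w1[of j] zero_carrier_vec[of N2] zero_carrier_vec[of N2]] by (simp add: ip_def[of "0\<^sub>v N2"])
    then show "cmod (ip (W i) (W j) - \<phi> (star C (v i) \<otimes>\<^bsub>C\<^esub> v j)) < \<epsilon>"
      using gw1[OF ij] \<eta>(3) by (simp add: E.form_def)
  next
    fix i j a assume ij: "i < m" "j < m" and a: "a \<in> SA" and vj: "v j = \<sigma>A a \<otimes>\<^bsub>C\<^esub> v i"
    have ac: "a \<in> carrier A" using a SA by blast
    note t12 = matrix_repD(3)[OF reps(1) ac] matrix_repD(3)[OF reps(3) ac]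
    have u: "\<tau>A1 a *\<^sub>v w1 i - w1 j \<in> carrier_vec N1" using mult_mat_vec_carrier[OF t12(1) w1[of i]] w1[of j] by simp
    have "\<tau>A a *\<^sub>v W i = (\<tau>A1 a *\<^sub>v w1 i) @\<^sub>v 0\<^sub>v N2"
      unfolding \<tau>A_def W_def dsum_mult_vec[OF t12 w1 zero_carrier_vec] mult_mat_zero_vec[OF t12(2)] ..
    then have "\<tau>A a *\<^sub>v W i - W j = (\<tau>A1 a *\<^sub>v w1 i - w1 j) @\<^sub>v 0\<^sub>v N2"
      unfolding W_def using t12(1) w1[of i] w1[of j] by (intro eq_vecI) auto
    then have "(vec_l2 (\<tau>A a *\<^sub>v W i - W j))\<^sup>2 = (vec_l2 (\<tau>A1 a *\<^sub>v w1 i - w1 j))\<^sup>2"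
      using vec_l2_append[OF u zero_carrier_vec[of N2]] by (simp add: vec_l2_zero)
    then have "vec_l2 (\<tau>A a *\<^sub>v W i - W j) = vec_l2 (\<tau>A1 a *\<^sub>v w1 i - w1 j)" by (rule power2_eq_imp_eq) simp_all
    also have "\<dots> \<le> sqrt (4 * \<eta>)"
    proof (rule gram_vector_close[where v = v and w = w1 and i = i and j = j and F = E.form and act = "\<lambda>b x. \<sigma>A b \<otimes>\<^bsub>C\<^esub> x",
          OF A.ucstar_axioms reps(1) MA w1 ac v[OF ij(1)] vj])
      fix y z c assume "y \<in> {i, j}" "z \<in> {i, j}" "c \<in> {\<one>\<^bsub>A\<^esub>, a, star A a \<otimes>\<^bsub>A\<^esub> a}"
      then show "cmod (ip (w1 y) (\<tau>A1 c *\<^sub>v w1 z) - E.form (v y) (\<sigma>A c \<otimes>\<^bsub>C\<^esub> v z)) \<le> \<eta>"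
        using ij a by (intro less_imp_le[OF g1]) (auto simp: SA'_def)
    qed
    finally show "vec_l2 (\<tau>A a *\<^sub>v W i - W j) < \<epsilon>" using s4 by linarith
  next
    fix i j a assume ij: "i < m" "j < m" and a: "a \<in> SB" and vj: "v j = \<sigma>B a \<otimes>\<^bsub>C\<^esub> v i"
    have ac: "a \<in> carrier B" using a SB by blast
    note t12 = matrix_repD(3)[OF reps(2) ac] matrix_repD(3)[OF reps(4) ac]
    let ?X = "\<tau>B0 a"
    let ?z = "\<lambda>i. 0\<^sub>v N1 @\<^sub>v w2 i"
    have X: "?X \<in> carrier_mat ?N ?N" by (rule matrix_repD(3)[OF \<tau>B0 ac])
    have z: "?z l \<in> carrier_vec ?N" for l using w2 by simp
    have UW: "U *\<^sub>v W l \<in> carrier_vec ?N" for l by (rule mult_mat_vec_carrier[OF U(1) W])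
    have XUW: "?X *\<^sub>v (U *\<^sub>v W i) \<in> carrier_vec ?N" by (rule mult_mat_vec_carrier[OF X UW])
    have Xz: "?X *\<^sub>v ?z i \<in> carrier_vec ?N" by (rule mult_mat_vec_carrier[OF X z])
    have isom: "vec_l2 (mat_adjoint U *\<^sub>v y) = vec_l2 y" if y: "y \<in> carrier_vec ?N" for y
    proof -
      have "ip (mat_adjoint U *\<^sub>v y) (mat_adjoint U *\<^sub>v y) = ip y (U *\<^sub>v (mat_adjoint U *\<^sub>v y))"
        by (rule ip_adjoint[OF U(1) y mult_mat_vec_carrier[OF Us y]])
      also have "U *\<^sub>v (mat_adjoint U *\<^sub>v y) = y"
        using assoc_mult_mat_vec[OF U(1) Us y] y by (simp add: U(3))
      finally have "(vec_l2 (mat_adjoint U *\<^sub>v y))\<^sup>2 = (vec_l2 y)\<^sup>2" unfolding ip_self by (metis of_real_eq_iff)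
      then show ?thesis by (rule power2_eq_imp_eq) simp_all
    qed
    have "\<tau>B a *\<^sub>v W i = mat_adjoint U *\<^sub>v (?X *\<^sub>v (U *\<^sub>v W i))"
      unfolding \<tau>B_def using assoc_mult_mat_vec[OF mult_carrier_mat[OF Us X] U(1) W] assoc_mult_mat_vec[OF Us X UW] by simp
    moreover have "W j = mat_adjoint U *\<^sub>v (U *\<^sub>v W j)"
      using assoc_mult_mat_vec[OF Us U(1) W, of j] W[of j] by (simp add: U(2))
    ultimately have "\<tau>B a *\<^sub>v W i - W j = mat_adjoint U *\<^sub>v (?X *\<^sub>v (U *\<^sub>v W i) - U *\<^sub>v W j)"
      using mult_minus_distrib_mat_vec[OF Us XUW UW, of j] by metis
    then have "vec_l2 (\<tau>B a *\<^sub>v W i - W j) = vec_l2 (?X *\<^sub>v (U *\<^sub>v W i) - U *\<^sub>v W j)"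
      using isom[of "?X *\<^sub>v (U *\<^sub>v W i) - U *\<^sub>v W j"] XUW UW by simp
    \<comment> \<open>Three errors: moving \<open>W i\<close> to the second family, the action of
      \<open>B\<close> there, and moving back to \<open>W j\<close>. Together they are at most
      \<open>(\<beta> + 1) * \<kappa> \<eta> + sqrt (4 * \<eta>)\<close>.\<close>
    also have "\<dots> \<le> vec_l2 (?X *\<^sub>v (U *\<^sub>v W i) - ?X *\<^sub>v ?z i) + (vec_l2 (?X *\<^sub>v ?z i - ?z j) + vec_l2 (?z j - U *\<^sub>v W j))"
      using vec_l2_minus_triangle[OF XUW Xz UW[of j]] vec_l2_minus_triangle[OF Xz z UW[of j], of j] by linarith
    also have "vec_l2 (?X *\<^sub>v (U *\<^sub>v W i) - ?X *\<^sub>v ?z i) \<le> \<beta> * \<kappa> \<eta>"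
    proof -
      have "?X *\<^sub>v (U *\<^sub>v W i) - ?X *\<^sub>v ?z i = ?X *\<^sub>v (U *\<^sub>v W i - ?z i)"
        by (rule mult_minus_distrib_mat_vec[OF X UW z, symmetric])
      then have "vec_l2 (?X *\<^sub>v (U *\<^sub>v W i) - ?X *\<^sub>v ?z i) \<le> mat_opnorm ?X * vec_l2 (U *\<^sub>v W i - ?z i)"
        using opnorm_bound[OF X, of "U *\<^sub>v W i - ?z i"] UW z by simp
      also have "\<dots> \<le> \<beta> * \<kappa> \<eta>"
      proof (intro mult_mono near ij \<beta>0)
        have "mat_opnorm ?X \<le> cnorm B a"
          using star_hom_contractive[OF B.ucstar_axioms ucstar_mat_cstar _ _ ac, of ?N \<tau>B0] \<tau>B0
          by (simp add: matrix_rep_def)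
        also have "\<dots> \<le> \<beta>" unfolding \<beta>_def using a SB B.cnorm_nonneg by (intro member_le_sum) auto
        finally show "mat_opnorm ?X \<le> \<beta>" .
      qed simp
      finally show ?thesis .
    qed
    also have "vec_l2 (?X *\<^sub>v ?z i - ?z j) \<le> sqrt (4 * \<eta>)"
    proof -
      have tw: "\<tau>B2 a *\<^sub>v w2 i \<in> carrier_vec N2" by (rule mult_mat_vec_carrier[OF t12(2) w2])
      have u: "\<tau>B2 a *\<^sub>v w2 i - w2 j \<in> carrier_vec N2" using tw w2[of j] by simp
      have "?X *\<^sub>v ?z i = 0\<^sub>v N1 @\<^sub>v (\<tau>B2 a *\<^sub>v w2 i)"
        unfolding \<tau>B0_def dsum_mult_vec[OF t12 zero_carrier_vec w2] mult_mat_zero_vec[OF t12(1)] ..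
      then have "?X *\<^sub>v ?z i - ?z j = 0\<^sub>v N1 @\<^sub>v (\<tau>B2 a *\<^sub>v w2 i - w2 j)"
        using t12(2) w2[of i] w2[of j] by (intro eq_vecI) auto
      then have "(vec_l2 (?X *\<^sub>v ?z i - ?z j))\<^sup>2 = (vec_l2 (\<tau>B2 a *\<^sub>v w2 i - w2 j))\<^sup>2"
        using vec_l2_append[OF zero_carrier_vec[of N1] u] by (simp add: vec_l2_zero)
      then have "vec_l2 (?X *\<^sub>v ?z i - ?z j) = vec_l2 (\<tau>B2 a *\<^sub>v w2 i - w2 j)" by (rule power2_eq_imp_eq) simp_all
      also have "\<dots> \<le> sqrt (4 * \<eta>)"
      proof (rule gram_vector_close[where v = v and w = w2 and i = i and j = j and F = E.form and act = "\<lambda>b x. \<sigma>B b \<otimes>\<^bsub>C\<^esub> x",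
          OF B.ucstar_axioms reps(4) MB w2 ac v[OF ij(1)] vj])
        fix y z c assume "y \<in> {i, j}" "z \<in> {i, j}" "c \<in> {\<one>\<^bsub>B\<^esub>, a, star B a \<otimes>\<^bsub>B\<^esub> a}"
        then show "cmod (ip (w2 y) (\<tau>B2 c *\<^sub>v w2 z) - E.form (v y) (\<sigma>B c \<otimes>\<^bsub>C\<^esub> v z)) \<le> \<eta>"
          using ij a by (intro less_imp_le[OF g2]) (auto simp: SB'_def)
      qed
      finally show ?thesis .
    qed
    also have "vec_l2 (?z j - U *\<^sub>v W j) \<le> \<kappa> \<eta>"
      using near[OF ij(2)] vec_l2_minus_commute[OF UW z] by metis
    finally show "vec_l2 (\<tau>B a *\<^sub>v W i - W j) < \<epsilon>" using \<eta>(1) by (simp add: algebra_simps)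
  qed
qed

end

section \<open>Passage to the limit\<close>

lemma vec_defect_lincomb:
  fixes U :: "complex vec"
  assumes "U \<in> carrier_vec n" "V \<in> carrier_vec n" "P \<in> carrier_vec n" "Q \<in> carrier_vec n" "Z \<in> carrier_vec n"
  shows "a \<cdot>\<^sub>v U + b \<cdot>\<^sub>v V - Z = (a \<cdot>\<^sub>v (U - P) + b \<cdot>\<^sub>v (V - Q)) + (- 1) \<cdot>\<^sub>v (Z - (a \<cdot>\<^sub>v P + b \<cdot>\<^sub>v Q))"
  using assms by (intro eq_vecI) (auto simp: algebra_simps)

lemma vec_defect_sum:
  fixes U :: "complex vec"
  assumes "U \<in> carrier_vec n" "V \<in> carrier_vec n" "P \<in> carrier_vec n" "Q \<in> carrier_vec n" "Z \<in> carrier_vec n"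
  shows "U + V - Z = ((U + (V - Q)) + (- 1) \<cdot>\<^sub>v (Z - (1 \<cdot>\<^sub>v P + 1 \<cdot>\<^sub>v Q))) + (- 1) \<cdot>\<^sub>v P"
  using assms by (intro eq_vecI) (auto simp: algebra_simps)

text \<open>The vectors \<open>W i v\<close> imitate the GNS vectors of \<open>\<phi>\<close>; along \<open>F\<close> they depend linearly on \<open>v\<close> although no
  single \<open>W i\<close> need be linear.\<close>

locale asymptotic_rep = ucstar_functional A "\<one>\<^bsub>A\<^esub>" \<phi> for A :: "'a cstar" (structure) and \<phi> +
  fixes F :: "'i filter" and N :: "'i \<Rightarrow> nat" and \<tau> :: "'i \<Rightarrow> 'a \<Rightarrow> complex mat" and W :: "'i \<Rightarrow> 'a \<Rightarrow> complex vec"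
  assumes rep: "matrix_rep A (N i) (\<tau> i)" and W: "W i v \<in> carrier_vec (N i)"
    and gram: "u \<in> carrier A \<Longrightarrow> v \<in> carrier A \<Longrightarrow> ((\<lambda>i. ip (W i u) (W i v)) \<longlongrightarrow> form u v) F"
begin

lemma norm_tendsto:
  assumes "v \<in> carrier A"
  shows "((\<lambda>i. vec_l2 (W i v)) \<longlongrightarrow> sqrt (Re (form v v))) F"
proof -
  have "((\<lambda>i. sqrt (Re (ip (W i v) (W i v)))) \<longlongrightarrow> sqrt (Re (form v v))) F"
    by (intro tendsto_intros gram assms)
  then show ?thesis by (simp add: ip_self)
qed

text \<open>The squared norm of the defect is a combination of Gram entries, and its limit is the
  same combination of values of \<open>form\<close>, which is 0 because \<open>form\<close> is
  sesquilinear.\<close>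

lemma asymptotically_linear:
  assumes u: "u \<in> carrier A" and v: "v \<in> carrier A"
  shows "((\<lambda>i. vec_l2 (W i (a \<odot> u \<oplus> b \<odot> v) - (a \<cdot>\<^sub>v W i u + b \<cdot>\<^sub>v W i v))) \<longlongrightarrow> 0) F"
proof -
  let ?z = "a \<odot> u \<oplus> b \<odot> v"
  have z: "?z \<in> carrier A" using u v by simp
  have fz: "form y ?z = a * form y u + b * form y v" if "y \<in> carrier A" for y
    using that u v by (simp add: form_add_right form_smult_right)
  let ?d = "\<lambda>i. W i ?z - (a \<cdot>\<^sub>v W i u + b \<cdot>\<^sub>v W i v)"
  have "of_real ((vec_l2 (?d i))\<^sup>2) = ip (W i ?z) (W i ?z) - (a * ip (W i ?z) (W i u) + b * ip (W i ?z) (W i v))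
      - (cnj a * (ip (W i u) (W i ?z) - (a * ip (W i u) (W i u) + b * ip (W i u) (W i v)))
        + cnj b * (ip (W i v) (W i ?z) - (a * ip (W i v) (W i u) + b * ip (W i v) (W i v))))" for i
  proof -
    have c: "a \<cdot>\<^sub>v W i u \<in> carrier_vec (N i)" "b \<cdot>\<^sub>v W i v \<in> carrier_vec (N i)"
      "a \<cdot>\<^sub>v W i u + b \<cdot>\<^sub>v W i v \<in> carrier_vec (N i)" "?d i \<in> carrier_vec (N i)"
      using W[of i] by simp_all
    have right: "ip y (?d i) = ip y (W i ?z) - (a * ip y (W i u) + b * ip y (W i v))" if "y \<in> carrier_vec (N i)" for y
      using that W[of i] c by (simp add: ip_minus_right[of _ "N i"] ip_add_right[of _ "N i"] ip_smult_right[of _ "N i"])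
    have "ip (?d i) (?d i) = ip (W i ?z) (?d i) - (cnj a * ip (W i u) (?d i) + cnj b * ip (W i v) (?d i))"
      using W[of i] c by (simp add: ip_minus_left[of _ "N i"] ip_add_left[of _ "N i"] ip_smult_left[of _ "N i"])
    then show ?thesis unfolding ip_self[symmetric] right[OF W] .
  qed
  moreover have "((\<lambda>i. ip (W i ?z) (W i ?z) - (a * ip (W i ?z) (W i u) + b * ip (W i ?z) (W i v))
      - (cnj a * (ip (W i u) (W i ?z) - (a * ip (W i u) (W i u) + b * ip (W i u) (W i v)))
        + cnj b * (ip (W i v) (W i ?z) - (a * ip (W i v) (W i u) + b * ip (W i v) (W i v))))) \<longlongrightarrow>
      form ?z ?z - (a * form ?z u + b * form ?z v)
      - (cnj a * (form u ?z - (a * form u u + b * form u v)) + cnj b * (form v ?z - (a * form v u + b * form v v)))) F"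
    by (intro tendsto_intros gram u v z)
  ultimately have "((\<lambda>i. complex_of_real ((vec_l2 (?d i))\<^sup>2)) \<longlongrightarrow> 0) F"
    unfolding fz[OF z] fz[OF u] fz[OF v] by simp
  from tendsto_real_sqrt[OF tendsto_Re[OF this]] show ?thesis by simp
qed

section \<open>Elements that act correctly in the limit\<close>

definition intertwined :: "'a \<Rightarrow> bool" where
  "intertwined y \<longleftrightarrow> (\<forall>v\<in>carrier A. ((\<lambda>i. vec_l2 (\<tau> i y *\<^sub>v W i v - W i (y \<otimes> v))) \<longlongrightarrow> 0) F)"

lemma intertwined_lincomb:
  assumes x: "x \<in> carrier A" "intertwined x" and y: "y \<in> carrier A" "intertwined y"
  shows "intertwined (a \<odot> x \<oplus> b \<odot> y)"
  unfolding intertwined_def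
proof
  fix v assume v: "v \<in> carrier A"
  let ?z = "a \<odot> x \<oplus> b \<odot> y"
  let ?p = "\<lambda>i. \<tau> i x *\<^sub>v W i v - W i (x \<otimes> v)" and ?q = "\<lambda>i. \<tau> i y *\<^sub>v W i v - W i (y \<otimes> v)"
    and ?r = "\<lambda>i. W i (a \<odot> (x \<otimes> v) \<oplus> b \<odot> (y \<otimes> v)) - (a \<cdot>\<^sub>v W i (x \<otimes> v) + b \<cdot>\<^sub>v W i (y \<otimes> v))"
  have "((\<lambda>i. cmod a * vec_l2 (?p i) + cmod b * vec_l2 (?q i) + vec_l2 (?r i)) \<longlongrightarrow> cmod a * 0 + cmod b * 0 + 0) F"
    using x y v by (intro tendsto_intros asymptotically_linear) (auto simp: intertwined_def)
  then have lim: "((\<lambda>i. cmod a * vec_l2 (?p i) + cmod b * vec_l2 (?q i) + vec_l2 (?r i)) \<longlongrightarrow> 0) F" by simp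
  show "((\<lambda>i. vec_l2 (\<tau> i ?z *\<^sub>v W i v - W i (?z \<otimes> v))) \<longlongrightarrow> 0) F"
  proof (rule Lim_null_comparison[OF always_eventually lim], rule allI)
    fix i
    note t = matrix_repD[OF rep[of i]]
    note tx = t(3)[OF x(1)] and ty = t(3)[OF y(1)]
    have zv: "?z \<otimes> v = a \<odot> (x \<otimes> v) \<oplus> b \<odot> (y \<otimes> v)" using x y v by (simp add: distrib_right smult_mult_left)
    have tz: "\<tau> i ?z *\<^sub>v W i v = a \<cdot>\<^sub>v (\<tau> i x *\<^sub>v W i v) + b \<cdot>\<^sub>v (\<tau> i y *\<^sub>v W i v)"
      using x y tx ty W[of i v] by (simp add: t(4,5) add_mult_distrib_mat_vec[of _ "N i" "N i"] smult_mat_vec[of _ "N i" "N i"])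
    have c: "\<tau> i x *\<^sub>v W i v \<in> carrier_vec (N i)" "\<tau> i y *\<^sub>v W i v \<in> carrier_vec (N i)"
      using mult_mat_vec_carrier[OF tx W] mult_mat_vec_carrier[OF ty W] .
    have "\<tau> i ?z *\<^sub>v W i v - W i (?z \<otimes> v) = (a \<cdot>\<^sub>v ?p i + b \<cdot>\<^sub>v ?q i) + (- 1) \<cdot>\<^sub>v ?r i"
      unfolding tz zv by (rule vec_defect_lincomb[OF c W W W])
    also have "vec_l2 \<dots> \<le> vec_l2 (a \<cdot>\<^sub>v ?p i + b \<cdot>\<^sub>v ?q i) + vec_l2 ((- 1) \<cdot>\<^sub>v ?r i)"
      using c W[of i] by (intro vec_l2_triangle[of _ "N i"]) simp_all
    also have "vec_l2 (a \<cdot>\<^sub>v ?p i + b \<cdot>\<^sub>v ?q i) \<le> vec_l2 (a \<cdot>\<^sub>v ?p i) + vec_l2 (b \<cdot>\<^sub>v ?q i)"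
      using c W[of i] by (intro vec_l2_triangle[of _ "N i"]) simp_all
    finally show "norm (vec_l2 (\<tau> i ?z *\<^sub>v W i v - W i (?z \<otimes> v))) \<le> cmod a * vec_l2 (?p i) + cmod b * vec_l2 (?q i) + vec_l2 (?r i)"
      by (simp add: vec_l2_smult)
  qed
qed

lemma opnorm_rep: "x \<in> carrier A \<Longrightarrow> v \<in> carrier_vec (N i) \<Longrightarrow> vec_l2 (\<tau> i x *\<^sub>v v) \<le> cnorm A x * vec_l2 v"
proof -
  assume x: "x \<in> carrier A" and v: "v \<in> carrier_vec (N i)"
  have "mat_opnorm (\<tau> i x) \<le> cnorm A x"
    using star_hom_contractive[OF ucstar_axioms ucstar_mat_cstar _ _ x, of "N i" "\<tau> i"] rep[of i]
    by (simp add: matrix_rep_def)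
  then show ?thesis
    using opnorm_bound[OF matrix_repD(3)[OF rep x] v] mult_right_mono[of "mat_opnorm (\<tau> i x)" "cnorm A x" "vec_l2 v"] by simp
qed

text \<open>Two errors: that of \<open>y\<close>, enlarged at most by the factor
  \<open>cnorm A x\<close> because each \<open>\<tau> i\<close> is contractive, and that of
  \<open>x\<close> at the vector \<open>y \<otimes> v\<close>.\<close>

lemma intertwined_mult:
  assumes x: "x \<in> carrier A" "intertwined x" and y: "y \<in> carrier A" "intertwined y"
  shows "intertwined (x \<otimes> y)"
  unfolding intertwined_def
proof
  fix v assume v: "v \<in> carrier A"
  let ?p = "\<lambda>i. \<tau> i y *\<^sub>v W i v - W i (y \<otimes> v)" and ?q = "\<lambda>i. \<tau> i x *\<^sub>v W i (y \<otimes> v) - W i (x \<otimes> (y \<otimes> v))"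
  have "((\<lambda>i. cnorm A x * vec_l2 (?p i) + vec_l2 (?q i)) \<longlongrightarrow> cnorm A x * 0 + 0) F"
    using x y v by (intro tendsto_intros) (auto simp: intertwined_def)
  then have lim: "((\<lambda>i. cnorm A x * vec_l2 (?p i) + vec_l2 (?q i)) \<longlongrightarrow> 0) F" by simp
  show "((\<lambda>i. vec_l2 (\<tau> i (x \<otimes> y) *\<^sub>v W i v - W i (x \<otimes> y \<otimes> v))) \<longlongrightarrow> 0) F"
  proof (rule Lim_null_comparison[OF always_eventually lim], rule allI)
    fix i
    note t = matrix_repD[OF rep[of i]]
    note tx = t(3)[OF x(1)] and ty = t(3)[OF y(1)]
    have c: "\<tau> i y *\<^sub>v W i v \<in> carrier_vec (N i)" "?p i \<in> carrier_vec (N i)"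
      using mult_mat_vec_carrier[OF ty W] W[of i] by simp_all
    have "\<tau> i (x \<otimes> y) *\<^sub>v W i v = \<tau> i x *\<^sub>v (\<tau> i y *\<^sub>v W i v)"
      using assoc_mult_mat_vec[OF tx ty W] by (simp add: t(6)[OF x(1) y(1)])
    then have "vec_l2 (\<tau> i (x \<otimes> y) *\<^sub>v W i v - W i (x \<otimes> y \<otimes> v)) \<le>
        vec_l2 (\<tau> i x *\<^sub>v (\<tau> i y *\<^sub>v W i v) - \<tau> i x *\<^sub>v W i (y \<otimes> v)) + vec_l2 (?q i)"
      using vec_l2_minus_triangle[OF mult_mat_vec_carrier[OF tx c(1)] mult_mat_vec_carrier[OF tx W] W] x y v
      by (simp add: mult_assoc)
    also have "\<tau> i x *\<^sub>v (\<tau> i y *\<^sub>v W i v) - \<tau> i x *\<^sub>v W i (y \<otimes> v) = \<tau> i x *\<^sub>v ?p i"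
      by (rule mult_minus_distrib_mat_vec[OF tx c(1) W, symmetric])
    finally show "norm (vec_l2 (\<tau> i (x \<otimes> y) *\<^sub>v W i v - W i (x \<otimes> y \<otimes> v))) \<le> cnorm A x * vec_l2 (?p i) + vec_l2 (?q i)"
      using opnorm_rep[OF x(1) c(2)] by simp
  qed
qed

text \<open>\<open>(cnorm A d)\<^sup>2 - star A d \<otimes> d\<close> is positive and acts on the
  GNS module of \<open>A\<close> over itself, so \<open>F_act_pos\<close> applies.\<close>

lemma form_mult_le:
  assumes d: "d \<in> carrier A" and v: "v \<in> carrier A"
  shows "Re (form (d \<otimes> v) (d \<otimes> v)) \<le> (cnorm A d)\<^sup>2 * Re (form v v)"
proof -
  let ?h = "of_real ((cnorm A d)\<^sup>2) \<odot> \<one> \<ominus> star A d \<otimes> d"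
  have "star_hom A A (\<lambda>x. x)" by (simp add: star_hom_def)
  then interpret M: cstar_module A "\<one>" "carrier A" "add A" "zero A" form "\<lambda>b x. b \<otimes> x"
    by (rule cstar_module_functional[OF ucstar_axioms]) simp
  have "pos ?h" using d by (intro pos_diff) (simp_all add: cstar_identity star_mult star_star)
  then have "0 \<le> Re (form v (?h \<otimes> v))" by (rule M.F_act_pos[OF _ v])
  also have "form v (?h \<otimes> v) = form v ((of_real ((cnorm A d)\<^sup>2) \<odot> \<one>) \<otimes> v) - form v ((star A d \<otimes> d) \<otimes> v)"
    by (rule M.F_minus) (use d v in simp_all)
  also have "form v ((of_real ((cnorm A d)\<^sup>2) \<odot> \<one>) \<otimes> v) = of_real ((cnorm A d)\<^sup>2) * form v v"
    using M.F_smult[OF e_closed v v] M.act_e[OF v] by simp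
  also have "form v ((star A d \<otimes> d) \<otimes> v) = form (d \<otimes> v) (d \<otimes> v)"
    using form_mult_left[of "star A d" v "d \<otimes> v"] d v by (simp add: mult_assoc star_star)
  finally show ?thesis by simp
qed

text \<open>Replacing \<open>y\<close> by a nearby \<open>x\<close> is cheap eventually along
  \<open>F\<close>: with \<open>d = y - x\<close>, contractivity bounds \<open>\<tau> i d\<close> on
  \<open>W i v\<close>, and \<open>form_mult_le\<close> bounds the limit of the norms of
  \<open>W i (d \<otimes> v)\<close>.\<close>

lemma intertwined_limit:
  assumes y: "y \<in> carrier A" and lim: "\<And>r. r > 0 \<Longrightarrow> \<exists>x\<in>carrier A. intertwined x \<and> cnorm A (y \<ominus> x) < r"
  shows "intertwined y"
  unfolding intertwined_def
proof
  fix v assume v: "v \<in> carrier A"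
  define S where "S = sqrt (Re (form v v))"
  have S: "S \<ge> 0" using form_self(1)[OF v] by (simp add: S_def)
  show "((\<lambda>i. vec_l2 (\<tau> i y *\<^sub>v W i v - W i (y \<otimes> v))) \<longlongrightarrow> 0) F"
  proof (rule tendstoI)
    fix \<epsilon> :: real assume e: "\<epsilon> > 0"
    \<comment> \<open>\<open>S\<close> is the limit of the norms of \<open>W i v\<close>, so
      \<open>S + 1\<close> bounds them eventually. The 4 splits \<open>\<epsilon>\<close> among four
      errors.\<close>
    define r where "r = \<epsilon> / (4 * (S + 1))"
    have r: "r > 0" using e S by (simp add: r_def)
    obtain x where x: "x \<in> carrier A" "intertwined x" "cnorm A (y \<ominus> x) < r" using lim[OF r] by blast
    let ?d = "y \<ominus> x"
    have d: "?d \<in> carrier A" and dv: "?d \<otimes> v \<in> carrier A" "y \<otimes> v \<in> carrier A" "x \<otimes> v \<in> carrier A" using x y v by simp_all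
    have yv: "1 \<odot> (?d \<otimes> v) \<oplus> 1 \<odot> (x \<otimes> v) = y \<otimes> v"
      using x y v distrib_right[of ?d x v] by (simp add: smult_1 minus_plus)
    have rS: "r * (S + 1) = \<epsilon> / 4" using S by (simp add: r_def field_simps)
    have "sqrt (Re (form (?d \<otimes> v) (?d \<otimes> v))) \<le> cnorm A ?d * S"
    proof (rule real_le_lsqrt)
      show "0 \<le> cnorm A ?d * S" using cnorm_nonneg[OF d] S by simp
      have "S\<^sup>2 = Re (form v v)" using form_self(1)[OF v] by (simp add: S_def)
      then show "Re (form (?d \<otimes> v) (?d \<otimes> v)) \<le> (cnorm A ?d * S)\<^sup>2" using form_mult_le[OF d v] by (simp add: power_mult_distrib)
    qed
    also have "\<dots> \<le> r * S" using x(3) S by (intro mult_right_mono) auto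
    also have "\<dots> < \<epsilon> / 4" using rS r by (simp add: algebra_simps)
    finally have "\<forall>\<^sub>F i in F. vec_l2 (W i (?d \<otimes> v)) < \<epsilon> / 4"
      by (rule order_tendstoD(2)[OF norm_tendsto[OF dv(1)]])
    moreover have "\<forall>\<^sub>F i in F. vec_l2 (W i v) < S + 1"
      by (rule order_tendstoD(2)[OF norm_tendsto[OF v]]) (simp add: S_def)
    moreover have "\<forall>\<^sub>F i in F. vec_l2 (\<tau> i x *\<^sub>v W i v - W i (x \<otimes> v)) < \<epsilon> / 4"
      using x(2) v e by (intro order_tendstoD(2)[where y = 0]) (auto simp: intertwined_def)
    moreover have "\<forall>\<^sub>F i in F. vec_l2 (W i (y \<otimes> v) - (1 \<cdot>\<^sub>v W i (?d \<otimes> v) + 1 \<cdot>\<^sub>v W i (x \<otimes> v))) < \<epsilon> / 4"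
      using asymptotically_linear[OF dv(1,3), of 1 1] e unfolding yv by (intro order_tendstoD(2)[where y = 0]) auto
    ultimately show "\<forall>\<^sub>F i in F. dist (vec_l2 (\<tau> i y *\<^sub>v W i v - W i (y \<otimes> v))) 0 < \<epsilon>"
    proof eventually_elim
      case (elim i)
      note t = matrix_repD[OF rep[of i]]
      let ?p = "\<tau> i x *\<^sub>v W i v - W i (x \<otimes> v)"
        and ?q = "W i (y \<otimes> v) - (1 \<cdot>\<^sub>v W i (?d \<otimes> v) + 1 \<cdot>\<^sub>v W i (x \<otimes> v))"
      have c: "\<tau> i x *\<^sub>v W i v \<in> carrier_vec (N i)" "\<tau> i ?d *\<^sub>v W i v \<in> carrier_vec (N i)"
        "?p \<in> carrier_vec (N i)" "?q \<in> carrier_vec (N i)"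
        using mult_mat_vec_carrier[OF t(3)[OF x(1)] W[of i v]] mult_mat_vec_carrier[OF t(3)[OF d] W[of i v]] W[of i] by simp_all
      have "y = ?d \<oplus> x" using x y by (simp add: minus_plus)
      then have "\<tau> i y = \<tau> i ?d + \<tau> i x" using t(4)[OF d x(1)] by simp
      then have ty: "\<tau> i y *\<^sub>v W i v = \<tau> i ?d *\<^sub>v W i v + \<tau> i x *\<^sub>v W i v"
        using add_mult_distrib_mat_vec[OF t(3)[OF d] t(3)[OF x(1)] W] by simp
      have "\<tau> i y *\<^sub>v W i v - W i (y \<otimes> v) = ((\<tau> i ?d *\<^sub>v W i v + ?p) + (- 1) \<cdot>\<^sub>v ?q) + (- 1) \<cdot>\<^sub>v W i (?d \<otimes> v)"
        unfolding ty by (rule vec_defect_sum[OF c(2,1) W W W])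
      then have "vec_l2 (\<tau> i y *\<^sub>v W i v - W i (y \<otimes> v)) \<le>
          vec_l2 (\<tau> i ?d *\<^sub>v W i v) + vec_l2 ?p + vec_l2 ?q + vec_l2 (W i (?d \<otimes> v))"
        using vec_l2_triangle[of "(\<tau> i ?d *\<^sub>v W i v + ?p) + (- 1) \<cdot>\<^sub>v ?q" "N i" "(- 1) \<cdot>\<^sub>v W i (?d \<otimes> v)"]
          vec_l2_triangle[of "\<tau> i ?d *\<^sub>v W i v + ?p" "N i" "(- 1) \<cdot>\<^sub>v ?q"] vec_l2_triangle[OF c(2,3)]
          add_carrier_vec[OF c(2,3)] c(4) W[of i] by (simp add: vec_l2_smult)
      moreover have "vec_l2 (\<tau> i ?d *\<^sub>v W i v) \<le> \<epsilon> / 4"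
      proof -
        have "cnorm A ?d * vec_l2 (W i v) \<le> r * (S + 1)"
          using x(3) elim(2) r cnorm_nonneg[OF d] by (intro mult_mono) auto
        then show ?thesis using opnorm_rep[OF d W, of i v] rS by linarith
      qed
      ultimately show ?case using elim by simp
    qed
  qed
qed

text \<open>The defining limit for \<open>y\<close> gives no direct access to
  \<open>star A y\<close>, so the closed subalgebra consists of the elements for which both are
  intertwined. Hence the generators must be closed under \<open>star\<close>.\<close>

theorem intertwined_generated:
  assumes gen: "cstar_generated_by A G" and G: "\<And>g. g \<in> G \<Longrightarrow> star A g \<in> G" "\<And>g. g \<in> G \<Longrightarrow> intertwined g"
    and x: "x \<in> carrier A"
  shows "intertwined x"
proof -
  define S where "S = {y \<in> carrier A. intertwined y \<and> intertwined (star A y)}"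
  have "G \<subseteq> S" using gen G by (auto simp: S_def cstar_generated_by_def)
  moreover have "cstar_subalgebra S A"
    unfolding cstar_subalgebra_def
  proof (intro conjI ballI allI)
    have "cmetric.mtopology closure_of S \<subseteq> S"
    proof
      fix y assume "y \<in> cmetric.mtopology closure_of S"
      then have y: "y \<in> carrier A" and near: "\<And>r. r > 0 \<Longrightarrow> \<exists>z\<in>S. cdist A y z < r"
        unfolding cmetric.metric_closure_of cmetric.in_mball by auto
      have "intertwined y"
      proof (rule intertwined_limit[OF y])
        fix r :: real assume "r > 0"
        then obtain z where "z \<in> S" "cdist A y z < r" using near by blast
        then show "\<exists>z\<in>carrier A. intertwined z \<and> cnorm A (y \<ominus> z) < r" using y by (auto simp: S_def cdist_cnorm)
      qed
      moreover have "intertwined (star A y)"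
      proof (rule intertwined_limit[OF star_closed[OF y]])
        fix r :: real assume "r > 0"
        then obtain z where z: "z \<in> S" "cdist A y z < r" using near by blast
        then have "z \<in> carrier A" by (simp add: S_def)
        then have "cnorm A (star A y \<ominus> star A z) < r" using z(2) y cdist_star[of y z] by (simp add: cdist_cnorm)
        then show "\<exists>z\<in>carrier A. intertwined z \<and> cnorm A (star A y \<ominus> z) < r" using z(1) by (auto simp: S_def)
      qed
      ultimately show "y \<in> S" using y by (simp add: S_def)
    qed
    then show "closedin cmetric.mtopology S" by (subst closure_of_subset_eq[symmetric]) (auto simp: S_def)
    fix y assume "y \<in> S"
    then have y: "y \<in> carrier A" "intertwined y" "star A y \<in> carrier A" "intertwined (star A y)" by (auto simp: S_def)
    show "star A y \<in> S" using y by (simp add: S_def star_star)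
    show sm: "c \<odot> y \<in> S" for c
      using intertwined_lincomb[OF y(1,2) y(1,2), of c 0] intertwined_lincomb[OF y(3,4) y(3,4), of "cnj c" 0] y
      by (simp add: S_def smult_0 star_smult)
    fix z assume "z \<in> S"
    then have z: "z \<in> carrier A" "intertwined z" "star A z \<in> carrier A" "intertwined (star A z)" by (auto simp: S_def)
    show "y \<oplus> z \<in> S"
      using intertwined_lincomb[OF y(1,2) z(1,2), of 1 1] intertwined_lincomb[OF y(3,4) z(3,4), of 1 1] y z
      by (simp add: S_def smult_1 star_add)
    show "y \<otimes> z \<in> S"
      using intertwined_mult[OF y(1,2) z(1,2)] intertwined_mult[OF z(3,4) y(3,4)] y z by (simp add: S_def star_mult)
  next
    have z: "intertwined \<zero>"
      unfolding intertwined_def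
    proof
      fix v assume v: "v \<in> carrier A"
      have "((\<lambda>i. vec_l2 (W i \<zero>)) \<longlongrightarrow> 0) F" using norm_tendsto[of \<zero>] by (simp add: form_zero_right)
      moreover have "vec_l2 (\<tau> i \<zero> *\<^sub>v W i v - W i (\<zero> \<otimes> v)) = vec_l2 (W i \<zero>)" for i
      proof -
        have "vec_l2 (\<tau> i \<zero> *\<^sub>v W i v) \<le> 0" using opnorm_rep[OF zero_closed W, of i v] by (simp add: cnorm_zero)
        then have "\<tau> i \<zero> *\<^sub>v W i v = 0\<^sub>v (N i)"
          using vec_l2_eq_0[OF mult_mat_vec_carrier[OF matrix_repD(3)[OF rep zero_closed] W, of i v]]
            vec_l2_nonneg[of "\<tau> i \<zero> *\<^sub>v W i v"] by simp
        then show ?thesis using v W[of i \<zero>] vec_l2_minus_commute[of "0\<^sub>v (N i)" "N i" "W i \<zero>"] by simp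
      qed
      ultimately show "((\<lambda>i. vec_l2 (\<tau> i \<zero> *\<^sub>v W i v - W i (\<zero> \<otimes> v))) \<longlongrightarrow> 0) F" by simp
    qed
    then show "\<zero> \<in> S" by (simp add: S_def star_zero)
  qed
  ultimately have "S = carrier A" using gen by (simp add: cstar_generated_by_def)
  then show ?thesis using x unfolding S_def by blast
qed

text \<open>Applied to the vector of the unit: if all \<open>\<tau> i x\<close> were 0, the norms of
  \<open>W i x\<close> would tend to 0, but they tend to
  \<open>sqrt (Re (form x x))\<close>.\<close>

lemma ex_nonzero_rep:
  assumes "F \<noteq> bot" and x: "x \<in> carrier A" "intertwined x" "form x x \<noteq> 0"
  shows "\<exists>i. \<tau> i x \<noteq> 0\<^sub>m (N i) (N i)"
proof (rule ccontr)
  assume "\<nexists>i. \<tau> i x \<noteq> 0\<^sub>m (N i) (N i)"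
  then have "vec_l2 (\<tau> i x *\<^sub>v W i \<one> - W i (x \<otimes> \<one>)) = vec_l2 (W i x)" for i
    using x(1) W[of i] vec_l2_minus_commute[OF zero_carrier_vec W, of i x] by (simp add: mult_zero_mat_vec)
  moreover have "((\<lambda>i. vec_l2 (\<tau> i x *\<^sub>v W i \<one> - W i (x \<otimes> \<one>))) \<longlongrightarrow> 0) F"
    using x(2) e_closed unfolding intertwined_def by (rule bspec)
  ultimately have "((\<lambda>i. vec_l2 (W i x)) \<longlongrightarrow> 0) F" by simp
  then have "sqrt (Re (form x x)) = 0" using tendsto_unique[OF assms(1) norm_tendsto[OF x(1)]] by simp
  then show False using form_self(2)[OF x(1)] x(3) by simp
qed

end

section \<open>Assembling the finite stages\<close>

context amalgam_setting
begin

text \<open>Indexes the model by the elements of \<open>V\<close> rather than by an enumeration.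
  Generators are taken inside \<open>V\<close>, so only finitely many elements of \<open>A\<close>
  and \<open>B\<close> are prescribed.\<close>

lemma finite_stage_amalgam:
  assumes \<phi>: "C.positive_functional \<phi>" and V: "finite V" "V \<subseteq> carrier C" and e: "\<epsilon> > 0"
    and universal: "\<And>N \<tau>A \<tau>B. compatible_reps D A B \<psi>A \<psi>B N \<tau>A \<tau>B \<Longrightarrow>
      \<exists>\<tau>. matrix_rep C N \<tau> \<and> (\<forall>a\<in>carrier A. \<tau> (\<sigma>A a) = \<tau>A a) \<and> (\<forall>b\<in>carrier B. \<tau> (\<sigma>B b) = \<tau>B b)"
  obtains N \<tau> W where "matrix_rep C N \<tau>" "\<And>v. W v \<in> carrier_vec N"
    "\<And>u v. u \<in> V \<Longrightarrow> v \<in> V \<Longrightarrow> cmod (ip (W u) (W v) - \<phi> (star C u \<otimes>\<^bsub>C\<^esub> v)) < \<epsilon>"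
    "\<And>g v. g \<in> V \<inter> (\<sigma>A ` carrier A \<union> \<sigma>B ` carrier B) \<Longrightarrow> v \<in> V \<Longrightarrow> g \<otimes>\<^bsub>C\<^esub> v \<in> V \<Longrightarrow>
      vec_l2 (\<tau> g *\<^sub>v W v - W (g \<otimes>\<^bsub>C\<^esub> v)) < \<epsilon>"
proof -
  obtain m f where f: "V = f ` {..<m::nat}"
    using finite_imp_nat_seg_image_inj_on[OF V(1)] by (auto simp: lessThan_def)
  define SA where "SA = inv_into (carrier A) \<sigma>A ` (V \<inter> \<sigma>A ` carrier A)"
  define SB where "SB = inv_into (carrier B) \<sigma>B ` (V \<inter> \<sigma>B ` carrier B)"
  have SA: "finite SA" "SA \<subseteq> carrier A" using V by (auto simp: SA_def inv_into_into)
  have SB: "finite SB" "SB \<subseteq> carrier B" using V by (auto simp: SB_def inv_into_into)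
  have fc: "f i \<in> carrier C" if "i < m" for i using that V f by auto
  obtain N \<tau>A \<tau>B W where c: "compatible_reps D A B \<psi>A \<psi>B N \<tau>A \<tau>B" and W: "\<And>i. W i \<in> carrier_vec N"
    and gram: "\<And>i j. i < m \<Longrightarrow> j < m \<Longrightarrow> cmod (ip (W i) (W j) - \<phi> (star C (f i) \<otimes>\<^bsub>C\<^esub> f j)) < \<epsilon>"
    and actA: "\<And>i j a. i < m \<Longrightarrow> j < m \<Longrightarrow> a \<in> SA \<Longrightarrow> f j = \<sigma>A a \<otimes>\<^bsub>C\<^esub> f i \<Longrightarrow> vec_l2 (\<tau>A a *\<^sub>v W i - W j) < \<epsilon>"
    and actB: "\<And>i j b. i < m \<Longrightarrow> j < m \<Longrightarrow> b \<in> SB \<Longrightarrow> f j = \<sigma>B b \<otimes>\<^bsub>C\<^esub> f i \<Longrightarrow> vec_l2 (\<tau>B b *\<^sub>v W i - W j) < \<epsilon>"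
    by (rule finite_stage[OF \<phi> fc SA SB e]) (assumption, rule that)
  obtain \<tau> where \<tau>: "matrix_rep C N \<tau>" "\<And>a. a \<in> carrier A \<Longrightarrow> \<tau> (\<sigma>A a) = \<tau>A a" "\<And>b. b \<in> carrier B \<Longrightarrow> \<tau> (\<sigma>B b) = \<tau>B b"
    using universal[OF c] by blast
  define idx where "idx v = inv_into {..<m} f v" for v
  have idx: "idx v < m" "f (idx v) = v" if "v \<in> V" for v
    using that inv_into_into[of v f "{..<m}"] f_inv_into_f[of v f "{..<m}"] unfolding f idx_def by auto
  show ?thesis
  proof (rule that[OF \<tau>(1), of "\<lambda>v. W (idx v)"])
    show "W (idx v) \<in> carrier_vec N" for v by (rule W)
    show "cmod (ip (W (idx u)) (W (idx v)) - \<phi> (star C u \<otimes>\<^bsub>C\<^esub> v)) < \<epsilon>" if "u \<in> V" "v \<in> V" for u v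
      using gram[OF idx(1)[OF that(1)] idx(1)[OF that(2)]] by (simp add: idx(2) that)
    fix g v assume g: "g \<in> V \<inter> (\<sigma>A ` carrier A \<union> \<sigma>B ` carrier B)" and v: "v \<in> V" "g \<otimes>\<^bsub>C\<^esub> v \<in> V"
    show "vec_l2 (\<tau> g *\<^sub>v W (idx v) - W (idx (g \<otimes>\<^bsub>C\<^esub> v))) < \<epsilon>"
    proof (cases "g \<in> \<sigma>A ` carrier A")
      case True
      define a where "a = inv_into (carrier A) \<sigma>A g"
      have a: "a \<in> SA" "\<sigma>A a = g" using True g f_inv_into_f[OF True] by (auto simp: SA_def a_def)
      have "\<tau> g = \<tau>A a" using \<tau>(2)[of a] a SA by auto
      then show ?thesis using actA[OF idx(1)[OF v(1)] idx(1)[OF v(2)] a(1)] by (simp add: idx(2) v a(2))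
    next
      case False
      then have gB: "g \<in> \<sigma>B ` carrier B" using g by blast
      define b where "b = inv_into (carrier B) \<sigma>B g"
      have b: "b \<in> SB" "\<sigma>B b = g" using gB g f_inv_into_f[OF gB] by (auto simp: SB_def b_def)
      have "\<tau> g = \<tau>B b" using \<tau>(3)[of b] b SB by auto
      then show ?thesis using actB[OF idx(1)[OF v(1)] idx(1)[OF v(2)] b(1)] by (simp add: idx(2) v b(2))
    qed
  qed
qed

text \<open>The stages are indexed by a finite set of vectors and a tolerance. Any fixed finite
  relation holds eventually with arbitrarily small error, so along the product filter the stages
  form an asymptotic representation that intertwines the generators, hence all of \<open>C\<close>,
  and \<open>x\<close> is seen at some stage.\<close>

theorem ex_separating_rep:
  assumes gen: "cstar_generated_by C (\<sigma>A ` carrier A \<union> \<sigma>B ` carrier B)"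
    and universal: "\<And>N \<tau>A \<tau>B. compatible_reps D A B \<psi>A \<psi>B N \<tau>A \<tau>B \<Longrightarrow>
      \<exists>\<tau>. matrix_rep C N \<tau> \<and> (\<forall>a\<in>carrier A. \<tau> (\<sigma>A a) = \<tau>A a) \<and> (\<forall>b\<in>carrier B. \<tau> (\<sigma>B b) = \<tau>B b)"
    and x: "x \<in> carrier C" "x \<noteq> \<zero>\<^bsub>C\<^esub>"
  obtains N \<tau> where "matrix_rep C N \<tau>" "\<tau> x \<noteq> 0\<^sub>m N N"
proof -
  let ?G = "\<sigma>A ` carrier A \<union> \<sigma>B ` carrier B"
  obtain \<phi> where \<phi>: "C.positive_functional \<phi>" and \<phi>x: "\<phi> (star C x \<otimes>\<^bsub>C\<^esub> x) = of_real ((cnorm C x)\<^sup>2)"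
    by (rule C.ex_state[OF x(1)]) (rule that)
  interpret E: ucstar_functional C "\<one>\<^bsub>C\<^esub>" \<phi> by (rule ucstar_functionalI[OF C.ucstar_axioms \<phi>])
  define good where "good i p \<longleftrightarrow> (case (i, p) of ((V, n), (N, \<tau>, W)) \<Rightarrow>
      (\<forall>u\<in>V. \<forall>v\<in>V. cmod (ip (W u) (W v) - E.form u v) < inverse (Suc n)) \<and>
      (\<forall>g\<in>V \<inter> ?G. \<forall>v\<in>V. g \<otimes>\<^bsub>C\<^esub> v \<in> V \<longrightarrow> vec_l2 (\<tau> g *\<^sub>v W v - W (g \<otimes>\<^bsub>C\<^esub> v)) < inverse (Suc n)))"
    for i :: "'c set \<times> nat" and p :: "nat \<times> ('c \<Rightarrow> complex mat) \<times> ('c \<Rightarrow> complex vec)"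
  have "\<exists>p. matrix_rep C (fst p) (fst (snd p)) \<and> (\<forall>v. snd (snd p) v \<in> carrier_vec (fst p)) \<and>
      (finite (fst i) \<and> fst i \<subseteq> carrier C \<longrightarrow> good i p)" for i
  proof -
    \<comment> \<open>Inadmissible indices get the empty set, so that a representation and vectors
      exist at every index.\<close>
    define V where "V = (if finite (fst i) \<and> fst i \<subseteq> carrier C then fst i else {})"
    have V: "finite V" "V \<subseteq> carrier C" by (simp_all add: V_def)
    have e: "0 < inverse (real (Suc (snd i)))" by simp
    obtain N \<tau> W where "matrix_rep C N \<tau>" "\<And>v. W v \<in> carrier_vec N"
      "\<And>u v. u \<in> V \<Longrightarrow> v \<in> V \<Longrightarrow> cmod (ip (W u) (W v) - \<phi> (star C u \<otimes>\<^bsub>C\<^esub> v)) < inverse (real (Suc (snd i)))"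
      "\<And>g v. g \<in> V \<inter> ?G \<Longrightarrow> v \<in> V \<Longrightarrow> g \<otimes>\<^bsub>C\<^esub> v \<in> V \<Longrightarrow> vec_l2 (\<tau> g *\<^sub>v W v - W (g \<otimes>\<^bsub>C\<^esub> v)) < inverse (real (Suc (snd i)))"
      by (rule finite_stage_amalgam[OF \<phi> V e universal]) (assumption, rule that)
    then show ?thesis
      by (intro exI[of _ "(N, \<tau>, W)"]) (auto simp: good_def V_def E.form_def split: prod.split)
  qed
  then obtain P where P: "\<And>i. matrix_rep C (fst (P i)) (fst (snd (P i)))" "\<And>i v. snd (snd (P i)) v \<in> carrier_vec (fst (P i))"
    "\<And>i. finite (fst i) \<Longrightarrow> fst i \<subseteq> carrier C \<Longrightarrow> good i (P i)" by metis
  define N where "N i = fst (P i)" for i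
  define \<tau> where "\<tau> i = fst (snd (P i))" for i
  define W where "W i = snd (snd (P i))" for i
  \<comment> \<open>The first factor exhausts the vectors, the second sends the tolerance to
    0.\<close>
  define F where "F = finite_subsets_at_top (carrier C) \<times>\<^sub>F (sequentially :: nat filter)"
  have goodD: "cmod (ip (W (V, n) u) (W (V, n) v) - E.form u v) < inverse (Suc n)"
    "g \<in> V \<Longrightarrow> g \<in> ?G \<Longrightarrow> g \<otimes>\<^bsub>C\<^esub> v \<in> V \<Longrightarrow> vec_l2 (\<tau> (V, n) g *\<^sub>v W (V, n) v - W (V, n) (g \<otimes>\<^bsub>C\<^esub> v)) < inverse (Suc n)"
    if "finite V" "V \<subseteq> carrier C" "u \<in> V" "v \<in> V" for V n u v g
    using P(3)[of "(V, n)"] that unfolding good_def W_def \<tau>_def by (auto split: prod.splits)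
  have ev: "\<forall>\<^sub>F i in F. finite (fst i) \<and> fst i \<subseteq> carrier C \<and> V \<subseteq> fst i \<and> inverse (real (Suc (snd i))) < r"
    if "finite V" "V \<subseteq> carrier C" "r > 0" for V r
  proof -
    have "\<forall>\<^sub>F Z in finite_subsets_at_top (carrier C). finite Z \<and> Z \<subseteq> carrier C \<and> V \<subseteq> Z"
      using that by (auto simp: eventually_finite_subsets_at_top)
    moreover have "\<forall>\<^sub>F n in sequentially. inverse (real (Suc n)) < r"
      using LIMSEQ_inverse_real_of_nat that(3) by (rule order_tendstoD(2))
    ultimately show ?thesis unfolding F_def by (rule eventually_mono[OF eventually_prodI]) auto
  qed
  interpret R: asymptotic_rep C \<phi> F N \<tau> W
  proof (intro asymptotic_rep.intro E.ucstar_functional_axioms asymptotic_rep_axioms.intro)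
    show "matrix_rep C (N i) (\<tau> i)" "W i v \<in> carrier_vec (N i)" for i v
      using P by (simp_all add: N_def \<tau>_def W_def)
    fix u v assume uv: "u \<in> carrier C" "v \<in> carrier C"
    show "((\<lambda>i. ip (W i u) (W i v)) \<longlongrightarrow> E.form u v) F"
    proof (rule tendstoI)
      fix r :: real assume r: "r > 0"
      show "\<forall>\<^sub>F i in F. dist (ip (W i u) (W i v)) (E.form u v) < r"
      proof (rule eventually_mono[OF ev[of "{u, v}" r]])
        fix i assume "finite (fst i) \<and> fst i \<subseteq> carrier C \<and> {u, v} \<subseteq> fst i \<and> inverse (real (Suc (snd i))) < r"
        then show "dist (ip (W i u) (W i v)) (E.form u v) < r"
          using goodD(1)[of "fst i" u v "snd i"] by (simp add: dist_norm)
      qed (use uv r in auto)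
    qed
  qed
  have "R.intertwined x"
  proof (rule R.intertwined_generated[OF gen _ _ x(1)])
    show "star C g \<in> ?G" if "g \<in> ?G" for g
      using that star_homD(5)[OF \<sigma>A(1), symmetric] star_homD(5)[OF \<sigma>B(1), symmetric] by auto
    fix g assume g: "g \<in> ?G"
    then have gc: "g \<in> carrier C" using gen by (auto simp: cstar_generated_by_def)
    show "R.intertwined g"
      unfolding R.intertwined_def
    proof (intro ballI tendstoI)
      fix v r assume v: "v \<in> carrier C" and "(r::real) > 0"
      then have "\<forall>\<^sub>F i in F. finite (fst i) \<and> fst i \<subseteq> carrier C \<and> {g, v, g \<otimes>\<^bsub>C\<^esub> v} \<subseteq> fst i \<and> inverse (real (Suc (snd i))) < r"
        using gc by (intro ev) auto
      then show "\<forall>\<^sub>F i in F. dist (vec_l2 (\<tau> i g *\<^sub>v W i v - W i (g \<otimes>\<^bsub>C\<^esub> v))) 0 < r"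
      proof eventually_elim
        case (elim i)
        then show ?case using goodD(2)[of "fst i" v v g "snd i"] g by auto
      qed
    qed
  qed
  moreover have "F \<noteq> bot" by (simp add: F_def prod_filter_eq_bot)
  moreover have "E.form x x \<noteq> 0" using x \<phi>x by (simp add: E.form_def C.cnorm_eq_0_iff)
  ultimately obtain i where "\<tau> i x \<noteq> 0\<^sub>m (N i) (N i)" using R.ex_nonzero_rep[OF _ x(1)] by blast
  then show ?thesis using that R.rep by blast
qed

end

text \<open>Reading vectors of length \<open>k * k\<close> row by row maps them linearly onto the
  matrices.\<close>

lemma cstar_fin_dim_mat_cstar: "cstar_fin_dim (mat_cstar k)"
proof -
  interpret M: cstar_algebra "mat_cstar k" by (rule cstar_algebra_mat_cstar)
  interpret V: vec_space "TYPE(complex)" "k * k" .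
  let ?f = "\<lambda>v :: complex vec. mat k k (\<lambda>(i, j). v $ (i * k + j))"
  have bound: "i * k + j < k * k" if "i < k" "j < k" for i j
  proof -
    have "i * k + j < Suc i * k" using that(2) by simp
    also have "\<dots> \<le> k * k" using that(1) by (intro mult_le_mono1) simp
    finally show ?thesis .
  qed
  have mh: "?f \<in> LinearCombinations.module_hom (class_ring :: complex ring) V.V (mat_cstar k)"
    unfolding LinearCombinations.module_hom_def using bound
    by (auto simp: module_vec_def intro!: eq_matI)
  have lm: "linear_map (class_ring :: complex ring) V.V (mat_cstar k) ?f"
    by (rule linear_map.intro[OF V.vectorspace_axioms M.vectorspace_axioms
          mod_hom.intro[OF V.module_axioms M.module_axioms mod_hom_axioms.intro[OF mh]]])
  have "?f ` carrier V.V = carrier (mat_cstar k)"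
  proof
    show "?f ` carrier V.V \<subseteq> carrier (mat_cstar k)" by auto
    show "carrier (mat_cstar k) \<subseteq> ?f ` carrier V.V"
    proof
      fix M assume "M \<in> carrier (mat_cstar k)"
      then have M: "M \<in> carrier_mat k k" by simp
      have "M = ?f (vec (k * k) (\<lambda>a. M $$ (a div k, a mod k)))"
        using M bound by (intro eq_matI) auto
      then show "M \<in> ?f ` carrier V.V" by (intro image_eqI) (auto simp: module_vec_def)
    qed
  qed
  then show ?thesis
    using linear_map.rank_nullity_main(2)[OF lm V.fin_dim] unfolding cstar_fin_dim_def by metis
qed

section \<open>Separability\<close>

text \<open>Terms whose values form a countable set closed under the operations. Scalars are indices
  into a countable set, which is taken dense below.\<close>

datatype star_expr = Gen nat | Add star_expr star_expr | Mult star_expr star_expr | Smult nat star_expr | Star star_expr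

instance star_expr :: countable by countable_datatype

primrec star_eval :: "'a cstar \<Rightarrow> (nat \<Rightarrow> complex) \<Rightarrow> (nat \<Rightarrow> 'a) \<Rightarrow> star_expr \<Rightarrow> 'a" where
  "star_eval A c u (Gen n) = u n"
| "star_eval A c u (Add s t) = star_eval A c u s \<oplus>\<^bsub>A\<^esub> star_eval A c u t"
| "star_eval A c u (Mult s t) = star_eval A c u s \<otimes>\<^bsub>A\<^esub> star_eval A c u t"
| "star_eval A c u (Smult n t) = c n \<odot>\<^bsub>A\<^esub> star_eval A c u t"
| "star_eval A c u (Star t) = star A (star_eval A c u t)"

context ucstar
begin

lemma ex_tends:
  assumes "U \<subseteq> carrier A" "x \<in> carrier A" "\<And>r. r > 0 \<Longrightarrow> \<exists>y\<in>U. cdist A x y < r"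
  shows "\<exists>s. (\<forall>n. s n \<in> U) \<and> tends s x"
proof -
  have "\<forall>n. \<exists>y\<in>U. cdist A x y < inverse (real (Suc n))" using assms(3) by simp
  then obtain s where s: "\<And>n. s n \<in> U" "\<And>n. cdist A x (s n) < inverse (real (Suc n))" by metis
  have "tends s x"
  proof (rule tends_bound[OF _ assms(2) LIMSEQ_inverse_real_of_nat])
    show "s n \<in> carrier A" for n using s(1) assms(1) by blast
    show "cdist A (s n) x \<le> inverse (real (Suc n))" for n
      using s(2)[of n] cmetric.commute[of x "s n"] by simp
  qed
  then show ?thesis using s(1) by blast
qed

text \<open>The limits of sequences of term values form a closed subalgebra containing
  \<open>G\<close>, hence everything; the countably many values are therefore dense.\<close>

theorem separable_generated:
  assumes gen: "cstar_generated_by A G" and U0: "countable U0" "U0 \<subseteq> carrier A"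
    and near: "\<And>g r. g \<in> G \<Longrightarrow> r > 0 \<Longrightarrow> \<exists>u\<in>U0. cdist A g u < r"
  shows "cstar_separable A"
proof -
  obtain Q :: "complex set" where Q: "countable Q" "\<And>X. open X \<Longrightarrow> X \<noteq> {} \<Longrightarrow> \<exists>d\<in>Q. d \<in> X"
    by (rule countable_dense_setE) (rule that)
  have Qne: "Q \<noteq> {}" using Q(2)[of UNIV] by auto
  \<comment> \<open>Inserting \<open>\<zero>\<close> makes the enumeration meaningful for empty
    \<open>U0\<close> and puts \<open>\<zero>\<close> among the values.\<close>
  define ev where "ev = star_eval A (from_nat_into Q) (from_nat_into (insert \<zero> U0))"
  define U where "U = range ev"
  have "ev t \<in> carrier A" for t
  proof (induction t)
    case (Gen n)
    have "from_nat_into (insert \<zero> U0) n \<in> insert \<zero> U0" by (rule from_nat_into) simp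
    then show ?case using U0 by (auto simp: ev_def)
  qed (simp_all add: ev_def)
  then have Uc: "U \<subseteq> carrier A" by (auto simp: U_def)
  have U0U: "u \<in> U" if u: "u \<in> U0" for u
  proof -
    obtain n where "from_nat_into (insert \<zero> U0) n = u"
      using from_nat_into_surj[OF countable_insert[OF U0(1)] insertI2[OF u]] by blast
    then have "ev (Gen n) = u" by (simp add: ev_def)
    then show ?thesis unfolding U_def by blast
  qed
  have U_ops: "x \<oplus> y \<in> U" "x \<otimes> y \<in> U" "star A x \<in> U" if xy: "x \<in> U" "y \<in> U" for x y
  proof -
    obtain s t where "x = ev s" "y = ev t" using xy unfolding U_def by blast
    then have "x \<oplus> y = ev (Add s t)" "x \<otimes> y = ev (Mult s t)" "star A x = ev (Star s)" by (simp_all add: ev_def)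
    then show "x \<oplus> y \<in> U" "x \<otimes> y \<in> U" "star A x \<in> U" unfolding U_def by blast+
  qed
  have U_smult: "c \<odot> x \<in> U" if cx: "c \<in> Q" "x \<in> U" for c x
  proof -
    obtain t where "x = ev t" using cx(2) unfolding U_def by blast
    moreover obtain n where "from_nat_into Q n = c" using from_nat_into_surj[OF Q(1) cx(1)] by blast
    ultimately have "c \<odot> x = ev (Smult n t)" by (simp add: ev_def)
    then show ?thesis unfolding U_def by blast
  qed
  define S where "S = {x. \<exists>s. (\<forall>n. s n \<in> U) \<and> tends s x}"
  have SI: "x \<in> S" if "\<And>n. s n \<in> U" "tends s x" for s x using that unfolding S_def by blast
  have Sc: "S \<subseteq> carrier A" by (auto simp: S_def tends_def)
  have near_S: "\<exists>y\<in>U. cdist A x y < r" if x: "x \<in> S" and r: "r > 0" for x r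
  proof -
    obtain s where s: "\<And>n. s n \<in> U" "tends s x" using x by (auto simp: S_def)
    have "\<forall>\<^sub>F n in sequentially. cdist A (s n) x < r"
      using s(2) r unfolding tends_def by (intro order_tendstoD(2)[where y = 0]) auto
    then obtain n where "cdist A (s n) x < r" by (auto simp: eventually_sequentially)
    then show ?thesis using cmetric.commute[of x "s n"] by (intro bexI[OF _ s(1)[of n]]) simp
  qed
  have memS: "x \<in> S" if "x \<in> carrier A" "\<And>r. r > 0 \<Longrightarrow> \<exists>y\<in>U. cdist A x y < r" for x
    using ex_tends[OF Uc that] unfolding S_def by blast
  have "G \<subseteq> S"
  proof
    fix g assume g: "g \<in> G"
    show "g \<in> S"
    proof (rule memS)
      show "g \<in> carrier A" using g gen by (auto simp: cstar_generated_by_def)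
      show "\<exists>y\<in>U. cdist A g y < r" if "r > 0" for r using near[OF g that] U0U by blast
    qed
  qed
  moreover have "cstar_subalgebra S A"
    unfolding cstar_subalgebra_def
  proof (intro conjI ballI allI)
    have "cmetric.mtopology closure_of S \<subseteq> S"
    proof
      fix x assume "x \<in> cmetric.mtopology closure_of S"
      then have x: "x \<in> carrier A" and nx: "\<And>r. r > 0 \<Longrightarrow> \<exists>z\<in>S. cdist A x z < r"
        unfolding cmetric.metric_closure_of cmetric.in_mball by auto
      show "x \<in> S"
      proof (rule memS[OF x])
        fix r :: real assume "r > 0"
        then have r: "r / 2 > 0" by simp
        obtain z where z: "z \<in> S" "cdist A x z < r / 2" using nx[OF r] by blast
        obtain y where y: "y \<in> U" "cdist A z y < r / 2" using near_S[OF z(1) r] by blast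
        have "cdist A x y < r"
          using cmetric.triangle[of x z y] x subsetD[OF Sc z(1)] subsetD[OF Uc y(1)] z(2) y(2) by simp
        then show "\<exists>y\<in>U. cdist A x y < r" using y(1) by blast
      qed
    qed
    then show "closedin cmetric.mtopology S" using Sc by (subst closure_of_subset_eq[symmetric]) auto
    have "from_nat_into (insert \<zero> U0) (to_nat_on (insert \<zero> U0) \<zero>) = \<zero>" using U0(1) by simp
    then have "ev (Gen (to_nat_on (insert \<zero> U0) \<zero>)) = \<zero>" by (simp add: ev_def)
    then have "\<zero> \<in> U" unfolding U_def by (metis rangeI)
    then show "\<zero> \<in> S" using tends_const[of \<zero>] by (intro SI) auto
    fix x assume "x \<in> S"
    then obtain s where s: "\<And>n. s n \<in> U" "tends s x" by (auto simp: S_def)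
    show "star A x \<in> S" using s by (intro SI[OF _ tends_star]) (auto intro: U_ops)
    show "c \<odot> x \<in> S" for c
    proof -
      have "\<forall>n. \<exists>q\<in>Q. dist q c < inverse (real (Suc n))"
      proof
        fix n
        obtain q where "q \<in> Q" "q \<in> ball c (inverse (real (Suc n)))"
          using Q(2)[of "ball c (inverse (real (Suc n)))"] by auto
        then show "\<exists>q\<in>Q. dist q c < inverse (real (Suc n))" by (auto simp: dist_commute)
      qed
      then obtain q where q: "\<And>n. q n \<in> Q" "\<And>n. dist (q n) c < inverse (real (Suc n))" by metis
      \<comment> \<open>A varying scalar is written as a multiple of \<open>e\<close>, so that its
        product with a varying element is covered by \<open>tends_mult\<close>.\<close>
      have "tends (\<lambda>n. q n \<odot> e) (c \<odot> e)"
      proof (rule tends_bound[OF _ _ LIMSEQ_inverse_real_of_nat])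
        show "cdist A (q n \<odot> e) (c \<odot> e) \<le> inverse (real (Suc n))" for n
          using q(2)[of n] by (simp add: cdist_cnorm cnorm_sc dist_norm flip: smult_diff)
      qed simp_all
      then have "tends (\<lambda>n. (q n \<odot> e) \<otimes> s n) ((c \<odot> e) \<otimes> x)" using s(2) by (rule tends_mult)
      moreover have "(q n \<odot> e) \<otimes> s n \<in> U" for n using U_smult[OF q(1) s(1), of n n] s(1)[of n] Uc by (auto simp: sc_left)
      ultimately have "(c \<odot> e) \<otimes> x \<in> S" by (rule SI[rotated])
      then show ?thesis using s(2) by (simp add: tends_def sc_left)
    qed
    fix y assume "y \<in> S"
    then obtain s' where s': "\<And>n. s' n \<in> U" "tends s' y" by (auto simp: S_def)
    show "x \<oplus> y \<in> S" using s s' by (intro SI[OF _ tends_add]) (auto intro: U_ops)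
    show "x \<otimes> y \<in> S" using s s' by (intro SI[OF _ tends_mult]) (auto intro: U_ops)
  qed
  ultimately have "S = carrier A" using gen by (simp add: cstar_generated_by_def)
  have "carrier A \<subseteq> cmetric.mtopology closure_of U"
  proof
    fix x assume x: "x \<in> carrier A"
    have "\<exists>y\<in>U. cdist A x y < r" if "r > 0" for r
      by (rule near_S[OF _ that]) (use x \<open>S = carrier A\<close> in blast)
    then show "x \<in> cmetric.mtopology closure_of U"
      using x Uc unfolding cmetric.metric_closure_of cmetric.in_mball by blast
  qed
  then have "cmetric.mtopology closure_of U = topspace cmetric.mtopology"
    using closure_of_subset_topspace[of cmetric.mtopology U] by simp
  moreover have "countable U" unfolding U_def by (rule countable_image) (rule countableI_type)
  moreover have "U \<subseteq> topspace cmetric.mtopology" using Uc by simp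
  ultimately show ?thesis
    unfolding cstar_separable_def separable_space_def by blast
qed

end

text \<open>Contractivity of \<open>\<sigma>\<close> carries a countable dense subset of
  \<open>A\<close> to one that is dense in the image.\<close>

lemma separable_dense_image:
  assumes A: "ucstar A e" "cstar_separable A" and C: "ucstar C e'" and \<sigma>: "star_hom A C \<sigma>" "\<sigma> e = e'"
  obtains U where "countable U" "U \<subseteq> carrier C" "\<And>a r. a \<in> carrier A \<Longrightarrow> r > 0 \<Longrightarrow> \<exists>u\<in>U. cdist C (\<sigma> a) u < r"
proof -
  interpret A: ucstar A e by (rule A(1))
  interpret C: ucstar C e' by (rule C)
  obtain U where U: "countable U" "U \<subseteq> carrier A" "A.cmetric.mtopology closure_of U = carrier A"
    using A(2) unfolding cstar_separable_def separable_space_def by auto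
  note h = star_homD(1)[OF \<sigma>(1)]
  show ?thesis
  proof (rule that[of "\<sigma> ` U"])
    fix a and r :: real assume a: "a \<in> carrier A" and r: "r > 0"
    have "a \<in> A.cmetric.mtopology closure_of U" using a U(3) by simp
    then obtain u where u: "u \<in> U" "cdist A a u < r"
      unfolding A.cmetric.metric_closure_of using r by auto
    have uc: "u \<in> carrier A" using u(1) U(2) by blast
    have "cdist C (\<sigma> a) (\<sigma> u) = cnorm C (\<sigma> (a \<ominus>\<^bsub>A\<^esub> u))"
      using a uc h star_hom_minus[OF A.cstar_algebra_axioms C.cstar_algebra_axioms \<sigma>(1) a uc] by (simp add: C.cdist_cnorm)
    also have "\<dots> \<le> cnorm A (a \<ominus>\<^bsub>A\<^esub> u)" using a uc by (intro star_hom_contractive[OF A(1) C \<sigma>]) simp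
    also have "\<dots> < r" using u(2) a uc by (simp add: A.cdist_cnorm)
    finally show "\<exists>y\<in>\<sigma> ` U. cdist C (\<sigma> a) y < r" using u(1) by blast
  qed (use U h in auto)
qed

theorem theorem4p1:
  fixes A :: "'a cstar" and B :: "'b cstar" and D :: "'d cstar" and C :: "'c cstar"
    and \<psi>A :: "'d \<Rightarrow> 'a" and \<psi>B :: "'d \<Rightarrow> 'b" and \<sigma>A :: "'a \<Rightarrow> 'c" and \<sigma>B :: "'b \<Rightarrow> 'c"
  assumes "cstar_algebra A" and "cstar_separable A" and "cstar_unital A" and "rfd A"
    and "cstar_algebra B" and "cstar_separable B" and "cstar_unital B" and "rfd B"
    and "cstar_algebra D" and "cstar_fin_dim D"
    and "unital_embedding D A \<psi>A" and "unital_embedding D B \<psi>B"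
    and "full_amalgamated_free_product D A B \<psi>A \<psi>B C \<sigma>A \<sigma>B"
  shows "rfd C \<longleftrightarrow>
    (\<exists>(k :: nat \<Rightarrow> nat) q1 q2.
       (\<forall>n. 0 < k n) \<and>
       unital_embedding A (cstar_prod (\<lambda>n. mat_cstar (k n))) q1 \<and>
       unital_embedding B (cstar_prod (\<lambda>n. mat_cstar (k n))) q2 \<and>
       (\<forall>d\<in>carrier D. q1 (\<psi>A d) = q2 (\<psi>B d)))"
proof -
  note A = assms(1-4) and B = assms(5-8) and D = assms(9,10) and \<psi>A = assms(11) and \<psi>B = assms(12) and P = assms(13)
  have C: "cstar_algebra C" and \<sigma>A: "unital_embedding A C \<sigma>A" and \<sigma>B: "unital_embedding B C \<sigma>B"
    and eq: "\<And>d. d \<in> carrier D \<Longrightarrow> \<sigma>A (\<psi>A d) = \<sigma>B (\<psi>B d)"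
    and gen: "cstar_generated_by C (\<sigma>A ` carrier A \<union> \<sigma>B ` carrier B)"
    using P unfolding full_amalgamated_free_product_def by blast+
  have uC: "cstar_unital C" and uD: "cstar_unital D" using \<sigma>A \<psi>A by (auto simp: unital_embedding_def)
  note ucA = ucstar_unital[OF A(1,3)] and ucB = ucstar_unital[OF B(1,3)]
    and ucC = ucstar_unital[OF C uC] and ucD = ucstar_unital[OF D(1) uD]
  show ?thesis
  proof
    assume "rfd C"
    then obtain k q where k: "\<And>n. 0 < k n" and q: "unital_embedding C (mat_prod k) q"
      by (rule rfd_imp_embedding[OF C uC]) (rule that)
    show "\<exists>(k :: nat \<Rightarrow> nat) q1 q2. (\<forall>n. 0 < k n) \<and> unital_embedding A (mat_prod k) q1 \<and>
       unital_embedding B (mat_prod k) q2 \<and> (\<forall>d\<in>carrier D. q1 (\<psi>A d) = q2 (\<psi>B d))"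
      using k unital_embedding_compose[OF \<sigma>A q] unital_embedding_compose[OF \<sigma>B q] eq
      by (intro exI[of _ k] exI[of _ "\<lambda>a. q (\<sigma>A a)"] exI[of _ "\<lambda>b. q (\<sigma>B b)"]) simp
  next
    assume "\<exists>(k :: nat \<Rightarrow> nat) q1 q2. (\<forall>n. 0 < k n) \<and> unital_embedding A (mat_prod k) q1 \<and>
       unital_embedding B (mat_prod k) q2 \<and> (\<forall>d\<in>carrier D. q1 (\<psi>A d) = q2 (\<psi>B d))"
    then obtain k :: "nat \<Rightarrow> nat" and q1 q2 where k: "\<And>n. 0 < k n" and q1: "unital_embedding A (mat_prod k) q1"
      and q2: "unital_embedding B (mat_prod k) q2" and q: "\<And>d. d \<in> carrier D \<Longrightarrow> q1 (\<psi>A d) = q2 (\<psi>B d)" by blast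
    have separated: "separated_cstar X k (\<lambda>n x. q x n)"
      if X: "ucstar X \<one>\<^bsub>X\<^esub>" and qX: "unital_embedding X (mat_prod k) q" for X :: "'x cstar" and q
    proof (intro separated_cstar.intro X separated_cstar_axioms.intro)
      interpret X: ucstar X "\<one>\<^bsub>X\<^esub>" by (rule X)
      note rep = mat_prod_coordinate[OF qX k]
      show "matrix_rep X (k n) (\<lambda>x. q x n)" for n by (rule rep)
      fix x assume x: "x \<in> carrier X" and 0: "\<And>n. q x n = 0\<^sub>m (k n) (k n)"
      have "0 \<cdot>\<^sub>m 1\<^sub>m n = (0\<^sub>m n n :: complex mat)" for n by (rule eq_matI) auto
      then have "q \<zero>\<^bsub>X\<^esub> n = 0\<^sub>m (k n) (k n)" for n
        using matrix_repD(5)[OF rep X.e_closed, of 0 n] matrix_repD(2)[OF rep, of n] by (simp add: X.smult_0)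
      then have "q x = q \<zero>\<^bsub>X\<^esub>" using 0 by (simp add: fun_eq_iff)
      then show "x = \<zero>\<^bsub>X\<^esub>" using qX x X.zero_closed unfolding unital_embedding_def inj_on_def by blast
    qed
    interpret amalgam_setting D A B C k "\<lambda>n a. q1 a n" "\<lambda>n b. q2 b n" \<psi>A \<psi>B \<sigma>A \<sigma>B
    proof (intro amalgam_setting.intro amalgam_setting_axioms.intro ucD ucC D(2) separated[OF ucA q1] separated[OF ucB q2])
      show "compatible_reps D A B \<psi>A \<psi>B (k n) (\<lambda>a. q1 a n) (\<lambda>b. q2 b n)" for n
        using mat_prod_coordinate[OF q1 k] mat_prod_coordinate[OF q2 k] q by (simp add: compatible_reps_def)
    qed (use \<psi>A \<psi>B \<sigma>A \<sigma>B eq in \<open>auto simp: unital_embedding_def\<close>)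
    \<comment> \<open>Matrix algebras do not have the carrier type of the test algebras, so the
      extended universal property is used; separability of \<open>A\<close> and \<open>B\<close>
      enters here.\<close>
    have universal: "\<exists>\<tau>. matrix_rep C N \<tau> \<and> (\<forall>a\<in>carrier A. \<tau> (\<sigma>A a) = \<tau>A a) \<and> (\<forall>b\<in>carrier B. \<tau> (\<sigma>B b) = \<tau>B b)"
      if c: "compatible_reps D A B \<psi>A \<psi>B N \<tau>A \<tau>B" for N \<tau>A \<tau>B
    proof -
      have "amalgam_factors D A B \<psi>A \<psi>B C \<sigma>A \<sigma>B (mat_cstar N)"
        by (rule full_amalgamated_free_product_universal[OF P A(1,2) B(1,2) cstar_algebra_mat_cstar])
      then obtain \<tau> where \<tau>: "star_hom C (mat_cstar N) \<tau>" "\<And>a. a \<in> carrier A \<Longrightarrow> \<tau> (\<sigma>A a) = \<tau>A a"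
          "\<And>b. b \<in> carrier B \<Longrightarrow> \<tau> (\<sigma>B b) = \<tau>B b"
        using c unfolding amalgam_factors_def compatible_reps_def matrix_rep_def by blast
      have "\<tau> \<one>\<^bsub>C\<^esub> = 1\<^sub>m N"
        using \<tau>(2)[OF A.e_closed] c \<sigma>A by (simp add: unital_embedding_def compatible_reps_def matrix_rep_def)
      then show ?thesis using \<tau> c unfolding compatible_reps_def matrix_rep_def by blast
    qed
    obtain UA where UA: "countable UA" "UA \<subseteq> carrier C" "\<And>a r. a \<in> carrier A \<Longrightarrow> r > 0 \<Longrightarrow> \<exists>u\<in>UA. cdist C (\<sigma>A a) u < r"
      by (rule separable_dense_image[OF ucA A(2) ucC amalgam_setting.\<sigma>A[OF amalgam_setting_axioms]]) (rule that)
    obtain UB where UB: "countable UB" "UB \<subseteq> carrier C" "\<And>b r. b \<in> carrier B \<Longrightarrow> r > 0 \<Longrightarrow> \<exists>u\<in>UB. cdist C (\<sigma>B b) u < r"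
      by (rule separable_dense_image[OF ucB B(2) ucC amalgam_setting.\<sigma>B[OF amalgam_setting_axioms]]) (rule that)
    \<comment> \<open>\<open>rfd\<close> includes separability, which \<open>C\<close> inherits from
      the two images that generate it.\<close>
    have "cstar_separable C"
    proof (rule C.separable_generated[OF gen, of "UA \<union> UB"])
      show "\<exists>u\<in>UA \<union> UB. cdist C g u < r" if "g \<in> \<sigma>A ` carrier A \<union> \<sigma>B ` carrier B" "r > 0" for g r
        using that(1) UA(3)[OF _ that(2)] UB(3)[OF _ that(2)] by blast
    qed (use UA UB in auto)
    moreover have "\<exists>(E :: (nat \<Rightarrow> complex) cstar) \<pi>. cstar_algebra E \<and> cstar_fin_dim E \<and> star_hom C E \<pi> \<and> \<pi> x \<noteq> \<zero>\<^bsub>E\<^esub>"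
      if x: "x \<in> carrier C" "x \<noteq> \<zero>\<^bsub>C\<^esub>" for x
    proof -
      obtain N \<tau> where \<tau>: "matrix_rep C N \<tau>" "\<tau> x \<noteq> 0\<^sub>m N N"
        by (rule ex_separating_rep[OF gen universal x]) (assumption, rule that)
      \<comment> \<open>The matrix algebra has to be exchanged for a test algebra on
        sequences.\<close>
      show ?thesis
        by (rule rfd_any_target[OF cstar_algebra_mat_cstar[of N] cstar_fin_dim_mat_cstar _ x(1), where \<pi> = \<tau>])
          (use \<tau> in \<open>simp_all add: matrix_rep_def\<close>)
    qed
    ultimately show "rfd C" unfolding rfd_def by blast
  qed
qed

end
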